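(* Let $\mathcal P^0$ be a Markov semigroup on $\mathsf A$ realised as the (vacuum) expectation semigroup of a QS flow $j$ on $\mathsf A$, that is, $\mathcal P^0_t=\mathbb E\circ j_t$ for all $t\in\mathbb R_+$, and let $\theta=\begin{bmatrix}\mathcal L&\delta^\dagger\\ \delta&\pi-\iota\end{bmatrix}$ be the ultraweak stochastic derivative of $j$, where $\iota(x)=I_{\mathsf k}\otimes x$. Let $l\in|\mathsf k\rangle\,\overline\otimes\,\mathsf A$ and $h=h^*\in\mathsf A$. There is a completely positive Markov semigroup $\mathcal P$ on $\mathsf A$ whose ultraweak generator is an extension of the operator with domain $\operatorname{Dom}\theta$ given by $$x\mapsto\mathcal L(x)+l^*\delta(x)+l^*\pi(x)l+\delta^\dagger(x)l+k^*x+xk,$$ where $k:=ih-\tfrac12l^*l$.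
   Context: All Hilbert spaces are complex, with inner products linear in the second argument. $\mathsf A$ is a von Neumann algebra acting faithfully on a Hilbert space $\mathfrak h$; $\mathsf k$ is a Hilbert space and $\widehat{\mathsf k}:=\mathbb C\oplus\mathsf k$. $\underline\otimes$ and $\overline\otimes$ denote algebraic and ultraweak tensor products; $|\mathsf k\rangle:=B(\mathbb C;\mathsf k)$, $\langle\mathsf k|:=B(\mathsf k;\mathbb C)$. Via $\widehat{\mathsf k}\otimes\mathfrak h=\mathfrak h\oplus(\mathsf k\otimes\mathfrak h)$, elements of $B(\widehat{\mathsf k})\,\overline\otimes\,\mathsf A$ are block matrices $\begin{bmatrix}k&m\\ l&n\end{bmatrix}$ with $k\in\mathsf A$, $l\in|\mathsf k\rangle\overline\otimes\mathsf A$, $m\in\langle\mathsf k|\overline\otimes\mathsf A$, $n\in B(\mathsf k)\overline\otimes\mathsf A$. Fock space: for a subinterval $J$ of $\mathbb R_+$, $\mathcal F_J$ is the symmetric Fock space over $L^2(J;\mathsf k)$, $\mathsf N_J:=B(\mathcal F_J)$, $I_J$ is the identity on $\mathcal F_J$; subscripts are omitted for $J=\mathbb R_+$; $\mathcal F=\mathcal F_{[0,t[}\otimes\mathcal F_{[t,\infty[}$. $\mathbb S$ is the space of right-continuous step functions in $L^2(\mathbb R_+;\mathsf k)$; $f_J$ equals $f$ on $J$ and $0$ elsewhere (similarly $c_J$ for a constant $c$); $\varpi(f):=e^{-\|f\|^2/2}\big((n!)^{-1/2}f^{\otimes n}\big)_{n\ge0}$; $\mathcal E$ is the linear span of $\{\varpi(f):f\in\mathbb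 S\}$. $E_u$ denotes $|u\rangle$ tensored with identity operators (e.g. $E_{\varpi(f)}:\mathfrak h\to\mathfrak h\otimes\mathcal F$, $v\mapsto v\otimes\varpi(f)$) and $E^u:=(E_u)^*$. Vacuum expectation: $\mathbb E(T):=E^{\varpi(0)}TE_{\varpi(0)}$ for $T\in\mathsf A\overline\otimes\mathsf N$. Processes: an (operator) process is a family $X=(X_t)_{t\ge0}$ of operators on $\mathfrak h\otimes\mathcal F$ with domain $\mathfrak h\underline\otimes\mathcal E$ that is weakly measurable in $t$ and adapted: $E^{\varpi(f)}X_tE_{\varpi(g)}=\langle\varpi(f_{[t,\infty[}),\varpi(g_{[t,\infty[})\rangle E^{\varpi(f_{[0,t[})}X_tE_{\varpi(g_{[0,t[})}$ for $f,g\in\mathbb S$; it is a process in $\mathsf A$ if $E^{\varpi(f)}X_tE_{\varpi(g)}\in\mathsf A$ for all $f,g,t$. A process on $\mathsf A$ is a family $k=(k_t)_{t\ge0}$ of linear maps on $\mathsf A$ with $(k_t(a))_{t\ge0}$ a process in $\mathsf A$ for each $a$. If $k$ is normal and completely bounded (i.e. each $k_t$ is), then $k_r(a)=k_{r)}(a)\otimes I_{[r,\infty[}$ with $k_{r)}:\mathsf A\to\mathsf A\overline\otimes\mathsf N_{[0,r[}$; put $\widehat k_r:=k_{r)}\overline\otimes\operatorname{id}_{\mathsf N_{[r,\infty[}}$. Let $T_r:\mathcal F\to\mathcal F_{[r,\infty[}$ be the unitary with $\varpi(f)\mapsto\varpi(f_r)$, $f_r(s)=f(s-r)$, and $\sigma_r:\mathsf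 A\overline\otimes\mathsf N\to\mathsf A\overline\otimes\mathsf N_{[r,\infty[}$ the normal *-isomorphism with $a\otimes z\mapsto a\otimes T_rzT_r^*$. $k$ is a QS cocycle if $k_0(a)=a\otimes I_{\mathcal F}$ and $k_{r+t}=\widehat k_r\circ\sigma_r\circ k_t$ for all $r,t\ge0$; it is a QS flow if moreover it is pointwise ultraweakly continuous in $t$, *-homomorphic and unital. A Markov semigroup on $\mathsf A$ is a pointwise ultraweakly continuous semigroup of normal positive unital maps on $\mathsf A$. Ultraweak stochastic derivative: for $t>0$ let $V_t:\mathsf k\otimes\mathfrak h\to\mathfrak h\otimes\mathcal F$ be the isometry determined by $c\otimes u\mapsto u\otimes(0,t^{-1/2}c_{[0,t[},0,0,\dots)$ and let $$\theta_t(a):=\begin{bmatrix}t^{-1/2}E^{\varpi(0)}\\ V_t^*\end{bmatrix}\big(j_t(a)-a\otimes I_{\mathcal F}\big)\begin{bmatrix}t^{-1/2}E_{\varpi(0)}&V_t\end{bmatrix}\in B(\widehat{\mathsf k})\overline\otimes\mathsf A .$$ Then $\theta(x):=\lim_{t\to0^+}\theta_t(x)$ (ultraweak limit), with $\operatorname{Dom}\theta$ the set of $x\in\mathsf A$ for which the limit exists. It is a *-invariant subspace; the maps $\mathcal L,\delta,\pi$ on $\operatorname{Dom}\theta$ are defined by the block form in the claim, with $\delta^\dagger(x)=\delta(x^* )^*$. *)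

theory Defs
  imports "HOL-Analysis.Analysis"
begin

section \<open>Complex Hilbert spaces\<close>

text \<open>
  Inner products are linear in the second argument.  Completeness is part of the class \<^class>\<open>banach\<close>.
\<close>

class scaleC =
  fixes scaleC :: "complex \<Rightarrow> 'a \<Rightarrow> 'a"  (infixr "*\<^sub>C" 75)

class complex_hilbert = banach + scaleC +
  fixes cinner :: "'a \<Rightarrow> 'a \<Rightarrow> complex"
  assumes scaleR_scaleC: "r *\<^sub>R x = complex_of_real r *\<^sub>C x"
    and scaleC_add_right: "c *\<^sub>C (x + y) = c *\<^sub>C x + c *\<^sub>C y"
    and scaleC_add_left: "(c + d) *\<^sub>C x = c *\<^sub>C x + d *\<^sub>C x"
    and scaleC_scaleC: "c *\<^sub>C (d *\<^sub>C x) = (c * d) *\<^sub>C x"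
    and cinner_commute: "cinner x y = cnj (cinner y x)"
    and cinner_add_right: "cinner x (y + z) = cinner x y + cinner x z"
    and cinner_scaleC_right: "cinner x (c *\<^sub>C y) = c * cinner x y"
    and cinner_self: "cinner x x = complex_of_real ((norm x)\<^sup>2)"

lemma cinner_add_left:
  "cinner (x + y) z = cinner x z + cinner y (z :: 'a::complex_hilbert)"
  by (metis cinner_add_right cinner_commute complex_cnj_add)

lemma cinner_scaleC_left:
  "cinner (c *\<^sub>C x) y = cnj c * cinner x (y :: 'a::complex_hilbert)"
  by (metis cinner_scaleC_right cinner_commute complex_cnj_mult)

lemma scaleC_one [simp]: "1 *\<^sub>C x = (x :: 'a::complex_hilbert)"
  by (metis of_real_1 scaleR_one scaleR_scaleC)

lemma scaleC_zero_left [simp]: "0 *\<^sub>C x = (0 :: 'a::complex_hilbert)"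
  by (metis of_real_0 scaleR_zero_left scaleR_scaleC)

lemma scaleC_minus_one: "(-1) *\<^sub>C x = - (x :: 'a::complex_hilbert)"
  by (metis of_real_1 of_real_minus scaleR_minus1_left scaleR_scaleC)

lemma cinner_zero_right [simp]: "cinner x 0 = (0::complex)" for x :: "'a::complex_hilbert"
  using cinner_add_right[of x 0 0] by simp

lemma cinner_zero_left [simp]: "cinner 0 x = (0::complex)" for x :: "'a::complex_hilbert"
  using cinner_add_left[of 0 0 x] by simp

lemma cinner_sum_right: "cinner x (\<Sum>i\<in>I. f i) = (\<Sum>i\<in>I. cinner x (f i))"
  for x :: "'a::complex_hilbert"
  by (induction I rule: infinite_finite_induct) (auto simp: cinner_add_right)

lemma cinner_sum_left: "cinner (\<Sum>i\<in>I. f i) x = (\<Sum>i\<in>I. cinner (f i) x)"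
  for x :: "'a::complex_hilbert"
  by (induction I rule: infinite_finite_induct) (auto simp: cinner_add_left)

lemma cinner_minus_right: "cinner x (- y) = - cinner x (y :: 'a::complex_hilbert)"
  by (metis cinner_scaleC_right mult_minus1 scaleC_minus_one)

lemma cinner_diff_right: "cinner x (y - z) = cinner x y - cinner x (z :: 'a::complex_hilbert)"
  by (metis add_uminus_conv_diff cinner_add_right cinner_minus_right)

lemma cinner_diff_left: "cinner (x - y) z = cinner x z - cinner y (z :: 'a::complex_hilbert)"
  by (metis cinner_diff_right cinner_commute complex_cnj_diff)

instantiation complex :: complex_hilbert
begin
definition scaleC_complex :: "complex \<Rightarrow> complex \<Rightarrow> complex" where "scaleC_complex c x = c * x"
definition cinner_complex :: "complex \<Rightarrow> complex \<Rightarrow> complex" where "cinner_complex x y = cnj x * y"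
instance
  by standard
    (auto simp: scaleC_complex_def cinner_complex_def algebra_simps scaleR_conv_of_real,
     metis complex_norm_square mult.commute of_real_power)
end

instantiation prod :: (complex_hilbert, complex_hilbert) complex_hilbert
begin
definition "c *\<^sub>C x = (c *\<^sub>C fst x, c *\<^sub>C snd x)"
definition "cinner x y = cinner (fst x) (fst y) + cinner (snd x) (snd y)"
instance
proof (standard, goal_cases)
  case (5 x y)
  show ?case unfolding cinner_prod_def
    by (metis cinner_commute complex_cnj_add)
next
  case (8 x)
  show ?case
    by (simp add: cinner_prod_def norm_prod_def cinner_self)
qed (auto simp: scaleC_prod_def cinner_prod_def scaleR_scaleC scaleC_add_right scaleC_add_left scaleC_scaleC
  cinner_add_right cinner_scaleC_right algebra_simps)
end

section \<open>The Hilbert space of a positive definite kernel\<close>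

text \<open>
  Tensor products, Fock spaces and the space of square integrable functions are all obtained as Hilbert
  space completions of a space spanned by symbols \<open>x\<close> whose inner products \<open>kern x y\<close> are prescribed.  The
  completion is realised as a space of functions: a vector \<open>\<phi>\<close> is represented by the function
  \<open>x \<mapsto> \<langle>x, \<phi>\<rangle>\<close>, and the functions occurring are those which extend to antilinear functionals bounded with
  respect to the kernel (Aronszajn's reproducing kernel space).  Finite linear combinations of symbols
  are lists of coefficient-symbol pairs.  The lemmas \<open>cinner_kvec\<close> and \<open>kvec_total\<close> below state that the
  vectors \<open>kvec x\<close> have the prescribed inner products and a dense span.
\<close>

class pd_kernel =
  fixes kern :: "'a \<Rightarrow> 'a \<Rightarrow> complex"
  assumes kern_commute: "kern x y = cnj (kern y x)"
    and kern_nonneg: "0 \<le> Re (\<Sum>(c, x)\<leftarrow>v. \<Sum>(d, y)\<leftarrow>v. cnj c * d * kern x y)"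

definition kform :: "(complex \<times> 'x::pd_kernel) list \<Rightarrow> (complex \<times> 'x) list \<Rightarrow> complex" where
  "kform v w = (\<Sum>(c, x)\<leftarrow>v. \<Sum>(d, y)\<leftarrow>w. cnj c * d * kern x y)"

abbreviation ksq :: "(complex \<times> 'x::pd_kernel) list \<Rightarrow> real" where
  "ksq v \<equiv> Re (kform v v)"

definition keval :: "('x \<Rightarrow> complex) \<Rightarrow> (complex \<times> 'x) list \<Rightarrow> complex" where
  "keval \<phi> v = (\<Sum>(c, x)\<leftarrow>v. cnj c * \<phi> x)"

definition kscale :: "complex \<Rightarrow> (complex \<times> 'x) list \<Rightarrow> (complex \<times> 'x) list" where
  "kscale a v = map (\<lambda>(c, x). (a * c, x)) v"

definition kfun :: "(complex \<times> 'x::pd_kernel) list \<Rightarrow> 'x \<Rightarrow> complex" where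
  "kfun v x = (\<Sum>(d, y)\<leftarrow>v. d * kern x y)"

lemma keval_kfun: "keval (kfun w) v = kform v w"
  unfolding keval_def kfun_def kform_def
  by (simp add: sum_list_const_mult[symmetric] case_prod_unfold mult.assoc)

lemma keval_append: "keval \<phi> (v @ w) = keval \<phi> v + keval \<phi> w"
  by (simp add: keval_def)

lemma keval_scale: "keval \<phi> (kscale a v) = cnj a * keval \<phi> v"
  by (simp add: keval_def kscale_def case_prod_unfold o_def sum_list_const_mult[symmetric] mult.assoc)

lemma keval_add: "keval (\<lambda>x. \<phi> x + \<psi> x) v = keval \<phi> v + keval \<psi> v"
  by (simp add: keval_def case_prod_unfold distrib_left sum_list_addf)

lemma keval_cmult: "keval (\<lambda>x. a * \<phi> x) v = a * keval \<phi> v"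
  by (simp add: keval_def case_prod_unfold sum_list_const_mult[symmetric] mult_ac)

lemma keval_zero: "keval (\<lambda>x. 0) v = 0"
  by (simp add: keval_def case_prod_unfold)

lemma keval_single: "keval \<phi> [(c, x)] = cnj c * \<phi> x"
  by (simp add: keval_def)

lemma keval_uminus: "keval (\<lambda>x. - \<phi> x) v = - keval \<phi> v"
  using keval_cmult[of "-1" \<phi> v] by simp

lemma keval_diff: "keval (\<lambda>x. \<phi> x - \<psi> x) v = keval \<phi> v - keval \<psi> v"
  using keval_add[of \<phi> "\<lambda>x. - \<psi> x" v] by (simp add: keval_uminus)

lemma kform_append_left: "kform (u @ v) w = kform u w + kform v w"
  by (simp only: keval_kfun[symmetric] keval_append)

lemma kform_scale_left: "kform (kscale a v) w = cnj a * kform v w"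
  by (simp only: keval_kfun[symmetric] keval_scale)

lemma kfun_append: "kfun (v @ w) = (\<lambda>x. kfun v x + kfun w x)"
  by (simp add: kfun_def fun_eq_iff)

lemma kfun_scale: "kfun (kscale a v) = (\<lambda>x. a * kfun v x)"
  by (simp add: kfun_def kscale_def fun_eq_iff case_prod_unfold o_def sum_list_const_mult[symmetric] mult.assoc)

lemma kform_append_right: "kform w (u @ v) = kform w u + kform w v"
  by (simp only: keval_kfun[symmetric] kfun_append keval_add)

lemma kform_scale_right: "kform w (kscale a v) = a * kform w v"
  by (simp only: keval_kfun[symmetric] kfun_scale keval_cmult)

lemma kform_Cons_left: "kform (p # v) w = kform [p] w + kform v w"
  using kform_append_left[of "[p]" v w] unfolding append_Cons append_Nil .

lemma kform_Cons_right: "kform w (p # v) = kform w [p] + kform w v"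
  using kform_append_right[of w "[p]" v] unfolding append_Cons append_Nil .

lemma kform_commute: "kform v w = cnj (kform w v)"
proof (induction v)
  case Nil
  have "kform w [] = 0" by (simp add: kform_def case_prod_unfold)
  then show ?case by (simp add: kform_def)
next
  case (Cons p v)
  have "kform [p] w = cnj (kform w [p])"
  proof (induction w)
    case Nil
    then show ?case by (simp add: kform_def case_prod_unfold)
  next
    case (Cons q w)
    have "kform [p] [q] = cnj (kform [q] [p])"
      using kern_commute[of "snd p" "snd q"] by (simp add: kform_def case_prod_unfold)
    then show ?case
      using Cons kform_Cons_right[of "[p]" q w] kform_Cons_left[of q w "[p]"] by (metis complex_cnj_add)
  qed
  then show ?case
    using Cons kform_Cons_left[of p v w] kform_Cons_right[of w p v] by (metis complex_cnj_add)
qed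

lemma ksq_nonneg [simp]: "0 \<le> ksq v"
  using kern_nonneg[of v] by (simp add: kform_def)

lemma kform_self: "kform v v = complex_of_real (ksq v)"
proof -
  have "Im (kform v v) = 0"
    using arg_cong[OF kform_commute[of v v], of Im] by simp
  then show ?thesis by (simp add: complex_eq_iff)
qed

lemma discr_aux:
  fixes a b c :: real
  assumes "\<And>t. 0 \<le> a + 2 * t * b + t\<^sup>2 * c" "0 \<le> c"
  shows "b\<^sup>2 \<le> a * c"
proof (cases "c = 0")
  case True
  have "b = 0"
  proof (rule ccontr)
    assume "b \<noteq> 0"
    then show False using assms(1)[of "- (a + 1) / (2 * b)"] True by (simp add: field_simps)
  qed
  then show ?thesis using True by simp
next
  case False
  then have "c > 0" using assms by simp
  then show ?thesis using assms(1)[of "- b / c"]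
    by (simp add: field_simps power2_eq_square)
qed

lemma ksq_add_scaled:
  "ksq (v @ kscale s w) = ksq v + 2 * Re (s * kform v w) + (cmod s)\<^sup>2 * ksq w"
proof -
  have "kform w v = cnj (kform v w)" by (rule kform_commute)
  moreover have "Re (cnj s * (s * kform w w)) = (cmod s)\<^sup>2 * ksq w"
  proof -
    have "cnj s * (s * kform w w) = complex_of_real ((cmod s)\<^sup>2) * complex_of_real (ksq w)"
      unfolding complex_norm_square kform_self[symmetric] by (simp add: mult_ac)
    then show ?thesis by simp
  qed
  ultimately show ?thesis
    by (simp add: kform_append_left kform_append_right kform_scale_left kform_scale_right algebra_simps)
qed

lemma kern_rotate:
  fixes f :: complex and q a :: real
  assumes "\<And>s. 0 \<le> a + 2 * Re (s * f) + (cmod s)\<^sup>2 * q" "0 \<le> q"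
  shows "(cmod f)\<^sup>2 \<le> a * q"
proof (cases "f = 0")
  case True
  then show ?thesis using assms(1)[of 0] assms(2) by simp
next
  case False
  define u where "u = cnj f / complex_of_real (cmod f)"
  have u: "u * f = complex_of_real (cmod f)" "cmod u = 1"
    using False by (auto simp: u_def norm_divide divide_simps complex_norm_square[symmetric] mult.commute power2_eq_square)
  show ?thesis
  proof (rule discr_aux)
    fix t :: real
    have "Re (complex_of_real t * u * f) = t * cmod f"
      using u(1) by (simp add: mult.assoc)
    moreover have "cmod (complex_of_real t * u) = \<bar>t\<bar>" by (simp add: norm_mult u(2))
    ultimately show "0 \<le> a + 2 * t * cmod f + t\<^sup>2 * q"
      using assms(1)[of "complex_of_real t * u"] by (simp add: mult_ac)
  qed fact
qed

lemma kform_cauchy_schwarz: "cmod (kform v w) \<le> sqrt (ksq w) * sqrt (ksq v)"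
proof -
  have "(cmod (kform v w))\<^sup>2 \<le> ksq v * ksq w"
    by (rule kern_rotate) (use ksq_add_scaled[of v _ w] ksq_nonneg in \<open>metis, simp\<close>)
  then have "cmod (kform v w) \<le> sqrt (ksq v * ksq w)"
    by (simp add: real_le_rsqrt)
  then show ?thesis by (simp add: real_sqrt_mult mult.commute)
qed

typedef (overloaded) 'x khilb =
  "{\<phi> :: 'x::pd_kernel \<Rightarrow> complex. \<exists>M\<ge>0. \<forall>v. cmod (keval \<phi> v) \<le> M * sqrt (ksq v)}"
  morphisms kapp Abs_khilb
  by (rule exI[of _ "\<lambda>_. 0"], simp add: keval_zero, rule exI[of _ 0], simp)

setup_lifting type_definition_khilb

lift_definition kcomb :: "(complex \<times> 'x::pd_kernel) list \<Rightarrow> 'x khilb" is kfun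
  by (metis keval_kfun kform_cauchy_schwarz ksq_nonneg real_sqrt_ge_zero)

definition kvec :: "'x::pd_kernel \<Rightarrow> 'x khilb" where "kvec x = kcomb [(1, x)]"

instantiation khilb :: (pd_kernel) "{ab_group_add, scaleC}"
begin

lift_definition zero_khilb :: "'a khilb" is "\<lambda>x. 0"
  by (auto simp: keval_zero)

lift_definition plus_khilb :: "'a khilb \<Rightarrow> 'a khilb \<Rightarrow> 'a khilb" is "\<lambda>\<phi> \<psi> x. \<phi> x + \<psi> x"
proof -
  fix \<phi> \<psi> :: "'a \<Rightarrow> complex"
  assume "\<exists>M\<ge>0. \<forall>v. cmod (keval \<phi> v) \<le> M * sqrt (ksq v)" "\<exists>M\<ge>0. \<forall>v. cmod (keval \<psi> v) \<le> M * sqrt (ksq v)"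
  then obtain M N where "M \<ge> 0" "\<And>v. cmod (keval \<phi> v) \<le> M * sqrt (ksq v)"
    "N \<ge> 0" "\<And>v. cmod (keval \<psi> v) \<le> N * sqrt (ksq v)" by auto
  then show "\<exists>M\<ge>0. \<forall>v. cmod (keval (\<lambda>x. \<phi> x + \<psi> x) v) \<le> M * sqrt (ksq v)"
    by (intro exI[of _ "M + N"]) (auto simp: keval_add distrib_right intro!: order.trans[OF norm_triangle_ineq] add_mono)
qed

lift_definition uminus_khilb :: "'a khilb \<Rightarrow> 'a khilb" is "\<lambda>\<phi> x. - \<phi> x"
  by (simp add: keval_uminus)

lift_definition minus_khilb :: "'a khilb \<Rightarrow> 'a khilb \<Rightarrow> 'a khilb" is "\<lambda>\<phi> \<psi> x. \<phi> x - \<psi> x"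
proof -
  fix \<phi> \<psi> :: "'a \<Rightarrow> complex"
  assume "\<exists>M\<ge>0. \<forall>v. cmod (keval \<phi> v) \<le> M * sqrt (ksq v)" "\<exists>M\<ge>0. \<forall>v. cmod (keval \<psi> v) \<le> M * sqrt (ksq v)"
  then obtain M N where "M \<ge> 0" "\<And>v. cmod (keval \<phi> v) \<le> M * sqrt (ksq v)"
    "N \<ge> 0" "\<And>v. cmod (keval \<psi> v) \<le> N * sqrt (ksq v)" by auto
  then show "\<exists>M\<ge>0. \<forall>v. cmod (keval (\<lambda>x. \<phi> x - \<psi> x) v) \<le> M * sqrt (ksq v)"
    by (intro exI[of _ "M + N"]) (auto simp: keval_diff distrib_right intro!: order.trans[OF norm_triangle_ineq4] add_mono)
qed

lift_definition scaleC_khilb :: "complex \<Rightarrow> 'a khilb \<Rightarrow> 'a khilb" is "\<lambda>a \<phi> x. a * \<phi> x"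
proof -
  fix \<phi> :: "'a \<Rightarrow> complex" and a :: complex
  assume "\<exists>M\<ge>0. \<forall>v. cmod (keval \<phi> v) \<le> M * sqrt (ksq v)"
  then obtain M where "M \<ge> 0" "\<And>v. cmod (keval \<phi> v) \<le> M * sqrt (ksq v)" by auto
  then show "\<exists>M\<ge>0. \<forall>v. cmod (keval (\<lambda>x. a * \<phi> x) v) \<le> M * sqrt (ksq v)"
    by (intro exI[of _ "cmod a * M"]) (auto simp: keval_cmult norm_mult mult.assoc mult_left_mono)
qed

instance
  by standard (transfer; simp add: fun_eq_iff algebra_simps)+

end

instantiation khilb :: (pd_kernel) scaleR
begin
definition scaleR_khilb :: "real \<Rightarrow> 'a khilb \<Rightarrow> 'a khilb" where
  "scaleR_khilb r \<phi> = complex_of_real r *\<^sub>C \<phi>"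
instance ..
end

instantiation khilb :: (pd_kernel) real_normed_vector
begin

definition norm_khilb :: "'a khilb \<Rightarrow> real" where
  "norm_khilb \<phi> = Inf {M. 0 \<le> M \<and> (\<forall>v. cmod (keval (kapp \<phi>) v) \<le> M * sqrt (ksq v))}"

definition sgn_khilb :: "'a khilb \<Rightarrow> 'a khilb" where
  "sgn_khilb \<phi> = \<phi> /\<^sub>R norm \<phi>"

definition dist_khilb :: "'a khilb \<Rightarrow> 'a khilb \<Rightarrow> real" where
  "dist_khilb \<phi> \<psi> = norm (\<phi> - \<psi>)"

definition uniformity_khilb :: "('a khilb \<times> 'a khilb) filter" where
  "uniformity_khilb = (INF e\<in>{0<..}. principal {(x, y). dist x y < e})"

definition open_khilb :: "'a khilb set \<Rightarrow> bool" where
  "open_khilb S \<longleftrightarrow> (\<forall>x\<in>S. \<forall>\<^sub>F (x', y) in uniformity. x' = x \<longrightarrow> y \<in> S)"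

lemma khilb_norm_ge0: "0 \<le> norm (\<phi> :: 'a khilb)"
  unfolding norm_khilb_def using kapp[of \<phi>] by (intro cInf_greatest) auto

lemma khilb_norm_le:
  "0 \<le> M \<Longrightarrow> (\<And>v. cmod (keval (kapp \<phi>) v) \<le> M * sqrt (ksq v)) \<Longrightarrow> norm (\<phi> :: 'a khilb) \<le> M"
  unfolding norm_khilb_def by (intro cInf_lower) (auto intro: bdd_belowI[of _ 0])

lemma keval_le_norm: "cmod (keval (kapp \<phi>) v) \<le> norm (\<phi> :: 'a khilb) * sqrt (ksq v)"
proof -
  let ?S = "{M. 0 \<le> M \<and> (\<forall>v. cmod (keval (kapp \<phi>) v) \<le> M * sqrt (ksq v))}"
  have ne: "?S \<noteq> {}" using kapp[of \<phi>] by auto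
  show ?thesis
  proof (cases "ksq v = 0")
    case True
    obtain M where "M \<in> ?S" using ne by auto
    then have "cmod (keval (kapp \<phi>) v) \<le> M * sqrt (ksq v)" by blast
    then show ?thesis using True by simp
  next
    case False
    then have pos: "sqrt (ksq v) > 0" by (simp add: order_less_le)
    have "cmod (keval (kapp \<phi>) v) / sqrt (ksq v) \<le> Inf ?S"
      by (rule cInf_greatest[OF ne]) (use pos in \<open>auto simp: pos_divide_le_eq\<close>)
    then show ?thesis using pos by (simp add: norm_khilb_def pos_divide_le_eq)
  qed
qed

lemma kapp_le_norm: "cmod (kapp \<phi> x) \<le> norm (\<phi> :: 'a khilb) * sqrt (ksq [(1, x)])"
  using keval_le_norm[of \<phi> "[(1, x)]"] by (simp add: keval_single)

lemma khilb_norm_scaleC: "norm (a *\<^sub>C \<phi> :: 'a khilb) = cmod a * norm \<phi>"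
proof -
  have le: "norm (a *\<^sub>C \<phi>) \<le> cmod a * norm \<phi>" for a and \<phi> :: "'a khilb"
    by (rule khilb_norm_le)
      (auto simp: khilb_norm_ge0 scaleC_khilb.rep_eq keval_cmult norm_mult mult.assoc keval_le_norm mult_left_mono)
  show ?thesis
  proof (cases "a = 0")
    case True
    then show ?thesis using le[of a \<phi>] khilb_norm_ge0[of "a *\<^sub>C \<phi>"] by simp
  next
    case False
    have "inverse a *\<^sub>C (a *\<^sub>C \<phi>) = \<phi>" using False by transfer (simp add: fun_eq_iff)
    then have "norm \<phi> \<le> norm (a *\<^sub>C \<phi>) / cmod a"
      using le[of "inverse a" "a *\<^sub>C \<phi>"] by (simp add: norm_inverse divide_inverse mult.commute)
    then have "cmod a * norm \<phi> \<le> norm (a *\<^sub>C \<phi>)"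
      using False by (simp add: field_simps)
    then show ?thesis using le[of a \<phi>] by simp
  qed
qed

instance
proof
  fix r s :: real and \<phi> \<psi> :: "'a khilb"
  show "dist \<phi> \<psi> = norm (\<phi> - \<psi>)" by (fact dist_khilb_def)
  show "sgn \<phi> = \<phi> /\<^sub>R norm \<phi>" by (fact sgn_khilb_def)
  show "r *\<^sub>R (\<phi> + \<psi>) = r *\<^sub>R \<phi> + r *\<^sub>R \<psi>"
    unfolding scaleR_khilb_def by transfer (simp add: algebra_simps)
  show "(r + s) *\<^sub>R \<phi> = r *\<^sub>R \<phi> + s *\<^sub>R \<phi>"
    unfolding scaleR_khilb_def by transfer (simp add: algebra_simps)
  show "r *\<^sub>R s *\<^sub>R \<phi> = (r * s) *\<^sub>R \<phi>"
    unfolding scaleR_khilb_def by transfer (simp add: algebra_simps)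
  show "1 *\<^sub>R \<phi> = \<phi>"
    unfolding scaleR_khilb_def by transfer simp
  show "norm \<phi> = 0 \<longleftrightarrow> \<phi> = 0"
  proof
    assume "norm \<phi> = 0"
    then have "kapp \<phi> x = 0" for x using kapp_le_norm[of \<phi> x] by simp
    then show "\<phi> = 0" by transfer auto
  next
    assume "\<phi> = 0"
    then have "norm \<phi> \<le> 0" by (intro khilb_norm_le) (auto simp: zero_khilb.rep_eq keval_zero)
    then show "norm \<phi> = 0" using khilb_norm_ge0[of \<phi>] by simp
  qed
  show "norm (\<phi> + \<psi>) \<le> norm \<phi> + norm \<psi>"
    by (rule khilb_norm_le)
      (auto simp: khilb_norm_ge0 plus_khilb.rep_eq keval_add distrib_right
        intro!: order.trans[OF norm_triangle_ineq] add_mono keval_le_norm)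
  show "norm (r *\<^sub>R \<phi>) = \<bar>r\<bar> * norm \<phi>"
    unfolding scaleR_khilb_def by (simp add: khilb_norm_scaleC)
qed (simp_all add: uniformity_khilb_def open_khilb_def)

end

instance khilb :: (pd_kernel) banach
proof
  fix X :: "nat \<Rightarrow> 'a khilb"
  assume C: "Cauchy X"
  have ptw: "Cauchy (\<lambda>n. kapp (X n) x)" for x
  proof (rule metric_CauchyI)
    fix e :: real assume "e > 0"
    define s where "s = sqrt (ksq [(1::complex, x)]) + 1"
    have s: "s > 0" "sqrt (ksq [(1::complex, x)]) \<le> s" unfolding s_def
      by (simp_all add: add_nonneg_pos)
    obtain N where N: "\<And>m n. m \<ge> N \<Longrightarrow> n \<ge> N \<Longrightarrow> dist (X m) (X n) < e / s"
      using metric_CauchyD[OF C, of "e / s"] \<open>e > 0\<close> s by auto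
    have "dist (kapp (X m) x) (kapp (X n) x) < e" if "m \<ge> N" "n \<ge> N" for m n
    proof -
      have "dist (kapp (X m) x) (kapp (X n) x) \<le> norm (X m - X n) * sqrt (ksq [(1, x)])"
        using kapp_le_norm[of "X m - X n" x] by (simp add: dist_norm minus_khilb.rep_eq)
      also have "\<dots> \<le> norm (X m - X n) * s" using s by (intro mult_left_mono) auto
      also have "\<dots> < e" using N[OF that] s by (simp add: dist_norm pos_less_divide_eq)
      finally show ?thesis .
    qed
    then show "\<exists>M. \<forall>m\<ge>M. \<forall>n\<ge>M. dist (kapp (X m) x) (kapp (X n) x) < e" by blast
  qed
  define \<phi> where "\<phi> x = lim (\<lambda>n. kapp (X n) x)" for x
  have lim: "(\<lambda>n. kapp (X n) x) \<longlonglongrightarrow> \<phi> x" for x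
    unfolding \<phi>_def using ptw[of x] Cauchy_convergent convergent_LIMSEQ_iff by blast
  have limev: "(\<lambda>n. keval (kapp (X n)) v) \<longlonglongrightarrow> keval \<phi> v" for v
    by (induction v) (auto simp: keval_def intro!: tendsto_intros lim)
  obtain K where K: "\<And>n. norm (X n) \<le> K" using Cauchy_Bseq[OF C] by (auto simp: Bseq_def)
  have "0 \<le> K" using K[of 0] norm_ge_zero order.trans by blast
  have "cmod (keval \<phi> v) \<le> K * sqrt (ksq v)" for v
  proof (rule LIMSEQ_le_const2[OF tendsto_norm[OF limev]], intro exI allI impI)
    fix n show "norm (keval (kapp (X n)) v) \<le> K * sqrt (ksq v)"
      by (rule order.trans[OF keval_le_norm]) (auto intro: mult_right_mono K)
  qed
  then have "\<phi> \<in> {\<phi>. \<exists>M\<ge>0. \<forall>v. cmod (keval \<phi> v) \<le> M * sqrt (ksq v)}" using \<open>0 \<le> K\<close> by blast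
  then have kapp_phi: "kapp (Abs_khilb \<phi>) = \<phi>" by (rule Abs_khilb_inverse)
  have "X \<longlonglongrightarrow> Abs_khilb \<phi>"
  proof (rule metric_LIMSEQ_I)
    fix e :: real assume "e > 0"
    then obtain N where N: "\<And>m n. m \<ge> N \<Longrightarrow> n \<ge> N \<Longrightarrow> dist (X m) (X n) < e / 2"
      using metric_CauchyD[OF C, of "e / 2"] by auto
    have "dist (X n) (Abs_khilb \<phi>) < e" if "n \<ge> N" for n
    proof -
      have "norm (X n - Abs_khilb \<phi>) \<le> e / 2"
      proof (rule khilb_norm_le)
        fix v
        have t: "(\<lambda>m. keval (kapp (X n)) v - keval (kapp (X m)) v) \<longlonglongrightarrow> keval (kapp (X n)) v - keval \<phi> v"
          by (intro tendsto_intros limev)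
        have "cmod (keval (kapp (X n)) v - keval \<phi> v) \<le> e / 2 * sqrt (ksq v)"
        proof (rule LIMSEQ_le_const2[OF tendsto_norm[OF t]], intro exI allI impI)
          fix m assume "N \<le> m"
          have "norm (keval (kapp (X n)) v - keval (kapp (X m)) v) \<le> norm (X n - X m) * sqrt (ksq v)"
            using keval_le_norm[of "X n - X m" v] by (simp add: minus_khilb.rep_eq keval_diff)
          also have "\<dots> \<le> e / 2 * sqrt (ksq v)"
            using N[OF that \<open>N \<le> m\<close>] by (intro mult_right_mono) (auto simp: dist_norm)
          finally show "norm (keval (kapp (X n)) v - keval (kapp (X m)) v) \<le> e / 2 * sqrt (ksq v)" .
        qed
        then show "cmod (keval (kapp (X n - Abs_khilb \<phi>)) v) \<le> e / 2 * sqrt (ksq v)"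
          by (simp add: minus_khilb.rep_eq kapp_phi keval_diff)
      qed (use \<open>e > 0\<close> in simp)
      then show ?thesis using \<open>e > 0\<close> by (simp add: dist_norm)
    qed
    then show "\<exists>no. \<forall>n\<ge>no. dist (X n) (Abs_khilb \<phi>) < e" by blast
  qed
  then show "convergent X" by (auto simp: convergent_def)
qed

lemma norm_kcomb: "norm (kcomb v) = sqrt (ksq v)"
proof (rule antisym)
  show "norm (kcomb v) \<le> sqrt (ksq v)"
    by (rule khilb_norm_le) (auto simp: kcomb.rep_eq keval_kfun kform_cauchy_schwarz)
  have "cmod (kform v v) = ksq v" by (subst kform_self) simp
  then have *: "ksq v \<le> norm (kcomb v) * sqrt (ksq v)"
    using keval_le_norm[of "kcomb v" v] by (simp add: kcomb.rep_eq keval_kfun)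
  show "sqrt (ksq v) \<le> norm (kcomb v)"
  proof (cases "ksq v = 0")
    case False
    then have "sqrt (ksq v) > 0" by (simp add: order_less_le)
    moreover have "sqrt (ksq v) * sqrt (ksq v) \<le> norm (kcomb v) * sqrt (ksq v)" using * by simp
    ultimately show ?thesis using mult_le_cancel_right_pos by blast
  qed simp
qed

lemma kcomb_dense: "\<exists>v. norm (\<phi> - kcomb v) \<le> e" if "e > 0" for \<phi> :: "'x::pd_kernel khilb"
proof -
  define J where "J v = ksq v - 2 * Re (keval (kapp \<phi>) v)" for v
  have lower: "J v \<ge> - (norm \<phi>)\<^sup>2" for v
  proof -
    have "Re (keval (kapp \<phi>) v) \<le> norm \<phi> * sqrt (ksq v)"
      using keval_le_norm[of \<phi> v] complex_Re_le_cmod order.trans by blast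
    moreover have "0 \<le> (norm \<phi> - sqrt (ksq v))\<^sup>2" by simp
    ultimately show ?thesis by (simp add: J_def power2_diff)
  qed
  define d where "d = Inf (range J)"
  have d_le: "d \<le> J v" for v unfolding d_def
    by (rule cInf_lower) (auto intro: bdd_belowI lower)
  have "\<exists>v. J v < d + e\<^sup>2"
    using cInf_lessD[of "range J" "d + e\<^sup>2"] \<open>e > 0\<close> unfolding d_def by auto
  then obtain v where v: "J v < d + e\<^sup>2" by blast
  have "norm (\<phi> - kcomb v) \<le> e"
  proof (rule khilb_norm_le)
    fix w
    let ?g = "kform v w - cnj (keval (kapp \<phi>) w)"
    have "0 \<le> e\<^sup>2 + 2 * Re (s * ?g) + (cmod s)\<^sup>2 * ksq w" for s
    proof -
      have "Re (cnj s * keval (kapp \<phi>) w) = Re (s * cnj (keval (kapp \<phi>) w))" by simp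
      then have "J (v @ kscale s w) = J v + 2 * Re (s * ?g) + (cmod s)\<^sup>2 * ksq w"
        unfolding J_def ksq_add_scaled by (simp add: keval_append keval_scale algebra_simps)
      then show ?thesis using d_le[of "v @ kscale s w"] v by simp
    qed
    then have "(cmod ?g)\<^sup>2 \<le> e\<^sup>2 * ksq w" by (rule kern_rotate) simp_all
    then have "cmod ?g \<le> e * sqrt (ksq w)"
      using \<open>e > 0\<close> real_le_rsqrt[of "cmod ?g" "e\<^sup>2 * ksq w"] by (simp add: real_sqrt_mult)
    moreover have "cmod ?g = cmod (keval (kapp \<phi>) w - kform w v)"
      by (metis complex_cnj_cnj complex_cnj_diff complex_mod_cnj kform_commute norm_minus_commute)
    ultimately show "cmod (keval (kapp (\<phi> - kcomb v)) w) \<le> e * sqrt (ksq w)"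
      by (simp add: minus_khilb.rep_eq keval_diff kcomb.rep_eq keval_kfun)
  qed (use \<open>e > 0\<close> in simp)
  then show ?thesis by blast
qed

lemma kcomb_seq: "\<exists>v. (\<lambda>n. kcomb (v n)) \<longlonglongrightarrow> \<phi>" for \<phi> :: "'x::pd_kernel khilb"
proof -
  have "\<forall>n. \<exists>v. norm (\<phi> - kcomb v) \<le> 1 / real (Suc n)" by (simp add: kcomb_dense)
  then obtain v where v: "\<And>n. norm (\<phi> - kcomb (v n)) \<le> 1 / real (Suc n)" by metis
  have "(\<lambda>n. norm (kcomb (v n) - \<phi>)) \<longlonglongrightarrow> 0"
  proof (rule tendsto_sandwich[OF _ _ tendsto_const])
    show "(\<lambda>n. 1 / real (Suc n)) \<longlonglongrightarrow> 0" by (rule LIMSEQ_inverse_real_of_nat[unfolded inverse_eq_divide])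
  qed (use v in \<open>auto simp: norm_minus_commute\<close>)
  then have "(\<lambda>n. kcomb (v n)) \<longlonglongrightarrow> \<phi>" by (simp add: LIM_zero_iff tendsto_norm_zero_iff)
  then show ?thesis by blast
qed

lemma kcomb_append: "kcomb (v @ w) = kcomb v + kcomb w"
  by transfer (simp add: kfun_append)

lemma kcomb_scale: "kcomb (kscale a v) = a *\<^sub>C kcomb v"
  by transfer (simp add: kfun_scale)

lemma khilb_scaleC_simps:
  fixes \<phi> \<psi> :: "'x::pd_kernel khilb"
  shows "a *\<^sub>C (\<phi> + \<psi>) = a *\<^sub>C \<phi> + a *\<^sub>C \<psi>" "(a + b) *\<^sub>C \<phi> = a *\<^sub>C \<phi> + b *\<^sub>C \<phi>"
    "a *\<^sub>C (b *\<^sub>C \<phi>) = (a * b) *\<^sub>C \<phi>" "(-1) *\<^sub>C \<phi> = - \<phi>"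
  by (transfer; simp add: algebra_simps)+

lemma tendsto_scaleC_khilb:
  fixes \<phi> :: "'x::pd_kernel khilb"
  assumes "X \<longlonglongrightarrow> \<phi>"
  shows "(\<lambda>n. a *\<^sub>C X n) \<longlonglongrightarrow> a *\<^sub>C \<phi>"
proof -
  have "bounded_linear (\<lambda>\<phi>::'x khilb. a *\<^sub>C \<phi>)"
  proof (rule bounded_linear_intro[where K = "cmod a"])
    show "a *\<^sub>C (r *\<^sub>R x) = r *\<^sub>R (a *\<^sub>C x)" for r and x :: "'x khilb"
      by (simp add: scaleR_khilb_def khilb_scaleC_simps mult.commute)
  qed (auto simp: khilb_scaleC_simps khilb_norm_scaleC mult.commute)
  then show ?thesis using assms by (rule bounded_linear.tendsto)
qed

instantiation khilb :: (pd_kernel) complex_hilbert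
begin

definition cinner_khilb :: "'a khilb \<Rightarrow> 'a khilb \<Rightarrow> complex" where
  "cinner_khilb \<phi> \<psi> = (complex_of_real ((norm (\<phi> + \<psi>))\<^sup>2 - (norm (\<phi> - \<psi>))\<^sup>2)
      - \<i> * complex_of_real ((norm (\<phi> + \<i> *\<^sub>C \<psi>))\<^sup>2 - (norm (\<phi> - \<i> *\<^sub>C \<psi>))\<^sup>2)) / 4"

lemma tendsto_cinner_khilb:
  fixes \<phi> \<psi> :: "'a khilb"
  assumes "X \<longlonglongrightarrow> \<phi>" "Y \<longlonglongrightarrow> \<psi>"
  shows "(\<lambda>n. cinner (X n) (Y n)) \<longlonglongrightarrow> cinner \<phi> \<psi>"
  unfolding cinner_khilb_def by (intro tendsto_intros tendsto_scaleC_khilb assms) simp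

lemma cinner_kcomb: "cinner (kcomb v) (kcomb w) = kform (v :: (complex \<times> 'a) list) w"
proof -
  have n: "(norm (kcomb v + s *\<^sub>C kcomb w))\<^sup>2 = ksq v + 2 * Re (s * kform v w) + (cmod s)\<^sup>2 * ksq w" for s
    unfolding kcomb_append[symmetric] kcomb_scale[symmetric] norm_kcomb real_sqrt_pow2[OF ksq_nonneg]
    by (rule ksq_add_scaled)
  have m: "kcomb v - kcomb w = kcomb v + (-1) *\<^sub>C kcomb w"
    "kcomb v - \<i> *\<^sub>C kcomb w = kcomb v + (-\<i>) *\<^sub>C kcomb w"
    "kcomb v + kcomb w = kcomb v + 1 *\<^sub>C kcomb w"
    by (transfer; simp add: fun_eq_iff)+
  show ?thesis unfolding cinner_khilb_def m n by (simp add: complex_eq_iff)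
qed

instance
proof
  fix \<phi> \<psi> \<xi> :: "'a khilb" and a b :: complex and r :: real
  obtain u v w where u: "(\<lambda>n. kcomb (u n)) \<longlonglongrightarrow> \<phi>" and v: "(\<lambda>n. kcomb (v n)) \<longlonglongrightarrow> \<psi>"
    and w: "(\<lambda>n. kcomb (w n)) \<longlonglongrightarrow> \<xi>" using kcomb_seq by metis
  show "r *\<^sub>R \<phi> = complex_of_real r *\<^sub>C \<phi>" by (fact scaleR_khilb_def)
  show "a *\<^sub>C (\<phi> + \<psi>) = a *\<^sub>C \<phi> + a *\<^sub>C \<psi>" "(a + b) *\<^sub>C \<phi> = a *\<^sub>C \<phi> + b *\<^sub>C \<phi>"
    "a *\<^sub>C (b *\<^sub>C \<phi>) = (a * b) *\<^sub>C \<phi>" by (fact khilb_scaleC_simps)+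
  show "cinner \<phi> \<psi> = cnj (cinner \<psi> \<phi>)"
  proof (rule LIMSEQ_unique[OF tendsto_cinner_khilb[OF u v]])
    have "(\<lambda>n. cnj (cinner (kcomb (v n)) (kcomb (u n)))) \<longlonglongrightarrow> cnj (cinner \<psi> \<phi>)"
      by (intro tendsto_intros tendsto_cinner_khilb u v)
    then show "(\<lambda>n. cinner (kcomb (u n)) (kcomb (v n))) \<longlonglongrightarrow> cnj (cinner \<psi> \<phi>)"
      by (simp add: cinner_kcomb flip: kform_commute)
  qed
  show "cinner \<phi> (\<psi> + \<xi>) = cinner \<phi> \<psi> + cinner \<phi> \<xi>"
  proof (rule LIMSEQ_unique[OF tendsto_cinner_khilb[OF u tendsto_add[OF v w]]])
    have "(\<lambda>n. cinner (kcomb (u n)) (kcomb (v n)) + cinner (kcomb (u n)) (kcomb (w n)))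
        \<longlonglongrightarrow> cinner \<phi> \<psi> + cinner \<phi> \<xi>"
      by (intro tendsto_intros tendsto_cinner_khilb u v w)
    then show "(\<lambda>n. cinner (kcomb (u n)) (kcomb (v n) + kcomb (w n))) \<longlonglongrightarrow> cinner \<phi> \<psi> + cinner \<phi> \<xi>"
      by (simp add: cinner_kcomb kcomb_append[symmetric] kform_append_right)
  qed
  show "cinner \<phi> (a *\<^sub>C \<psi>) = a * cinner \<phi> \<psi>"
  proof (rule LIMSEQ_unique[OF tendsto_cinner_khilb[OF u tendsto_scaleC_khilb[OF v]]])
    have "(\<lambda>n. a * cinner (kcomb (u n)) (kcomb (v n))) \<longlonglongrightarrow> a * cinner \<phi> \<psi>"
      by (intro tendsto_intros tendsto_cinner_khilb u v)
    then show "(\<lambda>n. cinner (kcomb (u n)) (a *\<^sub>C kcomb (v n))) \<longlonglongrightarrow> a * cinner \<phi> \<psi>"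
      by (simp add: cinner_kcomb kcomb_scale[symmetric] kform_scale_right)
  qed
  show "cinner \<phi> \<phi> = complex_of_real ((norm \<phi>)\<^sup>2)"
  proof (rule LIMSEQ_unique[OF tendsto_cinner_khilb[OF u u]])
    have "(\<lambda>n. complex_of_real ((norm (kcomb (u n)))\<^sup>2)) \<longlonglongrightarrow> complex_of_real ((norm \<phi>)\<^sup>2)"
      by (intro tendsto_intros u)
    then show "(\<lambda>n. cinner (kcomb (u n)) (kcomb (u n))) \<longlonglongrightarrow> complex_of_real ((norm \<phi>)\<^sup>2)"
      by (simp add: cinner_kcomb norm_kcomb flip: kform_self of_real_power)
  qed
qed

end

lemma cinner_kvec: "cinner (kvec x) (kvec y) = kern x y"
  by (simp add: kvec_def cinner_kcomb kform_def)

lemma cinner_kvec_left: "cinner (kvec x) \<phi> = kapp \<phi> x"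
proof -
  obtain u where u: "(\<lambda>n. kcomb (u n)) \<longlonglongrightarrow> \<phi>" using kcomb_seq by metis
  have "(\<lambda>n. kapp (kcomb (u n)) x) \<longlonglongrightarrow> kapp \<phi> x"
  proof (rule LIM_zero_cancel, rule tendsto_0_le[where K = "sqrt (ksq [(1, x)])"])
    show "(\<lambda>n. kcomb (u n) - \<phi>) \<longlonglongrightarrow> 0" using u by (simp add: LIM_zero)
    show "\<forall>\<^sub>F n in sequentially. norm (kapp (kcomb (u n)) x - kapp \<phi> x)
        \<le> norm (kcomb (u n) - \<phi>) * sqrt (ksq [(1, x)])"
      using kapp_le_norm[of "kcomb (u _) - \<phi>" x] by (simp add: minus_khilb.rep_eq)
  qed
  moreover have "cinner (kvec x) (kcomb v) = kapp (kcomb v) x" for v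
    by (simp add: kvec_def cinner_kcomb kcomb.rep_eq flip: keval_kfun) (simp add: keval_single)
  moreover have "(\<lambda>n. cinner (kvec x) (kcomb (u n))) \<longlonglongrightarrow> cinner (kvec x) \<phi>"
    by (intro tendsto_cinner_khilb u tendsto_const)
  ultimately show ?thesis using LIMSEQ_unique by simp
qed

lemma kvec_total: "(\<And>x. cinner (kvec x) \<phi> = 0) \<Longrightarrow> \<phi> = 0"
  unfolding cinner_kvec_left by transfer auto

lemma cinner_add_scaled:
  "(norm (x + s *\<^sub>C y))\<^sup>2 = (norm x)\<^sup>2 + 2 * Re (s * cinner x y) + (cmod s)\<^sup>2 * (norm (y::'a::complex_hilbert))\<^sup>2"
proof -
  have "complex_of_real ((norm (x + s *\<^sub>C y))\<^sup>2) = cinner (x + s *\<^sub>C y) (x + s *\<^sub>C y)"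
    by (rule cinner_self[symmetric])
  also have "\<dots> = complex_of_real ((norm x)\<^sup>2) + (s * cinner x y + cnj (s * cinner x y))
      + complex_of_real ((cmod s)\<^sup>2) * complex_of_real ((norm y)\<^sup>2)"
    unfolding complex_norm_square[of s] cinner_self[of x, symmetric] cinner_self[of y, symmetric]
    by (simp add: cinner_add_left cinner_add_right cinner_scaleC_left cinner_scaleC_right algebra_simps
        flip: cinner_commute)
  also have "\<dots> = complex_of_real ((norm x)\<^sup>2 + 2 * Re (s * cinner x y) + (cmod s)\<^sup>2 * (norm y)\<^sup>2)"
    unfolding complex_add_cnj by simp
  finally show ?thesis by (simp only: of_real_eq_iff)
qed

lemma cinner_cauchy_schwarz: "cmod (cinner x y) \<le> norm x * norm (y::'a::complex_hilbert)"
proof -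
  have "(cmod (cinner x y))\<^sup>2 \<le> (norm x)\<^sup>2 * (norm y)\<^sup>2"
    by (rule kern_rotate) (simp_all only: cinner_add_scaled[symmetric] zero_le_power2)
  then show ?thesis by (metis norm_ge_zero mult_nonneg_nonneg power2_le_imp_le power_mult_distrib)
qed

lemma bounded_bilinear_cinner: "bounded_bilinear (cinner :: 'a::complex_hilbert \<Rightarrow> 'a \<Rightarrow> complex)"
proof
  fix x y z :: 'a and r :: real
  show "cinner (x + y) z = cinner x z + cinner y z" by (rule cinner_add_left)
  show "cinner x (y + z) = cinner x y + cinner x z" by (rule cinner_add_right)
  show "cinner (r *\<^sub>R x) y = r *\<^sub>R cinner x y" "cinner x (r *\<^sub>R y) = r *\<^sub>R cinner x y"
    by (simp_all add: scaleR_scaleC cinner_scaleC_left cinner_scaleC_right scaleC_complex_def)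
  show "\<exists>K. \<forall>x y :: 'a. cmod (cinner x y) \<le> norm x * norm y * K"
    by (intro exI[of _ 1]) (simp add: cinner_cauchy_schwarz)
qed

lemma finite_orthonormal:
  fixes S :: "'a::complex_hilbert set"
  assumes "finite S"
  shows "\<exists>E. finite E \<and> (\<forall>e\<in>E. \<forall>f\<in>E. cinner e f = (if e = f then 1 else 0)) \<and>
    (\<forall>x\<in>S. x = (\<Sum>e\<in>E. cinner e x *\<^sub>C e))"
  using assms
proof (induction S)
  case empty
  show ?case by (intro exI[of _ "{}"]) auto
next
  case (insert x S)
  then obtain E where E: "finite E" "\<And>e f. e \<in> E \<Longrightarrow> f \<in> E \<Longrightarrow> cinner e f = (if e = f then 1 else 0)"
    and S: "\<And>z. z \<in> S \<Longrightarrow> z = (\<Sum>e\<in>E. cinner e z *\<^sub>C e)" by blast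
  define y where "y = x - (\<Sum>e\<in>E. cinner e x *\<^sub>C e)"
  have ortho: "cinner f y = 0" if "f \<in> E" for f
  proof -
    have "cinner f (\<Sum>e\<in>E. cinner e x *\<^sub>C e) = (\<Sum>e\<in>E. if f = e then cinner e x else 0)"
      unfolding cinner_sum_right by (intro sum.cong) (auto simp: cinner_scaleC_right E(2) that)
    then show ?thesis using that E(1) by (simp add: y_def cinner_diff_right)
  qed
  show ?case
  proof (cases "y = 0")
    case True
    then show ?thesis using E S by (intro exI[of _ E]) (auto simp: y_def)
  next
    case False
    define g where "g = complex_of_real (1 / norm y) *\<^sub>C y"
    have gE: "cinner f g = 0" "cinner g f = 0" if "f \<in> E" for f
      using ortho[OF that] cinner_commute[of y f] by (simp_all add: g_def cinner_scaleC_right cinner_scaleC_left)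
    have "norm g = 1" unfolding g_def scaleR_scaleC[symmetric] using False by simp
    then have gg: "cinner g g = 1" by (simp add: cinner_self[of g])
    have "g \<notin> E" using gE gg by fastforce
    have gsum: "cinner g (\<Sum>e\<in>E. a e *\<^sub>C e) = 0" for a
      unfolding cinner_sum_right by (intro sum.neutral) (auto simp: cinner_scaleC_right gE)
    have "x = (\<Sum>e\<in>insert g E. cinner e x *\<^sub>C e)"
    proof -
      have "x = y + (\<Sum>e\<in>E. cinner e x *\<^sub>C e)" by (simp add: y_def)
      moreover from this have "cinner g x = cinner g y" by (metis add.right_neutral cinner_add_right gsum)
      moreover have "cinner g y *\<^sub>C g = y"
      proof -
        have "cinner g y = complex_of_real (norm y)"
          using False by (simp add: g_def cinner_scaleC_left cinner_self[of y] power2_eq_square)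
        then show ?thesis using False by (simp add: g_def scaleC_scaleC)
      qed
      ultimately show ?thesis using E(1) \<open>g \<notin> E\<close> by simp
    qed
    moreover have "z = (\<Sum>e\<in>insert g E. cinner e z *\<^sub>C e)" if "z \<in> S" for z
    proof -
      have "cinner g z = 0" by (subst S[OF that]) (rule gsum)
      then show ?thesis using S[OF that] E(1) \<open>g \<notin> E\<close> by simp
    qed
    moreover have "cinner e f = (if e = f then 1 else 0)" if "e \<in> insert g E" "f \<in> insert g E" for e f
      using that E(2) gE gg \<open>g \<notin> E\<close> by (cases "e = g"; cases "f = g") auto
    ultimately show ?thesis using E(1) by (intro exI[of _ "insert g E"] conjI ballI) blast+
  qed
qed

lemma schur_product:
  fixes u :: "'i \<Rightarrow> 'a::complex_hilbert" and K :: "'i \<Rightarrow> 'i \<Rightarrow> complex"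
  assumes "finite I" and K: "\<And>c. 0 \<le> Re (\<Sum>i\<in>I. \<Sum>j\<in>I. cnj (c i) * c j * K i j)"
  shows "0 \<le> Re (\<Sum>i\<in>I. \<Sum>j\<in>I. cnj (c i) * c j * (cinner (u i) (u j) * K i j))"
proof -
  obtain E where E: "finite E" "\<And>x. x \<in> u ` I \<Longrightarrow> x = (\<Sum>e\<in>E. cinner e x *\<^sub>C e)"
    using finite_orthonormal[of "u ` I"] assms(1) by blast
  have exp: "cinner (u i) (u j) = (\<Sum>e\<in>E. cnj (cinner e (u i)) * cinner e (u j))" if "j \<in> I" for i j
    by (subst E(2)[of "u j"])
      (use that in \<open>auto simp: cinner_sum_right cinner_scaleC_right mult.commute intro!: sum.cong
        simp flip: cinner_commute\<close>)
  have "(\<Sum>i\<in>I. \<Sum>j\<in>I. cnj (c i) * c j * (cinner (u i) (u j) * K i j))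
      = (\<Sum>i\<in>I. \<Sum>j\<in>I. \<Sum>e\<in>E. cnj (c i * cinner e (u i)) * (c j * cinner e (u j)) * K i j)"
    by (intro sum.cong refl) (simp add: exp sum_distrib_left sum_distrib_right mult_ac)
  also have "\<dots> = (\<Sum>e\<in>E. \<Sum>i\<in>I. \<Sum>j\<in>I. cnj (c i * cinner e (u i)) * (c j * cinner e (u j)) * K i j)"
    by (simp only: sum.swap[where A = I and B = E])
  finally have "Re (\<Sum>i\<in>I. \<Sum>j\<in>I. cnj (c i) * c j * (cinner (u i) (u j) * K i j))
      = (\<Sum>e\<in>E. Re (\<Sum>i\<in>I. \<Sum>j\<in>I. cnj (c i * cinner e (u i)) * (c j * cinner e (u j)) * K i j))"
    by (simp only: Re_sum)
  then show ?thesis using K by (simp only: sum_nonneg)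
qed

lemma sum_list_square_nth:
  "(\<Sum>(c, x)\<leftarrow>v. \<Sum>(d, y)\<leftarrow>v. cnj c * d * K x y)
    = (\<Sum>i<length v. \<Sum>j<length v. cnj (fst (v ! i)) * fst (v ! j) * K (snd (v ! i)) (snd (v ! j)))"
  by (simp add: sum_list_sum_nth case_prod_unfold atLeast0LessThan)

lemma rank_one_psd: "0 \<le> Re (\<Sum>i\<in>I. \<Sum>j\<in>I. cnj (c i) * c j)"
proof -
  have "(\<Sum>i\<in>I. \<Sum>j\<in>I. cnj (c i) * c j) = sum c I * cnj (sum c I)"
    by (subst sum.swap) (simp add: sum_product mult.commute)
  then show ?thesis by (simp only: complex_norm_square[symmetric] Re_complex_of_real zero_le_power2)
qed

section \<open>Tensor product\<close>

datatype ('a, 'b) simple_tensor = Simple_Tensor 'a 'b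

instantiation simple_tensor :: (complex_hilbert, complex_hilbert) pd_kernel
begin

fun kern_simple_tensor :: "('a, 'b) simple_tensor \<Rightarrow> ('a, 'b) simple_tensor \<Rightarrow> complex" where
  "kern_simple_tensor (Simple_Tensor x y) (Simple_Tensor x' y') = cinner x x' * cinner y y'"

instance
proof
  fix p q :: "('a, 'b) simple_tensor"
  show "kern p q = cnj (kern q p)"
    by (cases p; cases q) (simp flip: cinner_commute)
next
  fix v :: "(complex \<times> ('a, 'b) simple_tensor) list"
  define n where "n = length v"
  define c where "c i = fst (v ! i)" for i
  define x where "x i = (case snd (v ! i) of Simple_Tensor a b \<Rightarrow> a)" for i
  define y where "y i = (case snd (v ! i) of Simple_Tensor a b \<Rightarrow> b)" for i
  have st: "snd (v ! i) = Simple_Tensor (x i) (y i)" for i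
    by (simp add: x_def y_def split: simple_tensor.split)
  have one: "0 \<le> Re (\<Sum>i<n. \<Sum>j<n. cnj (c i) * c j * 1)" for c :: "nat \<Rightarrow> complex"
    using rank_one_psd[of c "{..<n}"] by simp
  have "0 \<le> Re (\<Sum>i<n. \<Sum>j<n. cnj (c i) * c j * (cinner (x i) (x j) * (cinner (y i) (y j) * 1)))"
    by (intro schur_product one) simp_all
  then show "0 \<le> Re (\<Sum>(c, p)\<leftarrow>v. \<Sum>(d, q)\<leftarrow>v. cnj c * d * kern p q)"
    unfolding sum_list_square_nth by (simp add: st n_def c_def)
qed

end

type_synonym ('a, 'b) tensor = "('a, 'b) simple_tensor khilb"

definition tensor_vec :: "'a::complex_hilbert \<Rightarrow> 'b::complex_hilbert \<Rightarrow> ('a, 'b) tensor"  (infixl "\<otimes>" 70) where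
  "x \<otimes> y = kvec (Simple_Tensor x y)"

lemma cinner_tensor: "cinner (x \<otimes> y) (x' \<otimes> y') = cinner x x' * cinner y y'"
  by (simp add: tensor_vec_def cinner_kvec)

section \<open>Symmetric Fock space\<close>

text \<open>
  The symbol \<open>Symmetric_Tensor [x\<^sub>1, \<dots>, x\<^sub>n]\<close> stands for the orthogonal projection of
  \<open>x\<^sub>1 \<otimes> \<dots> \<otimes> x\<^sub>n\<close> onto the symmetric tensors; its inner product with the projection of
  \<open>y\<^sub>1 \<otimes> \<dots> \<otimes> y\<^sub>n\<close> is the average over all permutations \<open>p\<close> of the products of the
  \<open>\<langle>x\<^sub>i, y\<^bsub>p i\<^esub>\<rangle>\<close>.  Tensors of different degree are orthogonal.
\<close>

lemma product_psd:
  fixes x :: "'i \<Rightarrow> nat \<Rightarrow> 'a::complex_hilbert"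
  assumes "finite I"
  shows "0 \<le> Re (\<Sum>i\<in>I. \<Sum>j\<in>I. cnj (c i) * c j * (\<Prod>m<n. cinner (x i m) (x j m)))"
proof (induction n arbitrary: c)
  case 0
  show ?case using rank_one_psd[of c I] by simp
next
  case (Suc n)
  then show ?case
    using schur_product[OF assms Suc.IH, of c "\<lambda>i. x i n"]
    by (simp add: mult.commute)
qed

lemma permanent_shift:
  fixes x y :: "nat \<Rightarrow> 'a::complex_hilbert"
  assumes q: "q permutes {..<n}"
  shows "(\<Sum>p | p permutes {..<n}. \<Prod>m<n. cinner (x (q m)) (y (p m)))
    = (\<Sum>p | p permutes {..<n}. \<Prod>m<n. cinner (x m) (y (p m)))"
proof -
  have "(\<Prod>m<n. cinner (x (q m)) (y ((p \<circ> q) m))) = (\<Prod>m<n. cinner (x m) (y (p m)))" for p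
    using prod.permute[OF q, of "\<lambda>m. cinner (x m) (y (p m))"] by (simp add: o_def)
  then show ?thesis
    unfolding sum_permutations_compose_right[OF q, of "\<lambda>p. \<Prod>m<n. cinner (x (q m)) (y (p m))"] by simp
qed

lemma permanent_psd:
  fixes x :: "'i \<Rightarrow> nat \<Rightarrow> 'a::complex_hilbert"
  assumes "finite I"
  shows "0 \<le> Re (\<Sum>i\<in>I. \<Sum>j\<in>I. cnj (c i) * c j *
    (\<Sum>p | p permutes {..<n}. \<Prod>m<n. cinner (x i m) (x j (p m))))"
proof -
  let ?P = "{p. p permutes {..<n}}"
  let ?f = "\<lambda>i q j p. cnj (c i) * c j * (\<Prod>m<n. cinner (x i (q m)) (x j (p m)))"
  have finP: "finite ?P" by (rule finite_permutations) simp
  have "(\<Sum>s\<in>I \<times> ?P. \<Sum>t\<in>I \<times> ?P. ?f (fst s) (snd s) (fst t) (snd t))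
      = (\<Sum>i\<in>I. \<Sum>q\<in>?P. \<Sum>j\<in>I. \<Sum>p\<in>?P. ?f i q j p)"
    by (simp only: sum.cartesian_product' fst_conv snd_conv)
  also have "\<dots> = (\<Sum>i\<in>I. \<Sum>j\<in>I. \<Sum>q\<in>?P. \<Sum>p\<in>?P. ?f i q j p)"
    by (intro sum.cong refl sum.swap)
  also have "\<dots> = (\<Sum>i\<in>I. \<Sum>j\<in>I. \<Sum>q\<in>?P. cnj (c i) * c j *
      (\<Sum>p\<in>?P. \<Prod>m<n. cinner (x i m) (x j (p m))))"
    by (intro sum.cong refl) (simp add: permanent_shift flip: sum_distrib_left)
  also have "\<dots> = complex_of_real (fact n) * (\<Sum>i\<in>I. \<Sum>j\<in>I. cnj (c i) * c j *
      (\<Sum>p\<in>?P. \<Prod>m<n. cinner (x i m) (x j (p m))))"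
    by (simp add: card_permutations[of "{..<n}" n] sum_distrib_left)
  finally have "Re (\<Sum>s\<in>I \<times> ?P. \<Sum>t\<in>I \<times> ?P. ?f (fst s) (snd s) (fst t) (snd t))
      = fact n * Re (\<Sum>i\<in>I. \<Sum>j\<in>I. cnj (c i) * c j * (\<Sum>p\<in>?P. \<Prod>m<n. cinner (x i m) (x j (p m))))"
    by (simp only: Re_complex_of_real Im_complex_of_real times_complex.simps)
  moreover have "0 \<le> Re (\<Sum>s\<in>I \<times> ?P. \<Sum>t\<in>I \<times> ?P. ?f (fst s) (snd s) (fst t) (snd t))"
    using product_psd[of "I \<times> ?P" "\<lambda>s. c (fst s)" "\<lambda>s m. x (fst s) (snd s m)" n] assms finP by simp
  moreover have "0 \<le> r" if "0 \<le> fact n * r" for r :: real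
    using that fact_gt_zero[of n, where ?'a = real] by (simp only: zero_le_mult_iff) linarith
  ultimately show ?thesis by (simp only:)
qed

datatype 'a symmetric_tensor = Symmetric_Tensor "'a list"

instantiation symmetric_tensor :: (complex_hilbert) pd_kernel
begin

fun kern_symmetric_tensor :: "'a symmetric_tensor \<Rightarrow> 'a symmetric_tensor \<Rightarrow> complex" where
  "kern_symmetric_tensor (Symmetric_Tensor xs) (Symmetric_Tensor ys) =
    (if length xs = length ys
     then (\<Sum>p | p permutes {..<length xs}. \<Prod>i<length xs. cinner (xs ! i) (ys ! p i)) / fact (length xs)
     else 0)"

instance
proof
  fix a b :: "'a symmetric_tensor"
  obtain xs ys where ab: "a = Symmetric_Tensor xs" "b = Symmetric_Tensor ys"
    by (metis symmetric_tensor.exhaust)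
  show "kern a b = cnj (kern b a)"
  proof (cases "length xs = length ys")
    case True
    let ?n = "length ys"
    have "(\<Sum>p | p permutes {..<?n}. \<Prod>i<?n. cinner (xs ! i) (ys ! p i))
        = (\<Sum>p | p permutes {..<?n}. \<Prod>i<?n. cinner (xs ! i) (ys ! inv p i))"
      by (rule sum_permutations_inverse)
    also have "\<dots> = (\<Sum>p | p permutes {..<?n}. \<Prod>i<?n. cinner (xs ! p i) (ys ! i))"
    proof (intro sum.cong refl)
      fix p assume "p \<in> {p. p permutes {..<?n}}"
      then have p: "p permutes {..<?n}" by simp
      show "(\<Prod>i<?n. cinner (xs ! i) (ys ! inv p i)) = (\<Prod>i<?n. cinner (xs ! p i) (ys ! i))"
        using prod.permute[OF p, of "\<lambda>i. cinner (xs ! i) (ys ! inv p i)"]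
        by (simp add: o_def permutes_inverses[OF p])
    qed
    also have "\<dots> = cnj (\<Sum>p | p permutes {..<?n}. \<Prod>i<?n. cinner (ys ! i) (xs ! p i))"
      by (simp flip: cinner_commute)
    finally show ?thesis using True by (simp add: ab)
  qed (simp add: ab)
next
  fix v :: "(complex \<times> 'a symmetric_tensor) list"
  define N where "N = length v"
  define c where "c i = fst (v ! i)" for i
  define x where "x i = (case snd (v ! i) of Symmetric_Tensor xs \<Rightarrow> xs)" for i
  have st: "snd (v ! i) = Symmetric_Tensor (x i)" for i
    by (simp add: x_def split: symmetric_tensor.split)
  define L where "L = (\<lambda>i. length (x i)) ` {..<N}"
  define d where "d n i = (if length (x i) = n then c i else 0)" for n i
  let ?S = "\<lambda>n i j. \<Sum>p | p permutes {..<n}. \<Prod>m<n. cinner (x i ! m) (x j ! p m)"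
  have "(\<Sum>i<N. \<Sum>j<N. cnj (c i) * c j * kern (Symmetric_Tensor (x i)) (Symmetric_Tensor (x j)))
      = (\<Sum>i<N. \<Sum>j<N. \<Sum>n\<in>L. (cnj (d n i) * d n j * ?S n i j) / fact n)"
  proof (intro sum.cong refl)
    fix i j assume "i \<in> {..<N}"
    have "(\<Sum>n\<in>L. (cnj (d n i) * d n j * ?S n i j) / fact n)
        = (\<Sum>n\<in>L. if length (x i) = n then (cnj (c i) * d n j * ?S n i j) / fact n else 0)"
      by (intro sum.cong) (auto simp: d_def)
    also have "\<dots> = (cnj (c i) * d (length (x i)) j * ?S (length (x i)) i j) / fact (length (x i))"
      using \<open>i \<in> {..<N}\<close> by (simp add: L_def)
    also have "\<dots> = cnj (c i) * c j * kern (Symmetric_Tensor (x i)) (Symmetric_Tensor (x j))"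
      by (simp add: d_def)
    finally show "cnj (c i) * c j * kern (Symmetric_Tensor (x i)) (Symmetric_Tensor (x j))
        = (\<Sum>n\<in>L. (cnj (d n i) * d n j * ?S n i j) / fact n)" by simp
  qed
  also have "\<dots> = (\<Sum>n\<in>L. (\<Sum>i<N. \<Sum>j<N. cnj (d n i) * d n j * ?S n i j) / fact n)"
    by (simp only: sum.swap[where A = "{..<N}" and B = L] sum_divide_distrib)
  finally have "Re (\<Sum>(c, a)\<leftarrow>v. \<Sum>(d, b)\<leftarrow>v. cnj c * d * kern a b)
      = (\<Sum>n\<in>L. Re ((\<Sum>i<N. \<Sum>j<N. cnj (d n i) * d n j * ?S n i j) / complex_of_real (fact n)))"
    unfolding sum_list_square_nth by (simp only: st c_def N_def Re_sum of_real_fact)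
  also have "\<dots> \<ge> 0"
    unfolding Re_divide_of_real
    by (intro sum_nonneg divide_nonneg_nonneg permanent_psd) auto
  finally show "0 \<le> Re (\<Sum>(c, a)\<leftarrow>v. \<Sum>(d, b)\<leftarrow>v. cnj c * d * kern a b)" .
qed

end

type_synonym 'a fock = "'a symmetric_tensor khilb"

section \<open>Square integrable functions on the half-line\<close>

text \<open>
  The range is not assumed separable, so measurability means being a limit of simple functions.
  Functions are defined on the whole line, but only their values on the half-line matter.
\<close>

definition halfline :: "real measure" where
  "halfline = restrict_space lborel {0..}"

lemma space_halfline [simp]: "space halfline = {0..}"
  by (simp add: halfline_def space_restrict_space)

definition strongly_measurable :: "'a measure \<Rightarrow> ('a \<Rightarrow> 'b::topological_space) \<Rightarrow> bool" where
  "strongly_measurable M f \<longleftrightarrow>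
    (\<exists>s. (\<forall>n. simple_function M (s n)) \<and> (\<forall>t\<in>space M. (\<lambda>n::nat. s n t) \<longlonglongrightarrow> f t))"

typedef (overloaded) 'k sq_integrable =
  "{f :: real \<Rightarrow> 'k::complex_hilbert. strongly_measurable halfline f \<and> integrable halfline (\<lambda>t. (norm (f t))\<^sup>2)}"
  morphisms sq_fun Sq_fun
  by (rule exI[of _ "\<lambda>_. 0"]) (auto simp: strongly_measurable_def intro!: exI[of _ "\<lambda>_ _. 0"])

lemma strongly_measurable_cinner:
  fixes f g :: "'a \<Rightarrow> 'b::complex_hilbert"
  assumes f: "strongly_measurable M f" and g: "strongly_measurable M g"
  shows "(\<lambda>t. cinner (f t) (g t)) \<in> borel_measurable M"
proof -
  from f obtain r :: "nat \<Rightarrow> 'a \<Rightarrow> 'b"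
    where r: "\<forall>n. simple_function M (r n)" "\<forall>t\<in>space M. (\<lambda>n. r n t) \<longlonglongrightarrow> f t"
    unfolding strongly_measurable_def by (elim exE conjE)
  from g obtain s :: "nat \<Rightarrow> 'a \<Rightarrow> 'b"
    where s: "\<forall>n. simple_function M (s n)" "\<forall>t\<in>space M. (\<lambda>n. s n t) \<longlonglongrightarrow> g t"
    unfolding strongly_measurable_def by (elim exE conjE)
  show ?thesis
  proof (rule borel_measurable_LIMSEQ_metric)
    fix n :: nat
    show "(\<lambda>t. cinner (r n t) (s n t)) \<in> borel_measurable M"
      by (rule borel_measurable_simple_function, rule simple_function_compose2) (use r s in blast)+
  next
    fix t assume "t \<in> space M"
    then show "(\<lambda>n. cinner (r n t) (s n t)) \<longlonglongrightarrow> cinner (f t) (g t)"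
      by (intro bounded_bilinear.tendsto[OF bounded_bilinear_cinner]) (use r s in blast)+
  qed
qed

lemma sq_cinner_integrable:
  "integrable halfline (\<lambda>t. cinner (sq_fun f t) (sq_fun g t))"
proof (rule Bochner_Integration.integrable_bound)
  have fg: "integrable halfline (\<lambda>t. (norm (sq_fun f t))\<^sup>2)" "integrable halfline (\<lambda>t. (norm (sq_fun g t))\<^sup>2)"
    using sq_fun[of f] sq_fun[of g] by auto
  then show "integrable halfline (\<lambda>t. (norm (sq_fun f t))\<^sup>2 + (norm (sq_fun g t))\<^sup>2)" by simp
  show "(\<lambda>t. cinner (sq_fun f t) (sq_fun g t)) \<in> borel_measurable halfline"
    using sq_fun[of f] sq_fun[of g] by (intro strongly_measurable_cinner) simp_all
  have "cmod (cinner x y) \<le> (norm x)\<^sup>2 + (norm y)\<^sup>2" for x y :: 'a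
  proof -
    have "0 \<le> (norm x - norm y)\<^sup>2" "0 \<le> norm x * norm y" by auto
    then have "norm x * norm y \<le> (norm x)\<^sup>2 + (norm y)\<^sup>2" unfolding power2_diff by linarith
    then show ?thesis using cinner_cauchy_schwarz order.trans by blast
  qed
  then show "AE t in halfline. norm (cinner (sq_fun f t) (sq_fun g t))
      \<le> norm ((norm (sq_fun f t))\<^sup>2 + (norm (sq_fun g t))\<^sup>2)" by simp
qed

instantiation sq_integrable :: (complex_hilbert) pd_kernel
begin

definition kern_sq_integrable :: "'a sq_integrable \<Rightarrow> 'a sq_integrable \<Rightarrow> complex" where
  "kern_sq_integrable f g = (LINT t|halfline. cinner (sq_fun f t) (sq_fun g t))"

instance
proof
  fix f g :: "'a sq_integrable"
  show "kern f g = cnj (kern g f)"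
    unfolding kern_sq_integrable_def
    by (subst cinner_commute) (rule Bochner_Integration.integral_cnj)
next
  fix v :: "(complex \<times> 'a sq_integrable) list"
  define c where "c i = fst (v ! i)" for i
  define f where "f i = snd (v ! i)" for i
  define n where "n = length v"
  have "(\<Sum>i<n. \<Sum>j<n. cnj (c i) * c j * kern (f i) (f j))
      = (LINT t|halfline. (\<Sum>i<n. \<Sum>j<n. cnj (c i) * c j * cinner (sq_fun (f i) t) (sq_fun (f j) t)))"
    unfolding kern_sq_integrable_def by (simp add: sq_cinner_integrable)
  also have "\<dots> = (LINT t|halfline. complex_of_real ((norm (\<Sum>i<n. c i *\<^sub>C sq_fun (f i) t))\<^sup>2))"
    unfolding cinner_self[symmetric] cinner_sum_left
    unfolding cinner_sum_right cinner_scaleC_left cinner_scaleC_right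
    by (simp only: mult_ac)
  finally have "Re (\<Sum>i<n. \<Sum>j<n. cnj (c i) * c j * kern (f i) (f j)) \<ge> 0"
    unfolding integral_complex_of_real by simp
  then show "0 \<le> Re (\<Sum>(c, f)\<leftarrow>v. \<Sum>(d, g)\<leftarrow>v. cnj c * d * kern f g)"
    unfolding sum_list_square_nth by (simp add: c_def f_def n_def)
qed

end

type_synonym 'k L2 = "'k sq_integrable khilb"

section \<open>Bounded operators\<close>

lemma scaleC_zero_right [simp]: "c *\<^sub>C 0 = (0 :: 'a::complex_hilbert)"
  by (metis mult_zero_right scaleC_scaleC scaleC_zero_left)

typedef (overloaded) ('a, 'b) bop =
  "{T :: 'a::complex_hilbert \<Rightarrow> 'b::complex_hilbert. bounded_linear T \<and> (\<forall>c x. T (c *\<^sub>C x) = c *\<^sub>C T x)}"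
  morphisms bop_apply Bop
  by (rule exI[of _ "\<lambda>_. 0"]) (simp add: bounded_linear_zero scaleC_zero_right)

notation bop_apply  (infixr "\<cdot>" 75)

type_synonym 'a operator = "('a, 'a) bop"

setup_lifting type_definition_bop

lemma bounded_linear_scaleC: "bounded_linear (\<lambda>x::'a::complex_hilbert. c *\<^sub>C x)"
proof (rule bounded_linear_intro[where K = "cmod c"])
  fix x y :: 'a and r :: real
  show "c *\<^sub>C (x + y) = c *\<^sub>C x + c *\<^sub>C y" by (rule scaleC_add_right)
  show "c *\<^sub>C (r *\<^sub>R x) = r *\<^sub>R (c *\<^sub>C x)" by (simp add: scaleR_scaleC scaleC_scaleC mult.commute)
  have "complex_of_real ((norm (c *\<^sub>C x))\<^sup>2) = complex_of_real ((cmod c * norm x)\<^sup>2)"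
    unfolding cinner_self[symmetric, of "c *\<^sub>C x"] power_mult_distrib of_real_mult complex_norm_square cinner_self[symmetric, of x]
    by (simp add: cinner_scaleC_left cinner_scaleC_right mult_ac)
  then have "(norm (c *\<^sub>C x))\<^sup>2 = (cmod c * norm x)\<^sup>2" by (simp only: of_real_eq_iff)
  then have "norm (c *\<^sub>C x) = cmod c * norm x"
    by (rule power2_eq_imp_eq) simp_all
  then show "norm (c *\<^sub>C x) \<le> norm x * cmod c" by (simp add: mult.commute)
qed

instantiation bop :: (complex_hilbert, complex_hilbert) "{ab_group_add, scaleC}"
begin

lift_definition zero_bop :: "('a, 'b) bop" is "\<lambda>x. 0"
  by (simp add: scaleC_zero_right)

lift_definition plus_bop :: "('a, 'b) bop \<Rightarrow> ('a, 'b) bop \<Rightarrow> ('a, 'b) bop" is "\<lambda>S T x. S x + T x"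
  by (simp add: bounded_linear_add scaleC_add_right)

lift_definition minus_bop :: "('a, 'b) bop \<Rightarrow> ('a, 'b) bop \<Rightarrow> ('a, 'b) bop" is "\<lambda>S T x. S x - T x"
  by (simp add: bounded_linear_sub linear_diff[OF bounded_linear.linear[OF bounded_linear_scaleC]])

lift_definition uminus_bop :: "('a, 'b) bop \<Rightarrow> ('a, 'b) bop" is "\<lambda>S x. - S x"
  by (simp add: bounded_linear_minus linear_neg[OF bounded_linear.linear[OF bounded_linear_scaleC]])

lift_definition scaleC_bop :: "complex \<Rightarrow> ('a, 'b) bop \<Rightarrow> ('a, 'b) bop" is "\<lambda>c S x. c *\<^sub>C S x"
  by (simp add: bounded_linear_compose[OF bounded_linear_scaleC] scaleC_scaleC mult.commute)

instance
  by standard (transfer; simp add: fun_eq_iff algebra_simps)+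

end

lift_definition bop_id :: "'a::complex_hilbert operator"  ("\<one>") is "\<lambda>x. x"
  by (simp add: bounded_linear_ident)

lift_definition bop_comp :: "('b::complex_hilbert, 'c::complex_hilbert) bop \<Rightarrow> ('a::complex_hilbert, 'b) bop
    \<Rightarrow> ('a, 'c) bop"  (infixl "\<bullet>\<^sub>o" 70)
  is "\<lambda>S T x. S (T x)"
  by (simp add: bounded_linear_compose)

definition adj :: "('a::complex_hilbert, 'b::complex_hilbert) bop \<Rightarrow> ('b, 'a) bop"  ("_\<^sup>\<star>" [1000] 999) where
  "T\<^sup>\<star> = (THE S. \<forall>x y. cinner (S \<cdot> y) x = cinner y (T \<cdot> x))"

lemma riesz:
  fixes f :: "'a::complex_hilbert \<Rightarrow> complex"
  assumes f: "bounded_linear f" and fC: "\<And>c x. f (c *\<^sub>C x) = c * f x"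
  obtains y where "\<And>x. f x = cinner y x"
proof -
  define J where "J x = (norm x)\<^sup>2 - 2 * Re (f x)" for x
  obtain K where K: "\<And>x. norm (f x) \<le> norm x * K"
    using bounded_linear.bounded[OF f] by blast
  have lower: "- K\<^sup>2 \<le> J x" for x
  proof -
    have "Re (f x) \<le> norm x * K" using K[of x] complex_Re_le_cmod order.trans by blast
    moreover have "0 \<le> (norm x - K)\<^sup>2" by simp
    ultimately show ?thesis unfolding J_def power2_diff by linarith
  qed
  define d where "d = Inf (range J)"
  have d_le: "d \<le> J x" for x
    unfolding d_def by (rule cInf_lower) (auto intro: bdd_belowI lower)
  have "\<exists>x. J x < d + 1 / real (Suc n)" for n
    using cInf_lessD[of "range J" "d + 1 / real (Suc n)"] unfolding d_def by auto
  then obtain X where X: "\<And>n. J (X n) < d + 1 / real (Suc n)" by metis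
  have par: "(norm (x - y))\<^sup>2 \<le> 2 * (J x + J y - 2 * d)" for x y
  proof -
    have p: "(norm (x + y))\<^sup>2 + (norm (x - y))\<^sup>2 = 2 * (norm x)\<^sup>2 + 2 * (norm y)\<^sup>2"
      using cinner_add_scaled[of x 1 y] cinner_add_scaled[of x "-1" y] by (simp add: scaleC_minus_one)
    define m where "m = (1/2) *\<^sub>R (x + y)"
    have nm: "norm m = norm (x + y) / 2" unfolding m_def by simp
    have "f m = (1/2) *\<^sub>R (f x + f y)"
      unfolding m_def using f by (simp add: linear_simps(5) linear_simps(1))
    then have "2 * Re (f m) = Re (f x) + Re (f y)" by simp
    then have "J m = (norm (x + y))\<^sup>2 / 4 - Re (f x) - Re (f y)"
      unfolding J_def nm power_divide by simp
    with d_le[of m] p show ?thesis unfolding J_def by simp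
  qed
  have "Cauchy X"
  proof (rule metric_CauchyI)
    fix e :: real assume "e > 0"
    obtain N where N: "4 / e\<^sup>2 < real N" using reals_Archimedean2 by blast
    have "dist (X m) (X n) < e" if "m \<ge> N" "n \<ge> N" for m n
    proof -
      have b: "1 / real (Suc k) < e\<^sup>2 / 4" if "k \<ge> N" for k
      proof -
        have "4 / e\<^sup>2 < real (Suc k)" using N that by linarith
        then show ?thesis using \<open>e > 0\<close> by (simp add: field_simps)
      qed
      have "(norm (X m - X n))\<^sup>2 < e\<^sup>2"
        using par[of "X m" "X n"] X[of m] X[of n] b[OF that(1)] b[OF that(2)] by argo
      then show ?thesis using \<open>e > 0\<close> by (simp add: dist_norm power_less_imp_less_base)
    qed
    then show "\<exists>M. \<forall>m\<ge>M. \<forall>n\<ge>M. dist (X m) (X n) < e" by blast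
  qed
  then obtain y where y: "X \<longlonglongrightarrow> y" using Cauchy_convergent convergent_def by blast
  have "(\<lambda>n. J (X n)) \<longlonglongrightarrow> J y"
    unfolding J_def by (intro tendsto_intros y bounded_linear.tendsto[OF f])
  moreover have "(\<lambda>n. d + 1 / real (Suc n)) \<longlonglongrightarrow> d + 0"
    by (intro tendsto_intros LIMSEQ_inverse_real_of_nat[unfolded inverse_eq_divide])
  ultimately have "J y \<le> d + 0"
    by (rule LIMSEQ_le) (use X less_imp_le in blast)
  then have "J y \<le> d" by simp
  have "f w = cinner y w" for w
  proof -
    let ?g = "cinner y w - f w"
    have "0 \<le> 0 + 2 * Re (s * ?g) + (cmod s)\<^sup>2 * (norm w)\<^sup>2" for s
    proof -
      have "f (y + s *\<^sub>C w) = f y + s * f w" using f by (simp add: linear_simps(1) fC)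
      then have "J (y + s *\<^sub>C w) = J y + 2 * Re (s * ?g) + (cmod s)\<^sup>2 * (norm w)\<^sup>2"
        unfolding J_def cinner_add_scaled by (simp add: algebra_simps)
      then show ?thesis using d_le[of "y + s *\<^sub>C w"] \<open>J y \<le> d\<close> by linarith
    qed
    then have "(cmod ?g)\<^sup>2 \<le> 0 * (norm w)\<^sup>2" by (rule kern_rotate) simp
    then show ?thesis by simp
  qed
  then show thesis using that by blast
qed

lemma cinner_ext: "(\<And>z. cinner x z = cinner y z) \<Longrightarrow> x = (y :: 'a::complex_hilbert)"
  using cinner_self[of "x - y"] by (simp add: cinner_diff_left)

lemma bop_eqI: "(\<And>x. S \<cdot> x = T \<cdot> x) \<Longrightarrow> S = T"
  by transfer auto

lemma bop_linear: "bounded_linear ((\<cdot>) T)" "T \<cdot> (c *\<^sub>C x) = c *\<^sub>C T \<cdot> x"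
  using bop_apply[of T] by auto

lemma cinner_adj: "cinner (T\<^sup>\<star> \<cdot> y) x = cinner y (T \<cdot> x)"
proof -
  have "\<exists>z. \<forall>x. cinner y (T \<cdot> x) = cinner z x" for y
  proof -
    have "bounded_linear (\<lambda>x. cinner y (T \<cdot> x))"
      by (rule bounded_linear_compose[OF bounded_bilinear.bounded_linear_right[OF bounded_bilinear_cinner] bop_linear(1)])
    then show ?thesis
      by (rule riesz) (auto simp: bop_linear cinner_scaleC_right)
  qed
  then obtain S where S: "\<And>x y. cinner (S y) x = cinner y (T \<cdot> x)" by metis
  obtain K where K: "\<And>x. norm (T \<cdot> x) \<le> norm x * K" "0 \<le> K"
    using bounded_linear.nonneg_bounded[OF bop_linear(1)[of T]] by blast
  have "S (x + y) = S x + S y" for x y by (rule cinner_ext) (simp add: S cinner_add_left)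
  moreover have SC: "S (c *\<^sub>C x) = c *\<^sub>C S x" for c x
    by (rule cinner_ext) (simp add: S cinner_scaleC_left)
  moreover have "norm (S y) \<le> norm y * K" for y
  proof -
    have "(norm (S y))\<^sup>2 = cmod (cinner (S y) (S y))" by (simp add: cinner_self[of "S y"] norm_power)
    also have "\<dots> \<le> norm y * norm (T \<cdot> S y)" unfolding S by (rule cinner_cauchy_schwarz)
    also have "\<dots> \<le> norm y * (norm (S y) * K)" by (intro mult_left_mono K) simp
    finally show ?thesis by (cases "S y = 0") (auto simp: power2_eq_square K mult_ac)
  qed
  ultimately have "bounded_linear S"
    by (intro bounded_linear_intro[where K = K]) (auto simp: scaleR_scaleC)
  then have "\<forall>x y. cinner (Bop S \<cdot> y) x = cinner y (T \<cdot> x)"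
    using SC S by (simp add: Bop_inverse)
  then have "\<exists>!S. \<forall>x y. cinner (S \<cdot> y) x = cinner y (T \<cdot> x)"
    by (metis bop_eqI cinner_ext)
  from theI'[OF this] show ?thesis unfolding adj_def by blast
qed

definition complex_span :: "('a::complex_hilbert, 'b::complex_hilbert) bop set \<Rightarrow> ('a, 'b) bop set" where
  "complex_span S = {\<Sum>T\<in>F. c T *\<^sub>C T | F c. finite F \<and> F \<subseteq> S}"

definition nonneg_op :: "'a::complex_hilbert operator \<Rightarrow> bool" where
  "nonneg_op T \<longleftrightarrow> (\<forall>x. cinner x (T \<cdot> x) \<in> \<real>\<^sub>\<ge>\<^sub>0)"

subsection \<open>The ultraweak topology\<close>

text \<open>
  The weak topology generated by the functionals \<open>T \<mapsto> \<Sum>n. \<langle>u n, T (v n)\<rangle>\<close> with square summable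
  sequences \<open>u\<close> and \<open>v\<close>.
\<close>

definition uw_top :: "('a::complex_hilbert, 'b::complex_hilbert) bop topology" where
  "uw_top = topology_generated_by
    {{T. (\<Sum>n. cinner (u n) (T \<cdot> v n)) \<in> U} | u v U.
      summable (\<lambda>n::nat. (norm (u n))\<^sup>2) \<and> summable (\<lambda>n. (norm (v n))\<^sup>2) \<and> open U}"

lemma topspace_uw_top [simp]: "topspace uw_top = UNIV"
proof -
  have "UNIV \<in> {{T::('a,'b) bop. (\<Sum>n. cinner (u n) (T \<cdot> v n)) \<in> U} | u v U.
      summable (\<lambda>n::nat. (norm (u n))\<^sup>2) \<and> summable (\<lambda>n. (norm (v n))\<^sup>2) \<and> open U}"
    by (rule CollectI, rule exI[of _ "\<lambda>_. 0"], rule exI[of _ "\<lambda>_. 0"], rule exI[of _ UNIV]) auto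
  from Union_upper[OF this] show ?thesis
    unfolding uw_top_def topology_generated_by_topspace by (rule top.extremum_uniqueI)
qed

lemma Hausdorff_uw_top: "Hausdorff_space (uw_top :: ('a::complex_hilbert, 'b::complex_hilbert) bop topology)"
  unfolding Hausdorff_space_def
proof (intro allI impI)
  fix S T :: "('a, 'b) bop"
  assume "S \<in> topspace uw_top \<and> T \<in> topspace uw_top \<and> S \<noteq> T"
  then obtain x where "S \<cdot> x \<noteq> T \<cdot> x" using bop_eqI by blast
  then obtain y where y: "cinner y (S \<cdot> x) \<noteq> cinner y (T \<cdot> x)"
    by (metis cinner_commute cinner_ext)
  define u where "u n = (if n = (0::nat) then y else 0)" for n
  define v where "v n = (if n = (0::nat) then x else 0)" for n
  have uv: "(\<Sum>n. cinner (u n) (R \<cdot> v n)) = cinner y (R \<cdot> x)" for R :: "('a, 'b) bop"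
    by (subst suminf_finite[of "{0}"]) (auto simp: u_def v_def)
  have sum: "summable (\<lambda>n. (norm (u n))\<^sup>2)" "summable (\<lambda>n. (norm (v n))\<^sup>2)"
    by (rule summable_finite[of "{0}"]; simp add: u_def v_def)+
  obtain U V where UV: "open U" "open V" "cinner y (S \<cdot> x) \<in> U" "cinner y (T \<cdot> x) \<in> V" "U \<inter> V = {}"
    using y hausdorff by metis
  have op: "openin uw_top {R. cinner y (R \<cdot> x) \<in> W}" if "open W" for W
    unfolding uw_top_def
    by (rule topology_generated_by_Basis, rule CollectI, rule exI[of _ u], rule exI[of _ v], rule exI[of _ W])
      (simp only: uv sum that simp_thms)
  show "\<exists>U V. openin uw_top U \<and> openin uw_top V \<and> S \<in> U \<and> T \<in> V \<and> disjnt U V"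
    by (intro exI[of _ "{R. cinner y (R \<cdot> x) \<in> U}"] exI[of _ "{R. cinner y (R \<cdot> x) \<in> V}"])
      (use UV op in \<open>auto simp: disjnt_def\<close>)
qed

section \<open>Tensor products of operators, and block operators\<close>

lemma khilb_eqI: "(\<And>x. cinner (kvec x) \<phi> = cinner (kvec x) \<psi>) \<Longrightarrow> \<phi> = \<psi>"
  using kvec_total[of "\<phi> - \<psi>"] by (simp add: cinner_diff_right)

lemma tensor_eqI:
  assumes "\<And>x y. cinner (x \<otimes> y) \<phi> = cinner (x \<otimes> y) \<psi>"
  shows "\<phi> = (\<psi> :: ('a::complex_hilbert, 'b::complex_hilbert) tensor)"
proof (rule khilb_eqI)
  show "cinner (kvec p) \<phi> = cinner (kvec p) \<psi>" for p
    using assms by (cases p) (simp add: tensor_vec_def)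
qed

lemma tensor_bilinear:
  fixes x x' :: "'a::complex_hilbert" and y y' :: "'b::complex_hilbert"
  shows "(x + x') \<otimes> y = x \<otimes> y + x' \<otimes> y" "x \<otimes> (y + y') = x \<otimes> y + x \<otimes> y'"
    "(c *\<^sub>C x) \<otimes> y = c *\<^sub>C (x \<otimes> y)" "x \<otimes> (c *\<^sub>C y) = c *\<^sub>C (x \<otimes> y)"
  by (rule tensor_eqI; simp add: cinner_tensor cinner_add_right cinner_scaleC_right algebra_simps)+

lemma norm_tensor: "norm (x \<otimes> y) = norm x * norm y"
proof -
  have "complex_of_real ((norm (x \<otimes> y))\<^sup>2) = complex_of_real ((norm x * norm y)\<^sup>2)"
    unfolding cinner_self[symmetric, of "x \<otimes> y"] cinner_tensor
    by (simp add: cinner_self[of x] cinner_self[of y] power_mult_distrib)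
  then have "(norm (x \<otimes> y))\<^sup>2 = (norm x * norm y)\<^sup>2" by (simp only: of_real_eq_iff)
  then show ?thesis by (rule power2_eq_imp_eq) simp_all
qed

lift_definition left_ket :: "'a::complex_hilbert \<Rightarrow> ('b::complex_hilbert, ('a, 'b) tensor) bop" is
  "\<lambda>c v. c \<otimes> v"
proof -
  fix c :: 'a
  have "bounded_linear (\<lambda>v::'b. c \<otimes> v)"
    by (rule bounded_linear_intro[where K = "norm c"])
      (simp_all add: tensor_bilinear norm_tensor scaleR_scaleC mult.commute)
  then show "bounded_linear (\<lambda>v::'b. c \<otimes> v) \<and> (\<forall>d v. c \<otimes> (d *\<^sub>C v) = d *\<^sub>C (c \<otimes> v))"
    by (simp add: tensor_bilinear)
qed

lift_definition right_ket :: "'b::complex_hilbert \<Rightarrow> ('a::complex_hilbert, ('a, 'b) tensor) bop" is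
  "\<lambda>\<xi> v. v \<otimes> \<xi>"
proof -
  fix \<xi> :: 'b
  have "bounded_linear (\<lambda>v::'a. v \<otimes> \<xi>)"
    by (rule bounded_linear_intro[where K = "norm \<xi>"])
      (simp_all add: tensor_bilinear norm_tensor scaleR_scaleC)
  then show "bounded_linear (\<lambda>v::'a. v \<otimes> \<xi>) \<and> (\<forall>d v. (d *\<^sub>C v) \<otimes> \<xi> = d *\<^sub>C (v \<otimes> \<xi>))"
    by (simp add: tensor_bilinear)
qed

definition tensor_op :: "('a::complex_hilbert, 'c::complex_hilbert) bop \<Rightarrow>
    ('b::complex_hilbert, 'd::complex_hilbert) bop \<Rightarrow> (('a, 'b) tensor, ('c, 'd) tensor) bop"  (infixl "\<otimes>\<^sub>o" 70) where
  "S \<otimes>\<^sub>o T = (THE R. \<forall>x y. R \<cdot> (x \<otimes> y) = (S \<cdot> x) \<otimes> (T \<cdot> y))"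

lemma khilb_extension:
  fixes \<Phi> :: "'x::pd_kernel \<Rightarrow> 'b::complex_hilbert"
  assumes bound: "\<And>v. norm (\<Sum>(c, x)\<leftarrow>v. c *\<^sub>C \<Phi> x) \<le> C * sqrt (ksq v)" and "0 \<le> C"
  obtains R :: "('x khilb, 'b) bop" where "\<And>x. R \<cdot> kvec x = \<Phi> x"
proof -
  have ev: "keval (\<lambda>x. cinner (\<Phi> x) b) v = cinner (\<Sum>(c, x)\<leftarrow>v. c *\<^sub>C \<Phi> x) b" for b v
    by (induction v) (auto simp: keval_def cinner_add_left cinner_scaleC_left)
  have le: "cmod (keval (\<lambda>x. cinner (\<Phi> x) b) v) \<le> (C * norm b) * sqrt (ksq v)" for b v
  proof -
    have "cmod (keval (\<lambda>x. cinner (\<Phi> x) b) v) \<le> norm (\<Sum>(c, x)\<leftarrow>v. c *\<^sub>C \<Phi> x) * norm b"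
      unfolding ev by (rule cinner_cauchy_schwarz)
    also have "\<dots> \<le> (C * sqrt (ksq v)) * norm b" by (intro mult_right_mono bound) simp
    finally show ?thesis by (simp add: mult_ac)
  qed
  define Q where "Q b = Abs_khilb (\<lambda>x. cinner (\<Phi> x) b)" for b
  have Q: "kapp (Q b) = (\<lambda>x. cinner (\<Phi> x) b)" for b
    unfolding Q_def by (rule Abs_khilb_inverse) (use le \<open>0 \<le> C\<close> in \<open>auto intro!: exI[of _ "C * norm b"]\<close>)
  have add: "Q (a + b) = Q a + Q b" for a b
    by (rule khilb_eqI) (simp add: cinner_kvec_left Q plus_khilb.rep_eq cinner_add_right)
  have scale: "Q (c *\<^sub>C a) = c *\<^sub>C Q a" for a c
    by (rule khilb_eqI) (simp add: cinner_kvec_left Q scaleC_khilb.rep_eq cinner_scaleC_right)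
  have "norm (Q b) \<le> norm b * C" for b
    by (rule khilb_norm_le) (use le \<open>0 \<le> C\<close> in \<open>auto simp: Q mult_ac\<close>)
  then have "bounded_linear Q"
    by (intro bounded_linear_intro[where K = C]) (auto simp: add scale scaleR_scaleC)
  then have B: "Bop Q \<cdot> b = Q b" for b by (simp add: Bop_inverse scale)
  have "(Bop Q)\<^sup>\<star> \<cdot> kvec x = \<Phi> x" for x
    by (rule cinner_ext) (simp add: cinner_adj B cinner_kvec_left Q)
  then show thesis by (rule that)
qed

lemma kvec_bop_eqI: "(\<And>x. R \<cdot> kvec x = S \<cdot> kvec x) \<Longrightarrow> R = (S :: ('x::pd_kernel khilb, 'b::complex_hilbert) bop)"
proof (rule bop_eqI)
  fix \<phi> assume *: "\<And>x. R \<cdot> kvec x = S \<cdot> kvec x"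
  have "R\<^sup>\<star> \<cdot> y = S\<^sup>\<star> \<cdot> y" for y
    by (rule khilb_eqI) (metis * cinner_adj cinner_commute)
  then show "R \<cdot> \<phi> = S \<cdot> \<phi>" by (metis cinner_adj cinner_commute cinner_ext)
qed

lemma contraction_psd:
  fixes x :: "'i \<Rightarrow> 'a::complex_hilbert" and T :: "('a, 'b::complex_hilbert) bop"
  assumes "finite I" "\<And>x. norm (T \<cdot> x) \<le> norm x * K"
  shows "0 \<le> Re (\<Sum>i\<in>I. \<Sum>j\<in>I. cnj (c i) * c j *
    (complex_of_real (K\<^sup>2) * cinner (x i) (x j) - cinner (T \<cdot> x i) (T \<cdot> x j)))"
proof -
  let ?z = "\<Sum>i\<in>I. c i *\<^sub>C x i"
  have z: "cinner (\<Sum>i\<in>I. c i *\<^sub>C w i) (\<Sum>i\<in>I. c i *\<^sub>C w i) = (\<Sum>i\<in>I. \<Sum>j\<in>I. cnj (c i) * c j * cinner (w i) (w j))"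
    for w :: "'i \<Rightarrow> 'e::complex_hilbert"
    unfolding cinner_sum_left unfolding cinner_sum_right cinner_scaleC_left cinner_scaleC_right
    by (simp only: mult_ac)
  have T: "T \<cdot> ?z = (\<Sum>i\<in>I. c i *\<^sub>C T \<cdot> x i)"
    by (simp add: linear_sum[OF bounded_linear.linear[OF bop_linear(1)]] bop_linear(2))
  have "(\<Sum>i\<in>I. \<Sum>j\<in>I. cnj (c i) * c j * (complex_of_real (K\<^sup>2) * cinner (x i) (x j) - cinner (T \<cdot> x i) (T \<cdot> x j)))
      = complex_of_real (K\<^sup>2) * cinner ?z ?z - cinner (T \<cdot> ?z) (T \<cdot> ?z)"
    unfolding T z by (simp add: sum_subtractf sum_distrib_left right_diff_distrib mult_ac)
  also have "\<dots> = complex_of_real (K\<^sup>2 * (norm ?z)\<^sup>2 - (norm (T \<cdot> ?z))\<^sup>2)"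
    by (simp only: cinner_self of_real_diff of_real_mult)
  finally show ?thesis
    using power_mono[OF assms(2)[of ?z] norm_ge_zero, of 2] by (simp only: Re_complex_of_real)
      (simp add: power_mult_distrib mult.commute)
qed

lemma tensor_op_left_exists:
  fixes S :: "('a::complex_hilbert, 'c::complex_hilbert) bop"
  shows "\<exists>R :: (('a, 'b::complex_hilbert) tensor, ('c, 'b) tensor) bop. \<forall>x y. R \<cdot> (x \<otimes> y) = (S \<cdot> x) \<otimes> y"
proof -
  obtain K where K: "\<And>x. norm (S \<cdot> x) \<le> norm x * K" "0 \<le> K"
    using bounded_linear.nonneg_bounded[OF bop_linear(1)[of S]] by blast
  define \<Phi> :: "('a, 'b) simple_tensor \<Rightarrow> ('c, 'b) tensor"
    where "\<Phi> p = (case p of Simple_Tensor x y \<Rightarrow> (S \<cdot> x) \<otimes> y)" for p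
  have "norm (\<Sum>(c, p)\<leftarrow>v. c *\<^sub>C \<Phi> p) \<le> K * sqrt (ksq v)" for v
  proof -
    define n where "n = length v"
    define c where "c i = fst (v ! i)" for i
    define x where "x i = (case snd (v ! i) of Simple_Tensor a b \<Rightarrow> a)" for i
    define y where "y i = (case snd (v ! i) of Simple_Tensor a b \<Rightarrow> b)" for i
    have st: "snd (v ! i) = Simple_Tensor (x i) (y i)" for i
      by (simp add: x_def y_def split: simple_tensor.split)
    have s: "(\<Sum>(c, p)\<leftarrow>v. c *\<^sub>C \<Phi> p) = (\<Sum>i<n. c i *\<^sub>C ((S \<cdot> x i) \<otimes> y i))"
      by (simp add: sum_list_sum_nth case_prod_unfold atLeast0LessThan st \<Phi>_def c_def n_def)
    have "complex_of_real ((norm (\<Sum>(c, p)\<leftarrow>v. c *\<^sub>C \<Phi> p))\<^sup>2)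
        = (\<Sum>i<n. \<Sum>j<n. cnj (c i) * c j * (cinner (y i) (y j) * cinner (S \<cdot> x i) (S \<cdot> x j)))"
      unfolding s cinner_self[symmetric] cinner_sum_left
      unfolding cinner_sum_right cinner_scaleC_left cinner_scaleC_right cinner_tensor
      by (simp only: mult_ac)
    then have 1: "(norm (\<Sum>(c, p)\<leftarrow>v. c *\<^sub>C \<Phi> p))\<^sup>2
        = Re (\<Sum>i<n. \<Sum>j<n. cnj (c i) * c j * (cinner (y i) (y j) * cinner (S \<cdot> x i) (S \<cdot> x j)))"
      by (metis Re_complex_of_real)
    have "kform v v = (\<Sum>i<n. \<Sum>j<n. cnj (c i) * c j * (cinner (y i) (y j) * cinner (x i) (x j)))"
      unfolding kform_def sum_list_square_nth by (simp add: st n_def c_def mult_ac)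
    then have "complex_of_real (K\<^sup>2) * kform v v = (\<Sum>i<n. \<Sum>j<n. cnj (c i) * c j *
        (cinner (y i) (y j) * (complex_of_real (K\<^sup>2) * cinner (x i) (x j))))"
      by (simp only: sum_distrib_left mult_ac)
    then have 2: "K\<^sup>2 * ksq v = Re (\<Sum>i<n. \<Sum>j<n. cnj (c i) * c j *
        (cinner (y i) (y j) * (complex_of_real (K\<^sup>2) * cinner (x i) (x j))))"
      by (metis Re_complex_of_real kform_self of_real_mult)
    have "0 \<le> Re (\<Sum>i<n. \<Sum>j<n. cnj (c i) * c j * (cinner (y i) (y j) *
        (complex_of_real (K\<^sup>2) * cinner (x i) (x j) - cinner (S \<cdot> x i) (S \<cdot> x j))))"
      by (intro schur_product contraction_psd K) simp_all
    then have "(norm (\<Sum>(c, p)\<leftarrow>v. c *\<^sub>C \<Phi> p))\<^sup>2 \<le> K\<^sup>2 * ksq v"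
      unfolding 1 2 by (simp only: right_diff_distrib sum_subtractf minus_complex.simps)
    then have "(norm (\<Sum>(c, p)\<leftarrow>v. c *\<^sub>C \<Phi> p))\<^sup>2 \<le> (K * sqrt (ksq v))\<^sup>2"
      unfolding power_mult_distrib real_sqrt_pow2[OF ksq_nonneg] .
    then show ?thesis by (rule power2_le_imp_le) (simp add: K)
  qed
  then obtain R :: "(('a, 'b) tensor, ('c, 'b) tensor) bop" where "\<And>p. R \<cdot> kvec p = \<Phi> p"
    using khilb_extension[of \<Phi> K] K(2) by metis
  then show ?thesis by (intro exI[of _ R]) (simp add: tensor_vec_def \<Phi>_def)
qed

lemma tensor_swap_exists:
  "\<exists>R :: (('a::complex_hilbert, 'b::complex_hilbert) tensor, ('b, 'a) tensor) bop. \<forall>x y. R \<cdot> (x \<otimes> y) = y \<otimes> x"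
proof -
  define \<Phi> :: "('a, 'b) simple_tensor \<Rightarrow> ('b, 'a) tensor"
    where "\<Phi> p = (case p of Simple_Tensor x y \<Rightarrow> y \<otimes> x)" for p
  have gram: "cinner (\<Phi> p) (\<Phi> q) = kern p q" for p q
    by (cases p; cases q) (simp add: \<Phi>_def cinner_tensor mult.commute)
  have cs: "cinner (\<Phi> p) (\<Sum>(c, q)\<leftarrow>w. c *\<^sub>C \<Phi> q) = (\<Sum>(d, q)\<leftarrow>w. d * kern p q)" for p w
    by (induction w) (auto simp: cinner_add_right cinner_scaleC_right gram)
  have "cinner (\<Sum>(c, p)\<leftarrow>v. c *\<^sub>C \<Phi> p) (\<Sum>(c, p)\<leftarrow>w. c *\<^sub>C \<Phi> p) = kform v w" for v w
    unfolding kform_def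
    by (induction v) (auto simp: cinner_add_left cinner_scaleC_left cs[unfolded case_prod_unfold] sum_list_const_mult[symmetric]
        case_prod_unfold mult.assoc)
  then have "norm (\<Sum>(c, p)\<leftarrow>v. c *\<^sub>C \<Phi> p) \<le> 1 * sqrt (ksq v)" for v
    by (metis cinner_self Re_complex_of_real mult_1 order_refl real_sqrt_abs abs_norm_cancel)
  then obtain R :: "(('a, 'b) tensor, ('b, 'a) tensor) bop" where "\<And>p. R \<cdot> kvec p = \<Phi> p"
    using khilb_extension[of \<Phi> 1] zero_le_one by metis
  then show ?thesis by (intro exI[of _ R]) (simp add: tensor_vec_def \<Phi>_def)
qed

lemma tensor_op_apply:
  fixes S :: "('a::complex_hilbert, 'c::complex_hilbert) bop" and T :: "('b::complex_hilbert, 'd::complex_hilbert) bop"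
  shows "(S \<otimes>\<^sub>o T) \<cdot> (x \<otimes> y) = (S \<cdot> x) \<otimes> (T \<cdot> y)"
proof -
  obtain R1 :: "(('a, 'b) tensor, ('c, 'b) tensor) bop" where R1: "\<And>x y. R1 \<cdot> (x \<otimes> y) = (S \<cdot> x) \<otimes> y"
    using tensor_op_left_exists by metis
  obtain F1 :: "(('c, 'b) tensor, ('b, 'c) tensor) bop" where F1: "\<And>x y. F1 \<cdot> (x \<otimes> y) = y \<otimes> x"
    using tensor_swap_exists by metis
  obtain R2 :: "(('b, 'c) tensor, ('d, 'c) tensor) bop" where R2: "\<And>x y. R2 \<cdot> (x \<otimes> y) = (T \<cdot> x) \<otimes> y"
    using tensor_op_left_exists by metis
  obtain F2 :: "(('d, 'c) tensor, ('c, 'd) tensor) bop" where F2: "\<And>x y. F2 \<cdot> (x \<otimes> y) = y \<otimes> x"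
    using tensor_swap_exists by metis
  have "(F2 \<bullet>\<^sub>o R2 \<bullet>\<^sub>o F1 \<bullet>\<^sub>o R1) \<cdot> (x \<otimes> y) = (S \<cdot> x) \<otimes> (T \<cdot> y)" for x y
    by (simp add: bop_comp.rep_eq R1 R2 F1 F2)
  then have ex: "\<exists>R. \<forall>x y. R \<cdot> (x \<otimes> y) = (S \<cdot> x) \<otimes> (T \<cdot> y)" by metis
  have "R = R'" if "\<forall>x y. R \<cdot> (x \<otimes> y) = (S \<cdot> x) \<otimes> (T \<cdot> y)" "\<forall>x y. R' \<cdot> (x \<otimes> y) = (S \<cdot> x) \<otimes> (T \<cdot> y)"
    for R R' :: "(('a, 'b) tensor, ('c, 'd) tensor) bop"
  proof (rule kvec_bop_eqI)
    show "R \<cdot> kvec p = R' \<cdot> kvec p" for p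
      using that by (cases p) (simp add: tensor_vec_def)
  qed
  with ex have "\<exists>!R. \<forall>x y. R \<cdot> (x \<otimes> y) = (S \<cdot> x) \<otimes> (T \<cdot> y)" by blast
  from theI'[OF this] show ?thesis unfolding tensor_op_def by blast
qed

lift_definition column_op :: "('a::complex_hilbert, 'b::complex_hilbert) bop \<Rightarrow> ('a, 'c::complex_hilbert) bop \<Rightarrow> ('a, 'b \<times> 'c) bop"
  is "\<lambda>S T x. (S x, T x)"
  by (auto simp: scaleC_prod_def intro: bounded_linear_Pair)

lift_definition row_op :: "('b::complex_hilbert, 'a::complex_hilbert) bop \<Rightarrow> ('c::complex_hilbert, 'a) bop \<Rightarrow> ('b \<times> 'c, 'a) bop"
  is "\<lambda>S T p. S (fst p) + T (snd p)"
  by (auto simp: scaleC_prod_def scaleC_add_right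
      intro!: bounded_linear_add bounded_linear_compose[OF _ bounded_linear_fst] bounded_linear_compose[OF _ bounded_linear_snd])

section \<open>Von Neumann algebras and their maps\<close>

definition commutant :: "'h::complex_hilbert operator set \<Rightarrow> 'h operator set" where
  "commutant S = {T. \<forall>s\<in>S. T \<bullet>\<^sub>o s = s \<bullet>\<^sub>o T}"

text \<open>By the bicommutant condition the set is automatically a weakly closed unital subalgebra.\<close>

definition von_neumann_algebra :: "'h::complex_hilbert operator set \<Rightarrow> bool" where
  "von_neumann_algebra A \<longleftrightarrow> (\<forall>a\<in>A. a\<^sup>\<star> \<in> A) \<and> commutant (commutant A) = A"

definition uw_tensor :: "'a::complex_hilbert operator set \<Rightarrow> 'b::complex_hilbert operator set
    \<Rightarrow> ('a, 'b) tensor operator set"  (infixl "\<otimes>\<^sub>w" 70) where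
  "A \<otimes>\<^sub>w B = uw_top closure_of complex_span {a \<otimes>\<^sub>o b | a b. a \<in> A \<and> b \<in> B}"

text \<open>The space \<open>|k\<rangle> \<otimes> A\<close> of operators from \<open>h\<close> to \<open>k \<otimes> h\<close>; here \<open>left_ket c \<bullet>\<^sub>o a\<close> is \<open>|c\<rangle> \<otimes> a\<close>.\<close>

definition ket_tensor :: "'h::complex_hilbert operator set \<Rightarrow> ('h, ('k::complex_hilbert, 'h) tensor) bop set" where
  "ket_tensor A = uw_top closure_of complex_span {left_ket c \<bullet>\<^sub>o a | c a. a \<in> A}"

definition linear_map_on :: "('a::complex_hilbert, 'b::complex_hilbert) bop set
    \<Rightarrow> (('a, 'b) bop \<Rightarrow> ('c::complex_hilbert, 'd::complex_hilbert) bop) \<Rightarrow> bool" where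
  "linear_map_on A \<phi> \<longleftrightarrow> (\<forall>a\<in>A. \<forall>b\<in>A. \<phi> (a + b) = \<phi> a + \<phi> b) \<and> (\<forall>c. \<forall>a\<in>A. \<phi> (c *\<^sub>C a) = c *\<^sub>C \<phi> a)"

definition normal_map_on :: "'a::complex_hilbert operator set \<Rightarrow> ('a operator \<Rightarrow> 'b::complex_hilbert operator) \<Rightarrow> bool" where
  "normal_map_on A \<phi> \<longleftrightarrow> continuous_map (subtopology uw_top A) uw_top \<phi>"

definition star_hom_on :: "'a::complex_hilbert operator set \<Rightarrow> ('a operator \<Rightarrow> 'b::complex_hilbert operator) \<Rightarrow> bool" where
  "star_hom_on A \<phi> \<longleftrightarrow> linear_map_on A \<phi> \<and>
    (\<forall>a\<in>A. \<forall>b\<in>A. \<phi> (a \<bullet>\<^sub>o b) = \<phi> a \<bullet>\<^sub>o \<phi> b) \<and> (\<forall>a\<in>A. \<phi> (a\<^sup>\<star>) = (\<phi> a)\<^sup>\<star>)"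

definition positive_map_on :: "'a::complex_hilbert operator set \<Rightarrow> ('a operator \<Rightarrow> 'b::complex_hilbert operator) \<Rightarrow> bool" where
  "positive_map_on A \<phi> \<longleftrightarrow> (\<forall>a\<in>A. nonneg_op a \<longrightarrow> nonneg_op (\<phi> a))"

text \<open>
  An \<open>n\<close> by \<open>n\<close> matrix of operators on \<open>h\<close> is regarded as an operator on the \<open>n\<close>-fold direct sum of \<open>h\<close>: the
  next two definitions express its positivity and that its norm is at most \<open>M\<close>.
\<close>

definition nonneg_matrix :: "nat \<Rightarrow> (nat \<Rightarrow> nat \<Rightarrow> 'a::complex_hilbert operator) \<Rightarrow> bool" where
  "nonneg_matrix n a \<longleftrightarrow> (\<forall>v. (\<Sum>i<n. \<Sum>j<n. cinner (v i) (a i j \<cdot> v j)) \<in> \<real>\<^sub>\<ge>\<^sub>0)"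

definition matrix_norm_le :: "nat \<Rightarrow> (nat \<Rightarrow> nat \<Rightarrow> 'a::complex_hilbert operator) \<Rightarrow> real \<Rightarrow> bool" where
  "matrix_norm_le n a M \<longleftrightarrow>
    (\<forall>v. (\<Sum>i<n. (norm (\<Sum>j<n. a i j \<cdot> v j))\<^sup>2) \<le> M\<^sup>2 * (\<Sum>j<n. (norm (v j))\<^sup>2))"

definition completely_positive_on :: "'a::complex_hilbert operator set \<Rightarrow> ('a operator \<Rightarrow> 'b::complex_hilbert operator) \<Rightarrow> bool" where
  "completely_positive_on A \<phi> \<longleftrightarrow> (\<forall>n a. (\<forall>i<n. \<forall>j<n. a i j \<in> A) \<longrightarrow>
    nonneg_matrix n a \<longrightarrow> nonneg_matrix n (\<lambda>i j. \<phi> (a i j)))"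

definition completely_bounded_on :: "'a::complex_hilbert operator set \<Rightarrow> ('a operator \<Rightarrow> 'b::complex_hilbert operator) \<Rightarrow> bool" where
  "completely_bounded_on A \<phi> \<longleftrightarrow> (\<exists>C\<ge>0. \<forall>n a M. (\<forall>i<n. \<forall>j<n. a i j \<in> A) \<longrightarrow> 0 \<le> M \<longrightarrow>
    matrix_norm_le n a M \<longrightarrow> matrix_norm_le n (\<lambda>i j. \<phi> (a i j)) (C * M))"

definition markov_semigroup :: "'h::complex_hilbert operator set \<Rightarrow> (real \<Rightarrow> 'h operator \<Rightarrow> 'h operator) \<Rightarrow> bool" where
  "markov_semigroup A P \<longleftrightarrow>
    (\<forall>t\<ge>0. P t ` A \<subseteq> A \<and> linear_map_on A (P t) \<and> normal_map_on A (P t) \<and> positive_map_on A (P t) \<and> P t \<one> = \<one>) \<and>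
    (\<forall>a\<in>A. P 0 a = a) \<and> (\<forall>s\<ge>0. \<forall>t\<ge>0. \<forall>a\<in>A. P (s + t) a = P s (P t a)) \<and>
    (\<forall>a\<in>A. continuous_map (top_of_set {0..}) uw_top (\<lambda>t. P t a))"

text \<open>Unbounded operators on \<open>A\<close>, such as the ultraweak generator, are given by their graphs.\<close>

definition uw_generator :: "'h::complex_hilbert operator set \<Rightarrow> (real \<Rightarrow> 'h operator \<Rightarrow> 'h operator)
    \<Rightarrow> ('h operator \<times> 'h operator) set" where
  "uw_generator A P = {(x, y). x \<in> A \<and> y \<in> A \<and>
    limitin uw_top (\<lambda>t. complex_of_real (1 / t) *\<^sub>C (P t x - x)) y (at_right 0)}"

section \<open>Fock space over the half-line\<close>

definition step_functions :: "(real \<Rightarrow> 'k::complex_hilbert) set" where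
  "step_functions = {f. \<exists>n a b c. (\<forall>i<n. 0 \<le> a i \<and> a i \<le> b i) \<and>
    f = (\<lambda>s. \<Sum>i<(n::nat). indicator {a i..<b i} s *\<^sub>R c i)}"

definition restrict_to :: "real set \<Rightarrow> (real \<Rightarrow> 'k::complex_hilbert) \<Rightarrow> real \<Rightarrow> 'k" where
  "restrict_to J f = (\<lambda>s. indicator J s *\<^sub>R f s)"

definition shift_fun :: "real \<Rightarrow> (real \<Rightarrow> 'k::complex_hilbert) \<Rightarrow> real \<Rightarrow> 'k" where
  "shift_fun r f = (\<lambda>s. if r \<le> s then f (s - r) else 0)"

definition L2_of :: "(real \<Rightarrow> 'k::complex_hilbert) \<Rightarrow> 'k L2" where
  "L2_of f = kvec (Sq_fun f)"

lemma step_function_sq_integrable: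
  fixes f :: "real \<Rightarrow> 'k::complex_hilbert"
  assumes "f \<in> step_functions"
  shows "strongly_measurable halfline f" "integrable halfline (\<lambda>t. (norm (f t))\<^sup>2)"
proof -
  from assms obtain n :: nat and a b c where ab: "\<forall>i<n. 0 \<le> a i \<and> a i \<le> b i"
    and f: "f = (\<lambda>s. \<Sum>i<n. indicator {a i..<b i} s *\<^sub>R c i)"
    unfolding step_functions_def mem_Collect_eq by (elim exE conjE)
  have sets: "{0..} \<inter> {a i..<b i} \<in> sets halfline" for i
    unfolding halfline_def sets_restrict_space by (rule image_eqI[of _ _ "{a i..<b i}"]) auto
  have ind: "simple_function halfline (indicator {a i..<b i} :: real \<Rightarrow> real)" for i
    by (subst simple_function_cong[where g = "indicator ({0..} \<inter> {a i..<b i})"])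
      (use simple_function_indicator[OF sets] in \<open>auto simp: indicator_def\<close>)
  have sf: "simple_function halfline (\<lambda>s. \<Sum>i<m. indicator {a i..<b i} s *\<^sub>R c i)" for m
  proof (induction m)
    case (Suc m)
    show ?case
      unfolding sum.lessThan_Suc
      by (rule simple_function_compose2[OF Suc], rule simple_function_compose1[OF ind])
  qed simp
  then have "simple_function halfline f" unfolding f .
  then show "strongly_measurable halfline f"
    unfolding strongly_measurable_def by (intro exI[of _ "\<lambda>_. f"]) auto
  define B where "B = (\<Sum>i<n. norm (c i))"
  define R where "R = (\<Sum>i<n. b i)"
  have bR: "b i \<le> R" if "i < n" for i
    unfolding R_def by (rule member_le_sum) (use that ab in \<open>auto intro: order.trans\<close>)
  have le: "(norm (f t))\<^sup>2 \<le> B\<^sup>2 * indicator {0..R} t" for t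
  proof (cases "t \<in> {0..R}")
    case True
    have "norm (f t) \<le> B" unfolding f B_def
      by (intro sum_norm_le) (auto simp: indicator_def)
    then show ?thesis using True by (simp add: power_mono)
  next
    case False
    then have "f t = 0" unfolding f
      using ab bR by (intro sum.neutral) (fastforce simp: indicator_def)
    then show ?thesis by simp
  qed
  show "integrable halfline (\<lambda>t. (norm (f t))\<^sup>2)"
  proof (rule Bochner_Integration.integrable_bound)
    have "integrable lborel (\<lambda>t::real. indicator {0..} t *\<^sub>R (B\<^sup>2 * indicator {0..R} t :: real))"
    proof -
      have "(\<lambda>t::real. indicator {0..} t *\<^sub>R (B\<^sup>2 * indicator {0..R} t :: real)) = (\<lambda>t. B\<^sup>2 * indicator {0..R} t)"
        by (auto simp: fun_eq_iff indicator_def)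
      moreover have "integrable lborel (indicator {0..R} :: real \<Rightarrow> real)"
        by (rule integrable_real_indicator) (simp_all add: emeasure_lborel_Icc_eq)
      ultimately show ?thesis by simp
    qed
    then show "integrable halfline (\<lambda>t. B\<^sup>2 * indicator {0..R} t :: real)"
      unfolding halfline_def by (subst integrable_restrict_space) auto
    show "(\<lambda>t. (norm (f t))\<^sup>2) \<in> borel_measurable halfline"
      unfolding f
      by (rule borel_measurable_simple_function) (rule simple_function_compose1[OF sf[of n], where g = "\<lambda>x. (norm x)\<^sup>2"])
  qed (use le in auto)
qed

type_synonym 'k noise = "'k L2 fock"

definition sym_power :: "nat \<Rightarrow> 'a::complex_hilbert \<Rightarrow> 'a fock" where
  "sym_power n x = kvec (Symmetric_Tensor (replicate n x))"

text \<open>The normalised exponential vectors.\<close>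

definition coherent :: "(real \<Rightarrow> 'k::complex_hilbert) \<Rightarrow> 'k noise"  ("\<varpi>") where
  "\<varpi> f = exp (- (norm (L2_of f))\<^sup>2 / 2) *\<^sub>R (\<Sum>n. (1 / sqrt (fact n)) *\<^sub>R sym_power n (L2_of f))"

text \<open>
  The Fock space \<open>F\<^sub>J\<close> over the functions on an interval \<open>J\<close> is identified with the closed subspace of \<open>F\<close> spanned
  by the vectors \<open>\<varpi> f\<close> with \<open>f\<close> supported in \<open>J\<close>.  The isometry \<open>fock_split r\<close> from \<open>F\<close> to \<open>F \<otimes> F\<close>
  has the range \<open>F\<^bsub>[0,r[\<^esub> \<otimes> F\<^bsub>[r,\<infinity>[\<^esub>\<close> and is the canonical identification of the two spaces, while
  \<open>fock_shift r\<close> is the isometry \<open>T\<^sub>r\<close> from \<open>F\<close> onto \<open>F\<^bsub>[r,\<infinity>[\<^esub>\<close>.  Both are determined by the equations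
  below because the vectors \<open>\<varpi> f\<close> are total.

  The operator \<open>future_op r y\<close> is \<open>I\<^bsub>[0,r[\<^esub> \<otimes> y'\<close> where \<open>y'\<close> is the compression of \<open>y\<close> to \<open>F\<^bsub>[r,\<infinity>[\<^esub>\<close>;
  thus \<open>future_algebra r\<close> is \<open>I\<^bsub>[0,r[\<^esub> \<otimes> N\<^bsub>[r,\<infinity>[\<^esub>\<close>, the copy of \<open>N\<^bsub>[r,\<infinity>[\<^esub>\<close> inside \<open>N\<close>.
\<close>

definition fock_split :: "real \<Rightarrow> ('k::complex_hilbert noise, ('k noise, 'k noise) tensor) bop" where
  "fock_split r = (THE D. \<forall>f\<in>step_functions. D \<cdot> \<varpi> f = \<varpi> (restrict_to {0..<r} f) \<otimes> \<varpi> (restrict_to {r..} f))"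

definition fock_shift :: "real \<Rightarrow> 'k::complex_hilbert noise operator" where
  "fock_shift r = (THE T. \<forall>f\<in>step_functions. T \<cdot> \<varpi> f = \<varpi> (shift_fun r f))"

definition future_op :: "real \<Rightarrow> 'k::complex_hilbert noise operator \<Rightarrow> 'k noise operator" where
  "future_op r y = (fock_split r)\<^sup>\<star> \<bullet>\<^sub>o (\<one> \<otimes>\<^sub>o y) \<bullet>\<^sub>o fock_split r"

definition future_algebra :: "real \<Rightarrow> 'k::complex_hilbert noise operator set" where
  "future_algebra r = range (future_op r)"

section \<open>Quantum stochastic flows\<close>

text \<open>The operator \<open>E\<^bsup>\<varpi>(f)\<^esup> X E\<^bsub>\<varpi>(g)\<^esub>\<close>.\<close>

definition coherent_slice :: "(real \<Rightarrow> 'k::complex_hilbert) \<Rightarrow> (real \<Rightarrow> 'k)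
    \<Rightarrow> ('h::complex_hilbert, 'k noise) tensor operator \<Rightarrow> 'h operator" where
  "coherent_slice f g X = (right_ket (\<varpi> f))\<^sup>\<star> \<bullet>\<^sub>o X \<bullet>\<^sub>o right_ket (\<varpi> g)"

definition vacuum_expectation :: "('h::complex_hilbert, 'k::complex_hilbert noise) tensor operator \<Rightarrow> 'h operator" where
  "vacuum_expectation X = coherent_slice (\<lambda>_. 0) (\<lambda>_. 0) X"

text \<open>
  Cocycles and flows consist of maps into \<open>A \<otimes> N\<close>, so only processes of bounded operators are needed.
  Such an operator is identified with its restriction to the algebraic tensor product of \<open>h\<close> with the
  span of the vectors \<open>\<varpi> f\<close>.
\<close>

definition process_in :: "'h::complex_hilbert operator set
    \<Rightarrow> (real \<Rightarrow> ('h, 'k::complex_hilbert noise) tensor operator) \<Rightarrow> bool" where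
  "process_in A X \<longleftrightarrow>
    (\<forall>\<xi> u. \<forall>f\<in>step_functions.
      (\<lambda>t. cinner \<xi> (X t \<cdot> (u \<otimes> \<varpi> f))) \<in> borel_measurable halfline) \<and>
    (\<forall>t\<ge>0. \<forall>f\<in>step_functions. \<forall>g\<in>step_functions. 
      coherent_slice f g (X t) =
        cinner (\<varpi> (restrict_to {t..} f)) (\<varpi> (restrict_to {t..} g)) *\<^sub>C
          coherent_slice (restrict_to {0..<t} f) (restrict_to {0..<t} g) (X t) \<and>
      coherent_slice f g (X t) \<in> A)"

definition process_on :: "'h::complex_hilbert operator set
    \<Rightarrow> (real \<Rightarrow> 'h operator \<Rightarrow> ('h, 'k::complex_hilbert noise) tensor operator) \<Rightarrow> bool" where
  "process_on A k \<longleftrightarrow> (\<forall>t\<ge>0. linear_map_on A (k t)) \<and> (\<forall>a\<in>A. process_in A (\<lambda>t. k t a))"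

text \<open>
  The shift \<open>\<sigma>\<^sub>r\<close> from \<open>A \<otimes> N\<close> to \<open>A \<otimes> N\<^bsub>[r,\<infinity>[\<^esub>\<close>, and the map \<open>k\<^bsub>r)\<^esub> \<otimes> id\<close> from
  \<open>A \<otimes> N\<^bsub>[r,\<infinity>[\<^esub>\<close> to \<open>A \<otimes> N\<close>.  In the latter, \<open>k\<^bsub>r)\<^esub>(a) \<otimes> y\<close> is written as the product of
  \<open>k\<^sub>r(a) = k\<^bsub>r)\<^esub>(a) \<otimes> I\<^bsub>[r,\<infinity>[\<^esub>\<close> with the ampliation of \<open>y\<close>.  On their domains both maps are uniquely
  determined, by normality; their values elsewhere are never used, so any choice will do.
\<close>

definition is_noise_shift :: "'h::complex_hilbert operator set \<Rightarrow> real
    \<Rightarrow> (('h, 'k::complex_hilbert noise) tensor operator \<Rightarrow> ('h, 'k noise) tensor operator) \<Rightarrow> bool" where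
  "is_noise_shift A r \<sigma> \<longleftrightarrow>
    star_hom_on (A \<otimes>\<^sub>w UNIV) \<sigma> \<and> normal_map_on (A \<otimes>\<^sub>w UNIV) \<sigma> \<and>
    bij_betw \<sigma> (A \<otimes>\<^sub>w UNIV) (A \<otimes>\<^sub>w future_algebra r) \<and>
    (\<forall>a\<in>A. \<forall>z. \<sigma> (a \<otimes>\<^sub>o z) = a \<otimes>\<^sub>o future_op r (fock_shift r \<bullet>\<^sub>o z \<bullet>\<^sub>o (fock_shift r)\<^sup>\<star>))"

definition is_ampliation :: "'h::complex_hilbert operator set
    \<Rightarrow> (real \<Rightarrow> 'h operator \<Rightarrow> ('h, 'k::complex_hilbert noise) tensor operator) \<Rightarrow> real
    \<Rightarrow> (('h, 'k noise) tensor operator \<Rightarrow> ('h, 'k noise) tensor operator) \<Rightarrow> bool" where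
  "is_ampliation A k r \<kappa> \<longleftrightarrow>
    linear_map_on (A \<otimes>\<^sub>w future_algebra r) \<kappa> \<and> normal_map_on (A \<otimes>\<^sub>w future_algebra r) \<kappa> \<and>
    (\<forall>a\<in>A. \<forall>y\<in>future_algebra r. \<kappa> (a \<otimes>\<^sub>o y) = k r a \<bullet>\<^sub>o (\<one> \<otimes>\<^sub>o y))"

definition noise_shift :: "'h::complex_hilbert operator set \<Rightarrow> real
    \<Rightarrow> ('h, 'k::complex_hilbert noise) tensor operator \<Rightarrow> ('h, 'k noise) tensor operator" where
  "noise_shift A r = (SOME \<sigma>. is_noise_shift A r \<sigma>)"

definition ampliation :: "'h::complex_hilbert operator set
    \<Rightarrow> (real \<Rightarrow> 'h operator \<Rightarrow> ('h, 'k::complex_hilbert noise) tensor operator) \<Rightarrow> real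
    \<Rightarrow> ('h, 'k noise) tensor operator \<Rightarrow> ('h, 'k noise) tensor operator" where
  "ampliation A k r = (SOME \<kappa>. is_ampliation A k r \<kappa>)"

definition qs_cocycle :: "'h::complex_hilbert operator set
    \<Rightarrow> (real \<Rightarrow> 'h operator \<Rightarrow> ('h, 'k::complex_hilbert noise) tensor operator) \<Rightarrow> bool" where
  "qs_cocycle A k \<longleftrightarrow> process_on A k \<and>
    (\<forall>t\<ge>0. normal_map_on A (k t) \<and> completely_bounded_on A (k t)) \<and>
    (\<forall>a\<in>A. k 0 a = a \<otimes>\<^sub>o \<one>) \<and>
    (\<forall>r\<ge>0. \<forall>t\<ge>0. \<forall>a\<in>A. k (r + t) a = ampliation A k r (noise_shift A r (k t a)))"

definition qs_flow :: "'h::complex_hilbert operator set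
    \<Rightarrow> (real \<Rightarrow> 'h operator \<Rightarrow> ('h, 'k::complex_hilbert noise) tensor operator) \<Rightarrow> bool" where
  "qs_flow A j \<longleftrightarrow> qs_cocycle A j \<and>
    (\<forall>a\<in>A. continuous_map (top_of_set {0..}) uw_top (\<lambda>t. j t a)) \<and>
    (\<forall>t\<ge>0. star_hom_on A (j t) \<and> j t \<one> = \<one>)"

section \<open>The ultraweak stochastic derivative\<close>

text \<open>The isometry \<open>V\<^sub>t\<close>.\<close>

definition one_particle :: "real \<Rightarrow> (('k::complex_hilbert, 'h::complex_hilbert) tensor, ('h, 'k noise) tensor) bop" where
  "one_particle t = (THE V. \<forall>c u. V \<cdot> (c \<otimes> u) =
    u \<otimes> sym_power 1 (L2_of (restrict_to {0..<t} (\<lambda>_. (1 / sqrt t) *\<^sub>R c))))"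

definition difference_quotient :: "(real \<Rightarrow> 'h::complex_hilbert operator \<Rightarrow> ('h, 'k::complex_hilbert noise) tensor operator)
    \<Rightarrow> real \<Rightarrow> 'h operator \<Rightarrow> ('h \<times> ('k, 'h) tensor) operator" where
  "difference_quotient j t a =
    (let E = right_ket (\<varpi> (\<lambda>_. 0)); V = one_particle t; s = complex_of_real (1 / sqrt t)
     in column_op (s *\<^sub>C E\<^sup>\<star>) (V\<^sup>\<star>) \<bullet>\<^sub>o (j t a - a \<otimes>\<^sub>o \<one>) \<bullet>\<^sub>o row_op (s *\<^sub>C E) V)"

definition deriv_dom :: "'h::complex_hilbert operator set
    \<Rightarrow> (real \<Rightarrow> 'h operator \<Rightarrow> ('h, 'k::complex_hilbert noise) tensor operator) \<Rightarrow> 'h operator set" where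
  "deriv_dom A j = {x \<in> A. \<exists>T. limitin uw_top (\<lambda>t. difference_quotient j t x) T (at_right 0)}"

definition stoch_deriv :: "(real \<Rightarrow> 'h::complex_hilbert operator \<Rightarrow> ('h, 'k::complex_hilbert noise) tensor operator)
    \<Rightarrow> 'h operator \<Rightarrow> ('h \<times> ('k, 'h) tensor) operator" where
  "stoch_deriv j x = (THE T. limitin uw_top (\<lambda>t. difference_quotient j t x) T (at_right 0))"

text \<open>
  The entries of the block form \<open>[L, \<delta>\<^sup>\<dagger>; \<delta>, \<pi> - \<iota>]\<close> of the derivative, where \<open>\<iota> x = I \<otimes> x\<close>.
\<close>

definition deriv_L :: "(real \<Rightarrow> 'h::complex_hilbert operator \<Rightarrow> ('h, 'k::complex_hilbert noise) tensor operator)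
    \<Rightarrow> 'h operator \<Rightarrow> 'h operator" where
  "deriv_L j x = row_op \<one> 0 \<bullet>\<^sub>o stoch_deriv j x \<bullet>\<^sub>o column_op \<one> 0"

definition deriv_delta :: "(real \<Rightarrow> 'h::complex_hilbert operator \<Rightarrow> ('h, 'k::complex_hilbert noise) tensor operator)
    \<Rightarrow> 'h operator \<Rightarrow> ('h, ('k, 'h) tensor) bop" where
  "deriv_delta j x = row_op 0 \<one> \<bullet>\<^sub>o stoch_deriv j x \<bullet>\<^sub>o column_op \<one> 0"

definition deriv_delta_dagger :: "(real \<Rightarrow> 'h::complex_hilbert operator \<Rightarrow> ('h, 'k::complex_hilbert noise) tensor operator)
    \<Rightarrow> 'h operator \<Rightarrow> (('k, 'h) tensor, 'h) bop" where
  "deriv_delta_dagger j x = (deriv_delta j (x\<^sup>\<star>))\<^sup>\<star>"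

definition deriv_pi :: "(real \<Rightarrow> 'h::complex_hilbert operator \<Rightarrow> ('h, 'k::complex_hilbert noise) tensor operator)
    \<Rightarrow> 'h operator \<Rightarrow> ('k, 'h) tensor operator" where
  "deriv_pi j x = row_op 0 \<one> \<bullet>\<^sub>o stoch_deriv j x \<bullet>\<^sub>o column_op 0 \<one> + \<one> \<otimes>\<^sub>o x"


end

theory Submission
 imports Defs
begin

text \<open>
 The perturbed semigroup is \<open>P\<^sub>t(x) = Z\<^sub>t\<^sup>\<star> j\<^sub>t(x) Z\<^sub>t\<close>, where the operators \<open>Z\<^sub>t\<close> from \<open>h\<close> to \<open>h \<otimes> F\<close> solve the quantum
 stochastic differential equation \<open>dZ\<^sub>t = j\<^sub>t(k) Z\<^sub>t dt + j\<^sub>t(l) Z\<^sub>t dA\<^sup>\<star>\<^sub>t\<close> with \<open>Z\<^sub>0 = E\<close>, the vacuum embedding.  Only time and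
 creation integrals of adapted curves occur.  They are defined weakly against coherent vectors and bounded by means of
 the Clark-Ocone inequality, and the equation is solved by iteration.  Uniqueness of the solution and the cocycle
 property of \<open>j\<close> make \<open>Z\<close> a cocycle, so \<open>P\<close> is a semigroup of normal completely positive maps.

 Normality of \<open>j\<^sub>t\<close> enters through an isometry intertwining \<open>j\<^sub>t(a)\<close> with a direct sum of copies of \<open>a\<close>: it extends
 \<open>j\<^sub>t\<close> to \<open>A \<otimes> N\<close> and to the column \<open>l\<close>.

 For \<open>x\<close> in the domain of the stochastic derivative, \<open>(j\<^sub>t(x) - x) E\<close> is the stochastic integral of \<open>j\<^sub>s(L x) E\<close> and
 \<open>j\<^sub>s(\<delta> x) E\<close>, hence of order \<open>\<surd>t\<close>.  As \<open>Z\<^sub>t - E\<close> is of the same order, with the creation integral of \<open>l\<close> as its leading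
 term, the difference quotient of \<open>P\<close> at \<open>x\<close> converges to the asserted value.  That value vanishes at \<open>x = 1\<close> because
 \<open>k + k\<^sup>\<star> + l\<^sup>\<star>l = 0\<close>, so \<open>P\<close> is unital.
\<close>

text \<open>A direct proof that \<open>Z t\<close> is isometric would call for a product formula for
  stochastic integrals. The order of the argument avoids it: for arbitrary coefficients
  \<open>Z t\<close> is only known to grow at most exponentially, and \<open>P\<close> is a
  semigroup already at that stage. The relation between \<open>k\<close> and \<open>l\<close> enters
  solely through the generator at the unit; the right derivative of \<open>P t \<one>\<close> then
  vanishes at all times, and only afterwards does isometry of \<open>Z t\<close> follow.

  The generator is reached because \<open>Z t $ u\<close>, divided by the square root of
  \<open>t\<close>, is up to a null vector the image of the pair \<open>(u, l $ u)\<close> under the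
  very row operator that sandwiches the increment of \<open>j\<close> in its difference quotient. So
  the full matrix of the stochastic derivative is evaluated at such pairs, and \<open>\<pi>\<close>
  enters without any integral of number type.

  No space is separable. Dilations are therefore indexed by vectors, bases are replaced by frames
  obtained from the same dilation theorem, and operator identities are tested on coherent vectors of
  step functions.\<close>

no_notation vec_nth (infixl "$" 90) and fps_compose (infixl "oo" 55)
notation bop_apply (infixr "$" 75) and bop_comp (infixl "oo" 70) and tensor_op (infixl "ox" 70)

section \<open>Operators on Hilbert spaces\<close>

lemmas bop_rep_eqs [simp] = bop_comp.rep_eq plus_bop.rep_eq minus_bop.rep_eq uminus_bop.rep_eq
 scaleC_bop.rep_eq zero_bop.rep_eq bop_id.rep_eq column_op.rep_eq row_op.rep_eq
 left_ket.rep_eq right_ket.rep_eq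

declare tensor_op_apply [simp] cinner_adj [simp]

lemma bop_arith [simp]:
 fixes T :: "('a::complex_hilbert, 'b::complex_hilbert) bop"
 shows "T $ (x + y) = T $ x + T $ y" "T $ (x - y) = T $ x - T $ y" "T $ 0 = 0" "T $ (- x) = - (T $ x)"
  "T $ (c *\<^sub>C x) = c *\<^sub>C T $ x" "T $ (r *\<^sub>R x) = r *\<^sub>R T $ x"
 using bop_linear[of T] by (simp_all add: linear_simps)

lemma bop_sum: "T $ (\<Sum>i\<in>I. f i) = (\<Sum>i\<in>I. T $ f i)"
 by (simp add: linear_sum[OF bounded_linear.linear[OF bop_linear(1)]])

lemma cinner_adj2 [simp]: "cinner y (T\<^sup>\<star> $ x) = cinner (T $ y) x"
 by (metis cinner_adj cinner_commute)

lemma cinner_minus_left: "cinner (- x) y = - cinner x (y :: 'a::complex_hilbert)"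
 by (metis cinner_diff_left cinner_zero_left diff_0)

lemma cinner_ext': "(!!z. cinner z x = cinner z y) ==> x = (y :: 'a::complex_hilbert)"
 by (metis cinner_commute cinner_ext)

lemma bop_cinner_eqI: "(!!x y. cinner y (S $ x) = cinner y (T $ x)) ==> S = T"
 by (rule bop_eqI, rule cinner_ext')

lemma adj_simps [simp]:
 fixes S T :: "('a::complex_hilbert, 'b::complex_hilbert) bop"
 shows "(T\<^sup>\<star>)\<^sup>\<star> = T" "(S + T)\<^sup>\<star> = S\<^sup>\<star> + T\<^sup>\<star>" "(S - T)\<^sup>\<star> = S\<^sup>\<star> - T\<^sup>\<star>" "(c *\<^sub>C T)\<^sup>\<star> = cnj c *\<^sub>C T\<^sup>\<star>" "(0::('a,'b) bop)\<^sup>\<star> = 0"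
  "(- T)\<^sup>\<star> = - T\<^sup>\<star>"
 by (rule bop_cinner_eqI; simp add: cinner_add_left cinner_add_right cinner_diff_left cinner_diff_right
    cinner_scaleC_left cinner_scaleC_right cinner_minus_left cinner_minus_right)+

lemma adj_one [simp]: "\<one>\<^sup>\<star> = \<one>"
 by (rule bop_cinner_eqI) simp

lemma adj_comp [simp]: "(S oo T)\<^sup>\<star> = T\<^sup>\<star> oo S\<^sup>\<star>"
 by (rule bop_cinner_eqI) simp

lemma comp_assoc: "(R oo S) oo T = R oo (S oo T)"
 by (rule bop_eqI) simp

lemma comp_one [simp]: "\<one> oo T = T" "T oo \<one> = T"
 by (rule bop_eqI; simp)+

definition opnorm :: "('a::complex_hilbert, 'b::complex_hilbert) bop => real" where
 "opnorm T = onorm (($) T)"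

lemma opnorm: "norm (T $ x) <= opnorm T * norm x"
 unfolding opnorm_def by (rule onorm[OF bop_linear(1)])

lemma opnorm_nonneg [simp]: "0 <= opnorm T"
 unfolding opnorm_def by (rule onorm_pos_le[OF bop_linear(1)])

lemma opnorm_leI: "0 <= K ==> (!!x. norm (T $ x) <= K * norm x) ==> opnorm T <= K"
 unfolding opnorm_def by (rule onorm_bound)

lemma norm_scaleC: "norm (c *\<^sub>C x) = cmod c * norm (x::'a::complex_hilbert)"
proof -
 have "complex_of_real ((norm (c *\<^sub>C x))\<^sup>2) = complex_of_real ((cmod c * norm x)\<^sup>2)"
  unfolding cinner_self[symmetric, of "c *\<^sub>C x"] power_mult_distrib of_real_mult complex_norm_square cinner_self[symmetric, of x]
  by (simp add: cinner_scaleC_left cinner_scaleC_right mult_ac)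
 then have "(norm (c *\<^sub>C x))\<^sup>2 = (cmod c * norm x)\<^sup>2" by (simp only: of_real_eq_iff)
 then show ?thesis by (rule power2_eq_imp_eq) simp_all
qed

lemma norm_le_cinner: "0 <= K ==> (!!y. cmod (cinner y x) <= K * norm y) ==> norm (x::'a::complex_hilbert) <= K"
proof -
 assume K: "0 <= K" and le: "!!y. cmod (cinner y x) <= K * norm y"
 have "(norm x)\<^sup>2 <= K * norm x"
  using le[of x] by (simp add: cinner_self[of x] norm_power)
 then show ?thesis using K by (cases "x = 0") (auto simp: power2_eq_square)
qed

lemma norm_sq_Re: "(norm (x::'a::complex_hilbert))\<^sup>2 = Re (cinner x x)"
 by (simp add: cinner_self[of x])

lemma norm_sq_add: "(norm (x + y))\<^sup>2 = (norm x)\<^sup>2 + 2 * Re (cinner x y) + (norm (y::'a::complex_hilbert))\<^sup>2"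
 using cinner_add_scaled[of x 1 y] by simp

lemma norm_sq_diff: "(norm (x - y))\<^sup>2 = (norm x)\<^sup>2 - 2 * Re (cinner x y) + (norm (y::'a::complex_hilbert))\<^sup>2"
 using cinner_add_scaled[of x "-1" y] by (simp add: scaleC_minus_one)

lemma bop_exists:
 assumes "!!x y. f (x + y) = f x + f y" "!!c x. f (c *\<^sub>C x) = c *\<^sub>C f x" "!!x. norm (f x) <= K * norm x"
 obtains T :: "('a::complex_hilbert, 'b::complex_hilbert) bop" where "!!x. T $ x = f x"
proof -
 have "bounded_linear f"
  by (rule bounded_linear_intro[where K = K]) (use assms in \<open>auto simp: scaleR_scaleC mult.commute\<close>)
 then have "Bop f $ x = f x" for x using assms(2) by (simp add: Bop_inverse)
 then show thesis by (rule that)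
qed

section \<open>Total sets and operators determined on them\<close>

definition ctotal :: "'a::complex_hilbert set => bool" where
 "ctotal S \<longleftrightarrow> (\<forall>y. (\<forall>x\<in>S. cinner x y = 0) \<longrightarrow> y = 0)"

lemma total_vec_eqI:
 assumes "ctotal S" "!!x. x \<in> S ==> cinner x y = cinner x z"
 shows "y = z"
 using assms(1)[unfolded ctotal_def, rule_format, of "y - z"] assms(2) by (simp add: cinner_diff_right)

lemma total_bop_eqI:
 assumes "ctotal S" "!!x. x \<in> S ==> T $ x = T' $ x"
 shows "T = T'"
proof -
 have "T\<^sup>\<star> $ y = T'\<^sup>\<star> $ y" for y
  by (rule total_vec_eqI[OF assms(1)]) (simp add: assms(2))
 then have "T\<^sup>\<star> = T'\<^sup>\<star>" by (rule bop_eqI)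
 then have "(T\<^sup>\<star>)\<^sup>\<star> = (T'\<^sup>\<star>)\<^sup>\<star>" by (simp only:)
 then show ?thesis by simp
qed

lemma total_bop_cinner_eqI:
 assumes "ctotal S" "ctotal R" "!!x y. x \<in> S ==> y \<in> R ==> cinner y (T $ x) = cinner y (T' $ x)"
 shows "T = T'"
 by (rule total_bop_eqI[OF assms(1)], rule total_vec_eqI[OF assms(2)]) (rule assms(3))

lemma total_UNIV: "ctotal UNIV"
 unfolding ctotal_def by (metis UNIV_I cinner_ext' cinner_zero_right)

text \<open>One leg at a time: for \<open>y\<close> in \<open>R\<close> the slice of
  \<open>phi\<close> by \<open>y\<close> is orthogonal to \<open>S\<close>, hence zero; so the slice
  by any vector \<open>x\<close> of the first space is orthogonal to \<open>R\<close>, hence zero as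
  well.\<close>

lemma total_tensor:
 assumes "ctotal S" "ctotal R"
 shows "ctotal {x \<otimes> y | x y. x \<in> S \<and> y \<in> R}"
 unfolding ctotal_def
proof (intro allI impI)
 fix phi assume 0: "\<forall>p\<in>{x \<otimes> y | x y. x \<in> S \<and> y \<in> R}. cinner p phi = 0"
 have 1: "cinner (x \<otimes> y) phi = 0" if "x \<in> S" "y \<in> R" for x y
  using 0 that by blast
 have r: "(right_ket y)\<^sup>\<star> $ phi = 0" if "y \<in> R" for y
  by (rule total_vec_eqI[OF assms(1)]) (use 1 that in simp)
 have l: "(left_ket x)\<^sup>\<star> $ phi = 0" for x
 proof (rule total_vec_eqI[OF assms(2)])
  fix y assume "y \<in> R"
  have "cinner (x \<otimes> y) phi = cinner x ((right_ket y)\<^sup>\<star> $ phi)" by simp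
  also have "\<dots> = 0" using r[OF \<open>y \<in> R\<close>] by (simp del: cinner_adj2)
  finally show "cinner y ((left_ket x)\<^sup>\<star> $ phi) = cinner y 0" by simp
 qed
 show "phi = 0"
 proof (rule tensor_eqI)
  fix x y
  have "cinner (x \<otimes> y) phi = cinner y ((left_ket x)\<^sup>\<star> $ phi)" by simp
  also have "\<dots> = 0" using l by (simp del: cinner_adj2)
  finally show "cinner (x \<otimes> y) phi = cinner (x \<otimes> y) 0" by simp
 qed
qed

lemma continuous_cinner [continuous_intros]:
 fixes f g :: "'t::topological_space => 'a::complex_hilbert"
 shows "continuous_on S f ==> continuous_on S g ==> continuous_on S (%t. cinner (f t) (g t))"
 by (rule bounded_bilinear.continuous_on[OF bounded_bilinear_cinner])

lemma tendsto_cinner [tendsto_intros]: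
 fixes f g :: "'t => 'a::complex_hilbert"
 shows "(f \<longlongrightarrow> a) F ==> (g \<longlongrightarrow> b) F ==> ((%t. cinner (f t) (g t)) \<longlongrightarrow> cinner a b) F"
 by (rule bounded_bilinear.tendsto[OF bounded_bilinear_cinner])

lemma tendsto_bop [tendsto_intros]: "(f \<longlongrightarrow> a) F ==> ((%t. T $ f t) \<longlongrightarrow> T $ a) F"
 by (rule bounded_linear.tendsto[OF bop_linear(1)])

lemma tendsto_scaleC [tendsto_intros]:
 fixes f :: "'t => 'a::complex_hilbert"
 shows "(f \<longlongrightarrow> a) F ==> ((%t. c *\<^sub>C f t) \<longlongrightarrow> c *\<^sub>C a) F"
 by (rule bounded_linear.tendsto[OF bounded_linear_scaleC])

text \<open>
 The set \<open>G\<close> is the graph of a densely or non-densely defined bounded linear map.  For fixed \<open>xi\<close>, the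
 functional \<open>v \<mapsto> \<langle>xi, w\<rangle>\<close> is represented by a vector of the closure of the domain: it minimises
 \<open>\<parallel>v\<parallel>\<^sup>2 - 2 Re \<langle>xi, w\<rangle>\<close>.
\<close>

lemma graph_extension:
 fixes G :: "('a::complex_hilbert \<times> 'b::complex_hilbert) set"
 assumes add: "!!p q. p \<in> G ==> q \<in> G ==> p + q \<in> G" and scale: "!!c p. p \<in> G ==> c *\<^sub>C p \<in> G"
  and ne: "G \<noteq> {}" and bd: "!!v w. (v, w) \<in> G ==> norm w <= C * norm v" and "0 <= C"
 obtains R where "!!v w. (v, w) \<in> G ==> R $ v = w" "!!y. (!!v w. (v, w) \<in> G ==> cinner v y = 0) ==> R $ y = 0"
  "!!x. norm (R $ x) <= C * norm x"
proof -
 have ex: "\<exists>y. (\<forall>(v, w)\<in>G. cinner y v = cinner xi w) \<and> (\<forall>z. (\<forall>(v, w)\<in>G. cinner v z = 0) \<longrightarrow> cinner y z = 0)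
   \<and> norm y <= C * norm xi" for xi
 proof -
  define J where "J p = (norm (fst p))\<^sup>2 - 2 * Re (cinner xi (snd p))" for p :: "'a \<times> 'b"
  have lower: "- (C * norm xi)\<^sup>2 <= J p" if "p \<in> G" for p
  proof -
   have "Re (cinner xi (snd p)) <= norm xi * norm (snd p)"
    using cinner_cauchy_schwarz complex_Re_le_cmod order.trans by blast
   also have "\<dots> <= norm xi * (C * norm (fst p))" using bd[of "fst p" "snd p"] that by (intro mult_left_mono) auto
   finally have "Re (cinner xi (snd p)) <= (C * norm xi) * norm (fst p)" by (simp add: mult_ac)
   moreover have "0 <= (C * norm xi - norm (fst p))\<^sup>2" by simp
   ultimately show ?thesis unfolding J_def power2_diff by linarith
  qed
  define d where "d = Inf (J ` G)"
  have d_le: "d <= J p" if "p \<in> G" for p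
   unfolding d_def by (rule cInf_lower) (use that lower in \<open>auto intro!: bdd_belowI[of _ "- (C * norm xi)\<^sup>2"]\<close>)
  have "\<exists>p\<in>G. J p < d + 1 / real (Suc n)" for n
   using cInf_lessD[of "J ` G" "d + 1 / real (Suc n)"] ne unfolding d_def by auto
  then obtain X where X: "!!n. X n \<in> G" "!!n. J (X n) < d + 1 / real (Suc n)" by metis
  \<comment> \<open>Parallelogram law at the midpoint \<open>m\<close> of two points of the graph:
    minimising sequences of \<open>J\<close> are Cauchy in their first components.\<close>
  have par: "(norm (fst p - fst q))\<^sup>2 <= 2 * (J p + J q - 2 * d)" if "p \<in> G" "q \<in> G" for p q
  proof -
   define m where "m = (1/2) *\<^sub>C (p + q)"
   have "m \<in> G" unfolding m_def by (intro scale add that)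
   have "norm (fst m) = norm (fst p + fst q) / 2" unfolding m_def by (simp add: scaleC_prod_def norm_scaleC)
   then have "(norm (fst m))\<^sup>2 = (norm (fst p + fst q))\<^sup>2 / 4" by (simp only: power_divide) simp
   moreover have "2 * Re (cinner xi (snd m)) = Re (cinner xi (snd p)) + Re (cinner xi (snd q))"
    by (simp add: m_def scaleC_prod_def cinner_scaleC_right cinner_add_right)
   ultimately have "J m = (norm (fst p + fst q))\<^sup>2 / 4 - Re (cinner xi (snd p)) - Re (cinner xi (snd q))"
    unfolding J_def by simp
   with d_le[OF \<open>m \<in> G\<close>] norm_sq_add[of "fst p" "fst q"] norm_sq_diff[of "fst p" "fst q"]
   show ?thesis unfolding J_def by argo
  qed
  have "Cauchy (%n. fst (X n))"
  proof (rule metric_CauchyI)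
   fix e :: real assume "e > 0"
   obtain N where N: "4 / e\<^sup>2 < real N" using reals_Archimedean2 by blast
   have "dist (fst (X m)) (fst (X n)) < e" if "m >= N" "n >= N" for m n
   proof -
    have b: "1 / real (Suc k) < e\<^sup>2 / 4" if "k >= N" for k
    proof -
     have "4 / e\<^sup>2 < real (Suc k)" using N that by linarith
     then show ?thesis using \<open>e > 0\<close> by (simp add: field_simps)
    qed
    have "(norm (fst (X m) - fst (X n)))\<^sup>2 < e\<^sup>2"
     using par[OF X(1)[of m] X(1)[of n]] X(2)[of m] X(2)[of n] b[OF that(1)] b[OF that(2)] by argo
    then show ?thesis using \<open>e > 0\<close> by (simp add: dist_norm power_less_imp_less_base)
   qed
   then show "\<exists>M. \<forall>m\<ge>M. \<forall>n\<ge>M. dist (fst (X m)) (fst (X n)) < e" by blast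
  qed
  then obtain y where y: "(%n. fst (X n)) \<longlonglongrightarrow> y" using Cauchy_convergent convergent_def by blast
  \<comment> \<open>First variation: adding a multiple of \<open>(v, w)\<close> to the nearly
    minimal \<open>X n\<close> cannot push \<open>J\<close> below \<open>d\<close>, so in the limit
    the linear term has to vanish.\<close>
  have rep: "cinner y v = cinner xi w" if "(v, w) \<in> G" for v w
  proof -
   have lim: "(%n. 1 / real (Suc n) + 2 * Re (s * (cinner (fst (X n)) v - cinner xi w)) + (cmod s)\<^sup>2 * (norm v)\<^sup>2)
     \<longlonglongrightarrow> 0 + 2 * Re (s * (cinner y v - cinner xi w)) + (cmod s)\<^sup>2 * (norm v)\<^sup>2" for s
    by (intro tendsto_intros y LIMSEQ_inverse_real_of_nat[unfolded inverse_eq_divide])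
   have "0 <= 0 + 2 * Re (s * (cinner y v - cinner xi w)) + (cmod s)\<^sup>2 * (norm v)\<^sup>2" for s
   proof (rule LIMSEQ_le_const[OF lim], intro exI allI impI)
    fix n
    have "X n + s *\<^sub>C (v, w) \<in> G" by (intro add scale X that)
    then have "d <= J (X n + s *\<^sub>C (v, w))" by (rule d_le)
    also have "\<dots> = J (X n) + 2 * Re (s * (cinner (fst (X n)) v - cinner xi w)) + (cmod s)\<^sup>2 * (norm v)\<^sup>2"
     unfolding J_def by (simp add: scaleC_prod_def cinner_add_scaled cinner_add_right cinner_scaleC_right right_diff_distrib)
    finally show "0 <= 1 / real (Suc n) + 2 * Re (s * (cinner (fst (X n)) v - cinner xi w)) + (cmod s)\<^sup>2 * (norm v)\<^sup>2"
     using X(2)[of n] by linarith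
   qed
   then have "(cmod (cinner y v - cinner xi w))\<^sup>2 <= 0 * (norm v)\<^sup>2" by (rule kern_rotate) simp
   then show ?thesis by simp
  qed
  have orth: "cinner y z = 0" if "\<forall>(v, w)\<in>G. cinner v z = 0" for z
  proof -
   have "(%n. cinner (fst (X n)) z) \<longlonglongrightarrow> cinner y z" by (intro tendsto_intros y)
   moreover have "cinner (fst (X n)) z = 0" for n
    using that[rule_format, OF X(1)[of n]] by (simp add: case_prod_unfold)
   ultimately show ?thesis by (simp add: LIMSEQ_const_iff)
  qed
  have "norm y <= C * norm xi"
  proof -
   have "(%n. Re (cinner y (fst (X n)))) \<longlonglongrightarrow> Re (cinner y y)" by (intro tendsto_intros y)
   moreover have "(%n. C * norm xi * norm (fst (X n))) \<longlonglongrightarrow> C * norm xi * norm y" by (intro tendsto_intros y)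
   moreover have "Re (cinner y (fst (X n))) <= C * norm xi * norm (fst (X n))" for n
   proof -
    have "cinner y (fst (X n)) = cinner xi (snd (X n))"
     using rep[of "fst (X n)" "snd (X n)"] X(1) by simp
    then have "Re (cinner y (fst (X n))) <= norm xi * norm (snd (X n))"
     using cinner_cauchy_schwarz complex_Re_le_cmod order.trans by metis
    also have "\<dots> <= norm xi * (C * norm (fst (X n)))"
     using bd[of "fst (X n)" "snd (X n)"] X(1) by (intro mult_left_mono) auto
    finally show ?thesis by (simp add: mult_ac)
   qed
   ultimately have "Re (cinner y y) <= C * norm xi * norm y" by (intro LIMSEQ_le) auto
   then have "norm y * norm y <= (C * norm xi) * norm y" by (simp add: norm_sq_Re[symmetric] power2_eq_square)
   then show ?thesis using \<open>0 <= C\<close> by (cases "y = 0") auto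
  qed
  then show ?thesis using rep orth by blast
 qed
 then obtain Q where Q: "!!xi. (\<forall>(v, w)\<in>G. cinner (Q xi) v = cinner xi w) \<and>
   (\<forall>z. (\<forall>(v, w)\<in>G. cinner v z = 0) \<longrightarrow> cinner (Q xi) z = 0) \<and> norm (Q xi) <= C * norm xi" by metis
 have Q1: "cinner (Q xi) v = cinner xi w" if "(v, w) \<in> G" for xi v w using Q[of xi] that by blast
 have Q2: "cinner (Q xi) z = 0" if "!!v w. (v, w) \<in> G ==> cinner v z = 0" for xi z using Q[of xi] that by blast
 have Q3: "norm (Q xi) <= C * norm xi" for xi using Q[of xi] by blast
 \<comment> \<open>The second premise says that \<open>z\<close> lies in the closed span of the
   domain, as all values of \<open>Q\<close> do. It is what makes \<open>Q\<close> additive and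
   homogeneous.\<close>
 have uniq: "z = 0" if "!!v w. (v, w) \<in> G ==> cinner v z = 0" "!!y. (!!v w. (v, w) \<in> G ==> cinner v y = 0) ==> cinner z y = 0" for z
  using that(2)[OF that(1)] norm_sq_Re[of z] by simp
 have flip: "cinner v (Q xi) = cinner w xi" if "(v, w) \<in> G" for v w xi
  using Q1[OF that] by (metis cinner_commute)
 obtain T where T: "!!xi. T $ xi = Q xi"
 proof (rule bop_exists)
  fix x y :: 'b and c :: complex
  have "Q (x + y) - (Q x + Q y) = 0"
   by (rule uniq) (simp_all add: cinner_diff_right cinner_add_right cinner_diff_left cinner_add_left flip Q2)
  then show "Q (x + y) = Q x + Q y" by simp
  have "Q (c *\<^sub>C x) - c *\<^sub>C Q x = 0"
   by (rule uniq) (simp_all add: cinner_diff_right cinner_scaleC_right cinner_diff_left cinner_scaleC_left flip Q2)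
  then show "Q (c *\<^sub>C x) = c *\<^sub>C Q x" by simp
  show "norm (Q x) <= C * norm x" by (rule Q3)
 qed blast
 show thesis
 proof (rule that[of "T\<^sup>\<star>"])
  show "T\<^sup>\<star> $ v = w" if "(v, w) \<in> G" for v w
   by (rule cinner_ext) (simp add: T flip[OF that])
  show "T\<^sup>\<star> $ y = 0" if "!!v w. (v, w) \<in> G ==> cinner v y = 0" for y
   by (rule cinner_ext') (use Q2[OF that] in \<open>simp add: T\<close>)
  show "norm (T\<^sup>\<star> $ x) <= C * norm x" for x
  proof (rule norm_le_cinner)
   fix y
   have "cmod (cinner y (T\<^sup>\<star> $ x)) <= norm (Q y) * norm x" by (simp add: T cinner_cauchy_schwarz)
   also have "\<dots> <= (C * norm y) * norm x" by (intro mult_right_mono Q3) simp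
   finally show "cmod (cinner y (T\<^sup>\<star> $ x)) <= C * norm x * norm y" by (simp add: mult_ac)
  qed (simp add: \<open>0 <= C\<close>)
 qed
qed

text \<open>The finite combinations of the pairs \<open>(phi i, psi i)\<close> form a graph for
  \<open>graph_extension\<close>. The bound makes it single-valued, so the \<open>phi i\<close> may
  be linearly dependent.\<close>

lemma family_extension:
 fixes phi :: "'i => 'a::complex_hilbert" and psi :: "'i => 'b::complex_hilbert"
 assumes bd: "!!vs. set vs \<subseteq> UNIV \<times> I ==> norm (\<Sum>(c, i)\<leftarrow>vs. c *\<^sub>C psi i) <= C * norm (\<Sum>(c, i)\<leftarrow>vs. c *\<^sub>C phi i)" and "0 <= C"
 obtains R where "!!i. i \<in> I ==> R $ phi i = psi i" "!!y. (!!i. i \<in> I ==> cinner (phi i) y = 0) ==> R $ y = 0"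
  "!!x. norm (R $ x) <= C * norm x"
proof -
 define L where "L vs = ((\<Sum>(c, i)\<leftarrow>vs. c *\<^sub>C phi i), (\<Sum>(c, i)\<leftarrow>vs. c *\<^sub>C psi i))" for vs :: "(complex \<times> 'i) list"
 define S where "S = {vs :: (complex \<times> 'i) list. set vs \<subseteq> UNIV \<times> I}"
 have Ladd: "L vs + L ws = L (vs @ ws)" for vs ws by (simp add: L_def)
 have Lscale: "c *\<^sub>C L vs = L (kscale c vs)" for c vs
  by (induction vs) (auto simp: L_def kscale_def scaleC_prod_def scaleC_add_right scaleC_scaleC)
 have Lsub: "\<exists>R. (\<forall>v w. (v, w) \<in> L ` S \<longrightarrow> R $ v = w) \<and> (\<forall>y. (\<forall>v w. (v, w) \<in> L ` S \<longrightarrow> cinner v y = 0) \<longrightarrow> R $ y = 0)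
   \<and> (\<forall>x. norm (R $ x) <= C * norm x)"
 proof (rule graph_extension[of "L ` S" C])
  show "p + q \<in> L ` S" if "p \<in> L ` S" "q \<in> L ` S" for p q
   using that by (auto simp: Ladd S_def intro!: imageI)
  show "c *\<^sub>C p \<in> L ` S" if "p \<in> L ` S" for c p
   using that by (fastforce simp: Lscale S_def kscale_def intro!: imageI)
  show "L ` S \<noteq> {}" by (auto simp: S_def intro!: exI[of _ "[]"])
  show "norm w <= C * norm v" if "(v, w) \<in> L ` S" for v w
   using that bd by (auto simp: L_def S_def)
 qed (use \<open>0 <= C\<close> in blast)+
 then obtain R where R: "!!v w. (v, w) \<in> L ` S ==> R $ v = w"
  "!!y. (!!v w. (v, w) \<in> L ` S ==> cinner v y = 0) ==> R $ y = 0" "!!x. norm (R $ x) <= C * norm x" by metis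
 show thesis
 proof (rule that[of R])
  show "R $ phi i = psi i" if "i \<in> I" for i
   by (rule R(1), rule image_eqI[of _ _ "[(1, i)]"]) (use that in \<open>auto simp: L_def S_def\<close>)
  show "R $ y = 0" if "!!i. i \<in> I ==> cinner (phi i) y = 0" for y
  proof (rule R(2))
   have "cinner (\<Sum>(c, i)\<leftarrow>vs. c *\<^sub>C phi i) y = 0" if "set vs \<subseteq> UNIV \<times> I" for vs
    using that by (induction vs) (auto simp: cinner_add_left cinner_scaleC_left \<open>!!i. i \<in> I ==> cinner (phi i) y = 0\<close>)
   then show "cinner v y = 0" if "(v, w) \<in> L ` S" for v w using that by (auto simp: L_def S_def)
  qed
 qed (rule R(3))
qed

lemma cinner_sum_list:
 "cinner (\<Sum>(c, i)\<leftarrow>vs. c *\<^sub>C phi i) (\<Sum>(c, i)\<leftarrow>ws. c *\<^sub>C phi i)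
  = (\<Sum>(c, i)\<leftarrow>vs. \<Sum>(d, j)\<leftarrow>ws. cnj c * d * cinner (phi i) (phi j :: 'a::complex_hilbert))"
proof -
 have 1: "cinner x (\<Sum>(c, i)\<leftarrow>ws. c *\<^sub>C phi i) = (\<Sum>(d, j)\<leftarrow>ws. d * cinner x (phi j))" for x
  by (induction ws) (auto simp: cinner_add_right cinner_scaleC_right)
 have 2: "cinner (\<Sum>(c, i)\<leftarrow>vs. c *\<^sub>C phi i) x = (\<Sum>(c, i)\<leftarrow>vs. cnj c * cinner (phi i) x)" for x
  by (induction vs) (auto simp: cinner_add_left cinner_scaleC_left)
 show ?thesis
  by (subst 2, subst 1) (simp add: sum_list_const_mult[symmetric] case_prod_unfold mult.assoc)
qed

text \<open>Equal Gram matrices give equal norms of all finite combinations. As \<open>R\<close>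
  vanishes off the closed span of the \<open>phi i\<close>, it is a partial isometry in general and
  an isometry when that family is total.\<close>

lemma isometric_extension:
 fixes phi :: "'i => 'a::complex_hilbert" and psi :: "'i => 'b::complex_hilbert"
 assumes gram: "!!i j. i \<in> I ==> j \<in> I ==> cinner (psi i) (psi j) = cinner (phi i) (phi j)"
 obtains R where "!!i. i \<in> I ==> R $ phi i = psi i" "!!y. (!!i. i \<in> I ==> cinner (phi i) y = 0) ==> R $ y = 0"
  "ctotal (phi ` I) ==> R\<^sup>\<star> oo R = \<one>"
proof -
 have bd: "norm (\<Sum>(c, i)\<leftarrow>vs. c *\<^sub>C psi i) <= 1 * norm (\<Sum>(c, i)\<leftarrow>vs. c *\<^sub>C phi i)" if "set vs \<subseteq> UNIV \<times> I" for vs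
 proof -
  have "(\<Sum>(c, i)\<leftarrow>vs. \<Sum>(d, j)\<leftarrow>vs. cnj c * d * cinner (psi i) (psi j)) = (\<Sum>(c, i)\<leftarrow>vs. \<Sum>(d, j)\<leftarrow>vs. cnj c * d * cinner (phi i) (phi j))"
   using that by (intro arg_cong[where f = sum_list] map_cong) (auto simp: gram subset_iff intro!: arg_cong[where f = sum_list] map_cong)
  then have "(norm (\<Sum>(c, i)\<leftarrow>vs. c *\<^sub>C psi i))\<^sup>2 = (norm (\<Sum>(c, i)\<leftarrow>vs. c *\<^sub>C phi i))\<^sup>2"
   by (simp only: norm_sq_Re cinner_sum_list)
  then show ?thesis by simp
 qed
 obtain R where R: "!!i. i \<in> I ==> R $ phi i = psi i" "!!y. (!!i. i \<in> I ==> cinner (phi i) y = 0) ==> R $ y = 0"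
  "!!x. norm (R $ x) <= 1 * norm x"
  by (rule family_extension[of I psi 1 phi, OF bd zero_le_one]) (auto intro: that)
 have 3: "R\<^sup>\<star> oo R = \<one>" if "ctotal (phi ` I)"
  by (rule total_bop_cinner_eqI[OF that that]) (auto simp: R(1) gram)
 show thesis
 proof (rule that[of R])
  show "R $ phi i = psi i" if "i \<in> I" for i by (rule R(1)[OF that])
  show "R $ y = 0" if "!!i. i \<in> I ==> cinner (phi i) y = 0" for y by (rule R(2)[OF that])
  show "R\<^sup>\<star> oo R = \<one>" if "ctotal (phi ` I)" by (rule 3[OF that])
 qed
qed

lemma isometry_cinner: "R\<^sup>\<star> oo R = \<one> ==> cinner (R $ x) (R $ y) = cinner x y"
proof -
 assume R: "R\<^sup>\<star> oo R = \<one>"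
 have "cinner (R $ x) (R $ y) = cinner x ((R\<^sup>\<star> oo R) $ y)" by simp
 then show ?thesis unfolding R by simp
qed

lemma isometry_norm:
 assumes "R\<^sup>\<star> oo R = \<one>"
 shows "norm (R $ x) = norm x"
 using norm_sq_Re[of "R $ x"] norm_sq_Re[of x] unfolding isometry_cinner[OF assms, of x x] by (metis norm_ge_zero power2_eq_imp_eq)

lemma isometry_adj: "R\<^sup>\<star> oo R = \<one> ==> R\<^sup>\<star> $ (R $ x) = x"
proof -
 assume R: "R\<^sup>\<star> oo R = \<one>"
 have "R\<^sup>\<star> $ (R $ x) = (R\<^sup>\<star> oo R) $ x" by simp
 then show ?thesis unfolding R by simp
qed

lemma adj_norm_le: "(!!x. norm (T $ x) <= K * norm x) ==> 0 <= K ==> norm (T\<^sup>\<star> $ y) <= K * norm y"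
proof (rule norm_le_cinner)
 fix x assume K: "!!x. norm (T $ x) <= K * norm x"
 have "cmod (cinner x (T\<^sup>\<star> $ y)) <= norm (T $ x) * norm y" by (simp add: cinner_cauchy_schwarz)
 also have "\<dots> <= (K * norm x) * norm y" by (intro mult_right_mono K) simp
 finally show "cmod (cinner x (T\<^sup>\<star> $ y)) <= K * norm y * norm x" by (simp add: mult_ac)
qed simp

section \<open>The ultraweak topology\<close>

definition l2fam :: "('i => 'a::complex_hilbert) => bool" where
 "l2fam u \<longleftrightarrow> (%i. (norm (u i))\<^sup>2) summable_on UNIV"

lemma l2fam_nat: "l2fam u \<longleftrightarrow> summable (%n::nat. (norm (u n))\<^sup>2)"
 unfolding l2fam_def by (rule summable_on_UNIV_nonneg_real_iff) simp

lemma mult_le_sum_squares: "a * b <= a\<^sup>2 + (b::real)\<^sup>2"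
proof -
 have "0 <= (a - b)\<^sup>2" "0 <= (a + b)\<^sup>2" by simp_all
 then show ?thesis unfolding power2_diff power2_sum by linarith
qed

lemma l2fam_bop: "l2fam u ==> l2fam (%i. T $ u i)"
 unfolding l2fam_def
proof (rule summable_on_comparison_test)
 assume "(%i. (norm (u i))\<^sup>2) summable_on UNIV"
 then show "(%i. (opnorm T)\<^sup>2 * (norm (u i))\<^sup>2) summable_on UNIV" by (rule summable_on_cmult_right)
 show "(norm (T $ u x))\<^sup>2 <= (opnorm T)\<^sup>2 * (norm (u x))\<^sup>2" for x
  using power_mono[OF opnorm[of T "u x"], of 2] by (simp add: power_mult_distrib)
qed simp

lemma l2fam_abs_summable:
 assumes "l2fam u" "l2fam v"
 shows "(%i. cmod (cinner (u i) (v i))) summable_on UNIV"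
proof (rule summable_on_comparison_test)
 show "(%i. (norm (u i))\<^sup>2 + (norm (v i))\<^sup>2) summable_on UNIV"
  using assms unfolding l2fam_def by (rule summable_on_add)
 show "cmod (cinner (u i) (v i)) <= (norm (u i))\<^sup>2 + (norm (v i))\<^sup>2" for i
  using order.trans[OF cinner_cauchy_schwarz mult_le_sum_squares] .
qed simp

lemma l2fam_summable: "l2fam u ==> l2fam v ==> (%i. cinner (u i) (v i)) summable_on UNIV"
 using abs_summable_summable[OF l2fam_abs_summable] .

definition uwf :: "('i => 'b::complex_hilbert) => ('i => 'a::complex_hilbert) => ('a, 'b) bop => complex" where
 "uwf u v T = (\<Sum>\<^sub>\<infinity>i. cinner (u i) (T $ v i))"

lemma uwf_has_sum: "l2fam u ==> l2fam v ==> ((%i. cinner (u i) (T $ v i)) has_sum uwf u v T) UNIV"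
 unfolding uwf_def by (rule has_sum_infsum) (intro l2fam_summable l2fam_bop)

lemma uwf_nat: "l2fam u ==> l2fam v ==> uwf u v T = (\<Sum>n::nat. cinner (u n) (T $ v n))"
 using has_sum_imp_sums[OF uwf_has_sum] sums_unique by blast

lemma uw_top_eq: "uw_top = topology_generated_by
  {{T. uwf u v T \<in> U} | (u :: nat => 'b::complex_hilbert) (v :: nat => 'a::complex_hilbert) U. l2fam u \<and> l2fam v \<and> open U}"
proof -
 have "{{T::('a::complex_hilbert,'b::complex_hilbert) bop. (\<Sum>n. cinner (u n) (T $ v n)) \<in> U} | u v U.
   summable (%n::nat. (norm (u n))\<^sup>2) \<and> summable (%n. (norm (v n))\<^sup>2) \<and> open U}
  = {{T. uwf u v T \<in> U} | (u :: nat => 'b) (v :: nat => 'a) U. l2fam u \<and> l2fam v \<and> open U}"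
  unfolding l2fam_nat[symmetric] by (intro Collect_cong ex_cong1) (auto simp: uwf_nat)
 then show ?thesis unfolding uw_top_def by (rule arg_cong)
qed

lemma openin_uwf_nat:
 fixes u :: "nat => 'b::complex_hilbert" and v :: "nat => 'a::complex_hilbert"
 shows "l2fam u ==> l2fam v ==> open U ==> openin uw_top {T. uwf u v T \<in> U}"
 unfolding uw_top_eq by (rule topology_generated_by_Basis) blast

lemma uwf_nat_continuous:
 fixes u :: "nat => 'b::complex_hilbert" and v :: "nat => 'a::complex_hilbert"
 shows "l2fam u ==> l2fam v ==> continuous_map uw_top euclidean (uwf u v)"
 unfolding continuous_map_def by (simp add: openin_uwf_nat)

text \<open>A square summable family vanishes off a countable set, and \<open>g\<close> numbers that
  set. Hence functionals over arbitrary index types are already among those generating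
  \<open>uw_top\<close>.\<close>

lemma uwf_reindex:
 fixes u :: "'i => 'b::complex_hilbert" and v :: "'i => 'a::complex_hilbert"
 assumes "l2fam u" "l2fam v"
 obtains u' :: "nat => 'b" and v' :: "nat => 'a" where "l2fam u'" "l2fam v'" "uwf u v = uwf u' v'"
  "(\<Sum>\<^sub>\<infinity>n. (norm (v' n))\<^sup>2) = (\<Sum>\<^sub>\<infinity>i. (norm (v i))\<^sup>2)"
proof -
 let ?S = "{i. u i \<noteq> 0} \<union> {i. v i \<noteq> 0}"
 have "countable {i. u i \<noteq> 0}" "countable {i. v i \<noteq> 0}"
  using summable_countable_real assms unfolding l2fam_def by force+
 then obtain g :: "'i => nat" where g: "inj_on g ?S" using countable_Un countableE by metis
 define h where "h = inv_into ?S g"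
 have hg: "h (g i) = i" if "i \<in> ?S" for i using that g by (simp add: h_def)
 define u' where "u' n = (if n \<in> g ` ?S then u (h n) else 0)" for n
 define v' where "v' n = (if n \<in> g ` ?S then v (h n) else 0)" for n
 have hs: "((%n. if n \<in> g ` ?S then F (h n) else 0) has_sum s) UNIV \<longleftrightarrow> (F has_sum s) UNIV"
  if "!!i. i \<notin> ?S ==> F i = 0" for F :: "'i => 'z::{topological_comm_monoid_add,t2_space}" and s
 proof -
  have "((%n. if n \<in> g ` ?S then F (h n) else 0) has_sum s) UNIV \<longleftrightarrow> ((%n. F (h n)) has_sum s) (g ` ?S)"
   by (rule has_sum_cong_neutral) auto
  also have "\<dots> \<longleftrightarrow> (((%n. F (h n)) \<circ> g) has_sum s) ?S"
   by (rule has_sum_reindex[OF g])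
  also have "\<dots> \<longleftrightarrow> (F has_sum s) UNIV"
   by (rule has_sum_cong_neutral) (use that hg in auto)
  finally show ?thesis .
 qed
 have nu: "(%n. (norm (u' n))\<^sup>2) = (%n. if n \<in> g ` ?S then (norm (u (h n)))\<^sup>2 else 0)"
  "(%n. (norm (v' n))\<^sup>2) = (%n. if n \<in> g ` ?S then (norm (v (h n)))\<^sup>2 else 0)"
  by (auto simp: u'_def v'_def)
 show thesis
 proof
  show "l2fam u'" using assms(1) unfolding l2fam_def summable_on_def nu by (subst hs) auto
  show "l2fam v'" using assms(2) unfolding l2fam_def summable_on_def nu by (subst hs) auto
  have "((%n. cinner (u' n) (T $ v' n)) has_sum uwf u v T) UNIV" for T
  proof -
   have "(%n. cinner (u' n) (T $ v' n)) = (%n. if n \<in> g ` ?S then cinner (u (h n)) (T $ v (h n)) else 0)"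
    by (auto simp: u'_def v'_def)
   then show ?thesis
    using uwf_has_sum[OF assms, of T] by (simp only:) (subst hs, auto)
  qed
  then show "uwf u v = uwf u' v'" unfolding fun_eq_iff uwf_def[of u'] using infsumI by metis
  have "((%n. (norm (v' n))\<^sup>2) has_sum (\<Sum>\<^sub>\<infinity>i. (norm (v i))\<^sup>2)) UNIV"
   unfolding nu by (subst hs) (use assms(2) in \<open>auto simp: l2fam_def\<close>)
  then show "(\<Sum>\<^sub>\<infinity>n. (norm (v' n))\<^sup>2) = (\<Sum>\<^sub>\<infinity>i. (norm (v i))\<^sup>2)" by (rule infsumI)
 qed
qed

lemma uwf_continuous: "l2fam u ==> l2fam v ==> continuous_map uw_top euclidean (uwf u v)"
 by (erule uwf_reindex, assumption) (simp add: uwf_nat_continuous)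

lemma uwf_single: "uwf (%_::unit. x) (%_. y) T = cinner x (T $ y)"
 by (simp add: uwf_def UNIV_unit)

lemma l2fam_unit [simp]: "l2fam (u :: unit => 'a::complex_hilbert)"
 by (simp add: l2fam_def)

lemma cinner_uw_continuous: "continuous_map uw_top euclidean (%T. cinner x (T $ y))"
proof -
 have "uwf (%_::unit. x) (%_. y) = (%T. cinner x (T $ y))" by (rule ext) (rule uwf_single)
 then show ?thesis using uwf_continuous[of "%_::unit. x" "%_. y"] by simp
qed

lemma continuous_map_uw_iff:
 fixes phi :: "'t => ('a::complex_hilbert, 'b::complex_hilbert) bop"
 shows "continuous_map X uw_top phi \<longleftrightarrow> (\<forall>(u::nat => 'b) v. l2fam u \<longrightarrow> l2fam v \<longrightarrow> continuous_map X euclidean (%a. uwf u v (phi a)))"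
  (is "_ \<longleftrightarrow> ?R")
proof
 assume "continuous_map X uw_top phi"
 then show ?R using continuous_map_compose[OF _ uwf_nat_continuous] by (fastforce simp: o_def)
next
 assume R: ?R
 show "continuous_map X uw_top phi"
  unfolding uw_top_eq
 proof (subst continuous_on_generated_topo_iff, intro conjI allI impI)
  fix W assume "W \<in> {{T::('a,'b) bop. uwf u v T \<in> U} | (u :: nat => 'b) (v :: nat => 'a) U. l2fam u \<and> l2fam v \<and> open U}"
  then obtain u :: "nat => 'b" and v :: "nat => 'a" and U where W: "W = {T. uwf u v T \<in> U}" "l2fam u" "l2fam v" "open U" by blast
  have "openin X {a \<in> topspace X. uwf u v (phi a) \<in> U}"
   using R W(2-4) unfolding continuous_map_def by auto
  moreover have "phi -` W \<inter> topspace X = {a \<in> topspace X. uwf u v (phi a) \<in> U}" unfolding W(1) by auto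
  ultimately show "openin X (phi -` W \<inter> topspace X)" by simp
 next
  have "topspace uw_top = (UNIV :: ('a,'b) bop set)" by simp
  then show "phi ` topspace X \<subseteq> \<Union> {{T::('a,'b) bop. uwf u v T \<in> U} | (u :: nat => 'b) (v :: nat => 'a) U. l2fam u \<and> l2fam v \<and> open U}"
   unfolding uw_top_eq topology_generated_by_topspace by simp
 qed
qed

lemma limitin_uw_iff:
 fixes f :: "'t => ('a::complex_hilbert, 'b::complex_hilbert) bop"
 shows "limitin uw_top f T F \<longleftrightarrow> (\<forall>(u::nat => 'b) v. l2fam u \<longrightarrow> l2fam v \<longrightarrow> ((%t. uwf u v (f t)) \<longlongrightarrow> uwf u v T) F)"
  (is "_ \<longleftrightarrow> ?R")
proof
 assume "limitin uw_top f T F"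
 then show ?R
  using continuous_map_limit[OF uwf_nat_continuous] by (fastforce simp: o_def)
next
 assume R: ?R
 let ?B = "{{T::('a,'b) bop. uwf u v T \<in> U} | (u :: nat => 'b) (v :: nat => 'a) U. l2fam u \<and> l2fam v \<and> open U}"
 have "\<forall>\<^sub>F t in F. f t \<in> W" if "generate_topology_on ?B W" "T \<in> W" for W
  using that
 proof (induction rule: generate_topology_on.induct)
  case (Basis W)
  then obtain u :: "nat => 'b" and v :: "nat => 'a" and U where W: "W = {T. uwf u v T \<in> U}" "l2fam u" "l2fam v" "open U" by blast
  have "((%t. uwf u v (f t)) \<longlongrightarrow> uwf u v T) F" using R W(2,3) by blast
  from topological_tendstoD[OF this W(4)] show ?case using Basis(2) unfolding W(1) by simp
 next
  case (UN K)
  then obtain k where k: "k \<in> K" "T \<in> k" by blast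
  have "\<forall>\<^sub>F t in F. f t \<in> k" using UN k by blast
  then show ?case by (rule eventually_mono) (use k in blast)
 qed (auto intro: eventually_conj)
 then have "\<forall>\<^sub>F t in F. f t \<in> W" if "openin uw_top W" "T \<in> W" for W
  using that unfolding uw_top_eq openin_topology_generated_by_iff by blast
 then show "limitin uw_top f T F"
  unfolding limitin_def topspace_uw_top by simp
qed

lemma limitin_uw_cinner: "limitin uw_top f T F ==> ((%t. cinner x (f t $ y)) \<longlongrightarrow> cinner x (T $ y)) F"
 using continuous_map_limit[OF cinner_uw_continuous[of x y], of f T F] by (simp add: o_def)

text \<open>On bounded sets the weak and the ultraweak topology agree: the bound dominates the
  series termwise by \<open>?M\<close>, and Tannery's theorem exchanges limit and sum. All ultraweak
  limits below that are not given are obtained in this way.\<close>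

lemma limitin_uw_bounded:
 fixes f :: "'t => ('a::complex_hilbert, 'b::complex_hilbert) bop"
 assumes bd: "\<forall>\<^sub>F t in F. \<forall>x. norm (f t $ x) <= K * norm x"
  and lim: "!!x y. ((%t. cinner x (f t $ y)) \<longlongrightarrow> cinner x (T $ y)) F"
 shows "limitin uw_top f T F"
 unfolding limitin_uw_iff
proof (intro allI impI)
 fix u :: "nat => 'b" and v :: "nat => 'a"
 assume uv: "l2fam u" "l2fam v"
 show "((%t. uwf u v (f t)) \<longlongrightarrow> uwf u v T) F"
  unfolding uwf_nat[OF uv]
 proof (cases "F = bot")
  case False
  let ?M = "%n. \<bar>K\<bar> * ((norm (u n))\<^sup>2 + (norm (v n))\<^sup>2)"
  show "((%t. \<Sum>n. cinner (u n) (f t $ v n)) \<longlongrightarrow> (\<Sum>n. cinner (u n) (T $ v n))) F"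
  proof (rule tannerys_theorem[where M = ?M and a = "%n t. cinner (u n) (f t $ v n)", THEN conjunct2, THEN conjunct2])
   show "summable ?M" using uv unfolding l2fam_nat by (intro summable_mult summable_add)
   show "\<forall>\<^sub>F (k, t) in sequentially \<times>\<^sub>F F. norm (cinner (u k) (f t $ v k)) <= ?M k"
   proof -
    have "\<forall>\<^sub>F (k, t) in sequentially \<times>\<^sub>F F. (\<forall>x. norm (f t $ x) <= K * norm x)"
     using eventually_prod2[of sequentially "%t. \<forall>x. norm (f t $ x) <= K * norm x" F] bd by simp
    then show ?thesis
    proof (rule eventually_mono, clarify)
     fix k t assume b: "\<forall>x. norm (f t $ x) <= K * norm x"
     have "norm (cinner (u k) (f t $ v k)) <= norm (u k) * norm (f t $ v k)" by (rule cinner_cauchy_schwarz)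
     also have "\<dots> <= norm (u k) * (\<bar>K\<bar> * norm (v k))"
      by (intro mult_left_mono order.trans[OF b[rule_format]] mult_right_mono) auto
     also have "\<dots> = \<bar>K\<bar> * (norm (u k) * norm (v k))" by simp
     also have "\<dots> <= ?M k" by (intro mult_left_mono mult_le_sum_squares) simp
     finally show "norm (cinner (u k) (f t $ v k)) <= ?M k" .
    qed
   qed
  qed (use lim False in auto)
 qed simp
qed

lemma uwf_bop_left_right: "uwf u v (R oo T oo S) = uwf (%i. R\<^sup>\<star> $ u i) (%i. S $ v i) T"
 by (simp add: uwf_def)

lemma uw_continuous_sandwich: "continuous_map uw_top uw_top (%T. R oo T oo S)"
 unfolding continuous_map_uw_iff uwf_bop_left_right by (intro allI impI uwf_continuous l2fam_bop)

lemma uw_continuous_left: "continuous_map uw_top uw_top (%T. R oo T)"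
 using uw_continuous_sandwich[of R \<one>] by simp

lemma uw_continuous_right: "continuous_map uw_top uw_top (%T. T oo S)"
 using uw_continuous_sandwich[of \<one> S] by simp

lemma uwf_add: "l2fam u ==> l2fam v ==> uwf u v (S + T) = uwf u v S + uwf u v T"
 using has_sum_add[OF uwf_has_sum uwf_has_sum, of u v u v S T] unfolding uwf_def[of u v "S + T"]
 by (intro infsumI) (simp add: cinner_add_right)

lemma uwf_scaleC: "l2fam u ==> l2fam v ==> uwf u v (c *\<^sub>C T) = c * uwf u v T"
 using has_sum_cmult_right[OF uwf_has_sum, of u v c T] unfolding uwf_def[of u v "c *\<^sub>C T"]
 by (intro infsumI) (simp add: cinner_scaleC_right)

lemma uw_continuous_add: "continuous_map X uw_top phi ==> continuous_map X uw_top psi ==> continuous_map X uw_top (%x. phi x + psi x)"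
 unfolding continuous_map_uw_iff by (simp add: uwf_add continuous_map_add)

lemma uw_continuous_scaleC: "continuous_map X uw_top phi ==> continuous_map X uw_top (%x. c *\<^sub>C phi x)"
 unfolding continuous_map_uw_iff
proof (intro allI impI)
 fix u :: "nat => 'c" and v :: "nat => 'b"
 assume phi: "\<forall>u v. l2fam (u :: nat => 'c) \<longrightarrow> l2fam v \<longrightarrow> continuous_map X euclidean (%a. uwf u v (phi a))"
  and uv: "l2fam u" "l2fam v"
 have "continuous_map euclidean euclidean (%z::complex. c * z)"
  unfolding continuous_map_iff_continuous2 by (intro continuous_intros)
 from continuous_map_compose[OF _ this, of X "%a. uwf u v (phi a)"]
 show "continuous_map X euclidean (%a. uwf u v (c *\<^sub>C phi a))"
  using phi uv by (simp add: uwf_scaleC o_def)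
qed

lemma uw_continuous_add_const: "continuous_map uw_top uw_top (%T. S + T)" "continuous_map uw_top uw_top (%T. T + S)"
 by (rule uw_continuous_add; simp add: continuous_map_id[unfolded id_def])+

subsection \<open>Spans and their closures\<close>

definition csub :: "('a::complex_hilbert, 'b::complex_hilbert) bop set => bool" where
 "csub C \<longleftrightarrow> 0 \<in> C \<and> (\<forall>x\<in>C. \<forall>y\<in>C. x + y \<in> C) \<and> (\<forall>c. \<forall>x\<in>C. c *\<^sub>C x \<in> C)"

lemma complex_span_subset:
 assumes "csub C" "S \<subseteq> C"
 shows "complex_span S \<subseteq> C"
proof
 fix x assume "x \<in> complex_span S"
 then obtain F c where F: "finite F" "F \<subseteq> S" and x: "x = (\<Sum>T\<in>F. c T *\<^sub>C T)"
  unfolding complex_span_def by blast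
 have "(\<Sum>T\<in>F. c T *\<^sub>C T) \<in> C"
  using F by (induction F) (use assms in \<open>auto simp: csub_def\<close>)
 then show "x \<in> C" by (simp add: x)
qed

lemma bop_scaleC_simps [simp]:
 fixes T :: "('a::complex_hilbert, 'b::complex_hilbert) bop"
 shows "0 *\<^sub>C T = 0" "1 *\<^sub>C T = T" "c *\<^sub>C (0::('a, 'b) bop) = 0" "c *\<^sub>C (d *\<^sub>C T) = (c * d) *\<^sub>C T"
 by (rule bop_eqI; simp add: scaleC_scaleC)+

lemma bop_scaleC_add:
 fixes S T :: "('a::complex_hilbert, 'b::complex_hilbert) bop"
 shows "c *\<^sub>C (S + T) = c *\<^sub>C S + c *\<^sub>C T" "(c + d) *\<^sub>C T = c *\<^sub>C T + d *\<^sub>C T"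
 by (rule bop_eqI; simp add: scaleC_add_right scaleC_add_left)+

lemma bop_scaleC_sum: "c *\<^sub>C (\<Sum>i\<in>I. f i) = (\<Sum>i\<in>I. c *\<^sub>C (f i :: ('a::complex_hilbert, 'b::complex_hilbert) bop))"
 by (induction I rule: infinite_finite_induct) (simp_all add: bop_scaleC_add)

lemma csub_complex_span: "csub (complex_span S)"
 unfolding csub_def
proof (intro conjI ballI allI)
 show "0 \<in> complex_span S" unfolding complex_span_def by (auto intro!: exI[of _ "{}"])
next
 fix x y assume "x \<in> complex_span S" "y \<in> complex_span S"
 then obtain F c G d where F: "finite F" "F \<subseteq> S" "x = (\<Sum>T\<in>F. c T *\<^sub>C T)"
  and G: "finite G" "G \<subseteq> S" "y = (\<Sum>T\<in>G. d T *\<^sub>C T)"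
  unfolding complex_span_def by blast
 define c' where "c' T = (if T \<in> F then c T else 0)" for T
 define d' where "d' T = (if T \<in> G then d T else 0)" for T
 have "x = (\<Sum>T\<in>F \<union> G. c' T *\<^sub>C T)" unfolding F(3)
  by (rule sum.mono_neutral_cong_left) (use F G in \<open>auto simp: c'_def\<close>)
 moreover have "y = (\<Sum>T\<in>F \<union> G. d' T *\<^sub>C T)" unfolding G(3)
  by (rule sum.mono_neutral_cong_left) (use F G in \<open>auto simp: d'_def\<close>)
 ultimately have "x + y = (\<Sum>T\<in>F \<union> G. (c' T + d' T) *\<^sub>C T)"
  by (simp add: sum.distrib bop_scaleC_add)
 then show "x + y \<in> complex_span S"
  unfolding complex_span_def using F G by (intro CollectI exI[of _ "F \<union> G"] exI[of _ "%T. c' T + d' T"]) auto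
next
 fix a x assume "x \<in> complex_span S"
 then obtain F c where F: "finite F" "F \<subseteq> S" "x = (\<Sum>T\<in>F. c T *\<^sub>C T)"
  unfolding complex_span_def by blast
 then have "a *\<^sub>C x = (\<Sum>T\<in>F. (a * c T) *\<^sub>C T)" by (simp add: bop_scaleC_sum)
 then show "a *\<^sub>C x \<in> complex_span S" unfolding complex_span_def
  using F(1,2) by (intro CollectI exI[of _ F] exI[of _ "%T. a * c T"]) auto
qed

lemma complex_span_superset: "S \<subseteq> complex_span S"
proof
 fix T assume "T \<in> S"
 then show "T \<in> complex_span S" unfolding complex_span_def
  by (intro CollectI exI[of _ "{T}"] exI[of _ "%_. 1"]) auto
qed

definition uwspan :: "('a::complex_hilbert, 'b::complex_hilbert) bop set => ('a, 'b) bop set" where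
 "uwspan S = uw_top closure_of complex_span S"

lemma uwspan_superset: "S \<subseteq> uwspan S"
 unfolding uwspan_def using complex_span_superset closure_of_subset[of "complex_span S" uw_top] by fastforce

lemma uwspan_map_subset:
 assumes "continuous_map (subtopology uw_top (uwspan S)) uw_top phi" "phi ` complex_span S \<subseteq> complex_span R"
 shows "phi ` uwspan S \<subseteq> uwspan R"
proof -
 let ?X = "subtopology uw_top (uwspan S)"
 have sub: "complex_span S \<subseteq> uwspan S"
  unfolding uwspan_def using closure_of_subset[of "complex_span S" uw_top] by simp
 have "?X closure_of (complex_span S) = uwspan S"
  using sub by (simp add: closure_of_subtopology uwspan_def Int_absorb1)
 then have "phi ` uwspan S \<subseteq> uw_top closure_of (phi ` complex_span S)"
  using continuous_map_image_closure_subset[OF assms(1), of "complex_span S"] by simp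
 also have "\<dots> \<subseteq> uwspan R" unfolding uwspan_def by (rule closure_of_mono[OF assms(2)])
 finally show ?thesis .
qed

lemma csub_linear_eq:
 assumes "csub C" "linear_map_on C phi" "linear_map_on C psi"
 shows "csub {x \<in> C. phi x = psi x}"
proof -
 have "phi 0 = psi 0" if "0 \<in> C"
 proof -
  have "phi (0 *\<^sub>C 0) = 0 *\<^sub>C phi 0" "psi (0 *\<^sub>C 0) = 0 *\<^sub>C psi 0" using assms that unfolding linear_map_on_def by blast+
  then show ?thesis by simp
 qed
 then show ?thesis using assms unfolding csub_def linear_map_on_def by auto
qed

text \<open>The coincidence set is a subspace by linearity, so it contains the span of
  \<open>S\<close>; since \<open>uw_top\<close> is Hausdorff it then contains the closure.\<close>

lemma uwspan_eqI:
 assumes "continuous_map (subtopology uw_top (uwspan S)) uw_top phi" "continuous_map (subtopology uw_top (uwspan S)) uw_top psi"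
  and "linear_map_on (uwspan S) phi" "linear_map_on (uwspan S) psi"
  and "csub (uwspan S)" "!!x. x \<in> S ==> phi x = psi x" "x \<in> uwspan S"
 shows "phi x = psi x"
proof -
 let ?X = "subtopology uw_top (uwspan S)"
 have sub: "complex_span S \<subseteq> uwspan S"
  unfolding uwspan_def using closure_of_subset[of "complex_span S" uw_top] by simp
 have "complex_span S \<subseteq> {x \<in> uwspan S. phi x = psi x}"
  by (rule complex_span_subset[OF csub_linear_eq]) (use assms uwspan_superset in auto)
 moreover have "x \<in> ?X closure_of (complex_span S)"
  using sub assms(7) by (simp add: closure_of_subtopology uwspan_def Int_absorb1)
 ultimately show ?thesis
  using forall_in_closure_of_eq[OF _ Hausdorff_uw_top assms(1,2)] by blast
qed

text \<open>Addition is handled in one variable at a time. Translation by an element of the span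
  preserves the closure; so translation by an element of the closure maps the span into the closure,
  and by continuity the closure into itself.\<close>

lemma csub_uwspan: "csub (uwspan S)"
proof -
 have im: "(%x. x + y) ` uwspan S \<subseteq> uwspan S" if "y \<in> complex_span S" for y
  by (intro uwspan_map_subset continuous_map_from_subtopology uw_continuous_add_const)
   (use csub_complex_span[of S] that in \<open>auto simp: csub_def\<close>)
 have im2: "(%y. x + y) ` uwspan S \<subseteq> uwspan S" if "x \<in> uwspan S" for x
 proof -
  have "(%y. x + y) ` complex_span S \<subseteq> uwspan S" using im that by blast
  from closure_of_mono[OF this, of uw_top]
  have "uw_top closure_of ((%y. x + y) ` complex_span S) \<subseteq> uwspan S"
   unfolding uwspan_def closure_of_closure_of .
  moreover have "(%y. x + y) ` (uw_top closure_of complex_span S) \<subseteq> uw_top closure_of ((%y. x + y) ` complex_span S)"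
   by (intro continuous_map_image_closure_subset uw_continuous_add_const)
  ultimately show ?thesis unfolding uwspan_def by blast
 qed
 have "(%x. c *\<^sub>C x) ` uwspan S \<subseteq> uwspan S" for c
  using csub_complex_span[of S]
  by (intro uwspan_map_subset continuous_map_from_subtopology uw_continuous_scaleC)
   (auto simp: csub_def continuous_map_id[unfolded id_def])
 moreover have "0 \<in> uwspan S"
  using csub_complex_span[of S] closure_of_subset[of "complex_span S" uw_top] unfolding csub_def uwspan_def by auto
 ultimately show ?thesis using im2 unfolding csub_def by blast
qed

lemma uwspan_closed: "closedin uw_top C ==> csub C ==> S \<subseteq> C ==> uwspan S \<subseteq> C"
 unfolding uwspan_def by (rule closure_of_minimal[OF complex_span_subset])

lemma uw_tensor_eq: "A \<otimes>\<^sub>w B = uwspan {a ox b | a b. a \<in> A \<and> b \<in> B}"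
 by (simp add: uw_tensor_def uwspan_def)

lemma closedin_uw_eq: "continuous_map uw_top uw_top phi ==> continuous_map uw_top uw_top psi ==> closedin uw_top {T. phi T = psi T}"
 using closedin_continuous_maps_eq[OF Hausdorff_uw_top, of uw_top phi psi] by simp

section \<open>Direct sums of copies of a Hilbert space\<close>

text \<open>The Hilbert direct sum of copies of \<open>'h\<close> indexed by \<open>'i\<close>.
  Presented through a kernel, in which symbols with different indices are orthogonal, it inherits
  completeness from \<open>khilb\<close>.\<close>

datatype ('h, 'i) dsum_symbol = Dsum_Symbol 'h 'i

instantiation dsum_symbol :: (complex_hilbert, type) pd_kernel
begin

fun kern_dsum_symbol :: "('a, 'b) dsum_symbol => ('a, 'b) dsum_symbol => complex" where
 "kern_dsum_symbol (Dsum_Symbol x i) (Dsum_Symbol y j) = (if i = j then cinner x y else 0)"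

instance
proof
 fix p q :: "('a, 'b) dsum_symbol"
 show "kern p q = cnj (kern q p)"
  by (cases p; cases q) (simp flip: cinner_commute)
next
 fix v :: "(complex \<times> ('a, 'b) dsum_symbol) list"
 define n where "n = length v"
 define c where "c k = fst (v ! k)" for k
 define x where "x k = (case snd (v ! k) of Dsum_Symbol a b => a)" for k
 define i where "i k = (case snd (v ! k) of Dsum_Symbol a b => b)" for k
 have st: "snd (v ! k) = Dsum_Symbol (x k) (i k)" for k
  by (simp add: x_def i_def split: dsum_symbol.split)
 \<comment> \<open>\<open>y m k\<close> is the \<open>k\<close>-th summand as seen in the coordinate
   \<open>m\<close>; grouped by coordinates, the quadratic form is a sum of squared norms.\<close>
 define y where "y m k = (if i k = m then c k *\<^sub>C x k else 0)" for m k
 have "(\<Sum>k<n. \<Sum>l<n. cnj (c k) * c l * kern (Dsum_Symbol (x k) (i k)) (Dsum_Symbol (x l) (i l)))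
   = (\<Sum>k<n. \<Sum>l<n. \<Sum>m\<in>i ` {..<n}. cinner (y m k) (y m l))"
 proof (intro sum.cong refl)
  fix k l assume "k \<in> {..<n}"
  have "(\<Sum>m\<in>i ` {..<n}. cinner (y m k) (y m l))
    = (\<Sum>m\<in>i ` {..<n}. if i k = m then cinner (c k *\<^sub>C x k) (y (i k) l) else 0)"
   by (intro sum.cong) (auto simp: y_def)
  also have "\<dots> = cinner (c k *\<^sub>C x k) (y (i k) l)" using \<open>k \<in> {..<n}\<close> by simp
  also have "\<dots> = cnj (c k) * c l * kern (Dsum_Symbol (x k) (i k)) (Dsum_Symbol (x l) (i l))"
   by (simp add: y_def cinner_scaleC_left cinner_scaleC_right)
  finally show "cnj (c k) * c l * kern (Dsum_Symbol (x k) (i k)) (Dsum_Symbol (x l) (i l))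
    = (\<Sum>m\<in>i ` {..<n}. cinner (y m k) (y m l))" by simp
 qed
 also have "\<dots> = (\<Sum>m\<in>i ` {..<n}. \<Sum>k<n. \<Sum>l<n. cinner (y m k) (y m l))"
  by (simp only: sum.swap[where A = "{..<n}" and B = "i ` {..<n}"])
 also have "\<dots> = (\<Sum>m\<in>i ` {..<n}. cinner (\<Sum>k<n. y m k) (\<Sum>k<n. y m k))"
  unfolding cinner_sum_left unfolding cinner_sum_right ..
 finally have "Re (\<Sum>k<n. \<Sum>l<n. cnj (c k) * c l * kern (Dsum_Symbol (x k) (i k)) (Dsum_Symbol (x l) (i l)))
   = (\<Sum>m\<in>i ` {..<n}. (norm (\<Sum>k<n. y m k))\<^sup>2)"
  by (simp only: Re_sum norm_sq_Re)
 also have "\<dots> >= 0" by (intro sum_nonneg) simp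
 finally show "0 <= Re (\<Sum>(c, p)\<leftarrow>v. \<Sum>(d, q)\<leftarrow>v. cnj c * d * kern p q)"
  unfolding sum_list_square_nth by (simp only: st n_def c_def)
qed

end

type_synonym ('h, 'i) dsum = "('h, 'i) dsum_symbol khilb"

lift_definition inc :: "'i => ('h::complex_hilbert, ('h, 'i) dsum) bop" is "%i x. kvec (Dsum_Symbol x i)"
proof -
 fix i :: 'i
 let ?f = "%x::'h. kvec (Dsum_Symbol x i)"
 have k: "cinner (kvec p) (kvec (Dsum_Symbol (x::'h) i)) = (case p of Dsum_Symbol y j => if i = j then cinner y x else 0)" for p x
  by (cases p) (simp add: cinner_kvec)
 have add: "?f (x + y) = ?f x + ?f y" for x y
  by (rule khilb_eqI) (simp add: k cinner_add_right split: dsum_symbol.split)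
 have scale: "?f (c *\<^sub>C x) = c *\<^sub>C ?f x" for c x
  by (rule khilb_eqI) (simp add: k cinner_scaleC_right split: dsum_symbol.split)
 have "(norm (?f x))\<^sup>2 = (norm x)\<^sup>2" for x
  unfolding norm_sq_Re by (simp add: cinner_kvec)
 then have "norm (?f x) = norm x" for x by simp
 then have "bounded_linear ?f"
  by (intro bounded_linear_intro[where K = 1]) (simp_all add: add scale scaleR_scaleC)
 then show "bounded_linear ?f \<and> (\<forall>c x. ?f (c *\<^sub>C x) = c *\<^sub>C ?f x)" using scale by blast
qed

lemma cinner_inc: "cinner (inc i $ x) (inc j $ y) = (if i = j then cinner x y else 0)"
 by (simp add: inc.rep_eq cinner_kvec)

abbreviation coord :: "'i => ('h::complex_hilbert, 'i) dsum => 'h" where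
 "coord i zeta \<equiv> (inc i)\<^sup>\<star> $ zeta"

lemma coord_inc: "coord i (inc j $ x) = (if i = j then x else 0)"
 by (rule cinner_ext') (simp add: cinner_inc)

lemma total_inc: "ctotal {inc i $ (x::'h::complex_hilbert) | (i::'i) x. True}"
 unfolding ctotal_def
proof (intro allI impI)
 fix phi :: "('h, 'i) dsum" assume 0: "\<forall>p\<in>{inc i $ x | i x. True}. cinner p phi = 0"
 show "phi = 0"
 proof (rule kvec_total)
  fix p :: "('h, 'i) dsum_symbol"
  obtain x i where "p = Dsum_Symbol x i" by (cases p)
  then show "cinner (kvec p) phi = 0" using 0 by (auto simp: inc.rep_eq)
 qed
qed

lemma dsum_eqI:
 fixes zeta zeta' :: "('a::complex_hilbert, 'b) dsum"
 assumes "!!i. coord i zeta = coord i zeta'"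
 shows "zeta = zeta'"
proof (rule total_vec_eqI[OF total_inc])
 fix p :: "('a, 'b) dsum" assume "p \<in> {inc i $ x | i x. True}"
 then obtain i x where p: "p = inc i $ x" by blast
 have "cinner p zeta = cinner x (coord i zeta)" "cinner p zeta' = cinner x (coord i zeta')" by (simp_all add: p)
 then show "cinner p zeta = cinner p zeta'" using assms by (simp del: cinner_adj2)
qed

lemma norm_sum_inc: "finite F ==> (norm (\<Sum>i\<in>F. inc i $ u i))\<^sup>2 = (\<Sum>i\<in>F. (norm (u i))\<^sup>2)"
 unfolding norm_sq_Re cinner_sum_left
 unfolding cinner_sum_right cinner_inc by (simp add: norm_sq_Re)

lemma coord_bessel: "finite F ==> (\<Sum>i\<in>F. (norm (coord i zeta))\<^sup>2) <= (norm zeta)\<^sup>2"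
proof -
 assume F: "finite F"
 let ?s = "\<Sum>i\<in>F. inc i $ coord i zeta"
 have "cinner zeta ?s = (\<Sum>i\<in>F. cinner (coord i zeta) (coord i zeta))"
  unfolding cinner_sum_right by (intro sum.cong refl) (metis cinner_adj)
 then have "Re (cinner zeta ?s) = (norm ?s)\<^sup>2"
  unfolding norm_sum_inc[OF F] by (simp only: Re_sum norm_sq_Re[of "coord _ _"])
 moreover have "Re (cinner zeta ?s) <= norm zeta * norm ?s"
  using cinner_cauchy_schwarz complex_Re_le_cmod order.trans by blast
 ultimately have "norm ?s * norm ?s <= norm zeta * norm ?s" by (simp add: power2_eq_square)
 then have "norm ?s <= norm zeta" by (cases "?s = 0") auto
 then show ?thesis unfolding norm_sum_inc[OF F, symmetric] by simp
qed

lemma l2fam_coord: "l2fam (%i. coord i zeta)"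
 unfolding l2fam_def
 by (rule nonneg_bdd_above_summable_on) (use coord_bessel in \<open>auto intro!: bdd_aboveI[of _ "(norm zeta)\<^sup>2"]\<close>)

text \<open>The vector is the Riesz representative of the functional that pairs coordinates with
  \<open>u\<close>; Bessel's inequality bounds it by \<open>K\<close>, the square-sum norm of
  \<open>u\<close>.\<close>

lemma dsum_exists:
 fixes u :: "'i => 'h::complex_hilbert"
 assumes "l2fam u"
 shows "\<exists>zeta. (\<forall>i. coord i zeta = u i) \<and> (\<forall>zeta'. cinner zeta zeta' = (\<Sum>\<^sub>\<infinity>i. cinner (u i) (coord i zeta')))"
proof -
 let ?f = "%zeta'. \<Sum>\<^sub>\<infinity>i. cinner (u i) (coord i zeta')"
 define K where "K = sqrt (\<Sum>\<^sub>\<infinity>i. (norm (u i))\<^sup>2)"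
 have hs: "((%i. cinner (u i) (coord i zeta')) has_sum ?f zeta') UNIV" for zeta'
  by (rule has_sum_infsum) (intro l2fam_summable assms l2fam_coord)
 have bd: "norm (?f zeta') <= K * norm zeta'" for zeta'
 proof (rule tendsto_upperbound[OF tendsto_norm[OF hs[of zeta', unfolded has_sum_def]]])
  show "\<forall>\<^sub>F F in finite_subsets_at_top UNIV. norm (\<Sum>i\<in>F. cinner (u i) (coord i zeta')) <= K * norm zeta'"
  proof (rule eventually_mono[OF eventually_finite_subsets_at_top_weakI])
   fix F :: "'i set" assume F: "finite F"
   have "(\<Sum>i\<in>F. cinner (u i) (coord i zeta')) = cinner (\<Sum>i\<in>F. inc i $ u i) zeta'"
    by (simp add: cinner_sum_left)
   moreover have "norm (\<Sum>i\<in>F. inc i $ u i) <= K"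
   proof -
    have "(norm (\<Sum>i\<in>F. inc i $ u i))\<^sup>2 <= (\<Sum>\<^sub>\<infinity>i. (norm (u i))\<^sup>2)"
     unfolding norm_sum_inc[OF F]
     by (rule finite_sum_le_infsum) (use assms F in \<open>auto simp: l2fam_def\<close>)
    then show ?thesis unfolding K_def by (rule real_le_rsqrt)
   qed
   ultimately show "norm (\<Sum>i\<in>F. cinner (u i) (coord i zeta')) <= K * norm zeta'"
    using order.trans[OF cinner_cauchy_schwarz mult_right_mono[OF _ norm_ge_zero]] by metis
  qed simp
 qed simp
 have add: "?f (x + y) = ?f x + ?f y" for x y
  using has_sum_add[OF hs[of x] hs[of y]] by (intro infsumI) (simp add: cinner_add_right del: cinner_adj2)
 have scale: "?f (c *\<^sub>C x) = c * ?f x" for c x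
  using has_sum_cmult_right[OF hs[of x], of c] by (intro infsumI) (simp add: cinner_scaleC_right del: cinner_adj2)
 have "bounded_linear ?f"
 proof (rule bounded_linear_intro[where K = K])
  show "?f (r *\<^sub>R x) = r *\<^sub>R ?f x" for r x
   unfolding scaleR_scaleC scale scaleC_complex_def ..
 qed (use bd add in \<open>simp_all only: mult.commute\<close>)
 then obtain zeta where zeta: "!!x. ?f x = cinner zeta x"
  using riesz[of ?f] scale by metis
 have "coord j zeta = u j" for j
 proof (rule cinner_ext)
  fix z
  have "cinner (coord j zeta) z = ?f (inc j $ z)" unfolding zeta by simp
  also have "\<dots> = (\<Sum>\<^sub>\<infinity>i\<in>{j}. cinner (u i) (coord i (inc j $ z)))"
   by (rule infsum_cong_neutral) (auto simp: coord_inc simp del: cinner_adj2)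
  finally show "cinner (coord j zeta) z = cinner (u j) z" by (simp add: coord_inc del: cinner_adj2)
 qed
 then show ?thesis using zeta by metis
qed

text \<open>Rebuild a vector from the coordinates of \<open>zeta\<close> by
  \<open>dsum_exists\<close>: it is \<open>zeta\<close>, since coordinates determine the vector, and
  the pairing formula supplied there is the claim.\<close>

lemma parseval: "((%i. cinner (coord i zeta) (coord i zeta')) has_sum cinner zeta zeta') UNIV"
proof -
 obtain xi where xi: "!!i. coord i xi = coord i zeta" "!!zeta'. cinner xi zeta' = (\<Sum>\<^sub>\<infinity>i. cinner (coord i zeta) (coord i zeta'))"
  using dsum_exists[OF l2fam_coord[of zeta]] by metis
 have "xi = zeta" by (rule dsum_eqI) (rule xi)
 then have "cinner zeta zeta' = (\<Sum>\<^sub>\<infinity>i. cinner (coord i zeta) (coord i zeta'))" using xi(2) by simp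
 then show ?thesis using has_sum_infsum[OF l2fam_summable[OF l2fam_coord l2fam_coord]] by (simp del: cinner_adj cinner_adj2)
qed

lemma parseval_norm: "((%i. (norm (coord i zeta))\<^sup>2) has_sum (norm zeta)\<^sup>2) UNIV"
 using has_sum_Re[OF parseval[of zeta zeta]] by (simp only: norm_sq_Re)

lemma dsum_of_l2fam:
 assumes "l2fam u"
 obtains zeta where "!!i. coord i zeta = u i"
 using dsum_exists[OF assms] by blast

text \<open>The diagonal operator with every entry equal to \<open>T\<close>, that is,
  \<open>T\<close> tensored with the identity on the square summable scalar families.\<close>

definition amp :: "('a::complex_hilbert, 'b::complex_hilbert) bop => (('a, 'i) dsum, ('b, 'i) dsum) bop" where
 "amp T = (THE R. \<forall>i zeta. coord i (R $ zeta) = T $ coord i zeta)"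

lemma coord_amp [simp]:
 fixes T :: "('a::complex_hilbert, 'b::complex_hilbert) bop" and zeta :: "('a, 'c) dsum"
 shows "coord i (amp T $ zeta) = T $ coord i zeta"
proof -
 have "\<exists>xi. \<forall>i. coord i xi = T $ coord i zeta" for zeta :: "('a, 'c) dsum"
  using dsum_of_l2fam[OF l2fam_bop[OF l2fam_coord]] by metis
 then obtain f where f: "!!zeta i. coord i (f zeta) = T $ coord i (zeta :: ('a, 'c) dsum)" by metis
 obtain R where R: "!!zeta. R $ zeta = f zeta"
 proof (rule bop_exists)
  show "f (x + y) = f x + f y" "f (c *\<^sub>C x) = c *\<^sub>C f x" for x y c
   by (rule dsum_eqI; simp add: f)+
  show "norm (f x) <= opnorm T * norm x" for x
  proof -
   have "(norm (f x))\<^sup>2 <= (opnorm T)\<^sup>2 * (norm x)\<^sup>2"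
   proof (rule has_sum_mono[OF parseval_norm has_sum_cmult_right[OF parseval_norm]])
    show "(norm (coord i (f x)))\<^sup>2 <= (opnorm T)\<^sup>2 * (norm (coord i x))\<^sup>2" for i
     unfolding f power_mult_distrib[symmetric] by (intro power_mono opnorm) simp
   qed
   then show ?thesis unfolding power_mult_distrib[symmetric] by (rule power2_le_imp_le) simp
  qed
 qed blast
 have "\<exists>!R. \<forall>i zeta. coord i (R $ zeta) = T $ coord i (zeta :: ('a, 'c) dsum)"
 proof (rule ex1I[of _ R])
  show "\<forall>i zeta. coord i (R $ zeta) = T $ coord i zeta" by (simp add: R f)
  show "S = R" if "\<forall>i zeta. coord i (S $ zeta) = T $ coord i zeta" for S
   by (rule bop_eqI, rule dsum_eqI) (simp add: that R f)
 qed
 from theI'[OF this] show ?thesis unfolding amp_def by blast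
qed

lemma amp_inc [simp]: "amp T $ (inc i $ x) = inc i $ (T $ x)"
 by (rule dsum_eqI) (simp add: coord_inc)

lemma amp_simps:
 "amp (S + T) = amp S + amp T" "amp (c *\<^sub>C T) = c *\<^sub>C amp T" "amp (S oo R) = amp S oo amp R" "amp \<one> = \<one>"
 by (rule bop_eqI, rule dsum_eqI; simp)+

text \<open>After amplification a functional \<open>uwf u v\<close> is given by a single pair of
  vectors. This turns statements about normality into Hilbert space geometry.\<close>

lemma cinner_amp: "cinner zeta (amp T $ zeta') = uwf (%i. coord i zeta) (%i. coord i zeta') T"
 using infsumI[OF parseval[of zeta "amp T $ zeta'"]] unfolding uwf_def coord_amp by simp

lemma amp_adj: "amp (T\<^sup>\<star>) = (amp T)\<^sup>\<star>"
proof (rule bop_cinner_eqI)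
 fix zeta zeta'
 have "((%i. cinner (coord i zeta') (T\<^sup>\<star> $ coord i zeta)) has_sum cinner zeta' (amp (T\<^sup>\<star>) $ zeta)) UNIV"
  using parseval[of zeta' "amp (T\<^sup>\<star>) $ zeta"] by (simp only: coord_amp)
 moreover have "((%i. cinner (coord i zeta') (T\<^sup>\<star> $ coord i zeta)) has_sum cinner (amp T $ zeta') zeta) UNIV"
  using parseval[of "amp T $ zeta'" zeta] by (simp only: coord_amp cinner_adj2[of _ T])
 ultimately have "cinner zeta' (amp (T\<^sup>\<star>) $ zeta) = cinner (amp T $ zeta') zeta"
  by (rule has_sum_unique)
 then show "cinner zeta' (amp (T\<^sup>\<star>) $ zeta) = cinner zeta' ((amp T)\<^sup>\<star> $ zeta)" by simp
qed

text \<open>A functional of \<open>amp T\<close> is a double series in the coordinates; it converges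
  absolutely, so it merges into one functional \<open>uwf\<close> of \<open>T\<close> indexed by
  pairs.\<close>

lemma uw_continuous_amp: "continuous_map uw_top uw_top (amp :: ('a::complex_hilbert, 'b::complex_hilbert) bop => (('a, 'i) dsum, ('b, 'i) dsum) bop)"
 unfolding continuous_map_uw_iff
proof (intro allI impI)
 fix U :: "nat => ('b, 'i) dsum" and V :: "nat => ('a, 'i) dsum"
 assume UV: "l2fam U" "l2fam V"
 have l2: "l2fam (%(n, i). coord i (W n))" if "l2fam W" for W :: "nat => ('c::complex_hilbert, 'i) dsum"
 proof -
  have "(%(n, i). (norm (coord i (W n)))\<^sup>2) summable_on (SIGMA n:UNIV. UNIV)"
   by (rule summable_on_SigmaI[where g = "%n. (norm (W n))\<^sup>2"]) (use that parseval_norm in \<open>auto simp: l2fam_def\<close>)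
  then show ?thesis by (simp add: l2fam_def case_prod_unfold)
 qed
 have "uwf U V (amp T) = uwf (%(n, i). coord i (U n)) (%(n, i). coord i (V n)) T" for T
 proof -
  have "uwf U V (amp T) = (\<Sum>\<^sub>\<infinity>n. \<Sum>\<^sub>\<infinity>i. cinner (coord i (U n)) (T $ coord i (V n)))"
   unfolding uwf_def[of U] cinner_amp unfolding uwf_def ..
  also have "\<dots> = (\<Sum>\<^sub>\<infinity>(n, i)\<in>(SIGMA n:UNIV. UNIV). cinner (coord i (U n)) (T $ coord i (V n)))"
   by (rule infsum_Sigma'_banach)
    (use l2fam_summable[OF l2[OF UV(1)] l2fam_bop[OF l2[OF UV(2)], of T]] in \<open>simp add: case_prod_unfold\<close>)
  finally show ?thesis by (simp add: uwf_def case_prod_unfold)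
 qed
 then show "continuous_map uw_top euclidean (%T. uwf U V (amp T))"
  using uwf_continuous[OF l2[OF UV(1)] l2[OF UV(2)]] by simp
qed

section \<open>Normal homomorphisms are compressions of amplifications\<close>

definition star_algebra :: "'h::complex_hilbert operator set => bool" where
 "star_algebra A \<longleftrightarrow> csub A \<and> \<one> \<in> A \<and> (\<forall>a\<in>A. \<forall>b\<in>A. a oo b \<in> A) \<and> (\<forall>a\<in>A. a\<^sup>\<star> \<in> A)"

text \<open>The coordinates of the two vectors are merged along \<open>sum_decode\<close>. The new
  vector controls both old ones, for the same \<open>b\<close>, with a single norm.\<close>

lemma dsum_interleave:
 fixes eta1 eta2 :: "('h::complex_hilbert, nat) dsum"
 obtains eta :: "('h, nat) dsum" where "!!b :: 'h operator. (norm (amp b $ eta))\<^sup>2 = (norm (amp b $ eta1))\<^sup>2 + (norm (amp b $ eta2))\<^sup>2"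
proof -
 define v where "v s = (case s of Inl k => coord k eta1 | Inr k => coord k eta2)" for s :: "nat + nat"
 have hs: "((%n. (norm (b $ v (sum_decode n)))\<^sup>2) has_sum (norm (amp b $ eta1))\<^sup>2 + (norm (amp b $ eta2))\<^sup>2) UNIV"
  for b :: "'h operator"
 proof -
  have 1: "((%s. (norm (b $ v s))\<^sup>2) has_sum (norm (amp b $ eta1))\<^sup>2) (range Inl)"
   by (subst has_sum_reindex) (use parseval_norm[of "amp b $ eta1"] in \<open>auto simp: v_def o_def\<close>)
  have 2: "((%s. (norm (b $ v s))\<^sup>2) has_sum (norm (amp b $ eta2))\<^sup>2) (range Inr)"
   by (subst has_sum_reindex) (use parseval_norm[of "amp b $ eta2"] in \<open>auto simp: v_def o_def\<close>)
  have "((%s. (norm (b $ v s))\<^sup>2) has_sum (norm (amp b $ eta1))\<^sup>2 + (norm (amp b $ eta2))\<^sup>2) UNIV"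
   using has_sum_Un_disjoint[OF 1 2] by (auto simp: UNIV_sum)
  then show ?thesis
   using has_sum_reindex_bij_betw[OF bij_sum_decode, of "%s. (norm (b $ v s))\<^sup>2"] by blast
 qed
 have "l2fam (%n. v (sum_decode n))"
  using hs[of \<one>] unfolding l2fam_def summable_on_def by auto
 then obtain eta where eta: "!!n. coord n eta = v (sum_decode n)" using dsum_of_l2fam by blast
 have "(norm (amp b $ eta))\<^sup>2 = (norm (amp b $ eta1))\<^sup>2 + (norm (amp b $ eta2))\<^sup>2" for b :: "'h operator"
  using has_sum_unique[OF parseval_norm[of "amp b $ eta"]] hs[of b] by (simp add: eta)
 then show thesis by (rule that)
qed

text \<open>If \<open>eta1\<close> and \<open>eta2\<close> have coordinates \<open>u\<close> and
  \<open>v\<close>, then \<open>uwf u v\<close> at \<open>b\<^sup>\<star> oo b\<close> is the inner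
  product of \<open>amp b $ eta1\<close> and \<open>amp b $ eta2\<close>, small as soon as both
  vectors are. Interleaving handles these two vectors as well as finite intersections.\<close>

lemma uw_open_zero:
 fixes W :: "'h::complex_hilbert operator set"
 assumes "openin uw_top W" "0 \<in> W"
 shows "\<exists>eta :: ('h, nat) dsum. \<forall>b :: 'h operator. norm (amp b $ eta) < 1 \<longrightarrow> b\<^sup>\<star> oo b \<in> W"
proof -
 let ?B = "{{T::'h operator. uwf u v T \<in> U} | (u :: nat => 'h) (v :: nat => 'h) U. l2fam u \<and> l2fam v \<and> open U}"
 have "generate_topology_on ?B W" using assms(1) unfolding uw_top_eq openin_topology_generated_by_iff .
 then show ?thesis using assms(2)
 proof (induction rule: generate_topology_on.induct)
  case (Int W1 W2)
  then obtain eta1 eta2 :: "('h, nat) dsum" where eta: "!!b :: 'h operator. norm (amp b $ eta1) < 1 ==> b\<^sup>\<star> oo b \<in> W1"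
   "!!b :: 'h operator. norm (amp b $ eta2) < 1 ==> b\<^sup>\<star> oo b \<in> W2" by blast
  obtain eta :: "('h, nat) dsum" where *: "!!b :: 'h operator. (norm (amp b $ eta))\<^sup>2 = (norm (amp b $ eta1))\<^sup>2 + (norm (amp b $ eta2))\<^sup>2"
   by (rule dsum_interleave[of eta1 eta2]) (rule that)
  have "b\<^sup>\<star> oo b \<in> W1 \<inter> W2" if "norm (amp b $ eta) < 1" for b :: "'h operator"
  proof -
   have "(norm (amp b $ eta))\<^sup>2 < 1" using that by (simp add: power_less_one_iff abs_square_less_1)
   then have "(norm (amp b $ eta1))\<^sup>2 < 1" "(norm (amp b $ eta2))\<^sup>2 < 1"
    using *[of b] zero_le_power2[of "norm (amp b $ eta1)"] zero_le_power2[of "norm (amp b $ eta2)"] by linarith+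
   then show ?thesis using eta by (simp add: abs_square_less_1)
  qed
  then show ?case by blast
 next
  case (UN K)
  then obtain k where k: "k \<in> K" "0 \<in> k" by blast
  obtain eta :: "('h, nat) dsum" where "!!b :: 'h operator. norm (amp b $ eta) < 1 ==> b\<^sup>\<star> oo b \<in> k" using UN.IH[OF k] by blast
  then show ?case using k by blast
 next
  case (Basis W)
  then obtain u :: "nat => 'h" and v :: "nat => 'h" and U where W: "W = {T. uwf u v T \<in> U}" "l2fam u" "l2fam v" "open U" by blast
  have "uwf u v 0 = 0" by (simp add: uwf_def)
  then have "0 \<in> U" using Basis(2) W(1) by simp
  then obtain e where e: "e > 0" "ball 0 e \<subseteq> U" using W(4) openE by blast
  obtain eta1 eta2 :: "('h, nat) dsum" where eta: "!!n. coord n eta1 = u n" "!!n. coord n eta2 = v n"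
   using dsum_of_l2fam W(2,3) by metis
  obtain eta :: "('h, nat) dsum" where *: "!!b :: 'h operator. (norm (amp b $ eta))\<^sup>2 = (norm (amp b $ eta1))\<^sup>2 + (norm (amp b $ eta2))\<^sup>2"
   by (rule dsum_interleave[of eta1 eta2]) (rule that)
  \<comment> \<open>The factor \<open>1 / sqrt e\<close> converts the radius \<open>e\<close> of the
    ball inside \<open>U\<close> into the threshold \<open>1\<close>.\<close>
  have "b\<^sup>\<star> oo b \<in> W" if "norm (amp b $ (complex_of_real (1 / sqrt e) *\<^sub>C eta)) < 1" for b :: "'h operator"
  proof -
   have "norm (amp b $ eta) < sqrt e"
    using that e(1) by (simp add: norm_scaleC norm_divide divide_less_eq)
   then have "(norm (amp b $ eta))\<^sup>2 < (sqrt e)\<^sup>2" by (rule power_strict_mono) simp_all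
   then have "(norm (amp b $ eta))\<^sup>2 < e" using e(1) by simp
   moreover have "uwf u v (b\<^sup>\<star> oo b) = cinner (amp b $ eta1) (amp b $ eta2)"
   proof -
    have "cinner (amp b $ eta1) (amp b $ eta2) = cinner eta1 (amp (b\<^sup>\<star> oo b) $ eta2)" by (simp add: amp_simps amp_adj)
    then show ?thesis by (simp add: cinner_amp eta)
   qed
   moreover have "cmod (cinner (amp b $ eta1) (amp b $ eta2)) <= (norm (amp b $ eta))\<^sup>2"
    unfolding * using order.trans[OF cinner_cauchy_schwarz mult_le_sum_squares] .
   ultimately have "uwf u v (b\<^sup>\<star> oo b) \<in> ball 0 e" by simp
   then show ?thesis using e(2) W(1) by blast
  qed
  then show ?case by blast
 qed simp
qed

lemma polarization_eq:
 fixes f :: "'x => 'a::complex_hilbert" and g :: "'x => 'b::complex_hilbert"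
 assumes n: "!!s. norm (f x + s *\<^sub>C f y) = norm (g x + s *\<^sub>C g y)" and "norm (f x) = norm (g x)" "norm (f y) = norm (g y)"
 shows "cinner (f x) (f y) = cinner (g x) (g y)"
proof -
 have "Re (s * cinner (f x) (f y)) = Re (s * cinner (g x) (g y))" for s
  using cinner_add_scaled[of "f x" s "f y"] cinner_add_scaled[of "g x" s "g y"] n[of s] assms(2,3) by simp
 from this[of 1] this[of "-\<i>"] show ?thesis by (simp add: complex_eq_iff)
qed

text \<open>
 A vector functional dominated by another one is again a vector functional, on an infinite direct sum.
 With \<open>0 <= S <= 1\<close> in the commutant, the square root of \<open>S\<close> is avoided: putting
 \<open>S\<^sub>0 = S\<close> and \<open>S\<^bsub>n+1\<^esub> = S\<^sub>n - S\<^sub>n\<^sup>2\<close> gives \<open>S = \<Sum> S\<^sub>n\<^sup>2\<close>.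
\<close>

lemma positive_sum_squares:
 fixes S :: "'a::complex_hilbert operator"
 assumes "S\<^sup>\<star> = S" "!!x. 0 <= Re (cinner x (S $ x))" "!!x. Re (cinner x (S $ x)) <= (norm x)\<^sup>2"
 obtains T :: "nat => 'a operator" where "!!n R. R oo S = S oo R ==> R oo T n = T n oo R"
  "!!x. (%n. (norm (T n $ x))\<^sup>2) sums Re (cinner x (S $ x))"
proof -
 define T where "T = rec_nat S (%_ U. U - U oo U)"
 have T0: "T 0 = S" and TS: "T (Suc n) = T n - T n oo T n" for n by (simp_all add: T_def)
 have comm: "R oo T n = T n oo R" if "R oo S = S oo R" for n R
 proof (induction n)
  case (Suc n)
  have c: "R $ (T n $ x) = T n $ (R $ x)" for x using Suc by (metis bop_comp.rep_eq)
  show ?case by (rule bop_eqI) (simp add: TS c)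
 qed (use that T0 in simp)
 have sa: "(T n)\<^sup>\<star> = T n" for n by (induction n) (simp_all add: T0 TS assms(1))
 have sa': "cinner (T n $ x) y = cinner x (T n $ y)" for n x y
  using cinner_adj[of "T n" x y] by (simp only: sa)
 have step: "Re (cinner x (T (Suc n) $ x)) = Re (cinner x (T n $ x)) - (norm (T n $ x))\<^sup>2" for n x
  by (simp add: TS cinner_diff_right norm_sq_Re sa')
 have pos: "0 <= Re (cinner x (T n $ x)) \<and> Re (cinner x (T n $ x)) <= (norm x)\<^sup>2" for n x
 proof (induction n arbitrary: x)
  case 0 then show ?case by (simp add: T0 assms)
 next
  case (Suc n)
  let ?y = "x - T n $ x" and ?z = "T n $ x"
  \<comment> \<open>With \<open>U = T n\<close>, the next iterate \<open>U - U U\<close> equals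
    \<open>(1 - U) U (1 - U) + U (1 - U) U\<close>; both terms are positive when \<open>U\<close>
    lies between 0 and 1.\<close>
  have "Re (cinner x (T (Suc n) $ x)) = Re (cinner ?y (T n $ ?y)) + ((norm ?z)\<^sup>2 - Re (cinner ?z (T n $ ?z)))"
   by (simp add: TS cinner_diff_right cinner_diff_left norm_sq_Re sa')
  then have "0 <= Re (cinner x (T (Suc n) $ x))" using Suc[of ?y] Suc[of ?z] by linarith
  moreover have "Re (cinner x (T (Suc n) $ x)) <= (norm x)\<^sup>2"
   using step[of x n] Suc[of x] zero_le_power2[of "norm (T n $ x)"] by linarith
  ultimately show ?case by simp
 qed
 have part: "(\<Sum>n<N. (norm (T n $ x))\<^sup>2) = Re (cinner x (S $ x)) - Re (cinner x (T N $ x))" for N x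
  by (induction N) (simp_all add: T0 step)
 have sums: "(%n. (norm (T n $ x))\<^sup>2) sums Re (cinner x (S $ x))" for x
 proof -
  \<comment> \<open>The partial sums telescope, with remainder \<open>cinner x (T N $ x)\<close>.
    Boundedness of the sums forces \<open>T n $ x\<close> to 0, and with it the remainder.\<close>
  have "summable (%n. (norm (T n $ x))\<^sup>2)"
   by (rule summableI_nonneg_bounded[where x = "Re (cinner x (S $ x))"]) (use part[of x] pos in auto)
  then have "(%n. (norm (T n $ x))\<^sup>2) \<longlonglongrightarrow> 0" by (rule summable_LIMSEQ_zero)
  then have "(%n. norm (T n $ x)) \<longlonglongrightarrow> 0"
   using tendsto_real_sqrt by fastforce
  then have "(%n. T n $ x) \<longlonglongrightarrow> 0" by (rule tendsto_norm_zero_cancel)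
  then have "(%n. Re (cinner x (T n $ x))) \<longlonglongrightarrow> Re (cinner x 0)" by (intro tendsto_intros)
  then have "(%N. \<Sum>n<N. (norm (T n $ x))\<^sup>2) \<longlonglongrightarrow> Re (cinner x (S $ x)) - 0"
   unfolding part by (intro tendsto_intros) simp
  then show ?thesis unfolding sums_def by simp
 qed
 show thesis
 proof (rule that[of T])
  show "R oo T n = T n oo R" if "R oo S = S oo R" for n R by (rule comm[OF that])
 qed (rule sums)
qed

locale normal_hom =
 fixes A :: "'h::complex_hilbert operator set" and j :: "'h operator => 'g::complex_hilbert operator"
 assumes algebra: "star_algebra A" and hom: "star_hom_on A j" and normal: "normal_map_on A j" and unital: "j \<one> = \<one>"
begin

lemma j_simps:
 "a \<in> A ==> b \<in> A ==> j (a + b) = j a + j b" "a \<in> A ==> j (c *\<^sub>C a) = c *\<^sub>C j a"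
 "a \<in> A ==> b \<in> A ==> j (a oo b) = j a oo j b" "a \<in> A ==> j (a\<^sup>\<star>) = (j a)\<^sup>\<star>"
 using hom unfolding star_hom_on_def linear_map_on_def by blast+

lemma A_simps:
 "a \<in> A ==> b \<in> A ==> a + b \<in> A" "a \<in> A ==> c *\<^sub>C a \<in> A" "a \<in> A ==> b \<in> A ==> a oo b \<in> A"
 "a \<in> A ==> a\<^sup>\<star> \<in> A" "\<one> \<in> A" "0 \<in> A"
 using algebra unfolding star_algebra_def csub_def by blast+

text \<open>Normality gives an ultraweak neighbourhood of 0 on which the vector state of
  \<open>x\<close> stays below 1. By \<open>uw_open_zero\<close> it contains
  \<open>b\<^sup>\<star> oo b\<close> whenever \<open>amp b $ eta\<close> is short; scaling
  \<open>b\<close> so that \<open>j b $ x\<close> has norm 1 yields the inequality.\<close>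

lemma dominating_vector: "\<exists>eta :: ('h, nat) dsum. \<forall>b\<in>A. norm (j b $ x) <= norm (amp b $ eta)"
proof -
 let ?V = "{a \<in> A. cinner x (j a $ x) \<in> ball 0 1}"
 have "continuous_map (subtopology uw_top A) euclidean (%a. cinner x (j a $ x))"
  using continuous_map_compose[OF normal[unfolded normal_map_on_def] cinner_uw_continuous[of x x]] by (simp add: o_def)
 then have "openin (subtopology uw_top A) {a \<in> topspace (subtopology uw_top A). cinner x (j a $ x) \<in> ball 0 1}"
  by (rule openin_continuous_map_preimage) simp
 then have "openin (subtopology uw_top A) ?V" by simp
 then obtain W where W: "openin uw_top W" "?V = W \<inter> A" unfolding openin_subtopology by blast
 have "j 0 = 0" using j_simps(2)[of 0 0] A_simps by simp
 then have "0 \<in> ?V" using A_simps by simp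
 then have "0 \<in> W" using W by blast
 then obtain eta :: "('h, nat) dsum" where eta: "!!b :: 'h operator. norm (amp b $ eta) < 1 ==> b\<^sup>\<star> oo b \<in> W"
  using uw_open_zero[OF W(1)] by blast
 have "norm (j b $ x) <= norm (amp b $ eta)" if "b \<in> A" for b
 proof (rule ccontr)
  assume "\<not> norm (j b $ x) <= norm (amp b $ eta)"
  then have l: "norm (amp b $ eta) < norm (j b $ x)" by simp
  then have p: "0 < norm (j b $ x)" using norm_ge_zero order.strict_trans1 by blast
  let ?s = "complex_of_real (1 / norm (j b $ x))"
  let ?b = "?s *\<^sub>C b"
  have "norm (amp ?b $ eta) < 1" using l p by (simp add: amp_simps norm_scaleC norm_divide)
  then have "?b\<^sup>\<star> oo ?b \<in> W" by (rule eta)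
  moreover have "?b\<^sup>\<star> oo ?b \<in> A" by (intro A_simps that)
  ultimately have "?b\<^sup>\<star> oo ?b \<in> ?V" unfolding W(2) by simp
  then have "cmod (cinner x (j (?b\<^sup>\<star> oo ?b) $ x)) < 1" by simp
  moreover have "j (?b\<^sup>\<star> oo ?b) = (j ?b)\<^sup>\<star> oo j ?b"
   by (simp only: j_simps A_simps that)
  moreover have "norm (j ?b $ x) = 1" using p that by (simp add: j_simps norm_scaleC norm_divide)
  ultimately show False by (simp add: cinner_self norm_power)
 qed
 then show ?thesis by blast
qed

text \<open>By domination \<open>amp b $ eta\<close> is sent to \<open>j b $ x\<close> by a
  contraction \<open>R\<close> intertwining the two actions, so
  \<open>S = R\<^sup>\<star> oo R\<close> commutes with all \<open>amp a\<close>. Expanding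
  \<open>S\<close> as a sum of squares \<open>T n\<close> in the commutant turns the norm of
  \<open>j b $ x\<close> into the square sum of the norms of \<open>amp b $ (T n $ eta)\<close>,
  which all fit into one direct sum.\<close>

lemma vector_state: "\<exists>zeta :: ('h, nat) dsum. \<forall>b\<in>A. norm (amp b $ zeta) = norm (j b $ x)"
proof -
 obtain eta :: "('h, nat) dsum" where eta: "!!b. b \<in> A ==> norm (j b $ x) <= norm (amp b $ eta)" using dominating_vector by blast
 let ?G = "(%b. (amp b $ eta, j b $ x)) ` A"
 have "\<exists>R :: (('h, nat) dsum, 'g) bop. (\<forall>b\<in>A. R $ (amp b $ eta) = j b $ x) \<and>
   (\<forall>y. (\<forall>b\<in>A. cinner (amp b $ eta) y = 0) \<longrightarrow> R $ y = 0) \<and> (\<forall>y. norm (R $ y) <= norm y)"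
 proof (rule graph_extension[of ?G 1])
  show "p + q \<in> ?G" if "p \<in> ?G" "q \<in> ?G" for p q
  proof -
   obtain b c where bc: "b \<in> A" "c \<in> A" "p = (amp b $ eta, j b $ x)" "q = (amp c $ eta, j c $ x)" using \<open>p \<in> ?G\<close> \<open>q \<in> ?G\<close> by blast
   have "p + q = (amp (b + c) $ eta, j (b + c) $ x)" using bc by (simp add: amp_simps j_simps)
   then show ?thesis using A_simps(1)[OF bc(1,2)] by blast
  qed
  show "c *\<^sub>C p \<in> ?G" if "p \<in> ?G" for c p
  proof -
   obtain b where b: "b \<in> A" "p = (amp b $ eta, j b $ x)" using \<open>p \<in> ?G\<close> by blast
   have "c *\<^sub>C p = (amp (c *\<^sub>C b) $ eta, j (c *\<^sub>C b) $ x)" using b by (simp add: amp_simps j_simps scaleC_prod_def)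
   then show ?thesis using A_simps(2)[OF b(1)] by blast
  qed
  show "?G \<noteq> {}" using A_simps by blast
  show "norm w <= 1 * norm v" if "(v, w) \<in> ?G" for v w using that eta by auto
  show "(0::real) <= 1" by simp
 next
  fix R :: "(('h, nat) dsum, 'g) bop"
  assume R: "!!v w. (v, w) \<in> ?G ==> R $ v = w" "!!y. (!!v w. (v, w) \<in> ?G ==> cinner v y = 0) ==> R $ y = 0"
   "!!x. norm (R $ x) <= 1 * norm x"
  have "\<forall>b\<in>A. R $ (amp b $ eta) = j b $ x" using R(1) by blast
  moreover have "R $ y = 0" if "\<forall>b\<in>A. cinner (amp b $ eta) y = 0" for y by (rule R(2)) (use that in auto)
  ultimately show ?thesis using R(3) by (intro exI[of _ R]) simp
 qed
 then obtain R :: "(('h, nat) dsum, 'g) bop" where R1: "!!b. b \<in> A ==> R $ (amp b $ eta) = j b $ x"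
  and R2: "!!y. (!!b. b \<in> A ==> cinner (amp b $ eta) y = 0) ==> R $ y = 0" and R3: "!!y. norm (R $ y) <= norm y"
  by blast
 let ?D = "{amp b $ eta | b. b \<in> A}"
 \<comment> \<open>Intertwining is checked on the cyclic vectors and, separately, on their
   orthogonal complement, which is invariant and on which \<open>R\<close> vanishes.\<close>
 have tot: "ctotal (?D \<union> {y. \<forall>z\<in>?D. cinner z y = 0})"
  unfolding ctotal_def
 proof (intro allI impI)
  fix y assume y: "\<forall>z\<in>?D \<union> {y. \<forall>z\<in>?D. cinner z y = 0}. cinner z y = 0"
  then have "y \<in> {y. \<forall>z\<in>?D. cinner z y = 0}" by simp
  then have "cinner y y = 0" using y by blast
  then show "y = 0" by (simp add: cinner_self)
 qed
 have RA: "R oo amp a = j a oo R" if "a \<in> A" for a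
 proof (rule total_bop_eqI[OF tot])
  fix y assume "y \<in> ?D \<union> {y. \<forall>z\<in>?D. cinner z y = 0}"
  then consider b where "b \<in> A" "y = amp b $ eta" | "!!b. b \<in> A ==> cinner (amp b $ eta) y = 0" by blast
  then show "(R oo amp a) $ y = (j a oo R) $ y"
  proof cases
   case 1
   then have "(R oo amp a) $ y = R $ (amp (a oo b) $ eta)" by (simp add: amp_simps)
   also have "\<dots> = j (a oo b) $ x" using 1 that by (intro R1 A_simps)
   finally show ?thesis using 1 that by (simp add: j_simps R1)
  next
   case 2
   have "R $ (amp a $ y) = 0"
   proof (rule R2)
    fix b assume "b \<in> A"
    have "cinner (amp b $ eta) (amp a $ y) = cinner (amp (a\<^sup>\<star> oo b) $ eta) y" by (simp add: amp_simps amp_adj)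
    also have "\<dots> = 0" using \<open>b \<in> A\<close> that by (intro 2 A_simps)
    finally show "cinner (amp b $ eta) (amp a $ y) = 0" .
   qed
   then show ?thesis using R2[OF 2] by simp
  qed
 qed
 define S where "S = R\<^sup>\<star> oo R"
 have SA: "amp a oo S = S oo amp a" if "a \<in> A" for a
 proof -
  have "R\<^sup>\<star> oo j a = amp a oo R\<^sup>\<star>"
   using arg_cong[OF RA[OF A_simps(4)[OF that]], of adj] that by (simp add: j_simps amp_adj)
  then have "S oo amp a = (amp a oo R\<^sup>\<star>) oo R" unfolding S_def comp_assoc RA[OF that] by (simp flip: comp_assoc)
  then show ?thesis by (simp add: S_def comp_assoc)
 qed
 have S: "Re (cinner y (S $ y)) = (norm (R $ y))\<^sup>2" for y by (simp add: S_def norm_sq_Re)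
 obtain T :: "nat => ('h, nat) dsum operator" where T1: "!!n Q. Q oo S = S oo Q ==> Q oo T n = T n oo Q"
  and T2: "!!y. (%n. (norm (T n $ y))\<^sup>2) sums Re (cinner y (S $ y))"
 proof (rule positive_sum_squares[of S])
  show "S\<^sup>\<star> = S" by (simp add: S_def)
  show "Re (cinner y (S $ y)) <= (norm y)\<^sup>2" for y unfolding S by (intro power_mono R3) simp
 qed (auto simp: S)
 \<comment> \<open>All coordinates of all vectors \<open>T n $ eta\<close>, to be numbered by
   \<open>prod_decode\<close>.\<close>
 define w where "w = (%(n, m). coord m (T n $ eta))"
 have hs: "((%k. (norm (b $ w (prod_decode k)))\<^sup>2) has_sum (norm (j b $ x))\<^sup>2) UNIV" if "b \<in> A" for b
 proof -
  have c: "T n $ (amp b $ eta) = amp b $ (T n $ eta)" for n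
   using T1[OF SA[OF that], of n] by (metis bop_comp.rep_eq)
  have "(%n. (norm (amp b $ (T n $ eta)))\<^sup>2) sums (norm (j b $ x))\<^sup>2"
   using T2[of "amp b $ eta"] by (simp add: S R1 that c)
  then have out: "((%n. (norm (amp b $ (T n $ eta)))\<^sup>2) has_sum (norm (j b $ x))\<^sup>2) UNIV"
   by (rule sums_nonneg_imp_has_sum) simp
  have inn: "((%m. (norm (b $ w (n, m)))\<^sup>2) has_sum (norm (amp b $ (T n $ eta)))\<^sup>2) UNIV" for n
   using parseval_norm[of "amp b $ (T n $ eta)"] by (simp add: w_def)
  have "((%p. (norm (b $ w p))\<^sup>2) has_sum (norm (j b $ x))\<^sup>2) (SIGMA n:UNIV. UNIV)"
   by (rule has_sum_SigmaI[OF inn out summable_on_SigmaI[OF inn]]) (use out in \<open>auto simp: summable_on_def\<close>)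
  then have "((%p. (norm (b $ w p))\<^sup>2) has_sum (norm (j b $ x))\<^sup>2) UNIV" by simp
  then show ?thesis
   using has_sum_reindex_bij_betw[OF bij_prod_decode, of "%p. (norm (b $ w p))\<^sup>2"] by blast
 qed
 have "l2fam (%k. w (prod_decode k))"
  using hs[OF A_simps(5)] unfolding l2fam_def summable_on_def by auto
 then obtain zeta where zeta: "!!k. coord k zeta = w (prod_decode k)" using dsum_of_l2fam by blast
 have "(norm (amp b $ zeta))\<^sup>2 = (norm (j b $ x))\<^sup>2" if "b \<in> A" for b
  using has_sum_unique[OF parseval_norm[of "amp b $ zeta"]] hs[OF that] by (simp add: zeta)
 then show ?thesis by (intro exI[of _ zeta]) simp
qed

lemma vector_state_cinner:
 assumes "!!b. b \<in> A ==> norm (amp b $ zeta) = norm (j b $ x)" "b \<in> A" "c \<in> A"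
 shows "cinner (amp b $ zeta) (amp c $ zeta) = cinner (j b $ x) (j c $ x)"
proof (rule polarization_eq[where f = "%b. amp b $ zeta" and g = "%b. j b $ x"])
 fix s
 have "norm (amp (b + s *\<^sub>C c) $ zeta) = norm (j (b + s *\<^sub>C c) $ x)" by (intro assms(1) A_simps assms(2,3))
 then show "norm (amp b $ zeta + s *\<^sub>C amp c $ zeta) = norm (j b $ x + s *\<^sub>C j c $ x)"
  using assms(2,3) by (simp add: amp_simps j_simps A_simps)
qed (use assms in auto)

text \<open>Zorn's lemma for sets of vectors generating mutually orthogonal cyclic subspaces. A
  vector orthogonal to all of them could be added to a maximal set, so it belongs to it and is
  orthogonal to itself.\<close>

lemma cyclic_decomposition:
 obtains X where "!!x y b c. x \<in> X ==> y \<in> X ==> x \<noteq> y ==> b \<in> A ==> c \<in> A ==> cinner (j b $ x) (j c $ y) = 0"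
  "ctotal ((%(b, x). j b $ x) ` (A \<times> X))"
proof -
 define F where "F = {X. \<forall>x\<in>X. \<forall>y\<in>X. x \<noteq> y \<longrightarrow> (\<forall>b\<in>A. \<forall>c\<in>A. cinner (j b $ x) (j c $ y) = 0)}"
 have "\<exists>M\<in>F. \<forall>X\<in>F. M \<subseteq> X \<longrightarrow> X = M"
 proof (rule subset_Zorn')
  fix C assume "subset.chain F C"
  then have C: "C \<subseteq> F" "!!X Y. X \<in> C ==> Y \<in> C ==> X \<subseteq> Y \<or> Y \<subseteq> X" unfolding subset_chain_def by (blast, metis)
  show "\<Union> C \<in> F"
   unfolding F_def
  proof (rule CollectI, intro ballI impI)
   fix x y b c assume "x \<in> \<Union> C" "y \<in> \<Union> C" "x \<noteq> y" "b \<in> A" "c \<in> A"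
   then obtain X where "X \<in> C" "x \<in> X" "y \<in> X" using C(2) by blast
   then show "cinner (j b $ x) (j c $ y) = 0" using C(1) unfolding F_def using \<open>x \<noteq> y\<close> \<open>b \<in> A\<close> \<open>c \<in> A\<close> by blast
  qed
 qed
 then obtain M where M: "M \<in> F" "!!X. X \<in> F ==> M \<subseteq> X ==> X = M" by metis
 have "ctotal ((%(b, x). j b $ x) ` (A \<times> M))"
  unfolding ctotal_def
 proof (intro allI impI)
  fix y assume "\<forall>z\<in>(%(b, x). j b $ x) ` (A \<times> M). cinner z y = 0"
  then have y: "cinner (j b $ x) y = 0" if "b \<in> A" "x \<in> M" for b x using that by auto
  have yc: "cinner (j b $ x) (j c $ y) = 0" if "b \<in> A" "c \<in> A" "x \<in> M" for b c x
  proof -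
   have "cinner (j b $ x) (j c $ y) = cinner (j (c\<^sup>\<star> oo b) $ x) y" using that by (simp add: j_simps A_simps)
   also have "\<dots> = 0" using that by (intro y A_simps)
   finally show ?thesis .
  qed
  have yc': "cinner (j c $ y) (j b $ x) = 0" if "b \<in> A" "c \<in> A" "x \<in> M" for b c x
   using yc[OF that] cinner_commute[of "j c $ y" "j b $ x"] by simp
  have "insert y M \<in> F" using M(1) yc yc' unfolding F_def by auto
  then have "insert y M = M" by (rule M(2)) blast
  then have "y \<in> M" by blast
  then have "cinner (j \<one> $ y) y = 0" by (intro y A_simps)
  then show "y = 0" by (simp add: unital cinner_self)
 qed
 moreover have "cinner (j b $ x) (j c $ y) = 0" if "x \<in> M" "y \<in> M" "x \<noteq> y" "b \<in> A" "c \<in> A" for x y b c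
  using M(1) that unfolding F_def by blast
 ultimately show thesis by (rule that[rotated])
qed

text \<open>Each cyclic subspace is carried isometrically, through its vector state
  \<open>zeta x\<close>, into a block of countably many copies of \<open>'h\<close>. The blocks are
  labelled by the generating vectors \<open>x\<close> themselves, which explains the index type
  \<open>'g \<times> nat\<close>.\<close>

theorem dilation: "\<exists>W :: ('g, ('h, 'g \<times> nat) dsum) bop. W\<^sup>\<star> oo W = \<one> \<and> (\<forall>a\<in>A. W oo j a = amp a oo W)"
proof -
 obtain X where orth: "!!x y b c. x \<in> X ==> y \<in> X ==> x \<noteq> y ==> b \<in> A ==> c \<in> A ==> cinner (j b $ x) (j c $ y) = 0"
  and tot: "ctotal ((%(b, x). j b $ x) ` (A \<times> X))" using cyclic_decomposition by blast
 obtain zeta :: "'g => ('h, nat) dsum" where zeta: "!!x b. b \<in> A ==> norm (amp b $ zeta x) = norm (j b $ x)"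
  using vector_state by metis
 have "\<exists>E :: (('h, nat) dsum, ('h, 'g \<times> nat) dsum) bop. \<forall>k z. E $ (inc k $ z) = inc (x, k) $ z" for x :: 'g
 proof (rule isometric_extension[of UNIV "%(k, z). inc (x, k) $ z" "%(k, z::'h). inc k $ z"])
  fix E :: "(('h, nat) dsum, ('h, 'g \<times> nat) dsum) bop"
  assume "!!i. i \<in> UNIV ==> E $ (case i of (k, z) => inc k $ z) = (case i of (k, z) => inc (x, k) $ z)"
  then have "E $ (inc k $ z) = inc (x, k) $ z" for k z by (metis UNIV_I case_prod_conv)
  then show ?thesis by blast
 qed (auto simp: cinner_inc)
 then obtain E :: "'g => (('h, nat) dsum, ('h, 'g \<times> nat) dsum) bop" where E: "!!x k z. E x $ (inc k $ z) = inc (x, k) $ z" by metis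
 have EE: "(E x)\<^sup>\<star> oo E y = (if x = y then \<one> else 0)" for x y
  by (rule total_bop_cinner_eqI[OF total_inc total_inc]) (auto simp: E cinner_inc)
 have cEE: "cinner (E x $ alpha) (E y $ beta) = (if x = y then cinner alpha beta else 0)" for x y alpha beta
 proof -
  have "cinner (E x $ alpha) (E y $ beta) = cinner alpha (((E x)\<^sup>\<star> oo E y) $ beta)" by simp
  then show ?thesis unfolding EE by simp
 qed
 have EA: "amp b oo E x = E x oo amp b" for b x
  by (rule total_bop_eqI[OF total_inc]) (auto simp: E)
 let ?phi = "%(b, x). j b $ x" and ?psi = "%(b, x). E x $ (amp b $ zeta x)"
 have gram: "cinner (?psi p) (?psi q) = cinner (?phi p) (?phi q)" if "p \<in> A \<times> X" "q \<in> A \<times> X" for p q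
  using that by (auto simp: cEE orth vector_state_cinner[OF zeta])
 obtain W where W: "!!p. p \<in> A \<times> X ==> W $ ?phi p = ?psi p" "W\<^sup>\<star> oo W = \<one>"
  by (rule isometric_extension[of "A \<times> X" ?psi ?phi, OF gram]) (auto intro: that tot)
 have "W oo j a = amp a oo W" if "a \<in> A" for a
 proof (rule total_bop_eqI[OF tot])
  fix y assume "y \<in> ?phi ` (A \<times> X)"
  then obtain b x where bx: "b \<in> A" "x \<in> X" and y: "y = j b $ x" by auto
  have "W $ (j (a oo b) $ x) = E x $ (amp (a oo b) $ zeta x)" using W(1)[of "(a oo b, x)"] bx that A_simps by simp
  moreover have "W $ (j b $ x) = E x $ (amp b $ zeta x)" using W(1)[of "(b, x)"] bx by simp
  moreover have "amp a $ (E x $ z) = E x $ (amp a $ z)" for z using EA[of a x] by (metis bop_comp.rep_eq)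
  ultimately show "(W oo j a) $ y = (amp a oo W) $ y" using bx that by (simp add: y j_simps amp_simps)
 qed
 then show ?thesis using W(2) by blast
qed

end

section \<open>Exponential vectors\<close>

abbreviation symt :: "'a::complex_hilbert list => 'a fock" where
 "symt xs \<equiv> kvec (Symmetric_Tensor xs)"

lemma cinner_symt:
 "cinner (symt xs) (symt ys) = (if length xs = length ys
   then (\<Sum>p | p permutes {..<length xs}. \<Prod>i<length xs. cinner (xs ! i) (ys ! p i)) / fact (length xs) else 0)"
 by (simp add: cinner_kvec)

lemma fock_eqI:
 assumes "!!zs. cinner phi (symt zs) = cinner psi (symt zs)"
 shows "phi = psi"
proof (rule khilb_eqI)
 fix p :: "'a symmetric_tensor"
 obtain zs where "p = Symmetric_Tensor zs" by (cases p)
 then show "cinner (kvec p) phi = cinner (kvec p) psi"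
  using assms[of zs] cinner_commute[of "kvec p" phi] cinner_commute[of "kvec p" psi] by simp
qed

lemma cinner_symt_Cons:
 "cinner (symt (x # xs)) (symt zs) = (if length zs = Suc (length xs)
   then (\<Sum>p | p permutes {..<length zs}. cinner x (zs ! p 0) * (\<Prod>i<length xs. cinner (xs ! i) (zs ! p (Suc i)))) / fact (length zs) else 0)"
 by (simp add: cinner_symt prod.lessThan_Suc_shift del: prod.lessThan_Suc)

lemma symt_Cons_linear:
 "symt ((x + y) # xs) = symt (x # xs) + symt (y # xs)" "symt ((c *\<^sub>C x) # xs) = c *\<^sub>C symt (x # xs)"
 by (rule fock_eqI; simp add: cinner_add_left cinner_scaleC_left cinner_symt_Cons distrib_right sum.distrib add_divide_distrib sum_distrib_left mult.assoc)+

lemma symt_permute: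
 assumes "mset xs = mset ys"
 shows "symt xs = symt ys"
proof (rule fock_eqI)
 fix zs
 obtain q where q: "q permutes {..<length ys}" "permute_list q ys = xs"
  using mset_eq_permutation[OF assms] by blast
 have len: "length xs = length ys" using assms by (rule mset_eq_length)
 show "cinner (symt xs) (symt zs) = cinner (symt ys) (symt zs)"
 proof (cases "length ys = length zs")
  case True
  have "xs ! i = ys ! q i" if "i < length ys" for i
   using permute_list_nth[OF q(1) that] q(2) by simp
  then show ?thesis
   using permanent_shift[OF q(1), of "%i. ys ! i" "%i. zs ! i"] True len by (simp add: cinner_symt)
 qed (simp add: cinner_symt len)
qed

lemma norm_symt_le: "norm (symt xs) <= (\<Prod>i<length xs. norm (xs ! i))"
proof -
 let ?n = "length xs"
 let ?P = "{p. p permutes {..<?n}}"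
 have "cmod (cinner (symt xs) (symt xs)) <= (\<Prod>i<?n. norm (xs ! i))\<^sup>2"
 proof -
  have "cmod (\<Prod>i<?n. cinner (xs ! i) (xs ! p i)) <= (\<Prod>i<?n. norm (xs ! i))\<^sup>2" if "p \<in> ?P" for p
  proof -
   have "cmod (\<Prod>i<?n. cinner (xs ! i) (xs ! p i)) <= (\<Prod>i<?n. norm (xs ! i) * norm (xs ! p i))"
    unfolding prod_norm[symmetric] by (intro prod_mono) (auto simp: cinner_cauchy_schwarz)
   also have "(\<Prod>i<?n. norm (xs ! p i)) = (\<Prod>i<?n. norm (xs ! i))"
    using prod.permute[of p "{..<?n}" "%i. norm (xs ! i)"] that by (simp add: o_def)
   then have "(\<Prod>i<?n. norm (xs ! i) * norm (xs ! p i)) = (\<Prod>i<?n. norm (xs ! i))\<^sup>2"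
    by (simp add: prod.distrib power2_eq_square)
   finally show ?thesis .
  qed
  then have "cmod (\<Sum>p\<in>?P. \<Prod>i<?n. cinner (xs ! i) (xs ! p i)) <= (\<Sum>p\<in>?P. (\<Prod>i<?n. norm (xs ! i))\<^sup>2)"
   by (rule sum_norm_le)
  also have "\<dots> = fact ?n * (\<Prod>i<?n. norm (xs ! i))\<^sup>2"
   by (simp add: card_permutations[of "{..<?n}" ?n])
  finally show ?thesis by (simp add: cinner_symt norm_divide divide_le_eq mult.commute)
 qed
 then have "(norm (symt xs))\<^sup>2 <= (\<Prod>i<?n. norm (xs ! i))\<^sup>2"
  by (simp add: cinner_self norm_power)
 then show ?thesis by (rule power2_le_imp_le) (simp add: prod_nonneg)
qed

lemma cinner_sym_power: "cinner (sym_power n x) (sym_power m y) = (if n = m then cinner x y ^ n else 0)"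
proof -
 have "(\<Sum>p | p permutes {..<n}. \<Prod>i<n. cinner (replicate n x ! i) (replicate n y ! p i)) = (\<Sum>p | p permutes {..<n}. cinner x y ^ n)"
 proof (intro sum.cong refl)
  fix p assume "p \<in> {p. p permutes {..<n}}"
  then have "p i < n" if "i < n" for i using permutes_in_image[of p "{..<n}" i] that by simp
  then show "(\<Prod>i<n. cinner (replicate n x ! i) (replicate n y ! p i)) = cinner x y ^ n" by simp
 qed
 also have "\<dots> = fact n * cinner x y ^ n" by (simp add: card_permutations[of "{..<n}" n])
 finally have "cinner (sym_power n x) (sym_power n y) = cinner x y ^ n" unfolding sym_power_def cinner_symt by simp
 moreover have "cinner (sym_power n x) (sym_power m y) = 0" if "n \<noteq> m"
  using that by (simp add: sym_power_def cinner_symt)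
 ultimately show ?thesis by (cases "n = m") auto
qed

lemma norm_sym_power: "norm (sym_power n x) = norm x ^ n"
proof -
 have "complex_of_real ((norm (sym_power n x))\<^sup>2) = complex_of_real ((norm x ^ n)\<^sup>2)"
  unfolding cinner_self[symmetric, of "sym_power n x"] cinner_sym_power
  by (simp add: cinner_self[of x] power_mult[symmetric] mult.commute)
 then have "(norm (sym_power n x))\<^sup>2 = (norm x ^ n)\<^sup>2" by (simp only: of_real_eq_iff)
 then show ?thesis by (rule power2_eq_imp_eq) simp_all
qed

definition expv :: "'a::complex_hilbert => 'a fock" where
 "expv x = (\<Sum>n. (1 / sqrt (fact n)) *\<^sub>R sym_power n x)"

text \<open>A square root of a factorial is awkward to sum; splitting off \<open>(1/2) ^ n\<close>
  and using \<open>a b \<le> a\<^sup>2 + b\<^sup>2\<close> dominates the norms by a geometric plus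
  an exponential series.\<close>

lemma expv_sums: "(%n. (1 / sqrt (fact n)) *\<^sub>R sym_power n x) sums expv x"
proof -
 have "summable (%n. norm ((1 / sqrt (fact n)) *\<^sub>R sym_power n x))"
 proof (rule summable_comparison_test'[where N = 0])
  have "summable (%n. (1/4::real) ^ n)" by (rule summable_geometric) simp
  moreover have "summable (%n. (4 * (norm x)\<^sup>2) ^ n / fact n)" using summable_exp_generic[of "4 * (norm x)\<^sup>2"] by (simp add: divide_inverse mult.commute)
  ultimately show "summable (%n. (1/4) ^ n + (4 * (norm x)\<^sup>2) ^ n / fact n)" by (rule summable_add)
  fix n :: nat
  have "norm x ^ n / sqrt (fact n) = (1/2) ^ n * ((2 * norm x) ^ n / sqrt (fact n))"
   by (simp add: power_mult_distrib power_divide)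
  also have "\<dots> <= ((1/2) ^ n)\<^sup>2 + ((2 * norm x) ^ n / sqrt (fact n))\<^sup>2" by (rule mult_le_sum_squares)
  also have "\<dots> = (1/4) ^ n + (4 * (norm x)\<^sup>2) ^ n / fact n"
   by (simp add: power_divide power_mult_distrib power_mult[symmetric] mult.commute[of n 2]) (simp add: power_mult)
  finally show "norm (norm ((1 / sqrt (fact n)) *\<^sub>R sym_power n x)) <= (1/4) ^ n + (4 * (norm x)\<^sup>2) ^ n / fact n"
   by (simp add: norm_sym_power)
 qed
 then show ?thesis unfolding expv_def by (rule summable_sums[OF summable_norm_cancel])
qed

lemma cinner_sums_right: "f sums s ==> (%n. cinner x (f n)) sums cinner x (s :: 'a::complex_hilbert)"
 by (rule bounded_linear.sums[OF bounded_bilinear.bounded_linear_right[OF bounded_bilinear_cinner]])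

lemma cinner_sums_left: "f sums s ==> (%n. cinner (f n) x) sums cinner (s :: 'a::complex_hilbert) x"
 by (rule bounded_linear.sums[OF bounded_bilinear.bounded_linear_left[OF bounded_bilinear_cinner]])

lemma cinner_sym_power_expv: "cinner (sym_power n x) (expv y) = cinner x y ^ n / sqrt (fact n)"
proof -
 have s: "(%m. cinner (sym_power n x) ((1 / sqrt (fact m)) *\<^sub>R sym_power m y)) sums cinner (sym_power n x) (expv y)"
  by (rule cinner_sums_right[OF expv_sums])
 have "(%m. cinner (sym_power n x) ((1 / sqrt (fact m)) *\<^sub>R sym_power m y))
   = (%m. if m = n then cinner x y ^ n / sqrt (fact n) else 0)"
  by (auto simp: scaleR_scaleC cinner_scaleC_right cinner_sym_power)
 then show ?thesis using sums_unique2[OF s] sums_single[of n "%_. cinner x y ^ n / sqrt (fact n)"] by simp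
qed

lemma cinner_expv: "cinner (expv x) (expv y) = exp (cinner x y)"
proof -
 have s: "(%n. cinner ((1 / sqrt (fact n)) *\<^sub>R sym_power n x) (expv y)) sums cinner (expv x) (expv y)"
  by (rule cinner_sums_left[OF expv_sums])
 have "cinner ((1 / sqrt (fact n)) *\<^sub>R sym_power n x) (expv y) = cinner x y ^ n /\<^sub>R fact n" for n
 proof -
  have "complex_of_real (sqrt (fact n)) * complex_of_real (sqrt (fact n)) = fact n"
   by (simp flip: of_real_mult)
  then show ?thesis
   by (simp add: scaleR_scaleC cinner_scaleC_left cinner_sym_power_expv scaleC_complex_def divide_inverse mult_ac flip: inverse_mult_distrib)
 qed
 then show ?thesis using sums_unique2[OF s] exp_converges[of "cinner x y"] by simp
qed

section \<open>Polarisation and totality of the exponential vectors\<close>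

lemma sym_power_scaleC: "sym_power n (c *\<^sub>C x) = c ^ n *\<^sub>C sym_power n x"
proof -
 have "symt (replicate n (c *\<^sub>C x) @ zs) = c ^ n *\<^sub>C symt (replicate n x @ zs)" for zs
 proof (induction n arbitrary: zs)
  case (Suc n)
  have "symt (replicate (Suc n) (c *\<^sub>C x) @ zs) = c *\<^sub>C symt (x # replicate n (c *\<^sub>C x) @ zs)"
   by (simp add: symt_Cons_linear)
  also have "symt (x # replicate n (c *\<^sub>C x) @ zs) = symt (replicate n (c *\<^sub>C x) @ x # zs)"
   by (rule symt_permute) simp
  also have "\<dots> = c ^ n *\<^sub>C symt (replicate n x @ x # zs)" by (rule Suc)
  also have "symt (replicate n x @ x # zs) = symt (replicate (Suc n) x @ zs)"
   by (rule symt_permute) simp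
  finally show ?case by (simp add: scaleC_scaleC)
 qed simp
 from this[of "[]"] show ?thesis by (simp add: sym_power_def)
qed

text \<open>A symmetric power of \<open>y + t x\<close> is a polynomial in \<open>t\<close>; only
  the constant and the linear coefficient are identified, which is enough for polarisation. The tail
  \<open>zs\<close> receives the factors split off during the induction.\<close>

lemma symt_expand:
 "\<exists>v. (M > 0 \<longrightarrow> v 1 = of_nat M *\<^sub>C symt (x # replicate (M - 1) y @ zs)) \<and> v 0 = symt (replicate M y @ zs) \<and>
  (\<forall>t. symt (replicate M (y + t *\<^sub>C x) @ zs) = (\<Sum>k\<le>M. t ^ k *\<^sub>C v k))"
proof (induction M arbitrary: zs)
 case 0
 show ?case by (intro exI[of _ "%_. symt zs"]) simp
next
 case (Suc M)
 obtain v where v: "M > 0 ==> v 1 = of_nat M *\<^sub>C symt (x # replicate (M - 1) y @ y # zs)" "v 0 = symt (replicate M y @ y # zs)"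
  "!!t. symt (replicate M (y + t *\<^sub>C x) @ y # zs) = (\<Sum>k\<le>M. t ^ k *\<^sub>C v k)" using Suc[of "y # zs"] by blast
 obtain v' where v': "v' 0 = symt (replicate M y @ x # zs)"
  "!!t. symt (replicate M (y + t *\<^sub>C x) @ x # zs) = (\<Sum>k\<le>M. t ^ k *\<^sub>C v' k)" using Suc[of "x # zs"] by blast
 define w where "w k = (if k <= M then v k else 0) + (if k > 0 then v' (k - 1) else 0)" for k
 have rep: "symt (replicate M y @ y # zs) = symt (replicate (Suc M) y @ zs)" by (rule symt_permute) simp
 have "w 1 = of_nat (Suc M) *\<^sub>C symt (x # replicate M y @ zs)"
 proof -
  have v'0: "v' 0 = symt (x # replicate M y @ zs)" unfolding v' by (rule symt_permute) simp
  show ?thesis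
  proof (cases "M > 0")
   case True
   have "v 1 = of_nat M *\<^sub>C symt (x # replicate M y @ zs)"
    unfolding v(1)[OF True] using True by (intro arg_cong[where f = "(*\<^sub>C) (of_nat M)"] symt_permute) (cases M; simp)
   then show ?thesis using True by (simp add: w_def v'0 scaleC_add_left)
  qed (simp add: w_def v'0)
 qed
 moreover have "w 0 = symt (replicate (Suc M) y @ zs)" by (simp only: w_def v rep) simp
 moreover have "symt (replicate (Suc M) (y + t *\<^sub>C x) @ zs) = (\<Sum>k\<le>Suc M. t ^ k *\<^sub>C w k)" for t
 proof -
  let ?R = "replicate M (y + t *\<^sub>C x)"
  have "symt (replicate (Suc M) (y + t *\<^sub>C x) @ zs) = symt (y # ?R @ zs) + t *\<^sub>C symt (x # ?R @ zs)"
   by (simp add: symt_Cons_linear)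
  also have "symt (y # ?R @ zs) = symt (?R @ y # zs)" by (rule symt_permute) simp
  also have "symt (x # ?R @ zs) = symt (?R @ x # zs)" by (rule symt_permute) simp
  also have "symt (?R @ y # zs) + t *\<^sub>C symt (?R @ x # zs) = (\<Sum>k\<le>M. t ^ k *\<^sub>C v k) + (\<Sum>k\<le>M. t ^ Suc k *\<^sub>C v' k)"
   unfolding v v' by (simp add: linear_sum[OF bounded_linear.linear[OF bounded_linear_scaleC]] scaleC_scaleC)
  also have "(\<Sum>k\<le>M. t ^ k *\<^sub>C v k) = (\<Sum>k\<le>Suc M. t ^ k *\<^sub>C (if k <= M then v k else 0))" by simp
  also have "(\<Sum>k\<le>M. t ^ Suc k *\<^sub>C v' k) = (\<Sum>k\<le>Suc M. t ^ k *\<^sub>C (if k > 0 then v' (k - 1) else 0))"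
   by (subst sum.atMost_Suc_shift) simp
  finally show ?thesis by (simp only: w_def scaleC_add_right sum.distrib)
 qed
 ultimately show ?case by (intro exI[of _ w]) simp
qed

lemma power_series_zero:
 assumes "!!z::complex. (%n. a n * z ^ n) sums 0"
 shows "a n = (0::complex)"
proof -
 have "conv_radius a >= norm (1::complex)"
  by (rule conv_radius_geI) (use assms[of 1] in \<open>auto simp: sums_iff\<close>)
 then have r: "fps_conv_radius (Abs_fps a) > 0" unfolding fps_conv_radius_def
  using less_le_trans[of "0::ereal" 1 "conv_radius a"] by (simp add: one_ereal_def)
 have "Abs_fps a = 0"
 proof (rule eval_fps_eqD[OF r])
  show "\<forall>\<^sub>F z in nhds 0. eval_fps (Abs_fps a) z = eval_fps 0 z"
   using assms by (simp add: eval_fps_def sums_iff)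
 qed simp
 then show ?thesis by (metis fps_nth_Abs_fps fps_zero_nth)
qed

lemma bounded_symt_Cons: "\<exists>T. \<forall>x. T $ x = symt (x # xs)"
proof (rule bop_exists[where f = "%x. symt (x # xs)" and K = "\<Prod>i<length xs. norm (xs ! i)"])
 fix x
 show "norm (symt (x # xs)) <= (\<Prod>i<length xs. norm (xs ! i)) * norm x"
  using norm_symt_le[of "x # xs"] by (simp add: prod.lessThan_Suc_shift mult.commute del: prod.lessThan_Suc)
qed (auto simp: symt_Cons_linear)

text \<open>
 Totality of the exponential vectors: the power series in \<open>z\<close> of \<open>\<langle>eps(z x), phi\<rangle>\<close> isolates the powers, and
 differentiating the powers in the direction of new vectors yields all symmetric tensors (polarisation).
\<close>

lemma total_expv:
 assumes D: "ctotal D" "!!x y. x \<in> D ==> y \<in> D ==> x + y \<in> D" "!!c x. x \<in> D ==> c *\<^sub>C x \<in> D" "0 \<in> D"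
 shows "ctotal (expv ` D)"
 unfolding ctotal_def
proof (intro allI impI)
 fix phi assume "\<forall>z\<in>expv ` D. cinner z phi = 0"
 then have ex: "cinner phi (expv x) = 0" if "x \<in> D" for x
  using that cinner_commute[of phi "expv x"] by simp
 have pow: "cinner phi (sym_power n x) = 0" if "x \<in> D" for x n
 proof -
  have "(%n. (cinner phi (sym_power n x) / sqrt (fact n)) * z ^ n) sums 0" for z
  proof -
   have "(%n. cinner phi ((1 / sqrt (fact n)) *\<^sub>R sym_power n (z *\<^sub>C x))) sums cinner phi (expv (z *\<^sub>C x))"
    by (rule cinner_sums_right[OF expv_sums])
   then show ?thesis
    using ex[OF D(3)[OF that]] by (simp add: sym_power_scaleC scaleR_scaleC cinner_scaleC_right mult_ac)
  qed
  from power_series_zero[OF this] show ?thesis by simp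
 qed
 have mixed: "cinner phi (symt (xs @ replicate m y)) = 0" if "set xs \<subseteq> D" "y \<in> D" for xs m y
  using that
 proof (induction xs arbitrary: m y)
  case Nil
  then show ?case using pow by (simp add: sym_power_def)
 next
  case (Cons x xs)
  obtain v where v: "v 1 = of_nat (Suc m) *\<^sub>C symt (x # replicate m y @ xs)"
   "!!t. symt (replicate (Suc m) (y + t *\<^sub>C x) @ xs) = (\<Sum>k\<le>Suc m. t ^ k *\<^sub>C v k)"
   using symt_expand[of "Suc m" x y xs] by auto
  have "(\<Sum>k\<le>Suc m. cinner phi (v k) * t ^ k) = 0" for t
  proof -
   have "cinner phi (symt (xs @ replicate (Suc m) (y + t *\<^sub>C x))) = 0"
    by (rule Cons.IH) (use Cons.prems D in auto)
   moreover have "symt (xs @ replicate (Suc m) (y + t *\<^sub>C x)) = symt (replicate (Suc m) (y + t *\<^sub>C x) @ xs)"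
    by (rule symt_permute) simp
   ultimately have "cinner phi (\<Sum>k\<le>Suc m. t ^ k *\<^sub>C v k) = 0" unfolding v(2) by simp
   then show ?thesis unfolding cinner_sum_right cinner_scaleC_right by (simp only: mult.commute)
  qed
  \<comment> \<open>The polynomial vanishes for every \<open>t\<close>; its linear coefficient
    carries exactly one factor \<open>x\<close>.\<close>
  then have "cinner phi (v 1) = 0" by (rule zero_polynom_imp_zero_coeffs) simp
  then have "cinner phi (symt (x # replicate m y @ xs)) = 0" unfolding v(1) cinner_scaleC_right
   by (simp del: of_nat_Suc)
  moreover have "symt (x # replicate m y @ xs) = symt ((x # xs) @ replicate m y)" by (rule symt_permute) simp
  ultimately show ?case by simp
 qed
 \<comment> \<open>From tensors with entries in \<open>D\<close> to arbitrary entries, one slot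
   after another: a symmetric tensor is a bounded linear function of each entry, and
   \<open>D\<close> is total.\<close>
 have "cinner phi (symt (as @ bs)) = 0" if "set bs \<subseteq> D" for as bs
  using that
 proof (induction as arbitrary: bs)
  case Nil
  then show ?case
  proof (cases bs)
   case Nil
   then show ?thesis using pow[OF D(4), of 0] by (simp add: sym_power_def)
  next
   case (Cons b bs')
   then show ?thesis using mixed[of bs b 0] Nil by simp
  qed
 next
  case (Cons a as)
  obtain T where T: "!!x. T $ x = symt (x # as @ bs)" using bounded_symt_Cons by blast
  have "T\<^sup>\<star> $ phi = 0"
  proof (rule total_vec_eqI[OF D(1)])
   fix x assume "x \<in> D"
   have "symt (x # as @ bs) = symt (as @ x # bs)" by (rule symt_permute) simp
   then have "cinner phi (T $ x) = 0" unfolding T using Cons.IH[of "x # bs"] Cons.prems \<open>x \<in> D\<close> by simp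
   then show "cinner x (T\<^sup>\<star> $ phi) = cinner x 0" using cinner_commute[of "T $ x" phi] by simp
  qed
  then have "cinner phi (T $ a) = 0" by (metis cinner_adj cinner_zero_left)
  then show ?case by (simp add: T)
 qed
 from this[of "[]"] show "phi = 0" by (intro fock_eqI) simp
qed

section \<open>Square integrable functions and step functions\<close>

definition sqi :: "(real => 'k::complex_hilbert) => bool" where
 "sqi f \<longleftrightarrow> strongly_measurable halfline f \<and> integrable halfline (%t. (norm (f t))\<^sup>2)"

lemma step_sqi: "f \<in> step_functions ==> sqi f"
 unfolding sqi_def using step_function_sq_integrable by blast

lemma sq_fun_Sq_fun: "sqi f ==> sq_fun (Sq_fun f) = f"
 by (rule Sq_fun_inverse) (simp add: sqi_def)

lemma sqi_sq_fun: "sqi (sq_fun g)"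
 using sq_fun[of g] by (simp add: sqi_def)

lemma sqi_cinner_integrable: "sqi f ==> sqi g ==> integrable halfline (%t. cinner (f t) (g t))"
 using sq_cinner_integrable[of "Sq_fun f" "Sq_fun g"] by (simp add: sq_fun_Sq_fun)

lemma L2_cinner: "sqi f ==> sqi g ==> cinner (L2_of f) (L2_of g) = (LINT t|halfline. cinner (f t) (g t))"
 by (simp add: L2_of_def cinner_kvec kern_sq_integrable_def sq_fun_Sq_fun)

lemma kvec_eq_L2_of: "kvec g = L2_of (sq_fun g)"
 by (simp add: L2_of_def sq_fun_inverse)

lemma L2_norm: "sqi f ==> (norm (L2_of f))\<^sup>2 = (LINT t|halfline. (norm (f t))\<^sup>2)"
 unfolding norm_sq_Re L2_cinner integral_Re[OF sqi_cinner_integrable, symmetric] ..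

lemma strongly_measurable_compose2:
 assumes f: "strongly_measurable M f" and g: "strongly_measurable M g"
  and h: "!!x y a b. x \<longlonglongrightarrow> a ==> y \<longlonglongrightarrow> b ==> (%n. h (x n) (y n)) \<longlonglongrightarrow> h a b"
 shows "strongly_measurable M (%t. h (f t) (g t))"
proof -
 obtain r where r: "!!n. simple_function M (r n)" "!!t. t \<in> space M ==> (%n::nat. r n t) \<longlonglongrightarrow> f t"
  using f unfolding strongly_measurable_def by metis
 obtain s where s: "!!n. simple_function M (s n)" "!!t. t \<in> space M ==> (%n::nat. s n t) \<longlonglongrightarrow> g t"
  using g unfolding strongly_measurable_def by metis
 show ?thesis unfolding strongly_measurable_def
 proof (intro exI[of _ "%n t. h (r n t) (s n t)"] conjI allI ballI)
  show "simple_function M (%t. h (r n t) (s n t))" for n by (rule simple_function_compose2[OF r(1) s(1)])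
  fix t assume "t \<in> space M"
  then show "(%n. h (r n t) (s n t)) \<longlonglongrightarrow> h (f t) (g t)" by (intro h r s)
 qed
qed

lemma sqi_add: "sqi f ==> sqi g ==> sqi (%t. f t + g t)"
proof -
 assume fg: "sqi f" "sqi g"
 have m: "strongly_measurable halfline (%t. f t + g t)"
  by (rule strongly_measurable_compose2[where h = "(+)"]) (use fg in \<open>auto simp: sqi_def intro: tendsto_add\<close>)
 have "integrable halfline (%t. (norm (f t + g t))\<^sup>2)"
 proof (rule Bochner_Integration.integrable_bound)
  show "integrable halfline (%t. 2 * (norm (f t))\<^sup>2 + 2 * (norm (g t))\<^sup>2)"
   using fg unfolding sqi_def by (intro Bochner_Integration.integrable_add integrable_mult_right) auto
  have "(%t. cinner (f t + g t) (f t + g t)) \<in> borel_measurable halfline"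
   by (rule strongly_measurable_cinner[OF m m])
  then have "(%t. Re (cinner (f t + g t) (f t + g t))) \<in> borel_measurable halfline" by measurable
  then show "(%t. (norm (f t + g t))\<^sup>2) \<in> borel_measurable halfline" by (simp only: norm_sq_Re)
  have "(norm (x + y))\<^sup>2 <= 2 * (norm x)\<^sup>2 + 2 * (norm y)\<^sup>2" for x y :: 'a
   using norm_sq_add[of x y] norm_sq_diff[of x y] zero_le_power2[of "norm (x - y)"] by linarith
  then show "AE t in halfline. norm ((norm (f t + g t))\<^sup>2) <= norm (2 * (norm (f t))\<^sup>2 + 2 * (norm (g t))\<^sup>2)"
   by (auto intro!: AE_I2 order.trans[OF _ abs_ge_self])
 qed
 then show ?thesis using m by (simp add: sqi_def)
qed

lemma sqi_scaleC: "sqi f ==> sqi (%t. c *\<^sub>C f t)"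
proof -
 assume f: "sqi f"
 have "strongly_measurable halfline (%t. c *\<^sub>C f t)"
  using strongly_measurable_compose2[of halfline f f "%x y. c *\<^sub>C x"] f unfolding sqi_def
  by (auto intro: tendsto_scaleC)
 moreover have "(%t. (norm (c *\<^sub>C f t))\<^sup>2) = (%t. (cmod c)\<^sup>2 * (norm (f t))\<^sup>2)" by (simp add: norm_scaleC power_mult_distrib)
 ultimately show ?thesis using f by (simp add: sqi_def)
qed

lemma L2_of_eqI:
 assumes "!!q. cinner (L2_of (sq_fun q)) x = cinner (L2_of (sq_fun q)) y"
 shows "x = y"
 using khilb_eqI[of x y] assms by (simp add: kvec_eq_L2_of)

lemma L2_of_add: "sqi f ==> sqi g ==> L2_of (%t. f t + g t) = L2_of f + L2_of g"
 by (rule L2_of_eqI)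
  (simp add: cinner_add_right L2_cinner sqi_sq_fun sqi_add sqi_cinner_integrable Bochner_Integration.integral_add)

lemma L2_of_scaleC: "sqi f ==> L2_of (%t. c *\<^sub>C f t) = c *\<^sub>C L2_of f"
 by (rule L2_of_eqI)
  (simp add: cinner_scaleC_right L2_cinner sqi_sq_fun sqi_scaleC)

lemma L2_of_diff: "sqi f ==> sqi g ==> L2_of (%t. f t - g t) = L2_of f - L2_of g" "sqi f ==> sqi g ==> sqi (%t. f t - g t)"
 using L2_of_add[of f "%t. (-1) *\<^sub>C g t"] L2_of_scaleC[of g "-1"] sqi_scaleC[of g "-1"] sqi_add[of f "%t. (-1) *\<^sub>C g t"]
 by (simp_all add: scaleC_minus_one)

lemma sqi_zero: "sqi (%_. 0)"
 unfolding sqi_def strongly_measurable_def by (auto intro!: exI[of _ "%_ _. 0"])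

lemma L2_of_zero [simp]: "L2_of (%_. 0) = 0"
 using L2_of_scaleC[OF sqi_zero, of 0] by simp

text \<open>Dominated convergence for the squared distance. The factor 2 is the level at which
  \<open>total_step\<close> truncates its simple functions; 9 is the square of 2 + 1.\<close>

lemma L2_dominated:
 assumes h: "!!n. sqi (h n)" and g: "sqi g" and lim: "!!t. 0 <= t ==> (%n. h n t) \<longlonglongrightarrow> g t"
  and bd: "!!n t. 0 <= t ==> norm (h n t) <= 2 * norm (g t)"
 shows "(%n. L2_of (h n)) \<longlonglongrightarrow> L2_of g"
proof -
 have "(%n. LINT t|halfline. (norm (h n t - g t))\<^sup>2) \<longlonglongrightarrow> (LINT t|halfline. 0)"
 proof (rule integral_dominated_convergence[where w = "%t. 9 * (norm (g t))\<^sup>2"])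
  show "(%t. (norm (h n t - g t))\<^sup>2) \<in> borel_measurable halfline" for n
   using L2_of_diff(2)[OF h g] unfolding sqi_def by blast
  show "integrable halfline (%t. 9 * (norm (g t))\<^sup>2)" using g unfolding sqi_def by simp
  show "AE t in halfline. (%n. (norm (h n t - g t))\<^sup>2) \<longlonglongrightarrow> 0"
  proof (rule AE_I2)
   fix t assume "t \<in> space halfline"
   then have "(%n. (norm (h n t - g t))\<^sup>2) \<longlonglongrightarrow> (norm (g t - g t))\<^sup>2" by (intro tendsto_intros lim) simp
   then show "(%n. (norm (h n t - g t))\<^sup>2) \<longlonglongrightarrow> 0" by simp
  qed
  show "AE t in halfline. norm ((norm (h n t - g t))\<^sup>2) <= 9 * (norm (g t))\<^sup>2" for n
  proof (rule AE_I2)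
   fix t assume "t \<in> space halfline"
   then have "norm (h n t - g t) <= 3 * norm (g t)"
    using bd[of t n] norm_triangle_ineq4[of "h n t" "g t"] by simp
   then have "(norm (h n t - g t))\<^sup>2 <= (3 * norm (g t))\<^sup>2" by (rule power_mono) simp
   then show "norm ((norm (h n t - g t))\<^sup>2) <= 9 * (norm (g t))\<^sup>2" by (simp add: power_mult_distrib)
  qed
 qed simp
 then have "(%n. (norm (L2_of (h n) - L2_of g))\<^sup>2) \<longlonglongrightarrow> 0"
  using L2_norm[OF L2_of_diff(2)[OF h g]] by (simp add: L2_of_diff(1)[OF h g])
 from tendsto_real_sqrt[OF this] have "(%n. norm (L2_of (h n) - L2_of g)) \<longlonglongrightarrow> 0" by simp
 then show ?thesis by (simp add: LIM_zero_iff tendsto_norm_zero_iff)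
qed

subsection \<open>Step functions\<close>

definition elem_step :: "real => real => 'k::complex_hilbert => real => 'k" where
 "elem_step a b c = (%s. indicator {a..<b} s *\<^sub>R c)"

lemma elem_step_in: "0 <= a ==> elem_step a b c \<in> step_functions"
proof -
 assume a: "0 <= a"
 have "elem_step a b c = (%s. \<Sum>i<(1::nat). indicator {a..<max a b} s *\<^sub>R c)"
  by (auto simp: elem_step_def indicator_def fun_eq_iff)
 then show ?thesis unfolding step_functions_def
  by (intro CollectI exI[of _ "1::nat"] exI[of _ "%_. a"] exI[of _ "%_. max a b"] exI[of _ "%_. c"]) (use a in auto)
qed

lemma step_add: "f \<in> step_functions ==> g \<in> step_functions ==> (%s. f s + g s) \<in> step_functions"
proof -
 assume "f \<in> step_functions" "g \<in> step_functions"
 then obtain n m :: nat and a b c a' b' c' where f: "!!i. i < n ==> 0 <= a i \<and> a i <= b i" "f = (%s. \<Sum>i<n. indicator {a i..<b i} s *\<^sub>R c i)"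
  and g: "!!i. i < m ==> 0 <= a' i \<and> a' i <= b' i" "g = (%s. \<Sum>i<m. indicator {a' i..<b' i} s *\<^sub>R c' i)"
  unfolding step_functions_def by blast
 define A where "A i = (if i < n then a i else a' (i - n))" for i
 define B where "B i = (if i < n then b i else b' (i - n))" for i
 define C where "C i = (if i < n then c i else c' (i - n))" for i
 have sum_add: "(\<Sum>i<n + m. F i) = (\<Sum>i<n. F i) + (\<Sum>i<m. F (n + i))" for F :: "nat => 'a"
  by (induction m) (auto simp: add.assoc)
 have "(%s. \<Sum>i<n + m. indicator {A i..<B i} s *\<^sub>R C i) = (%s. f s + g s)"
  unfolding f g sum_add by (simp add: A_def B_def C_def)
 then show ?thesis unfolding step_functions_def using f(1) g(1)
  by (intro CollectI exI[of _ "n + m"] exI[of _ A] exI[of _ B] exI[of _ C])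
   (auto simp: A_def B_def)
qed

lemma step_zero: "(%_. 0) \<in> step_functions"
 using elem_step_in[of 0 0 0] by (simp add: elem_step_def)

lemma step_induct [consumes 1, case_names zero elem add]:
 assumes "f \<in> step_functions" "P (%_. 0)" "!!a b c. 0 <= a ==> a <= b ==> P (elem_step a b c)"
  "!!f g. f \<in> step_functions ==> g \<in> step_functions ==> P f ==> P g ==> P (%s. f s + g s)"
 shows "P f"
proof -
 obtain n :: nat and a b c where f: "!!i. i < n ==> 0 <= a i \<and> a i <= b i" "f = (%s. \<Sum>i<n. indicator {a i..<b i} s *\<^sub>R c i)"
  using assms(1) unfolding step_functions_def by blast
 have "(%s. \<Sum>i<m. indicator {a i..<b i} s *\<^sub>R c i) \<in> step_functions \<and> P (%s. \<Sum>i<m. indicator {a i..<b i} s *\<^sub>R c i)"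
  if "m <= n" for m
  using that
 proof (induction m)
  case 0
  then show ?case using assms(2) step_zero by simp
 next
  case (Suc m)
  then have m: "0 <= a m" "a m <= b m" using f(1)[of m] by auto
  let ?S = "%s. \<Sum>i<m. indicator {a i..<b i} s *\<^sub>R c i"
  have eq: "(%s. \<Sum>i<Suc m. indicator {a i..<b i} s *\<^sub>R c i) = (%s. ?S s + elem_step (a m) (b m) (c m) s)"
   by (simp only: sum.lessThan_Suc elem_step_def)
  have S: "?S \<in> step_functions" "P ?S" using Suc by auto
  show ?case unfolding eq
   by (intro conjI step_add assms(4) S elem_step_in m assms(3))
 qed
 then show ?thesis using f(2) by blast
qed

lemma step_map:
 assumes "f \<in> step_functions" "\<Phi> (%_. 0) = (%_. 0)" "!!a b c. 0 <= a ==> a <= b ==> \<Phi> (elem_step a b c) \<in> step_functions"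
  "!!f g. \<Phi> (%s. f s + g s) = (%s. \<Phi> f s + \<Phi> g s)"
 shows "\<Phi> f \<in> step_functions"
 using assms(1) by (induction rule: step_induct) (simp_all add: assms step_zero step_add)

lemma step_scaleC: "f \<in> step_functions ==> (%s. d *\<^sub>C f s) \<in> step_functions"
proof (rule step_map[where \<Phi> = "%f s. d *\<^sub>C f s"])
 fix a b :: real and c :: 'a assume "0 <= a"
 have "(%s. d *\<^sub>C elem_step a b c s) = elem_step a b (d *\<^sub>C c)"
  by (auto simp: elem_step_def scaleR_scaleC scaleC_scaleC mult.commute)
 then show "(%s. d *\<^sub>C elem_step a b c s) \<in> step_functions" using elem_step_in[OF \<open>0 <= a\<close>] by simp
qed (auto simp: scaleC_add_right)

lemma step_restrict_before: "f \<in> step_functions ==> restrict_to {0..<r} f \<in> step_functions"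
proof (rule step_map[where \<Phi> = "restrict_to {0..<r}"])
 fix a b :: real and c :: 'a assume "0 <= a"
 then have "restrict_to {0..<r} (elem_step a b c) = elem_step a (min b r) c"
  by (intro ext) (auto simp: elem_step_def restrict_to_def indicator_def)
 then show "restrict_to {0..<r} (elem_step a b c) \<in> step_functions" using elem_step_in[OF \<open>0 <= a\<close>] by simp
qed (auto simp: restrict_to_def scaleR_add_right)

lemma step_restrict_after: "f \<in> step_functions ==> restrict_to {r..} f \<in> step_functions"
proof (rule step_map[where \<Phi> = "restrict_to {r..}"])
 fix a b :: real and c :: 'a assume "0 <= a"
 then have "restrict_to {r..} (elem_step a b c) = elem_step (max a r) b c"
  by (intro ext) (auto simp: elem_step_def restrict_to_def indicator_def)
 then show "restrict_to {r..} (elem_step a b c) \<in> step_functions" using elem_step_in[of "max a r" b c] \<open>0 <= a\<close> by auto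
qed (auto simp: restrict_to_def scaleR_add_right)

lemma step_shift: "0 <= r ==> f \<in> step_functions ==> shift_fun r f \<in> step_functions"
proof (rule step_map[where \<Phi> = "shift_fun r"])
 fix a b :: real and c :: 'a assume "0 <= a" "0 <= r"
 then have "shift_fun r (elem_step a b c) = elem_step (a + r) (b + r) c"
  by (intro ext) (auto simp: elem_step_def shift_fun_def indicator_def)
 then show "shift_fun r (elem_step a b c) \<in> step_functions" using elem_step_in[of "a + r"] \<open>0 <= a\<close> \<open>0 <= r\<close> by simp
qed (auto simp: shift_fun_def)

text \<open>The part of \<open>f\<close> after time \<open>r\<close>, moved back to start at 0; it
  vanishes on negative arguments, as step functions do, so that it is a step function again.\<close>

definition unshift_fun :: "real => (real => 'k::complex_hilbert) => real => 'k" where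
 "unshift_fun r f = (%s. if 0 <= s then f (s + r) else 0)"

lemma step_unshift: "f \<in> step_functions ==> unshift_fun r f \<in> step_functions"
proof (rule step_map[where \<Phi> = "unshift_fun r"])
 fix a b :: real and c :: 'a
 have "unshift_fun r (elem_step a b c) = elem_step (max 0 (a - r)) (b - r) c"
  by (intro ext) (auto simp: elem_step_def unshift_fun_def indicator_def)
 then show "unshift_fun r (elem_step a b c) \<in> step_functions" using elem_step_in[of "max 0 (a - r)"] by simp
qed (auto simp: unshift_fun_def)

lemma step_negative: "f \<in> step_functions ==> s < 0 ==> f s = 0"
 by (induction rule: step_induct) (auto simp: elem_step_def)

lemma shift_unshift: "shift_fun r (unshift_fun r f) = restrict_to {r..} f"
 by (auto simp: shift_fun_def unshift_fun_def restrict_to_def)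

lemma step_split: "f \<in> step_functions ==> (%s. restrict_to {0..<r} f s + restrict_to {r..} f s) = f"
proof
 fix s assume "f \<in> step_functions"
 then show "restrict_to {0..<r} f s + restrict_to {r..} f s = f s"
  using step_negative[of f s] by (auto simp: restrict_to_def indicator_def)
qed

subsection \<open>Totality of the step functions\<close>

lemma sets_halfline_Int: "B \<in> sets borel ==> B \<inter> {0..} \<in> sets halfline"
 unfolding halfline_def sets_restrict_space by (rule image_eqI[of _ _ B]) auto

lemma sqi_simple:
 fixes s :: "real => 'k::complex_hilbert"
 assumes s: "simple_function halfline s" and supp: "!!t. 0 <= t ==> N <= t ==> s t = 0"
 shows "sqi s"
proof -
 have "finite (s ` {0..})" using s unfolding simple_function_def by simp
 then have "bounded (s ` {0..})" by (rule finite_imp_bounded)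
 then obtain B where B: "!!t. 0 <= t ==> norm (s t) <= B" unfolding bounded_iff by auto
 have "integrable halfline (%t. (norm (s t))\<^sup>2)"
 proof (rule Bochner_Integration.integrable_bound)
  have "integrable lborel (indicator {0..N} :: real => real)"
   by (rule integrable_real_indicator) (simp_all add: emeasure_lborel_Icc_eq)
  moreover have "(%t. indicator {0..} t *\<^sub>R (B\<^sup>2 * indicator {0..N} t :: real)) = (%t. B\<^sup>2 * indicator {0..N} t)"
   by (auto simp: fun_eq_iff indicator_def)
  ultimately show "integrable halfline (%t. B\<^sup>2 * indicator {0..N} t :: real)"
   unfolding halfline_def by (subst integrable_restrict_space) auto
  show "(%t. (norm (s t))\<^sup>2) \<in> borel_measurable halfline"
   by (rule borel_measurable_simple_function) (rule simple_function_compose1[OF s])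
  show "AE t in halfline. norm ((norm (s t))\<^sup>2) <= norm (B\<^sup>2 * indicator {0..N} t :: real)"
  proof (rule AE_I2)
   fix t assume "t \<in> space halfline"
   then have t: "0 <= t" by simp
   show "norm ((norm (s t))\<^sup>2) <= norm (B\<^sup>2 * indicator {0..N} t :: real)"
    using power_mono[OF B[OF t] norm_ge_zero, of 2] supp[OF t] t by (cases "t <= N") auto
  qed
 qed
 then show ?thesis unfolding sqi_def strongly_measurable_def
  using s by (auto intro!: exI[of _ "%_. s"])
qed

definition cut :: "real set => real => 'k::complex_hilbert => real => 'k" where
 "cut B N c = (%t. indicator (B \<inter> {0..<N}) t *\<^sub>R c)"

lemma sqi_cut: "B \<in> sets borel ==> sqi (cut B N c)"
proof (rule sqi_simple[where N = N])
 assume B: "B \<in> sets borel"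
 have "(B \<inter> {0..<N}) \<inter> {0..} \<in> sets halfline" using B by (intro sets_halfline_Int) simp
 moreover have "(B \<inter> {0..<N}) \<inter> {0..} = B \<inter> {0..<N}" by auto
 ultimately show "simple_function halfline (cut B N c)"
  unfolding cut_def by (intro simple_function_compose1[where g = "%x. x *\<^sub>R c"] simple_function_indicator) simp
qed (simp add: cut_def)

text \<open>Dynkin's argument from the intersection-stable half-lines \<open>{..<a}\<close> shows
  that \<open>phi\<close> is orthogonal to all indicators of bounded Borel sets with vector values.
  Finite sums give bounded-support simple functions, and these approximate every square integrable
  function.\<close>

lemma total_step: "ctotal (L2_of ` (step_functions :: (real => 'k::complex_hilbert) set))"
 unfolding ctotal_def
proof (intro allI impI)
 fix phi :: "'k L2" assume "\<forall>z\<in>L2_of ` step_functions. cinner z phi = 0"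
 then have st: "cinner (L2_of f) phi = 0" if "f \<in> step_functions" for f using that by blast
 have cut: "cinner (L2_of (cut B N c)) phi = 0" if "B \<in> sets borel" for B N c
 proof -
  have gen: "B \<in> sigma_sets UNIV (range (%a::real. {..<a}))"
   using that unfolding borel_eq_lessThan by (simp add: lessThan_def eucl_less_def)
  have sb: "sigma_sets UNIV (range (%a::real. {..<a})) = sets borel"
   unfolding borel_eq_lessThan by (simp add: lessThan_def eucl_less_def)
  show ?thesis
  proof (rule sigma_sets_induct_disjoint[OF _ _ gen])
   show "Int_stable (range (%a::real. {..<a}))"
   proof (rule Int_stableI)
    fix a b assume "a \<in> range (%a::real. {..<a})" "b \<in> range (%a::real. {..<a})"
    then obtain u v :: real where "a = {..<u}" "b = {..<v}" by blast
    then have "a \<inter> b = {..<min u v}" by auto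
    then show "a \<inter> b \<in> range (%a::real. {..<a})" by blast
   qed
   show "cinner (L2_of (cut A N c)) phi = 0" if "A \<in> range (%a::real. {..<a})" for A
   proof -
    from that obtain u where "A = {..<u}" by (elim rangeE)
    then have "cut A N c = elem_step 0 (min u N) c"
     by (intro ext) (auto simp: cut_def elem_step_def indicator_def)
    then show ?thesis using st[OF elem_step_in[of 0]] by simp
   qed
   show "cinner (L2_of (cut {} N c)) phi = 0"
    using st[OF step_zero] by (simp add: cut_def)
   show "cinner (L2_of (cut (UNIV - A) N c)) phi = 0"
    if "A \<in> sigma_sets UNIV (range (%a::real. {..<a}))" "cinner (L2_of (cut A N c)) phi = 0" for A
   proof -
    have A: "A \<in> sets borel" using that(1) sb by simp
    have "cut (UNIV - A) N c = (%t. elem_step 0 N c t - cut A N c t)"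
     by (intro ext) (auto simp: cut_def elem_step_def indicator_def)
    then show ?thesis
     using L2_of_diff(1)[OF step_sqi[OF elem_step_in[of 0 N c]] sqi_cut[OF A]] that(2) st[OF elem_step_in[of 0]]
     by (simp add: cinner_diff_left)
   qed
   show "cinner (L2_of (cut (\<Union>i. A i) N c)) phi = 0"
    if disj: "disjoint_family A" and rng: "range A \<subseteq> sigma_sets UNIV (range (%a::real. {..<a}))"
     and IH: "!!i. cinner (L2_of (cut (A i) N c)) phi = 0" for A :: "nat => real set"
   proof -
    have A: "A i \<in> sets borel" for i using rng sb by blast
    define h where "h n = cut (\<Union>i<n. A i) N c" for n
    have hm: "(\<Union>i<n. A i) \<in> sets borel" for n using A by auto
    have h0: "cinner (L2_of (h n)) phi = 0" for n
    proof (induction n)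
     case 0
     then show ?case using st[OF step_zero] by (simp add: h_def cut_def)
    next
     case (Suc n)
     have "A n \<inter> A i = {}" if "i < n" for i
      by (rule disjoint_family_onD[OF disj]) (use that in auto)
     then have "A n \<inter> (\<Union>i<n. A i) = {}" by blast
     then have "h (Suc n) = (%t. h n t + cut (A n) N c t)"
      by (intro ext) (auto simp: h_def cut_def lessThan_Suc indicator_def)
     then show ?case using L2_of_add[OF sqi_cut[OF hm] sqi_cut[OF A[of n]], of n N c N c] Suc IH
      by (simp add: h_def cinner_add_left)
    qed
    have "(%n. L2_of (h n)) \<longlonglongrightarrow> L2_of (cut (\<Union>i. A i) N c)"
    proof (rule L2_dominated)
     show "sqi (h n)" for n unfolding h_def by (rule sqi_cut[OF hm])
     show "sqi (cut (\<Union>i. A i) N c)" using A by (intro sqi_cut) auto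
     fix t :: real
     show "(%n. h n t) \<longlonglongrightarrow> cut (\<Union>i. A i) N c t"
     proof (cases "t \<in> (\<Union>i. A i)")
      case True
      then obtain i where i: "t \<in> A i" by blast
      have "h n t = cut (\<Union>i. A i) N c t" if "n > i" for n
       using i that by (auto simp: h_def cut_def indicator_def)
      then show ?thesis by (intro tendsto_eventually eventually_at_top_dense[THEN iffD2]) blast
     next
      case False
      then show ?thesis by (auto simp: h_def cut_def)
     qed
     show "norm (h n t) <= 2 * norm (cut (\<Union>i. A i) N c t)" for n
      by (auto simp: h_def cut_def indicator_def)
    qed
    then have "(%n. cinner (L2_of (h n)) phi) \<longlonglongrightarrow> cinner (L2_of (cut (\<Union>i. A i) N c)) phi"
     by (intro tendsto_intros)
    then show ?thesis by (simp add: h0 LIMSEQ_const_iff)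
   qed
  qed simp
 qed
 have simple: "cinner (L2_of (%t. indicator {0..<N} t *\<^sub>R s t)) phi = 0" if s: "simple_function halfline s" for s :: "real => 'k" and N
 proof -
  let ?R = "s ` {0..}"
  have fin: "finite ?R" using s unfolding simple_function_def by simp
  have meas: "s -` {y} \<inter> {0..} \<in> sets borel" for y
  proof -
   have "s -` {y} \<inter> space halfline \<in> sets halfline" using s by (rule simple_functionD)
   then show ?thesis unfolding halfline_def sets_restrict_space by (auto simp: space_restrict_space)
  qed
  have part: "(%t. \<Sum>y\<in>R. cut (s -` {y} \<inter> {0..}) N y t) = (%t. indicator {t. 0 <= t \<and> t < N \<and> s t \<in> R} t *\<^sub>R s t)"
   if "finite R" for R
  proof
   fix t
   have "(\<Sum>y\<in>R. cut (s -` {y} \<inter> {0..}) N y t) = (\<Sum>y\<in>R. if s t = y then indicator {0..<N} t *\<^sub>R s t else 0)"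
    by (intro sum.cong) (auto simp: cut_def indicator_def)
   then show "(\<Sum>y\<in>R. cut (s -` {y} \<inter> {0..}) N y t) = indicator {t. 0 <= t \<and> t < N \<and> s t \<in> R} t *\<^sub>R s t"
    using that by (auto simp: indicator_def)
  qed
  have "sqi (%t. \<Sum>y\<in>R. cut (s -` {y} \<inter> {0..}) N y t) \<and> cinner (L2_of (%t. \<Sum>y\<in>R. cut (s -` {y} \<inter> {0..}) N y t)) phi = 0"
   if "finite R" for R
   using that
  proof (induction R)
   case empty
   show ?case using st[OF step_zero] sqi_zero by simp
  next
   case (insert y R)
   then show ?case
    using sqi_add[OF sqi_cut[OF meas[of y], of N y]] L2_of_add[OF sqi_cut[OF meas[of y], of N y]] cut[OF meas[of y], of N y]
    by (simp add: cinner_add_left)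
  qed
  moreover have "(%t. indicator {0..<N} t *\<^sub>R s t) = (%t. \<Sum>y\<in>?R. cut (s -` {y} \<inter> {0..}) N y t)"
   unfolding part[OF fin] by (intro ext) (auto simp: indicator_def)
  ultimately show ?thesis using fin by simp
 qed
 show "phi = 0"
 proof (rule L2_of_eqI)
  fix q :: "'k sq_integrable"
  let ?g = "sq_fun q"
  have g: "sqi ?g" by (rule sqi_sq_fun)
  then obtain s where s: "!!n. simple_function halfline (s n)" "!!t. 0 <= t ==> (%n::nat. s n t) \<longlonglongrightarrow> ?g t"
   unfolding sqi_def strongly_measurable_def by (metis atLeast_iff space_halfline)
  have gm: "(%t. norm (?g t)) \<in> borel_measurable halfline"
  proof -
   have "(%t. sqrt ((norm (?g t))\<^sup>2)) \<in> borel_measurable halfline"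
    using g unfolding sqi_def by (intro borel_measurable_sqrt[THEN measurable_compose[rotated]]) auto
   then show ?thesis by simp
  qed
  \<comment> \<open>Cut off in time at \<open>n\<close> and in size at twice the limit. Where the
    limit is nonzero the truncation is eventually inactive; where it is zero it forces the value
    0.\<close>
  define h where "h n t = indicator {0..<real n} t *\<^sub>R (if norm (s n t) <= 2 * norm (?g t) then s n t else 0)" for n t
  have hs: "simple_function halfline (%t. if norm (s n t) <= 2 * norm (?g t) then s n t else 0)" for n
  proof (rule simple_function_If[OF s(1) simple_function_const])
   have "(%t. norm (s n t)) \<in> borel_measurable halfline"
    by (rule borel_measurable_simple_function) (rule simple_function_compose1[OF s(1)])
   then show "{t \<in> space halfline. norm (s n t) <= 2 * norm (?g t)} \<in> sets halfline"
    using gm by measurable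
  qed
  have "(%n. L2_of (h n)) \<longlonglongrightarrow> L2_of ?g"
  proof (rule L2_dominated[OF _ g])
   show "sqi (h n)" for n
   proof (rule sqi_simple[where N = "real n"])
    have "{0..<real n} \<inter> {0..} \<in> sets halfline" by (intro sets_halfline_Int) simp
    moreover have "{0..<real n} \<inter> {0..} = {0..<real n}" by auto
    ultimately show "simple_function halfline (h n)"
     unfolding h_def by (intro simple_function_compose2[OF _ hs, where h = "(*\<^sub>R)"] simple_function_indicator) simp
   qed (simp add: h_def)
   fix t :: real assume t: "0 <= t"
   show "norm (h n t) <= 2 * norm (?g t)" for n by (auto simp: h_def indicator_def)
   obtain M where M: "t < real M" using reals_Archimedean2 by blast
   have evM: "\<forall>\<^sub>F n in sequentially. t < real n" using M
    by (intro eventually_sequentiallyI[of M]) simp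
   show "(%n. h n t) \<longlonglongrightarrow> ?g t"
   proof (cases "?g t = 0")
    case True
    then have "h n t = 0" for n by (simp add: h_def)
    then show ?thesis using True by simp
   next
    case False
    have "(%n. norm (s n t)) \<longlonglongrightarrow> norm (?g t)" by (intro tendsto_norm s t)
    then have "\<forall>\<^sub>F n in sequentially. norm (s n t) < 2 * norm (?g t)"
     by (rule order_tendstoD) (use False in simp)
    with evM have "\<forall>\<^sub>F n in sequentially. s n t = h n t"
     by eventually_elim (use t in \<open>auto simp: h_def\<close>)
    from tendsto_cong[OF this] s(2)[OF t] show ?thesis by simp
   qed
  qed
  then have "(%n. cinner (L2_of (h n)) phi) \<longlonglongrightarrow> cinner (L2_of ?g) phi" by (intro tendsto_intros)
  moreover have "cinner (L2_of (h n)) phi = 0" for n unfolding h_def by (rule simple[OF hs])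
  ultimately show "cinner (L2_of (sq_fun q)) phi = cinner (L2_of (sq_fun q)) 0" by (simp add: LIMSEQ_const_iff)
 qed
qed

section \<open>Coherent vectors\<close>

abbreviation ip :: "(real => 'k::complex_hilbert) => (real => 'k) => complex" where
 "ip f g \<equiv> cinner (L2_of f) (L2_of g)"

lemma coherent_eq: "\<varpi> f = exp (- (norm (L2_of f))\<^sup>2 / 2) *\<^sub>R expv (L2_of f)"
 by (simp add: coherent_def expv_def)

lemma cinner_coherent: "cinner (\<varpi> f) (\<varpi> g) = exp (ip f g - (ip f f + ip g g) / 2)"
proof -
 have e: "complex_of_real (exp (- (norm x)\<^sup>2 / 2)) = exp (- (cinner x x) / 2)" for x :: "'z::complex_hilbert"
  by (simp add: cinner_self exp_of_real[symmetric])
 show ?thesis unfolding coherent_eq scaleR_scaleC cinner_scaleC_left cinner_scaleC_right cinner_expv complex_cnj_complex_of_real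
  unfolding e by (simp add: exp_add[symmetric] diff_divide_distrib add_divide_distrib diff_diff_eq)
qed

lemma total_coherent: "ctotal (\<varpi> ` (step_functions :: (real => 'k::complex_hilbert) set))"
proof -
 have "ctotal (expv ` L2_of ` (step_functions :: (real => 'k) set))"
 proof (rule total_expv[OF total_step])
  show "x + y \<in> L2_of ` step_functions" if "x \<in> L2_of ` step_functions" "y \<in> L2_of ` step_functions" for x y :: "'k L2"
  proof -
   from that obtain f g where fg: "f \<in> step_functions" "g \<in> step_functions" "x = L2_of f" "y = L2_of g" by blast
   show ?thesis unfolding fg(3,4) L2_of_add[OF step_sqi[OF fg(1)] step_sqi[OF fg(2)], symmetric]
    by (rule imageI[OF step_add[OF fg(1,2)]])
  qed
  show "c *\<^sub>C x \<in> L2_of ` step_functions" if "x \<in> L2_of ` step_functions" for c and x :: "'k L2"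
  proof -
   from that obtain f where f: "f \<in> step_functions" "x = L2_of f" by blast
   show ?thesis unfolding f(2) L2_of_scaleC[OF step_sqi[OF f(1)], symmetric]
    by (rule imageI[OF step_scaleC[OF f(1)]])
  qed
  show "0 \<in> L2_of ` (step_functions :: (real => 'k) set)" by (rule image_eqI[OF _ step_zero]) simp
 qed
 then show ?thesis unfolding ctotal_def by (simp add: coherent_eq scaleR_scaleC cinner_scaleC_left)
qed

lemma total_tensor_coherent:
 "ctotal {u \<otimes> \<varpi> f | (u :: 'h::complex_hilbert) (f :: real => 'k::complex_hilbert). f \<in> step_functions}"
proof -
 have "{x \<otimes> y | x y. x \<in> (UNIV :: 'h set) \<and> y \<in> \<varpi> ` (step_functions :: (real => 'k) set)}
   = {u \<otimes> \<varpi> f | (u :: 'h) (f :: real => 'k). f \<in> step_functions}" by blast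
 then show ?thesis using total_tensor[OF total_UNIV[where 'a = 'h] total_coherent[where 'k = 'k]] by (simp only:)
qed

lemma tensor_bop_eqI:
 assumes "!!x y. S $ (x \<otimes> y) = T $ (x \<otimes> y)"
 shows "S = T"
proof (rule kvec_bop_eqI)
 fix p show "S $ kvec p = T $ kvec p"
  using assms by (cases p) (simp add: tensor_vec_def)
qed

lemma tensor_op_adj: "(S ox T)\<^sup>\<star> = S\<^sup>\<star> ox T\<^sup>\<star>"
 by (rule tensor_bop_eqI, rule tensor_eqI) (simp add: cinner_tensor)

lemma tensor_op_comp: "(S ox T) oo (S' ox T') = (S oo S') ox (T oo T')"
 by (rule tensor_bop_eqI) simp

lemma tensor_op_one: "\<one> ox \<one> = \<one>"
 by (rule tensor_bop_eqI) simp

subsection \<open>Splitting and shifting the Fock space\<close>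

abbreviation bef :: "real => (real => 'k::complex_hilbert) => real => 'k" where
 "bef r f \<equiv> restrict_to {0..<r} f"

abbreviation aft :: "real => (real => 'k::complex_hilbert) => real => 'k" where
 "aft r f \<equiv> restrict_to {r..} f"

definition conc :: "real => (real => 'k::complex_hilbert) => (real => 'k) => real => 'k" where
 "conc r f h = (%s. bef r f s + shift_fun r h s)"

lemma conc_simps:
 assumes "0 <= r"
 shows "f \<in> step_functions ==> h \<in> step_functions ==> conc r f h \<in> step_functions"
  "bef r (conc r f h) = bef r f" "h \<in> step_functions ==> unshift_fun r (conc r f h) = h"
  "f \<in> step_functions ==> conc r f (unshift_fun r f) = f"
  "bef r (bef r f) = bef r f" "conc r (bef r f) h = conc r f h"
proof -
 show "conc r f h \<in> step_functions" if "f \<in> step_functions" "h \<in> step_functions"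
  unfolding conc_def using assms that by (intro step_add step_restrict_before step_shift)
 show "bef r (conc r f h) = bef r f" by (intro ext) (auto simp: conc_def restrict_to_def shift_fun_def indicator_def)
 show "unshift_fun r (conc r f h) = h" if "h \<in> step_functions"
  using assms step_negative[OF that] by (intro ext) (auto simp: conc_def restrict_to_def shift_fun_def unshift_fun_def indicator_def)
 show "conc r f (unshift_fun r f) = f" if "f \<in> step_functions"
  unfolding conc_def shift_unshift by (rule step_split[OF that])
 show "bef r (bef r f) = bef r f" by (intro ext) (auto simp: restrict_to_def indicator_def)
 then show "conc r (bef r f) h = conc r f h" by (simp add: conc_def)
qed

lemma bef_bef: "r <= s ==> bef r (bef s f) = bef r f" "r <= s ==> bef s (bef r f) = bef r f"
 by (intro ext; auto simp: restrict_to_def indicator_def)+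

lemma ip_split:
 assumes "f \<in> step_functions" "g \<in> step_functions"
 shows "ip f g = ip (bef r f) (bef r g) + ip (aft r f) (aft r g)"
proof -
 have orth: "ip (bef r f) (aft r g) = 0" if "f \<in> step_functions" "g \<in> step_functions" for f g :: "real => 'a"
 proof -
  have "(%t. cinner (bef r f t) (aft r g t)) = (%t. 0)" by (intro ext) (auto simp: restrict_to_def indicator_def)
  then show ?thesis using that by (simp add: L2_cinner step_sqi step_restrict_before step_restrict_after)
 qed
 have L: "L2_of f = L2_of (bef r f) + L2_of (aft r f)" if "f \<in> step_functions" for f :: "real => 'a"
  using L2_of_add[of "bef r f" "aft r f"] step_split[OF that, of r] that
  by (simp add: step_sqi step_restrict_before step_restrict_after)
 show ?thesis
  unfolding L[OF assms(1)] L[OF assms(2)] cinner_add_left cinner_add_right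
  using orth[OF assms] orth[OF assms(2,1)] cinner_commute[of "L2_of (aft r f)" "L2_of (bef r g)"] by simp
qed

lemma ip_shift:
 assumes "0 <= r" "f \<in> step_functions" "g \<in> step_functions"
 shows "ip (shift_fun r f) (shift_fun r g) = ip f g"
proof -
 have "ip (shift_fun r f) (shift_fun r g) = (LINT t|lborel. indicator {0..} t *\<^sub>R cinner (shift_fun r f t) (shift_fun r g t))"
  using assms by (simp add: L2_cinner step_sqi step_shift halfline_def integral_restrict_space)
 also have "\<dots> = (LINT t|lborel. indicator {0..} (r + 1 * t) *\<^sub>R cinner (shift_fun r f (r + 1 * t)) (shift_fun r g (r + 1 * t)))"
  by (subst lborel_integral_real_affine[of 1 _ r]) simp_all
 also have "\<dots> = (LINT t|lborel. indicator {0..} t *\<^sub>R cinner (f t) (g t))"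
  by (intro Bochner_Integration.integral_cong) (use assms(1) in \<open>auto simp: shift_fun_def indicator_def\<close>)
 also have "\<dots> = ip f g"
  using assms by (simp add: L2_cinner step_sqi halfline_def integral_restrict_space)
 finally show ?thesis .
qed

lemma ip_unshift:
 assumes "0 <= r" "f \<in> step_functions" "g \<in> step_functions"
 shows "ip (unshift_fun r f) (unshift_fun r g) = ip (aft r f) (aft r g)"
 using ip_shift[OF assms(1) step_unshift step_unshift, OF assms(2,3), of r r] by (simp add: shift_unshift)

lemma ip_bef_integral:
 assumes "f \<in> step_functions" "g \<in> step_functions" "0 <= s"
 shows "((%t. cinner (f t) (g t)) has_integral ip (bef s f) (bef s g)) {0..s}"
proof -
 let ?F = "%t. cinner (f t) (g t)"
 have st: "sqi (bef s f)" "sqi (bef s g)" using assms by (simp_all add: step_sqi step_restrict_before)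
 have eq: "(%t. indicator {0..} t *\<^sub>R cinner (bef s f t) (bef s g t)) = (%t. indicator {0..<s} t *\<^sub>R ?F t)"
  by (intro ext) (auto simp: restrict_to_def indicator_def)
 have int: "set_integrable lborel {0..<s} ?F"
  using sqi_cinner_integrable[OF st] unfolding set_integrable_def halfline_def
  by (simp add: integrable_restrict_space eq)
 have "ip (bef s f) (bef s g) = (LINT t:{0..<s}|lborel. ?F t)"
  unfolding L2_cinner[OF st] halfline_def set_lebesgue_integral_def
  by (simp add: integral_restrict_space eq)
 with set_borel_integral_eq_integral[OF int] have "(?F has_integral ip (bef s f) (bef s g)) {0..<s}"
  by (simp add: has_integral_integral)
 moreover have "{t \<in> {0..<s} - {0..s}. ?F t \<noteq> 0} = {}" "{t \<in> {0..s} - {0..<s}. ?F t \<noteq> 0} \<subseteq> {s}" by auto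
 ultimately show ?thesis
  by (subst (asm) has_integral_spike_set_eq[of _ "{0..s}"]) (auto intro: negligible_subset[OF negligible_sing])
qed

lemma coherent_split:
 assumes "f \<in> step_functions" "g \<in> step_functions"
 shows "cinner (\<varpi> f) (\<varpi> g) = cinner (\<varpi> (bef r f)) (\<varpi> (bef r g)) * cinner (\<varpi> (aft r f)) (\<varpi> (aft r g))"
 unfolding cinner_coherent ip_split[OF assms, of r] ip_split[OF assms(1,1), of r] ip_split[OF assms(2,2), of r]
 by (simp add: exp_add[symmetric] diff_divide_distrib add_divide_distrib algebra_simps)

lemma coherent_split_unshift:
 assumes "0 <= r" "f \<in> step_functions" "g \<in> step_functions"
 shows "cinner (\<varpi> f) (\<varpi> g) = cinner (\<varpi> (bef r f)) (\<varpi> (bef r g)) * cinner (\<varpi> (unshift_fun r f)) (\<varpi> (unshift_fun r g))"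
 using coherent_split[OF assms(2,3), of r] assms by (simp add: cinner_coherent ip_unshift)

lemma coherent_operator_exists:
 fixes psi :: "(real => 'k::complex_hilbert) => 'b::complex_hilbert"
 assumes "!!f g. f \<in> step_functions ==> g \<in> step_functions ==> cinner (psi f) (psi g) = cinner (\<varpi> f) (\<varpi> g)"
 shows "\<exists>!D. \<forall>f\<in>step_functions. D $ \<varpi> f = psi f" "!!D. \<forall>f\<in>step_functions. D $ \<varpi> f = psi f ==> D\<^sup>\<star> oo D = \<one>"
proof -
 show "D\<^sup>\<star> oo D = \<one>" if "\<forall>f\<in>step_functions. D $ \<varpi> f = psi f" for D
  by (rule total_bop_cinner_eqI[OF total_coherent total_coherent]) (use that assms in auto)
 have uniq: "D = D'" if "\<forall>f\<in>step_functions. D $ \<varpi> f = psi f" "\<forall>f\<in>step_functions. D' $ \<varpi> f = psi f" for D D'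
  by (rule total_bop_eqI[OF total_coherent]) (use that in auto)
 have "\<exists>D. \<forall>f\<in>step_functions. D $ \<varpi> f = psi f"
 proof (rule isometric_extension[of step_functions psi \<varpi>])
  fix R assume "!!f. f \<in> step_functions ==> R $ \<varpi> f = psi f"
  then show ?thesis by blast
 qed (rule assms)
 with uniq show "\<exists>!D. \<forall>f\<in>step_functions. D $ \<varpi> f = psi f" by blast
qed

lemma fock_split_gram:
 "f \<in> step_functions ==> g \<in> step_functions ==>
  cinner (\<varpi> (bef r f) \<otimes> \<varpi> (aft r f)) (\<varpi> (bef r g) \<otimes> \<varpi> (aft r g)) = cinner (\<varpi> f) (\<varpi> g)"
 by (simp only: cinner_tensor coherent_split[of f g r])

lemma fock_split_coherent: "f \<in> step_functions ==> fock_split r $ \<varpi> f = \<varpi> (bef r f) \<otimes> \<varpi> (aft r f)"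
 using theI'[OF coherent_operator_exists(1)[OF fock_split_gram, of r]] unfolding fock_split_def by blast

lemma fock_shift_gram:
 "0 <= r ==> f \<in> step_functions ==> g \<in> step_functions ==> cinner (\<varpi> (shift_fun r f)) (\<varpi> (shift_fun r g)) = cinner (\<varpi> f) (\<varpi> g)"
 by (simp add: cinner_coherent ip_shift)

lemma fock_shift_coherent: "0 <= r ==> f \<in> step_functions ==> fock_shift r $ \<varpi> f = \<varpi> (shift_fun r f)"
 using theI'[OF coherent_operator_exists(1)[OF fock_shift_gram, of r]] unfolding fock_shift_def by blast

lemma fock_shift_isometry: "0 <= r ==> (fock_shift r)\<^sup>\<star> oo fock_shift r = \<one>"
 by (rule coherent_operator_exists(2)[OF fock_shift_gram]) (auto intro: fock_shift_coherent)

text \<open>The splitting at time \<open>r\<close> with the future leg moved back to time 0, so that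
  operators on the whole Fock space can act on it.\<close>

definition past_future :: "real => ('k::complex_hilbert noise, ('k noise, 'k noise) tensor) bop" where
 "past_future r = (\<one> ox (fock_shift r)\<^sup>\<star>) oo fock_split r"

lemma past_future_coherent:
 assumes "0 <= r" "f \<in> step_functions"
 shows "past_future r $ \<varpi> f = \<varpi> (bef r f) \<otimes> \<varpi> (unshift_fun r f)"
proof -
 have "\<varpi> (aft r f) = fock_shift r $ \<varpi> (unshift_fun r f)"
  using fock_shift_coherent[OF assms(1) step_unshift[OF assms(2)]] by (simp add: shift_unshift)
 then show ?thesis
  by (simp add: past_future_def fock_split_coherent[OF assms(2)] isometry_adj[OF fock_shift_isometry[OF assms(1)]])
qed

lemma past_future_isometry: "0 <= r ==> (past_future r)\<^sup>\<star> oo past_future r = \<one>"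
 by (rule total_bop_cinner_eqI[OF total_coherent total_coherent])
  (auto simp: past_future_coherent cinner_tensor coherent_split_unshift[symmetric])

text \<open>The identity on the Fock space before \<open>r\<close>, tensored with \<open>z\<close>
  transported to the Fock space after \<open>r\<close>.\<close>

definition shifted :: "real => 'k::complex_hilbert noise operator => 'k noise operator" where
 "shifted r z = future_op r (fock_shift r oo z oo (fock_shift r)\<^sup>\<star>)"

lemma shifted_eq: "shifted r z = (past_future r)\<^sup>\<star> oo (\<one> ox z) oo past_future r"
proof -
 have eq: "\<one> ox (fock_shift r oo z oo (fock_shift r)\<^sup>\<star>) = (\<one> ox fock_shift r) oo (\<one> ox z) oo (\<one> ox (fock_shift r)\<^sup>\<star>)"
  by (simp add: tensor_op_comp)
 show ?thesis unfolding shifted_def future_op_def eq past_future_def by (simp add: tensor_op_adj comp_assoc)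
qed

lemma cinner_shifted:
 assumes "0 <= r" "f \<in> step_functions" "g \<in> step_functions"
 shows "cinner (\<varpi> f) (shifted r z $ \<varpi> g)
  = cinner (\<varpi> (bef r f)) (\<varpi> (bef r g)) * cinner (\<varpi> (unshift_fun r f)) (z $ \<varpi> (unshift_fun r g))"
 using assms by (simp add: shifted_eq past_future_coherent cinner_tensor)

text \<open>Compressing \<open>y\<close> to the future is the same as pulling it back along the
  shift and shifting again. Consequently \<open>future_algebra r\<close> is exactly the range of
  \<open>shifted r\<close>.\<close>

lemma future_op_shifted: "0 <= r ==> future_op r y = shifted r ((fock_shift r)\<^sup>\<star> oo y oo fock_shift r)"
proof (rule total_bop_cinner_eqI[OF total_coherent total_coherent])
 fix x x' :: "'a noise" assume r: "0 <= r" and "x \<in> \<varpi> ` step_functions" "x' \<in> \<varpi> ` step_functions"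
 then obtain f g where f: "f \<in> step_functions" "x = \<varpi> f" and g: "g \<in> step_functions" "x' = \<varpi> g" by blast
 have a: "\<varpi> (aft r f) = fock_shift r $ \<varpi> (unshift_fun r f)" if "f \<in> step_functions" for f :: "real => 'a"
  using fock_shift_coherent[OF r step_unshift[OF that]] by (simp add: shift_unshift)
 have "cinner x' (future_op r y $ x) = cinner (\<varpi> (bef r g)) (\<varpi> (bef r f)) * cinner (\<varpi> (aft r g)) (y $ \<varpi> (aft r f))"
  by (simp add: f g future_op_def fock_split_coherent cinner_tensor)
 also have "\<dots> = cinner x' (shifted r ((fock_shift r)\<^sup>\<star> oo y oo fock_shift r) $ x)"
  unfolding f g cinner_shifted[OF r g(1) f(1)] a[OF f(1)] a[OF g(1)] by simp
 finally show "cinner x' (future_op r y $ x) = cinner x' (shifted r ((fock_shift r)\<^sup>\<star> oo y oo fock_shift r) $ x)" .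
qed

lemma future_algebra_eq: "0 <= r ==> future_algebra r = range (shifted r)"
 unfolding future_algebra_def using future_op_shifted by (auto simp: shifted_def)

text \<open>Places the past of \<open>f\<close> in front of a vector moved to start at
  \<open>r\<close>. These isometries intertwine \<open>z\<close> with \<open>shifted r z\<close>,
  and since their ranges are jointly total, identities for \<open>shifted\<close> reduce to
  identities for \<open>z\<close>.\<close>

definition glue :: "real => (real => 'k::complex_hilbert) => 'k noise operator" where
 "glue r f = (past_future r)\<^sup>\<star> oo left_ket (\<varpi> (bef r f))"

lemma glue_coherent:
 assumes "0 <= r" "f \<in> step_functions" "h \<in> step_functions"
 shows "glue r f $ \<varpi> h = \<varpi> (conc r f h)"
proof -
 have "past_future r $ \<varpi> (conc r f h) = \<varpi> (bef r f) \<otimes> \<varpi> h"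
  using assms by (simp add: past_future_coherent conc_simps)
 then show ?thesis using isometry_adj[OF past_future_isometry[OF assms(1)], of "\<varpi> (conc r f h)"] by (simp add: glue_def)
qed

lemma glue_adj:
 assumes "0 <= r" "f \<in> step_functions" "g \<in> step_functions"
 shows "(glue r f)\<^sup>\<star> $ \<varpi> g = cinner (\<varpi> (bef r f)) (\<varpi> (bef r g)) *\<^sub>C \<varpi> (unshift_fun r g)"
proof (rule total_vec_eqI[OF total_coherent])
 fix x :: "'a noise" assume "x \<in> \<varpi> ` step_functions"
 then obtain h where h: "h \<in> step_functions" "x = \<varpi> h" by blast
 show "cinner x ((glue r f)\<^sup>\<star> $ \<varpi> g) = cinner x (cinner (\<varpi> (bef r f)) (\<varpi> (bef r g)) *\<^sub>C \<varpi> (unshift_fun r g))"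
  using assms h coherent_split_unshift[OF assms(1) conc_simps(1)[OF assms(1,2) h(1)] assms(3)]
  by (simp add: glue_coherent cinner_scaleC_right conc_simps)
qed

lemma shifted_glue:
 assumes "0 <= r" "f \<in> step_functions"
 shows "shifted r z oo glue r f = glue r f oo z"
proof (rule total_bop_eqI[OF total_coherent], rule total_vec_eqI[OF total_coherent])
 fix x y :: "'a noise" assume "x \<in> \<varpi> ` step_functions" "y \<in> \<varpi> ` step_functions"
 then obtain h g where h: "h \<in> step_functions" "x = \<varpi> h" and g: "g \<in> step_functions" "y = \<varpi> g" by blast
 have "cinner y ((glue r f oo z) $ x) = cinner ((glue r f)\<^sup>\<star> $ y) (z $ x)" by simp
 also have "\<dots> = cinner (\<varpi> (bef r g)) (\<varpi> (bef r f)) * cinner (\<varpi> (unshift_fun r g)) (z $ \<varpi> h)"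
  unfolding g(2) h(2) glue_adj[OF assms g(1)] cinner_scaleC_left using cinner_commute[of "\<varpi> (bef r g)" "\<varpi> (bef r f)"] by simp
 also have "\<dots> = cinner y ((shifted r z oo glue r f) $ x)"
  using assms g h by (simp add: glue_coherent cinner_shifted conc_simps)
 finally show "cinner y ((shifted r z oo glue r f) $ x) = cinner y ((glue r f oo z) $ x)" by simp
qed

text \<open>The projection onto the Fock space over \<open>[0, r[\<close>.\<close>

definition past_proj :: "real => 'k::complex_hilbert noise operator" where
 "past_proj r = (right_ket (\<varpi> (%_. 0)))\<^sup>\<star> oo past_future r"

lemma coherent_vacuum: "cinner (\<varpi> (%_. 0)) (\<varpi> (%_. 0)) = 1" "norm (\<varpi> (%_. 0)) = 1"
proof -
 show *: "cinner (\<varpi> (%_. 0)) (\<varpi> (%_. 0)) = 1" by (simp add: cinner_coherent)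
 show "norm (\<varpi> (%_. 0)) = 1"
  by (rule power2_eq_imp_eq) (simp_all add: norm_sq_Re *)
qed

lemma right_ket_adj: "(right_ket xi)\<^sup>\<star> $ (x \<otimes> y) = cinner xi y *\<^sub>C x"
 by (rule cinner_ext') (simp add: cinner_tensor cinner_scaleC_right mult.commute)

lemma past_proj_coherent:
 assumes "0 <= r" "f \<in> step_functions"
 shows "past_proj r $ \<varpi> f = cinner (\<varpi> (%_. 0)) (\<varpi> (unshift_fun r f)) *\<^sub>C \<varpi> (bef r f)"
 using assms by (simp add: past_proj_def past_future_coherent right_ket_adj)

lemma unshift_bef: "0 <= r ==> unshift_fun r (bef r f) = (%_. 0)"
 by (intro ext) (auto simp: unshift_fun_def restrict_to_def indicator_def)

lemma bef_zero [simp]: "bef r (%_. 0) = (%_. 0)"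
 by (simp add: restrict_to_def)

lemma past_proj_bef: "0 <= r ==> f \<in> step_functions ==> past_proj r $ \<varpi> (bef r f) = \<varpi> (bef r f)"
 by (simp add: past_proj_coherent step_restrict_before unshift_bef coherent_vacuum conc_simps)

lemma past_proj_vacuum: "0 <= r ==> past_proj r $ \<varpi> (%_. 0) = \<varpi> (%_. 0)"
 using past_proj_bef[of r "%_. 0"] step_zero by simp

lemma past_proj_mult: 
 assumes "0 <= r" "r <= s"
 shows "past_proj s oo past_proj r = past_proj r"
proof (rule total_bop_eqI[OF total_coherent])
 fix x :: "'a noise" assume "x \<in> \<varpi> ` step_functions"
 then obtain f where f: "f \<in> step_functions" "x = \<varpi> f" by blast
 have "past_proj s $ \<varpi> (bef r f) = \<varpi> (bef r f)"
  using past_proj_bef[of s "bef r f"] assms f by (simp add: bef_bef step_restrict_before)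
 then show "(past_proj s oo past_proj r) $ x = past_proj r $ x" using assms f by (simp add: past_proj_coherent)
qed

lemma past_proj_adj: "0 <= r ==> (past_proj r)\<^sup>\<star> = past_proj r"
proof (rule total_bop_cinner_eqI[OF total_coherent total_coherent])
 fix x y :: "'a noise" assume r: "0 <= r" and "x \<in> \<varpi> ` step_functions" "y \<in> \<varpi> ` step_functions"
 then obtain f g where f: "f \<in> step_functions" "x = \<varpi> f" and g: "g \<in> step_functions" "y = \<varpi> g" by blast
 have "cinner y ((past_proj r)\<^sup>\<star> $ x) = cnj (cinner (\<varpi> (%_. 0)) (\<varpi> (unshift_fun r g))) * cinner (\<varpi> (bef r g)) (\<varpi> f)"
  using r f g by (simp add: past_proj_coherent cinner_scaleC_left)
 also have "cinner (\<varpi> (bef r g)) (\<varpi> f) = cinner (\<varpi> (bef r g)) (\<varpi> (bef r f)) * cinner (\<varpi> (%_. 0)) (\<varpi> (unshift_fun r f))"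
  using coherent_split_unshift[OF r step_restrict_before[OF g(1)] f(1)] r by (simp add: conc_simps unshift_bef)
 also have "cnj (cinner (\<varpi> (%_. 0)) (\<varpi> (unshift_fun r g))) * (cinner (\<varpi> (bef r g)) (\<varpi> (bef r f)) * cinner (\<varpi> (%_. 0)) (\<varpi> (unshift_fun r f)))
   = cinner y (past_proj r $ x)"
  using r f g coherent_split_unshift[OF r g(1) step_restrict_before[OF f(1)]] cinner_commute[of "\<varpi> (unshift_fun r g)" "\<varpi> (%_. 0)"]
  by (simp add: past_proj_coherent cinner_scaleC_right conc_simps unshift_bef)
 finally show "cinner y ((past_proj r)\<^sup>\<star> $ x) = cinner y (past_proj r $ x)" .
qed

text \<open>Restricting to times before \<open>r + t\<close> keeps the past of \<open>r\<close>
  untouched and restricts the remainder to times before \<open>t\<close>. For \<open>t = 0\<close>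
  this displays \<open>past_proj r\<close> as a shifted operator, which is why it will commute with
  \<open>j r a\<close>.\<close>

lemma past_proj_shifted:
 assumes "0 <= r" "0 <= t"
 shows "past_proj (r + t) = shifted r (past_proj t)"
proof (rule total_bop_cinner_eqI[OF total_coherent total_coherent])
 fix x y :: "'a noise" assume "x \<in> \<varpi> ` step_functions" "y \<in> \<varpi> ` step_functions"
 then obtain f g where f: "f \<in> step_functions" "x = \<varpi> f" and g: "g \<in> step_functions" "y = \<varpi> g" by blast
 have 1: "unshift_fun t (unshift_fun r f) = unshift_fun (r + t) f"
  using assms by (intro ext) (auto simp: unshift_fun_def add_ac)
 have 2: "bef r (bef (r + t) f) = bef r f" by (rule bef_bef) (use assms in simp)
 have 3: "unshift_fun r (bef (r + t) f) = bef t (unshift_fun r f)"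
  using assms by (intro ext) (auto simp: unshift_fun_def restrict_to_def indicator_def)
 show "cinner y (past_proj (r + t) $ x) = cinner y (shifted r (past_proj t) $ x)"
  using assms f g coherent_split_unshift[OF assms(1) g(1) step_restrict_before[OF f(1)], of "r + t"]
  by (simp add: past_proj_coherent cinner_shifted cinner_scaleC_right step_unshift 1 2 3)
qed

subsection \<open>One-particle vectors\<close>

lemma sym_power_1_linear:
 "sym_power 1 (x + y) = sym_power 1 x + sym_power 1 y" "sym_power 1 (c *\<^sub>C x) = c *\<^sub>C sym_power 1 x"
 using symt_Cons_linear(1)[of x y "[]"] symt_Cons_linear(2)[of c x "[]"] by (simp_all add: sym_power_def)

lemma cinner_coherent_particle: "cinner (\<varpi> f) (sym_power 1 x) = cinner (\<varpi> f) (\<varpi> (%_. 0)) * cinner (L2_of f) x"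
proof -
 have "cinner (sym_power 1 x) (expv (L2_of f)) = cinner x (L2_of f)"
  using cinner_sym_power_expv[of 1 x "L2_of f"] by simp
 then have "cinner (expv (L2_of f)) (sym_power 1 x) = cinner (L2_of f) x"
  using cinner_commute[of "expv (L2_of f)" "sym_power 1 x"] cinner_commute[of x "L2_of f"] by simp
 moreover have "complex_of_real (exp (- (norm (L2_of f))\<^sup>2 / 2)) = cinner (\<varpi> f) (\<varpi> (%_. 0))"
  by (simp add: cinner_coherent cinner_self exp_of_real[symmetric])
 ultimately show ?thesis by (simp add: coherent_eq[of f] scaleR_scaleC cinner_scaleC_left)
qed

definition particle :: "real => 'k::complex_hilbert => 'k noise" where
 "particle t c = sym_power 1 (L2_of (restrict_to {0..<t} (%_. (1 / sqrt t) *\<^sub>R c)))"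

lemma particle_step: "0 <= t ==> restrict_to {0..<t} (%_. c) \<in> step_functions"
 using elem_step_in[of 0 t c] by (simp add: elem_step_def restrict_to_def)

lemma cinner_coherent_particle_t:
 assumes "0 < t" "f \<in> step_functions"
 shows "cinner (\<varpi> f) (particle t c) = cinner (\<varpi> f) (\<varpi> (%_. 0)) * ((1 / sqrt t) * integral {0..t} (%s. cinner (f s) c))"
proof -
 let ?g = "restrict_to {0..<t} (%_. (1 / sqrt t) *\<^sub>R c)"
 have g: "?g \<in> step_functions" using assms by (intro particle_step) simp
 have gg: "bef t ?g = ?g" using assms by (intro conc_simps) simp
 have a0: "aft t ?g = (%_. 0)" by (intro ext) (auto simp: restrict_to_def indicator_def)
 have z: "negligible {t}" by simp
 have "ip f ?g = ip (bef t f) (bef t ?g)"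
  using ip_split[OF assms(2) g, of t] by (simp only: a0 L2_of_zero cinner_zero_right add_0_right)
 also have "\<dots> = integral {0..t} (%s. cinner (f s) (?g s))"
  using ip_bef_integral[OF assms(2) g, of t] assms by (simp add: integral_unique)
 also have "\<dots> = integral {0..t} (%s. (1 / sqrt t) * cinner (f s) c)"
  by (rule integral_spike[OF z]) (auto simp: restrict_to_def scaleR_scaleC cinner_scaleC_right)
 also have "\<dots> = (1 / sqrt t) * integral {0..t} (%s. cinner (f s) c)" by (rule integral_mult_right)
 finally show ?thesis unfolding particle_def cinner_coherent_particle by simp
qed

lemma cinner_particle: "0 < t ==> cinner (particle t c) (particle t d) = cinner c d"
proof -
 assume t: "0 < t"
 let ?g = "%c. restrict_to {0..<t} (%_. (1 / sqrt t) *\<^sub>R c) :: real => 'a"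
 have g: "?g c \<in> step_functions" for c using t by (intro particle_step) simp
 have z: "negligible {t}" by simp
 have gg: "bef t (?g c) = ?g c" for c using t by (intro conc_simps) simp
 have s: "complex_of_real (sqrt t) * complex_of_real (sqrt t) = complex_of_real t" using t by (simp flip: of_real_mult)
 have "ip (?g c) (?g d) = integral {0..t} (%s. cinner (?g c s) (?g d s))"
  using ip_bef_integral[OF g[of c] g[of d], of t] t unfolding gg by (simp add: integral_unique)
 also have "\<dots> = integral {0..t} (%s. cinner c d / t)"
  by (rule integral_spike[OF z]) (use s in \<open>auto simp: restrict_to_def scaleR_scaleC cinner_scaleC_right cinner_scaleC_left divide_inverse mult_ac simp flip: inverse_mult_distrib\<close>)
 also have "\<dots> = cinner c d" using t by (simp add: scaleR_conv_of_real)
 finally show ?thesis unfolding particle_def cinner_sym_power by simp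
qed

lemma one_particle_apply:
 fixes c :: "'k::complex_hilbert" and u :: "'h::complex_hilbert"
 assumes "0 < t"
 shows "one_particle t $ (c \<otimes> u) = u \<otimes> particle t c"
  "(one_particle t)\<^sup>\<star> oo (one_particle t :: (('k, 'h) tensor, ('h, 'k noise) tensor) bop) = \<one>"
proof -
 let ?P = "%V :: (('k, 'h) tensor, ('h, 'k noise) tensor) bop. \<forall>c u. V $ (c \<otimes> u) = u \<otimes> particle t c"
 have "\<exists>V. ?P V"
 proof (rule isometric_extension[of UNIV "%(c, u). u \<otimes> particle t c" "%(c :: 'k, u :: 'h). c \<otimes> u"])
  fix V :: "(('k, 'h) tensor, ('h, 'k noise) tensor) bop"
  assume V: "!!p. p \<in> UNIV ==> V $ (case p of (c, u) => c \<otimes> u) = (case p of (c, u) => u \<otimes> particle t c)"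
  have "?P V" using V[of "(_, _)"] by simp
  then show ?thesis by blast
 qed (use assms in \<open>auto simp: cinner_tensor cinner_particle mult.commute\<close>)
 moreover have "V = V'" if "?P V" "?P V'" for V V'
  by (rule tensor_bop_eqI) (simp add: that)
 ultimately have "\<exists>!V. ?P V" by blast
 from theI'[OF this] have *: "one_particle t $ (c \<otimes> u) = u \<otimes> particle t c" for c :: 'k and u :: 'h
  unfolding one_particle_def particle_def by blast
 then show "one_particle t $ (c \<otimes> u) = u \<otimes> particle t c" .
 show "(one_particle t)\<^sup>\<star> oo (one_particle t :: (('k, 'h) tensor, ('h, 'k noise) tensor) bop) = \<one>"
  by (rule tensor_bop_eqI, rule tensor_eqI) (use assms in \<open>simp add: * cinner_tensor cinner_particle mult.commute\<close>)
qed

section \<open>Von Neumann algebras\<close>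

lemma vna_mem: "von_neumann_algebra A ==> a \<in> A \<longleftrightarrow> (\<forall>b\<in>commutant A. a oo b = b oo a)"
 unfolding von_neumann_algebra_def commutant_def by blast

lemma comp_add_distrib:
 "R oo (S + T) = R oo S + R oo T" "(S + T) oo Q = S oo Q + T oo Q"
 "R oo (c *\<^sub>C S) = c *\<^sub>C (R oo S)" "(c *\<^sub>C S) oo Q = c *\<^sub>C (S oo Q)"
 "R oo 0 = 0" "0 oo Q = 0"
 by (rule bop_eqI; simp)+

lemma commutant_adj: "(!!a. a \<in> A ==> a\<^sup>\<star> \<in> A) ==> b \<in> commutant A ==> b\<^sup>\<star> \<in> commutant A"
proof -
 assume A: "!!a. a \<in> A ==> a\<^sup>\<star> \<in> A" and b: "b \<in> commutant A"
 have "b\<^sup>\<star> oo a = a oo b\<^sup>\<star>" if "a \<in> A" for a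
 proof -
  have "b oo a\<^sup>\<star> = a\<^sup>\<star> oo b" using b A[OF that] unfolding commutant_def by blast
  from arg_cong[OF this, of adj] show ?thesis by simp
 qed
 then show ?thesis unfolding commutant_def by blast
qed

lemma vna_star_algebra:
 assumes A: "von_neumann_algebra A"
 shows "star_algebra A"
proof -
 have com: "a oo c oo b = b oo (a oo c)" if "a oo b = b oo a" "c oo b = b oo c" for a b c :: "'a operator"
  using that by (metis comp_assoc)
 have mem: "a oo b = b oo a" if "a \<in> A" "b \<in> commutant A" for a b using vna_mem[OF A] that by blast
 show ?thesis
  unfolding star_algebra_def csub_def
 proof (intro conjI ballI allI)
  show "0 \<in> A" "\<one> \<in> A" unfolding vna_mem[OF A] by (simp_all add: comp_add_distrib)
  show "x + y \<in> A" if "x \<in> A" "y \<in> A" for x y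
   unfolding vna_mem[OF A] using mem[OF that(1)] mem[OF that(2)] by (simp add: comp_add_distrib)
  show "c *\<^sub>C x \<in> A" if "x \<in> A" for c x
   unfolding vna_mem[OF A] using mem[OF that] by (simp add: comp_add_distrib)
  show "x oo y \<in> A" if "x \<in> A" "y \<in> A" for x y
   unfolding vna_mem[OF A] using com mem that by blast
  show "x\<^sup>\<star> \<in> A" if "x \<in> A" for x using A that unfolding von_neumann_algebra_def by blast
 qed
qed

lemma vna_closed:
 assumes "von_neumann_algebra A"
 shows "closedin uw_top A"
proof -
 have "closedin uw_top {a. a oo b = b oo a}" for b :: "'a operator"
  by (rule closedin_uw_eq[OF uw_continuous_right uw_continuous_left])
 moreover have eq: "A = \<Inter> ((%b. {a. a oo b = b oo a}) ` commutant A)"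
  using vna_mem[OF assms] by auto
 moreover have "commutant A \<noteq> {}" unfolding commutant_def by (auto intro!: exI[of _ \<one>])
 ultimately show ?thesis by (subst eq, intro closedin_Inter) auto
qed

lift_definition ketbra :: "'b::complex_hilbert => 'a::complex_hilbert => ('a, 'b) bop" is "%x y z. cinner y z *\<^sub>C x"
proof -
 fix x :: 'b and y :: 'a
 have "bounded_linear (%z. cinner y z *\<^sub>C x)"
 proof (rule bounded_linear_intro[where K = "norm y * norm x"])
  show "norm (cinner y z *\<^sub>C x) <= norm z * (norm y * norm x)" for z
   using mult_right_mono[OF cinner_cauchy_schwarz[of y z] norm_ge_zero[of x]] by (simp add: norm_scaleC mult_ac)
 qed (simp_all add: cinner_add_right scaleC_add_left scaleR_scaleC cinner_scaleC_right scaleC_scaleC)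
 then show "bounded_linear (%z. cinner y z *\<^sub>C x) \<and> (\<forall>c z. cinner y (c *\<^sub>C z) *\<^sub>C x = c *\<^sub>C (cinner y z *\<^sub>C x))"
  by (simp add: cinner_scaleC_right scaleC_scaleC)
qed

declare ketbra.rep_eq [simp]

lemma right_ket_comp: "right_ket xi oo a oo (right_ket eta)\<^sup>\<star> = a ox ketbra xi eta"
 by (rule tensor_bop_eqI) (simp add: right_ket_adj tensor_bilinear)

subsection \<open>Frames\<close>

text \<open>The dilation theorem, applied to the scalar action of the complex numbers on
  \<open>'f\<close>, embeds \<open>'f\<close> isometrically into a direct sum of copies of the
  scalars. Pulling back the coordinate vectors yields a Parseval frame, which serves wherever an
  orthonormal basis would.\<close>

lemma frame_exists:
 obtains e :: "'f::complex_hilbert \<times> nat => 'f" where "!!x y. ((%i. cinner x (e i) * cinner (e i) y) has_sum cinner x y) UNIV"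
proof -
 define j :: "complex operator => 'f operator" where "j T = (T $ 1) *\<^sub>C \<one>" for T
 have T1: "T $ z = z * (T $ 1)" for T :: "complex operator" and z
  using bop_arith(5)[of T z 1] by (simp add: scaleC_complex_def)
 have T1s: "T\<^sup>\<star> $ 1 = cnj (T $ 1)" for T :: "complex operator"
  using cinner_adj[of T 1 1] by (metis cinner_complex_def complex_cnj_cnj complex_cnj_one mult.right_neutral mult_1)
 interpret normal_hom "UNIV :: complex operator set" j
 proof
  show "star_algebra (UNIV :: complex operator set)" by (simp add: star_algebra_def csub_def)
  show "star_hom_on UNIV j"
   unfolding star_hom_on_def linear_map_on_def
  proof (intro conjI ballI allI)
   show "j (a + b) = j a + j b" for a b by (rule bop_eqI) (simp add: j_def scaleC_add_left)
   show "j (c *\<^sub>C a) = c *\<^sub>C j a" for c a by (simp add: j_def scaleC_complex_def)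
   show "j (a oo b) = j a oo j b" for a b
    by (rule bop_eqI) (use T1[of a "b $ 1"] in \<open>simp add: j_def scaleC_scaleC mult.commute\<close>)
   show "j (a\<^sup>\<star>) = (j a)\<^sup>\<star>" for a by (simp add: j_def T1s)
  qed
  show "normal_map_on UNIV j"
   unfolding normal_map_on_def subtopology_UNIV continuous_map_uw_iff
  proof (intro allI impI)
   fix u v :: "nat => 'f" assume uv: "l2fam u" "l2fam v"
   have "uwf u v (j T) = cinner (cnj (uwf u v \<one>)) (T $ 1)" for T
    unfolding j_def uwf_scaleC[OF uv] by (simp add: cinner_complex_def mult.commute)
   then show "continuous_map uw_top euclidean (%T. uwf u v (j T))"
    using cinner_uw_continuous by simp
  qed
  show "j \<one> = \<one>" by (simp add: j_def)
 qed
 obtain W :: "('f, (complex, 'f \<times> nat) dsum) bop" where W: "W\<^sup>\<star> oo W = \<one>" using dilation by blast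
 define e where "e i = W\<^sup>\<star> $ (inc i $ 1)" for i
 have c: "coord i (W $ x) = cinner (e i) x" for i x
 proof -
  have "cinner (e i) x = cinner 1 (coord i (W $ x))" by (simp add: e_def)
  then show ?thesis by (simp add: cinner_complex_def del: cinner_adj2)
 qed
 have "((%i. cinner x (e i) * cinner (e i) y) has_sum cinner x y) UNIV" for x y
 proof -
  have "((%i. cinner (coord i (W $ x)) (coord i (W $ y))) has_sum cinner x y) UNIV"
   using parseval[of "W $ x" "W $ y"] by (simp only: isometry_cinner[OF W])
  then show ?thesis unfolding c using cinner_commute[of x] by (simp add: cinner_complex_def)
 qed
 then show thesis by (rule that)
qed

text \<open>Expanding the second leg in the frame embeds the tensor product into a direct sum of
  copies of the first leg and turns \<open>T ox \<one>\<close> into \<open>amp T\<close>. Ultraweak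
  facts about amplifications thereby carry over to tensor products.\<close>

lemma tensor_frame:
 obtains R :: "(('h::complex_hilbert, 'f::complex_hilbert) tensor, ('h, 'f \<times> nat) dsum) bop" and e
 where "R\<^sup>\<star> oo R = \<one>" "!!T. R oo (T ox \<one>) = amp T oo R" "!!i. (inc i)\<^sup>\<star> oo R = (right_ket (e i))\<^sup>\<star>"
proof -
 obtain e :: "'f \<times> nat => 'f" where e: "!!x y. ((%i. cinner x (e i) * cinner (e i) y) has_sum cinner x y) UNIV"
  by (rule frame_exists) (rule that)
 have cn: "cinner x (e i) * cinner (e i) y = cnj (cinner (e i) x) * cinner (e i) y" for x i y
  using cinner_commute[of x "e i"] by simp
 have l2: "l2fam (%i. cinner (e i) y *\<^sub>C (x::'h))" for x y
 proof -
  have "((%i. Re (cinner y (e i) * cinner (e i) y)) has_sum Re (cinner y y)) UNIV" by (rule has_sum_Re[OF e])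
  moreover have "Re (cinner y (e i) * cinner (e i) y) = (cmod (cinner (e i) y))\<^sup>2" for i
   unfolding cn by (simp add: cmod_power2) (simp add: power2_eq_square)
  ultimately have "(%i. (cmod (cinner (e i) y))\<^sup>2) summable_on UNIV" by (simp add: has_sum_imp_summable)
  from summable_on_cmult_left[OF this, of "(norm x)\<^sup>2"] show ?thesis by (simp add: l2fam_def norm_scaleC power_mult_distrib)
 qed
 define Z where "Z x y = (SOME zeta. \<forall>i. coord i zeta = cinner (e i) y *\<^sub>C (x::'h))" for x y
 have Z: "coord i (Z x y) = cinner (e i) y *\<^sub>C x" for x y i
 proof -
  have "\<exists>zeta. \<forall>i. coord i zeta = cinner (e i) y *\<^sub>C x" using dsum_exists[OF l2[of y x]] by blast
  from someI_ex[OF this] show ?thesis unfolding Z_def by blast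
 qed
 have gram: "cinner (Z x y) (Z x' y') = cinner (x \<otimes> y) (x' \<otimes> y')" for x x' y y'
 proof -
  have "((%i. cinner (coord i (Z x y)) (coord i (Z x' y'))) has_sum cinner (Z x y) (Z x' y')) UNIV" by (rule parseval)
  moreover have "((%i. cinner (coord i (Z x y)) (coord i (Z x' y'))) has_sum cinner y y' * cinner x x') UNIV"
   using has_sum_cmult_left[OF e[of y y'], of "cinner x x'"]
   unfolding Z cinner_scaleC_left cinner_scaleC_right cn by (simp add: mult_ac)
  ultimately have "cinner (Z x y) (Z x' y') = cinner y y' * cinner x x'" by (rule has_sum_unique)
  then show ?thesis by (simp add: cinner_tensor mult.commute)
 qed
 have "\<exists>R. \<forall>x y. R $ (x \<otimes> y) = Z x y"
 proof (rule isometric_extension[of UNIV "%(x, y). Z x y" "%(x, y). x \<otimes> y"])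
  fix R assume R: "!!p. p \<in> UNIV ==> R $ (case p of (x, y) => x \<otimes> y) = (case p of (x, y) => Z x y)"
  have "R $ (x \<otimes> y) = Z x y" for x y using R[of "(x, y)"] by simp
  then show ?thesis by blast
 qed (auto simp: gram)
 then obtain R where R: "!!x y. R $ (x \<otimes> y) = Z x y" by blast
 show thesis
 proof (rule that[of R e])
  show "R\<^sup>\<star> oo R = \<one>"
   by (rule tensor_bop_eqI, rule tensor_eqI) (simp add: R gram)
  show "R oo (T ox \<one>) = amp T oo R" for T
   by (rule tensor_bop_eqI, rule dsum_eqI) (simp add: R Z)
  show "(inc i)\<^sup>\<star> oo R = (right_ket (e i))\<^sup>\<star>" for i
   by (rule tensor_bop_eqI) (simp add: R Z right_ket_adj)
 qed
qed

lemma uw_continuous_tensor_one: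
 "continuous_map uw_top uw_top (%T :: 'h::complex_hilbert operator. T ox (\<one> :: 'f::complex_hilbert operator))"
proof -
 obtain R :: "(('h, 'f) tensor, ('h, 'f \<times> nat) dsum) bop" and e
  where R: "R\<^sup>\<star> oo R = \<one>" "!!T. R oo (T ox \<one>) = amp T oo R" "!!i. (inc i)\<^sup>\<star> oo R = (right_ket (e i))\<^sup>\<star>"
  by (rule tensor_frame) (rule that)
 have "T ox \<one> = R\<^sup>\<star> oo amp T oo R" for T
 proof -
  have "R\<^sup>\<star> oo (R oo (T ox \<one>)) = R\<^sup>\<star> oo (amp T oo R)" unfolding R(2) ..
  then show ?thesis by (simp add: comp_assoc[symmetric] R(1))
 qed
 then show ?thesis
  using continuous_map_compose[OF uw_continuous_amp uw_continuous_sandwich[of "R\<^sup>\<star>" R]] by (simp add: o_def)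
qed

subsection \<open>Tensor products with the algebra of all bounded operators\<close>

text \<open>The commutant of the ampliated commutant of \<open>A\<close>. By
  \<open>mult_alg_eq\<close> it is \<open>A\<close> tensored with all bounded operators, but
  membership is tested by mere commutation.\<close>

definition mult_alg :: "'h::complex_hilbert operator set => ('h, 'f::complex_hilbert) tensor operator set" where
 "mult_alg A = {X. \<forall>b\<in>commutant A. X oo (b ox \<one>) = (b ox \<one>) oo X}"

lemma right_ket_tensor: "(b ox \<one>) oo right_ket xi = right_ket xi oo b"
 by (rule bop_eqI) simp

lemma slice_mem:
 fixes X :: "('h::complex_hilbert, 'f::complex_hilbert) tensor operator"
 assumes A: "von_neumann_algebra A" and X: "X \<in> mult_alg A"
 shows "(right_ket xi)\<^sup>\<star> oo X oo right_ket eta \<in> A"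
 unfolding vna_mem[OF A]
proof
 fix b assume b: "b \<in> commutant A"
 have "(right_ket xi)\<^sup>\<star> oo (b ox \<one>) = b oo (right_ket xi)\<^sup>\<star>"
  by (rule tensor_bop_eqI) (simp add: right_ket_adj)
 then have 1: "b oo (right_ket xi)\<^sup>\<star> = (right_ket xi)\<^sup>\<star> oo (b ox \<one>)" by simp
 have 2: "X oo (b ox \<one>) = (b ox \<one>) oo X" using X b unfolding mult_alg_def by blast
 have "(right_ket xi)\<^sup>\<star> oo X oo right_ket eta oo b = (right_ket xi)\<^sup>\<star> oo (X oo (b ox \<one>)) oo right_ket eta"
  by (simp add: comp_assoc right_ket_tensor)
 also have "\<dots> = b oo ((right_ket xi)\<^sup>\<star> oo X oo right_ket eta)"
  unfolding 2 by (simp add: comp_assoc[symmetric] 1)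
 finally show "(right_ket xi)\<^sup>\<star> oo X oo right_ket eta oo b = b oo ((right_ket xi)\<^sup>\<star> oo X oo right_ket eta)" .
qed

lemma simple_mem_mult_alg:
 assumes "a \<in> A"
 shows "a ox z \<in> mult_alg A"
proof -
 have "a oo b = b oo a" if "b \<in> commutant A" for b using that assms unfolding commutant_def by auto
 then show ?thesis by (simp add: mult_alg_def tensor_op_comp)
qed

lemma closedin_mult_alg: "closedin uw_top (mult_alg A)"
proof -
 have "closedin uw_top {X. X oo (b ox \<one>) = (b ox \<one>) oo X}" for b :: "'a operator"
  by (rule closedin_uw_eq[OF uw_continuous_right uw_continuous_left])
 moreover have eq: "mult_alg A = \<Inter> ((%b. {X. X oo (b ox \<one>) = (b ox \<one>) oo X}) ` commutant A)"
  unfolding mult_alg_def by auto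
 moreover have "commutant A \<noteq> {}" unfolding commutant_def by (auto intro!: exI[of _ \<one>])
 ultimately show ?thesis by (subst eq, intro closedin_Inter) auto
qed

lemma csub_mult_alg: "csub (mult_alg A)"
 by (auto simp: csub_def mult_alg_def comp_add_distrib)

lemma mult_alg_adj:
 assumes A: "von_neumann_algebra A" and X: "X \<in> mult_alg A"
 shows "X\<^sup>\<star> \<in> mult_alg A"
proof -
 have "X\<^sup>\<star> oo (b ox \<one>) = (b ox \<one>) oo X\<^sup>\<star>" if "b \<in> commutant A" for b
 proof -
  have "b\<^sup>\<star> \<in> commutant A" by (rule commutant_adj[OF _ that]) (use A in \<open>auto simp: von_neumann_algebra_def\<close>)
  then have "X oo (b\<^sup>\<star> ox \<one>) = (b\<^sup>\<star> ox \<one>) oo X" using X unfolding mult_alg_def by blast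
  from arg_cong[OF this, of adj] show ?thesis by (simp add: tensor_op_adj)
 qed
 then show ?thesis by (simp add: mult_alg_def)
qed

text \<open>The operators \<open>P J\<close> are finite coordinate projections of the direct sum,
  compressed by \<open>R\<close>: contractions tending weakly to the identity. So \<open>Y\<close>
  is the ultraweak limit of \<open>Y oo P J\<close>, and membership in a closed subspace can be
  checked one frame vector at a time.\<close>

lemma frame_approx:
 fixes e :: "'i => 'f::complex_hilbert" and V :: "(('h::complex_hilbert, 'f) tensor, 'g::complex_hilbert) bop set"
  and R :: "(('h, 'f) tensor, ('h, 'i) dsum) bop"
 assumes R: "R\<^sup>\<star> oo R = \<one>" "!!i. (inc i)\<^sup>\<star> oo R = (right_ket (e i))\<^sup>\<star>"
  and V: "closedin uw_top V" "csub V" and Y: "!!i. Y oo right_ket (e i) oo (right_ket (e i))\<^sup>\<star> \<in> V"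
 shows "Y \<in> V"
proof -
 define P where "P J = (\<Sum>i\<in>J. right_ket (e i) oo (right_ket (e i))\<^sup>\<star> :: ('h, 'f) tensor operator)" for J
 have rk: "right_ket (e i) = R\<^sup>\<star> oo inc i" for i using arg_cong[OF R(2)[of i], of adj] by simp
 have Papp: "P J $ x = R\<^sup>\<star> $ (\<Sum>i\<in>J. inc i $ coord i (R $ x))" for J x
 proof (induction J rule: infinite_finite_induct)
  case (insert i J)
  then have "P (insert i J) = right_ket (e i) oo (right_ket (e i))\<^sup>\<star> + P J" by (simp add: P_def)
  with insert show ?case by (simp add: rk)
 qed (simp_all add: P_def)
 have Pn: "norm (P J $ x) <= norm x" if "finite J" for J x
 proof -
  have "norm (R\<^sup>\<star> $ y) <= 1 * norm y" for y
   by (rule adj_norm_le) (simp_all add: isometry_norm[OF R(1)])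
  then have "norm (P J $ x) <= norm (\<Sum>i\<in>J. inc i $ coord i (R $ x))" unfolding Papp by simp
  also have "\<dots> <= norm (R $ x)"
   by (rule power2_le_imp_le) (simp_all add: norm_sum_inc[OF that] coord_bessel[OF that] del: cinner_adj2)
  finally show ?thesis by (simp add: isometry_norm[OF R(1)])
 qed
 have lim: "limitin uw_top (%J. Y oo P J) Y (finite_subsets_at_top UNIV)"
 proof (rule limitin_uw_bounded[where K = "opnorm Y"])
  show "\<forall>\<^sub>F J in finite_subsets_at_top UNIV. \<forall>x. norm ((Y oo P J) $ x) <= opnorm Y * norm x"
  proof (rule eventually_finite_subsets_at_top_weakI, intro allI)
   fix J :: "'i set" and x assume "finite J"
   have "norm (Y $ (P J $ x)) <= opnorm Y * norm (P J $ x)" by (rule opnorm)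
   also have "\<dots> <= opnorm Y * norm x" by (intro mult_left_mono Pn[OF \<open>finite J\<close>]) simp
   finally show "norm ((Y oo P J) $ x) <= opnorm Y * norm x" by simp
  qed
  fix x y
  let ?x = "Y\<^sup>\<star> $ x"
  have "((%i. cinner (coord i (R $ ?x)) (coord i (R $ y))) has_sum cinner (R $ ?x) (R $ y)) UNIV" by (rule parseval)
  then have "((%J. \<Sum>i\<in>J. cinner (coord i (R $ ?x)) (coord i (R $ y))) \<longlongrightarrow> cinner ?x y) (finite_subsets_at_top UNIV)"
   unfolding has_sum_def isometry_cinner[OF R(1)] .
  moreover have "cinner x ((Y oo P J) $ y) = (\<Sum>i\<in>J. cinner (coord i (R $ ?x)) (coord i (R $ y)))" for J
  proof -
   have "cinner x ((Y oo P J) $ y) = cinner ?x (P J $ y)" by simp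
   also have "\<dots> = cinner (R $ ?x) (\<Sum>i\<in>J. inc i $ coord i (R $ y))" unfolding Papp by (simp del: cinner_adj)
   also have "\<dots> = (\<Sum>i\<in>J. cinner (coord i (R $ ?x)) (coord i (R $ y)))"
    unfolding cinner_sum_right by (intro sum.cong refl) (rule cinner_adj[symmetric])
   finally show ?thesis .
  qed
  ultimately show "((%J. cinner x ((Y oo P J) $ y)) \<longlongrightarrow> cinner x (Y $ y)) (finite_subsets_at_top UNIV)"
   by simp
 qed
 have mem: "Y oo P J \<in> V" if "finite J" for J
  using that
 proof (induction J)
  case empty
  then show ?case using V(2) by (simp add: P_def comp_add_distrib csub_def)
 next
  case (insert i J)
  then have "Y oo P (insert i J) = Y oo right_ket (e i) oo (right_ket (e i))\<^sup>\<star> + Y oo P J"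
   by (simp add: P_def comp_add_distrib comp_assoc)
  then show ?case using Y[of i] insert V(2) unfolding csub_def by metis
 qed
 show ?thesis
  by (rule limitin_closedin[OF lim V(1)]) (auto intro: eventually_finite_subsets_at_top_weakI mem)
qed

lemma uw_continuous_adj: "continuous_map uw_top uw_top adj"
 unfolding continuous_map_uw_iff
proof (intro allI impI)
 fix u :: "nat => 'a" and v :: "nat => 'b" assume uv: "l2fam u" "l2fam v"
 have "uwf u v (T\<^sup>\<star>) = cnj (uwf v u T)" for T :: "('a, 'b) bop"
 proof -
  have "cinner (u i) (T\<^sup>\<star> $ v i) = cnj (cinner (v i) (T $ u i))" for i
   using cinner_commute[of "T $ u i" "v i"] by simp
  then show ?thesis unfolding uwf_def by (simp only: infsum_cnj)
 qed
 moreover have "continuous_map euclidean euclidean cnj"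
  unfolding continuous_map_iff_continuous2 by (intro continuous_intros)
 from continuous_map_compose[OF uwf_continuous[OF uv(2,1)] this]
 have "continuous_map uw_top euclidean (%T :: ('a, 'b) bop. cnj (uwf v u T))" by (simp add: o_def)
 ultimately show "continuous_map uw_top euclidean (%T :: ('a, 'b) bop. uwf u v (T\<^sup>\<star>))"
  by simp
qed

text \<open>One inclusion holds because \<open>mult_alg A\<close> is a closed subspace. For the
  other, \<open>frame_approx\<close> is applied on the right of \<open>X\<close> and, after taking
  adjoints, on the left; what remains is a slice of \<open>X\<close>, an element of
  \<open>A\<close>, tensored with a rank one operator.\<close>

lemma mult_alg_eq:
 fixes A :: "'h::complex_hilbert operator set"
 assumes A: "von_neumann_algebra A"
 shows "A \<otimes>\<^sub>w UNIV = (mult_alg A :: ('h, 'f::complex_hilbert) tensor operator set)"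
proof
 let ?S = "{a ox b | a (b :: 'f operator). a \<in> A \<and> b \<in> UNIV}"
 show "A \<otimes>\<^sub>w (UNIV :: 'f operator set) \<subseteq> mult_alg A"
  unfolding uw_tensor_eq
  by (rule uwspan_closed[OF closedin_mult_alg csub_mult_alg]) (auto intro: simple_mem_mult_alg)
 obtain R :: "(('h, 'f) tensor, ('h, 'f \<times> nat) dsum) bop" and e
  where R: "R\<^sup>\<star> oo R = \<one>" "!!T. R oo (T ox \<one>) = amp T oo R" "!!i. (inc i)\<^sup>\<star> oo R = (right_ket (e i))\<^sup>\<star>"
  by (rule tensor_frame) (rule that)
 let ?r = "%i. right_ket (e i) :: ('h, ('h, 'f) tensor) bop"
 have closed: "closedin uw_top (uwspan ?S)" unfolding uwspan_def by simp
 show "mult_alg A \<subseteq> A \<otimes>\<^sub>w (UNIV :: 'f operator set)"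
  unfolding uw_tensor_eq
 proof
  fix X :: "('h, 'f) tensor operator" assume X: "X \<in> mult_alg A"
  show "X \<in> uwspan ?S"
  proof (rule frame_approx[OF R(1,3) closed csub_uwspan])
   fix j
   let ?V = "{T. T\<^sup>\<star> \<in> uwspan ?S}"
   have "closedin uw_top {T \<in> topspace uw_top. T\<^sup>\<star> \<in> uwspan ?S}"
    by (rule closedin_continuous_map_preimage[OF uw_continuous_adj closed])
   then have cV: "closedin uw_top ?V" by simp
   have sV: "csub ?V" using csub_uwspan[of ?S] unfolding csub_def by simp
   have "(X oo ?r j oo (?r j)\<^sup>\<star>)\<^sup>\<star> \<in> ?V"
   proof (rule frame_approx[OF R(1,3) cV sV])
    fix i
    let ?a = "(?r i)\<^sup>\<star> oo X oo ?r j"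
    have "((X oo ?r j oo (?r j)\<^sup>\<star>)\<^sup>\<star> oo ?r i oo (?r i)\<^sup>\<star>)\<^sup>\<star> = ?r i oo ?a oo (?r j)\<^sup>\<star>"
     by (simp add: comp_assoc)
    also have "\<dots> = ?a ox ketbra (e i) (e j)" by (rule right_ket_comp)
    also have "\<dots> \<in> uwspan ?S" using slice_mem[OF A X] uwspan_superset[of ?S] by blast
    finally show "(X oo ?r j oo (?r j)\<^sup>\<star>)\<^sup>\<star> oo ?r i oo (?r i)\<^sup>\<star> \<in> ?V" by simp
   qed
   then show "X oo ?r j oo (?r j)\<^sup>\<star> \<in> uwspan ?S" by simp
  qed
 qed
qed

section \<open>The cocycle property\<close>

lemma total_pairs: "ctotal ((%(u, f). u \<otimes> \<varpi> f) ` ((UNIV :: 'h::complex_hilbert set) \<times> (step_functions :: (real => 'k::complex_hilbert) set)))"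
proof -
 have "(%(u, f). u \<otimes> \<varpi> f) ` ((UNIV :: 'h set) \<times> (step_functions :: (real => 'k) set)) = {u \<otimes> \<varpi> f | u f. f \<in> step_functions}" by auto
 then show ?thesis using total_tensor_coherent[where 'h = 'h and 'k = 'k] by (simp only:)
qed

lemma coherent_bop_eqI:
 assumes "!!u f. f \<in> step_functions ==> S $ (u \<otimes> \<varpi> f) = T $ (u \<otimes> \<varpi> f)"
 shows "S = T"
 by (rule total_bop_eqI[OF total_tensor_coherent]) (use assms in auto)

lemma coherent_vec_eqI:
 assumes "!!u f. f \<in> step_functions ==> cinner (u \<otimes> \<varpi> f) x = cinner (u \<otimes> \<varpi> f) y"
 shows "x = y"
 by (rule total_vec_eqI[OF total_tensor_coherent]) (use assms in auto)

lemma coherent_op_eqI: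
 assumes "!!u v f g. f \<in> step_functions ==> g \<in> step_functions ==> cinner (v \<otimes> \<varpi> g) (S $ (u \<otimes> \<varpi> f)) = cinner (v \<otimes> \<varpi> g) (T $ (u \<otimes> \<varpi> f))"
 shows "S = T"
 by (intro coherent_bop_eqI coherent_vec_eqI assms)

lemma uwspan_subtopology_compose:
 assumes "continuous_map (subtopology X S) (subtopology Y T) f" "continuous_map (subtopology Y T) Z g"
 shows "continuous_map (subtopology X S) Z (%x. g (f x))"
 using continuous_map_compose[OF assms] by (simp add: o_def)

lemma tensor_isometry_exists:
 fixes psi :: "'h::complex_hilbert => (real => 'k::complex_hilbert) => 'b::complex_hilbert"
 assumes "!!u v f g. f \<in> step_functions ==> g \<in> step_functions ==> cinner (psi u f) (psi v g) = cinner u v * cinner (\<varpi> f) (\<varpi> g)"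
 shows "\<exists>K. (\<forall>u. \<forall>f\<in>step_functions. K $ (u \<otimes> \<varpi> f) = psi u f) \<and> K\<^sup>\<star> oo K = \<one>"
proof (rule isometric_extension[of "UNIV \<times> step_functions" "%(u, f). psi u f" "%(u, f). u \<otimes> \<varpi> f"])
 fix K assume K: "!!p. p \<in> UNIV \<times> step_functions ==> K $ (case p of (u, f) => u \<otimes> \<varpi> f) = (case p of (u, f) => psi u f)"
  "ctotal ((%(u, f). u \<otimes> \<varpi> f) ` ((UNIV :: 'h set) \<times> (step_functions :: (real => 'k) set))) ==> K\<^sup>\<star> oo K = \<one>"
 have "K $ (u \<otimes> \<varpi> f) = psi u f" if "f \<in> step_functions" for u f using K(1)[of "(u, f)"] that by simp
 then show ?thesis using K(2)[OF total_pairs] by blast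
qed (auto simp: assms cinner_tensor)

lemma shifted_one: "0 <= r ==> shifted r \<one> = \<one>"
 by (simp add: shifted_eq tensor_op_one past_future_isometry)

lemma shifted_adj: "(shifted r z)\<^sup>\<star> = shifted r (z\<^sup>\<star>)"
 by (simp add: shifted_eq tensor_op_adj comp_assoc)

lemma shifted_coherent:
 "0 <= r ==> f \<in> step_functions ==> shifted r z $ \<varpi> f = glue r f $ (z $ \<varpi> (unshift_fun r f))"
 using arg_cong[OF shifted_glue[of r f z], of "%T. T $ \<varpi> (unshift_fun r f)"]
 by (simp add: glue_coherent step_unshift conc_simps)

lemma shifted_mult: "0 <= r ==> shifted r (y oo z) = shifted r y oo shifted r z"
proof (rule total_bop_eqI[OF total_coherent])
 fix x :: "'a noise" assume r: "0 <= r" and "x \<in> \<varpi> ` step_functions"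
 then obtain f where f: "f \<in> step_functions" "x = \<varpi> f" by blast
 have "shifted r y $ (glue r f $ xi) = glue r f $ (y $ xi)" for xi
  using arg_cong[OF shifted_glue[OF r f(1), of y], of "%T. T $ xi"] by simp
 then show "shifted r (y oo z) $ x = (shifted r y oo shifted r z) $ x"
  using r f by (simp add: shifted_coherent)
qed

lemma glue_isometry: "0 <= r ==> f \<in> step_functions ==> (glue r f)\<^sup>\<star> oo glue r f = \<one>"
proof (rule total_bop_cinner_eqI[OF total_coherent total_coherent])
 fix x y :: "'a noise" assume r: "0 <= r" "f \<in> step_functions" and "x \<in> \<varpi> ` step_functions" "y \<in> \<varpi> ` step_functions"
 then obtain h g where h: "h \<in> step_functions" "x = \<varpi> h" and g: "g \<in> step_functions" "y = \<varpi> g" by blast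
 have "cinner (\<varpi> (bef r f)) (\<varpi> (bef r f)) = 1" by (simp add: cinner_coherent)
 then show "cinner y (((glue r f)\<^sup>\<star> oo glue r f) $ x) = cinner y (\<one> $ x)"
  using r h g coherent_split_unshift[OF r(1) conc_simps(1)[OF r g(1)] conc_simps(1)[OF r h(1)]]
  by (simp add: glue_coherent conc_simps)
qed

text \<open>The shift is spatial: \<open>K\<close> moves the past into a separate leg, and
  \<open>sg X\<close> lets \<open>X\<close> act on the rest. Multiplicativity follows because
  \<open>sg X\<close> is intertwined with \<open>X\<close> by the isometries \<open>C f\<close>,
  whose ranges span the space; compression by the one with vacuum past is the inverse.\<close>

lemma noise_shift_exists:
 fixes A :: "'h::complex_hilbert operator set"
 assumes A: "von_neumann_algebra A" and r: "0 <= r"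
 shows "\<exists>sg :: ('h, 'k::complex_hilbert noise) tensor operator => ('h, 'k noise) tensor operator. is_noise_shift A r sg"
proof -
 have "\<exists>K. (\<forall>u. \<forall>f\<in>step_functions. K $ (u \<otimes> \<varpi> f) = ((u::'h) \<otimes> \<varpi> (unshift_fun r f)) \<otimes> \<varpi> (bef r (f :: real => 'k))) \<and> K\<^sup>\<star> oo K = \<one>"
  by (rule tensor_isometry_exists) (simp add: cinner_tensor coherent_split_unshift[OF r])
 then obtain K :: "(('h, 'k noise) tensor, (('h, 'k noise) tensor, 'k noise) tensor) bop"
  where K: "!!u f. f \<in> step_functions ==> K $ (u \<otimes> \<varpi> f) = (u \<otimes> \<varpi> (unshift_fun r f)) \<otimes> \<varpi> (bef r f)"
   and Kiso: "K\<^sup>\<star> oo K = \<one>" by blast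
 define sg where "sg X = K\<^sup>\<star> oo (X ox \<one>) oo K" for X
 have sgm: "cinner (v \<otimes> \<varpi> g) (sg X $ (u \<otimes> \<varpi> f)) = cinner (v \<otimes> \<varpi> (unshift_fun r g)) (X $ (u \<otimes> \<varpi> (unshift_fun r f))) * cinner (\<varpi> (bef r g)) (\<varpi> (bef r f))"
  if "f \<in> step_functions" "g \<in> step_functions" for u v f g X
  using that by (simp add: sg_def K cinner_tensor)
 define C where "C f = (\<one> :: 'h operator) ox glue r (f :: real => 'k)" for f
 have sgC: "sg X oo C f = C f oo X" if f: "f \<in> step_functions" for X f
 proof (rule coherent_op_eqI)
  fix u v and h g :: "real => 'k" assume h: "h \<in> step_functions" and g: "g \<in> step_functions"
  have Cadj: "(C f)\<^sup>\<star> $ (v \<otimes> \<varpi> g) = cinner (\<varpi> (bef r f)) (\<varpi> (bef r g)) *\<^sub>C (v \<otimes> \<varpi> (unshift_fun r g))"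
   by (simp add: C_def tensor_op_adj glue_adj[OF r f g] tensor_bilinear)
  have "cinner (v \<otimes> \<varpi> g) ((C f oo X) $ (u \<otimes> \<varpi> h)) = cinner ((C f)\<^sup>\<star> $ (v \<otimes> \<varpi> g)) (X $ (u \<otimes> \<varpi> h))" by simp
  also have "\<dots> = cinner (\<varpi> (bef r g)) (\<varpi> (bef r f)) * cinner (v \<otimes> \<varpi> (unshift_fun r g)) (X $ (u \<otimes> \<varpi> h))"
   unfolding Cadj cinner_scaleC_left using cinner_commute[of "\<varpi> (bef r g)" "\<varpi> (bef r f)"] by simp
  also have "\<dots> = cinner (v \<otimes> \<varpi> g) ((sg X oo C f) $ (u \<otimes> \<varpi> h))"
   using r f g h by (simp add: C_def glue_coherent sgm conc_simps)
  finally show "cinner (v \<otimes> \<varpi> g) ((sg X oo C f) $ (u \<otimes> \<varpi> h)) = cinner (v \<otimes> \<varpi> g) ((C f oo X) $ (u \<otimes> \<varpi> h))" by simp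
 qed
 have sgC': "sg X $ (C f $ xi) = C f $ (X $ xi)" if "f \<in> step_functions" for X f xi
  using arg_cong[OF sgC[OF that, of X], of "%T. T $ xi"] by simp
 have Cu: "u \<otimes> \<varpi> f = C f $ (u \<otimes> \<varpi> (unshift_fun r f))" if "f \<in> step_functions" for u f
  using that r by (simp add: C_def glue_coherent step_unshift conc_simps)
 have mult: "sg (X oo Y) = sg X oo sg Y" for X Y
  by (rule coherent_bop_eqI) (simp add: Cu sgC')
 have Ciso: "(C f)\<^sup>\<star> oo C f = \<one>" if "f \<in> step_functions" for f
  using glue_isometry[OF r that] by (simp add: C_def tensor_op_adj tensor_op_comp tensor_op_one)
 define tau where "tau Y = (C (%_. 0))\<^sup>\<star> oo Y oo C (%_. 0)" for Y
 have tausg: "tau (sg X) = X" for X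
  unfolding tau_def comp_assoc sgC[OF step_zero] by (simp add: comp_assoc[symmetric] Ciso[OF step_zero])
 have sgs: "sg (a ox z) = a ox shifted r z" for a z
  by (rule coherent_op_eqI) (simp add: sgm cinner_tensor cinner_shifted[OF r])
 have add: "sg (X + Y) = sg X + sg Y" and scale: "sg (c *\<^sub>C X) = c *\<^sub>C sg X" for X Y c
  by (rule coherent_op_eqI; simp add: sgm cinner_add_right cinner_scaleC_right distrib_right)+
 have cont: "continuous_map uw_top uw_top sg"
  using continuous_map_compose[OF uw_continuous_tensor_one uw_continuous_sandwich[of "K\<^sup>\<star>" K]]
  by (simp add: o_def sg_def[abs_def])
 have conttau: "continuous_map uw_top uw_top tau"
  unfolding tau_def[abs_def] by (rule uw_continuous_sandwich)
 have addtau: "tau (X + Y) = tau X + tau Y" and scaletau: "tau (c *\<^sub>C X) = c *\<^sub>C tau X" for X Y c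
  by (simp_all add: tau_def comp_add_distrib)
 let ?S = "{a ox b | a (b :: 'k noise operator). a \<in> A \<and> b \<in> UNIV}"
 let ?R = "{a ox b | a (b :: 'k noise operator). a \<in> A \<and> b \<in> future_algebra r}"
 have span: "phi ` complex_span S \<subseteq> complex_span R"
  if "!!x y. phi (x + y) = phi x + phi y" "!!c x. phi (c *\<^sub>C x) = c *\<^sub>C phi x" "phi ` S \<subseteq> R"
  for phi :: "('h, 'k noise) tensor operator => ('h, 'k noise) tensor operator" and S R
 proof -
  have "phi 0 = 0" using that(2)[of 0 0] by simp
  then have "csub {x. phi x \<in> complex_span R}" using csub_complex_span[of R] that(1,2) unfolding csub_def by auto
  then have "complex_span S \<subseteq> {x. phi x \<in> complex_span R}"
   by (rule complex_span_subset) (use that(3) complex_span_superset[of R] in auto)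
  then show ?thesis by blast
 qed
 have S1: "sg ` ?S \<subseteq> ?R"
 proof
  fix y assume "y \<in> sg ` ?S"
  then obtain a b where "a \<in> A" "y = a ox shifted r b" using sgs by blast
  then show "y \<in> ?R" unfolding future_algebra_eq[OF r] by blast
 qed
 have im1: "sg ` uwspan ?S \<subseteq> uwspan ?R"
  by (rule uwspan_map_subset[OF continuous_map_from_subtopology[OF cont] span[OF add scale S1]])
 have taus: "tau (a ox shifted r z) = a ox z" for a z
  using tausg[of "a ox z"] by (simp add: sgs)
 have S2: "tau ` ?R \<subseteq> ?S"
  unfolding future_algebra_eq[OF r] using taus by blast
 have im2: "tau ` uwspan ?R \<subseteq> uwspan ?S"
  by (rule uwspan_map_subset[OF continuous_map_from_subtopology[OF conttau] span[OF addtau scaletau S2]])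
 \<comment> \<open>Both sides are normal and linear, and they agree on the generators
   \<open>a ox shifted r z\<close>.\<close>
 have sgtau: "sg (tau Y) = Y" if "Y \<in> uwspan ?R" for Y
 proof (rule uwspan_eqI[where phi = "%Y. sg (tau Y)" and psi = "%Y. Y", OF _ _ _ _ csub_uwspan _ that])
  show "continuous_map (subtopology uw_top (uwspan ?R)) uw_top (%Y. sg (tau Y))"
   using continuous_map_compose[OF conttau cont] by (intro continuous_map_from_subtopology) (simp add: o_def)
  show "continuous_map (subtopology uw_top (uwspan ?R)) uw_top (%Y. Y)"
   using continuous_map_id[unfolded id_def] by (rule continuous_map_from_subtopology)
 qed (auto simp: linear_map_on_def add scale addtau scaletau taus sgs future_algebra_eq[OF r])
 have "is_noise_shift A r sg"
  unfolding is_noise_shift_def uw_tensor_eq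
 proof (intro conjI)
  show "star_hom_on (uwspan ?S) sg"
   unfolding star_hom_on_def linear_map_on_def
   by (simp add: add scale mult) (simp add: sg_def tensor_op_adj comp_assoc)
  show "normal_map_on (uwspan ?S) sg"
   unfolding normal_map_on_def by (rule continuous_map_from_subtopology[OF cont])
  show "bij_betw sg (uwspan ?S) (uwspan ?R)"
   by (rule bij_betw_byWitness[where f' = tau]) (use tausg sgtau im1 im2 in auto)
  show "\<forall>a\<in>A. \<forall>z. sg (a ox z) = a ox future_op r (fock_shift r oo z oo (fock_shift r)\<^sup>\<star>)"
   by (simp add: sgs shifted_def)
 qed
 then show ?thesis by blast
qed

section \<open>The flow, its dilations and the endomorphisms \<open>J r\<close>\<close>

locale flow =
 fixes A :: "'h::complex_hilbert operator set"
  and j :: "real => 'h operator => ('h, 'k::complex_hilbert noise) tensor operator"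
 assumes vna: "von_neumann_algebra A" and qs_flow: "qs_flow A j"
begin

abbreviation M :: "('h, 'k noise) tensor operator set" where "M \<equiv> mult_alg A"

lemma normal_hom: "0 <= t ==> normal_hom A (j t)"
 using qs_flow vna_star_algebra[OF vna] unfolding qs_flow_def qs_cocycle_def normal_hom_def by auto

lemma j_zero: "a \<in> A ==> j 0 a = a ox \<one>"
 using qs_flow unfolding qs_flow_def qs_cocycle_def by blast

lemma j_uw_continuous: "a \<in> A ==> continuous_map (top_of_set {0..}) uw_top (%t. j t a)"
 using qs_flow unfolding qs_flow_def by blast

lemma process: "a \<in> A ==> process_in A (%t. j t a)"
 using qs_flow unfolding qs_flow_def qs_cocycle_def process_on_def by blast

lemma cinner_coherent_slice: "cinner v (coherent_slice f g X $ u) = cinner (v \<otimes> \<varpi> f) (X $ (u \<otimes> \<varpi> g))"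
 by (simp add: coherent_slice_def)

lemma j_adapted:
 assumes "0 <= t" "a \<in> A" "f \<in> step_functions" "g \<in> step_functions"
 shows "cinner (v \<otimes> \<varpi> f) (j t a $ (u \<otimes> \<varpi> g))
  = cinner (\<varpi> (unshift_fun t f)) (\<varpi> (unshift_fun t g)) * cinner (v \<otimes> \<varpi> (bef t f)) (j t a $ (u \<otimes> \<varpi> (bef t g)))"
proof -
 have "coherent_slice f g (j t a) = cinner (\<varpi> (aft t f)) (\<varpi> (aft t g)) *\<^sub>C coherent_slice (bef t f) (bef t g) (j t a)"
  using process[OF assms(2)] assms unfolding process_in_def by blast
 moreover have "cinner (\<varpi> (aft t f)) (\<varpi> (aft t g)) = cinner (\<varpi> (unshift_fun t f)) (\<varpi> (unshift_fun t g))"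
  using assms by (simp add: cinner_coherent ip_unshift)
 ultimately show ?thesis
  unfolding cinner_coherent_slice[symmetric] by (simp add: cinner_scaleC_right)
qed

lemma j_mult_alg:
 assumes "0 <= t" "a \<in> A"
 shows "j t a \<in> M"
 unfolding mult_alg_def
proof (intro CollectI ballI)
 fix b assume b: "b \<in> commutant A"
 show "j t a oo (b ox \<one>) = (b ox \<one>) oo j t a"
 proof (rule coherent_op_eqI)
  fix u v and f g :: "real => 'k" assume fg: "f \<in> step_functions" "g \<in> step_functions"
  have "coherent_slice g f (j t a) \<in> A" using process[OF assms(2)] assms fg unfolding process_in_def by blast
  then have "coherent_slice g f (j t a) oo b = b oo coherent_slice g f (j t a)" using vna_mem[OF vna] b by blast
  then have "cinner v (coherent_slice g f (j t a) $ (b $ u)) = cinner v (b $ (coherent_slice g f (j t a) $ u))"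
   by (metis bop_comp.rep_eq)
  then have "cinner v (coherent_slice g f (j t a) $ (b $ u)) = cinner (b\<^sup>\<star> $ v) (coherent_slice g f (j t a) $ u)"
   by (simp only: cinner_adj)
  then show "cinner (v \<otimes> \<varpi> g) ((j t a oo (b ox \<one>)) $ (u \<otimes> \<varpi> f)) = cinner (v \<otimes> \<varpi> g) (((b ox \<one>) oo j t a) $ (u \<otimes> \<varpi> f))"
   unfolding cinner_coherent_slice using cinner_adj[of "b ox \<one>" "v \<otimes> \<varpi> g" "j t a $ (u \<otimes> \<varpi> f)"]
   by (simp add: tensor_op_adj del: cinner_adj)
 qed
qed

definition dil :: "real => (('h, 'k noise) tensor, ('h, ('h, 'k noise) tensor \<times> nat) dsum) bop" where
 "dil r = (SOME W. W\<^sup>\<star> oo W = \<one> \<and> (\<forall>a\<in>A. W oo j r a = amp a oo W))"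

lemma dil: "0 <= r ==> (dil r)\<^sup>\<star> oo dil r = \<one>" "0 <= r ==> a \<in> A ==> dil r oo j r a = amp a oo dil r"
 using someI_ex[OF normal_hom.dilation[OF normal_hom[of r]]] unfolding dil_def by blast+

lemma dil_cinner: "0 <= r ==> a \<in> A ==> cinner (dil r $ x) (amp a $ (dil r $ y)) = cinner x (j r a $ y)"
 using arg_cong[OF dil(2)[of r a], of "%T. T $ y"] isometry_cinner[OF dil(1), of r x "j r a $ y"] by simp

text \<open>Applies the dilation of \<open>j r\<close> to the past and carries the future, moved
  back to time 0, as the noise leg of every copy. Then \<open>amp X\<close> acts with
  \<open>X\<close> on each copy of initial space and future together.\<close>

definition conn :: "real => (('h, 'k noise) tensor, (('h, 'k noise) tensor, ('h, 'k noise) tensor \<times> nat) dsum) bop" where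
 "conn r = (SOME K. (\<forall>u. \<forall>f\<in>step_functions. K $ (u \<otimes> \<varpi> f) = amp (right_ket (\<varpi> (unshift_fun r f))) $ (dil r $ (u \<otimes> \<varpi> (bef r f)))) \<and> K\<^sup>\<star> oo K = \<one>)"

lemma amp_adj_comp: "cinner (amp S $ zeta) (amp T $ zeta') = cinner zeta (amp (S\<^sup>\<star> oo T) $ zeta')"
 by (simp add: amp_simps amp_adj)

lemma right_ket_adj_comp: "(right_ket xi)\<^sup>\<star> oo right_ket eta = cinner xi eta *\<^sub>C \<one>"
 by (rule bop_eqI) (simp add: right_ket_adj)

lemma conn:
 assumes r: "0 <= r"
 shows "f \<in> step_functions ==> conn r $ (u \<otimes> \<varpi> f) = amp (right_ket (\<varpi> (unshift_fun r f))) $ (dil r $ (u \<otimes> \<varpi> (bef r f)))"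
  "(conn r)\<^sup>\<star> oo conn r = \<one>"
proof -
 have "\<exists>K. (\<forall>u. \<forall>f\<in>step_functions. K $ (u \<otimes> \<varpi> f) = amp (right_ket (\<varpi> (unshift_fun r f))) $ (dil r $ (u \<otimes> \<varpi> (bef r f)))) \<and> K\<^sup>\<star> oo K = \<one>"
 proof (rule tensor_isometry_exists)
  fix u v and f g :: "real => 'k" assume "f \<in> step_functions" "g \<in> step_functions"
  then show "cinner (amp (right_ket (\<varpi> (unshift_fun r f))) $ (dil r $ (u \<otimes> \<varpi> (bef r f)))) (amp (right_ket (\<varpi> (unshift_fun r g))) $ (dil r $ (v \<otimes> \<varpi> (bef r g))))
   = cinner u v * cinner (\<varpi> f) (\<varpi> g)"
   unfolding amp_adj_comp right_ket_adj_comp amp_simps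
   by (simp add: cinner_scaleC_right isometry_cinner[OF dil(1)[OF r]] cinner_tensor coherent_split_unshift[OF r, of f g])
 qed
 from someI_ex[OF this] show "f \<in> step_functions ==> conn r $ (u \<otimes> \<varpi> f) = amp (right_ket (\<varpi> (unshift_fun r f))) $ (dil r $ (u \<otimes> \<varpi> (bef r f)))"
  "(conn r)\<^sup>\<star> oo conn r = \<one>" unfolding conn_def by blast+
qed

text \<open>The endomorphisms \<open>J\<^sub>r\<close>: the composition of the shift with the ampliation of \<open>j\<^sub>r\<close>.\<close>

definition J :: "real => ('h, 'k noise) tensor operator => ('h, 'k noise) tensor operator" where
 "J r X = (conn r)\<^sup>\<star> oo amp X oo conn r"

lemma J_simps: "J r (X + Y) = J r X + J r Y" "J r (c *\<^sub>C X) = c *\<^sub>C J r X" "J r (X\<^sup>\<star>) = (J r X)\<^sup>\<star>"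
 by (simp_all add: J_def amp_simps amp_adj comp_add_distrib comp_assoc)

lemma J_uw_continuous: "continuous_map uw_top uw_top (J r)"
 using continuous_map_compose[OF uw_continuous_amp uw_continuous_sandwich[of "(conn r)\<^sup>\<star>" "conn r"]]
 by (simp add: o_def J_def[abs_def])

lemma cinner_J_dil:
 assumes "0 <= r" "f \<in> step_functions" "g \<in> step_functions"
 shows "cinner (v \<otimes> \<varpi> g) (J r X $ (u \<otimes> \<varpi> f))
  = cinner (dil r $ (v \<otimes> \<varpi> (bef r g))) (amp (coherent_slice (unshift_fun r g) (unshift_fun r f) X) $ (dil r $ (u \<otimes> \<varpi> (bef r f))))"
proof -
 have "cinner (v \<otimes> \<varpi> g) (J r X $ (u \<otimes> \<varpi> f)) = cinner (conn r $ (v \<otimes> \<varpi> g)) (amp X $ (conn r $ (u \<otimes> \<varpi> f)))"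
  by (simp add: J_def)
 also have "\<dots> = cinner (amp (right_ket (\<varpi> (unshift_fun r g))) $ (dil r $ (v \<otimes> \<varpi> (bef r g))))
   (amp (X oo right_ket (\<varpi> (unshift_fun r f))) $ (dil r $ (u \<otimes> \<varpi> (bef r f))))"
  by (simp add: conn(1) assms amp_simps)
 finally show ?thesis unfolding amp_adj_comp by (simp add: coherent_slice_def comp_assoc)
qed

lemma cinner_J:
 assumes "0 <= r" "f \<in> step_functions" "g \<in> step_functions" "coherent_slice (unshift_fun r g) (unshift_fun r f) X \<in> A"
 shows "cinner (v \<otimes> \<varpi> g) (J r X $ (u \<otimes> \<varpi> f))
  = cinner (v \<otimes> \<varpi> (bef r g)) (j r (coherent_slice (unshift_fun r g) (unshift_fun r f) X) $ (u \<otimes> \<varpi> (bef r f)))"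
 using assms by (simp add: cinner_J_dil dil_cinner)

lemma A_simps:
 "a \<in> A ==> b \<in> A ==> a + b \<in> A" "a \<in> A ==> c *\<^sub>C a \<in> A" "a \<in> A ==> b \<in> A ==> a oo b \<in> A"
 "a \<in> A ==> a\<^sup>\<star> \<in> A" "\<one> \<in> A" "0 \<in> A"
 using vna_star_algebra[OF vna] unfolding star_algebra_def csub_def by blast+

lemma j_simps:
 assumes "0 <= t"
 shows "a \<in> A ==> b \<in> A ==> j t (a + b) = j t a + j t b" "a \<in> A ==> j t (c *\<^sub>C a) = c *\<^sub>C j t a"
 "a \<in> A ==> b \<in> A ==> j t (a oo b) = j t a oo j t b" "a \<in> A ==> j t (a\<^sup>\<star>) = (j t a)\<^sup>\<star>" "j t \<one> = \<one>"
 using normal_hom.j_simps[OF normal_hom[OF assms]] normal_hom.unital[OF normal_hom[OF assms]] by auto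

text \<open>Adaptedness concerns coherent futures only. For fixed pasts both sides are bounded
  linear in the future vector \<open>psi\<close>, so the factorisation extends by totality.\<close>

lemma j_glue:
 assumes r: "0 <= r" and a: "a \<in> A" and f: "f \<in> step_functions" and g: "g \<in> step_functions"
 shows "cinner (v \<otimes> \<varpi> g) (j r a $ (u \<otimes> (glue r f $ psi)))
  = cinner (\<varpi> (unshift_fun r g)) psi * cinner (v \<otimes> \<varpi> (bef r g)) (j r a $ (u \<otimes> \<varpi> (bef r f)))"
proof -
 let ?c = "cinner (v \<otimes> \<varpi> (bef r g)) (j r a $ (u \<otimes> \<varpi> (bef r f)))"
 let ?y = "(glue r f)\<^sup>\<star> $ ((left_ket u)\<^sup>\<star> $ ((j r a)\<^sup>\<star> $ (v \<otimes> \<varpi> g)))"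
 have "?y = cnj ?c *\<^sub>C \<varpi> (unshift_fun r g)"
 proof (rule total_vec_eqI[OF total_coherent])
  fix x :: "'k noise" assume "x \<in> \<varpi> ` step_functions"
  then obtain h where h: "h \<in> step_functions" "x = \<varpi> h" by blast
  have "cinner ?y x = cinner (v \<otimes> \<varpi> g) (j r a $ (u \<otimes> \<varpi> (conc r f h)))"
   using r f h by (simp add: glue_coherent del: cinner_adj2)
  also have "\<dots> = cinner (\<varpi> (unshift_fun r g)) (\<varpi> h) * ?c"
   using j_adapted[OF r a g conc_simps(1)[OF r f h(1)]] r h by (simp add: conc_simps)
  finally have "cinner x ?y = cnj (cinner (\<varpi> (unshift_fun r g)) (\<varpi> h) * ?c)"
   using cinner_commute[of x ?y] by simp
  then show "cinner x ?y = cinner x (cnj ?c *\<^sub>C \<varpi> (unshift_fun r g))"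
   using cinner_commute[of "\<varpi> h" "\<varpi> (unshift_fun r g)"] h by (simp add: cinner_scaleC_right mult.commute)
 qed
 then have "cinner ?y psi = ?c * cinner (\<varpi> (unshift_fun r g)) psi" by (simp add: cinner_scaleC_left del: cinner_adj cinner_adj2)
 moreover have "cinner ?y psi = cinner (v \<otimes> \<varpi> g) (j r a $ (u \<otimes> (glue r f $ psi)))" by (simp del: cinner_adj2)
 ultimately show ?thesis by simp
qed

lemma J_simple:
 assumes "0 <= r" "a \<in> A"
 shows "J r (a ox z) = j r a oo (\<one> ox shifted r z)"
proof (rule coherent_op_eqI)
 fix u v and f g :: "real => 'k" assume f: "f \<in> step_functions" and g: "g \<in> step_functions"
 let ?c = "cinner (\<varpi> (unshift_fun r g)) (z $ \<varpi> (unshift_fun r f))"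
 have s: "coherent_slice (unshift_fun r g) (unshift_fun r f) (a ox z) = ?c *\<^sub>C a"
  by (rule bop_cinner_eqI) (simp add: cinner_coherent_slice cinner_tensor cinner_scaleC_right mult.commute)
 have "cinner (v \<otimes> \<varpi> g) (J r (a ox z) $ (u \<otimes> \<varpi> f)) = ?c * cinner (v \<otimes> \<varpi> (bef r g)) (j r a $ (u \<otimes> \<varpi> (bef r f)))"
  using cinner_J[OF assms(1) f g, of "a ox z" v u] assms by (simp add: s A_simps j_simps cinner_scaleC_right)
 also have "\<dots> = cinner (v \<otimes> \<varpi> g) (j r a $ (u \<otimes> (glue r f $ (z $ \<varpi> (unshift_fun r f)))))"
  by (simp only: j_glue[OF assms f g])
 finally show "cinner (v \<otimes> \<varpi> g) (J r (a ox z) $ (u \<otimes> \<varpi> f)) = cinner (v \<otimes> \<varpi> g) ((j r a oo (\<one> ox shifted r z)) $ (u \<otimes> \<varpi> f))"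
  by (simp add: shifted_coherent[OF assms(1) f])
qed

lemma J_one_simple: "0 <= r ==> J r (\<one> ox z) = \<one> ox shifted r z"
 using J_simple[OF _ A_simps(5), of r z] by (simp add: j_simps)

lemma J_j: "0 <= r ==> a \<in> A ==> J r (a ox \<one>) = j r a"
 by (simp add: J_simple shifted_one tensor_op_one)

text \<open>The map \<open>J r\<close> respects adjoints; applied to the adjoint of
  \<open>a ox z\<close>, the formula for simple tensors produces the factors in the opposite
  order.\<close>

lemma j_shifted_commute:
 assumes "0 <= r" "a \<in> A"
 shows "j r a oo (\<one> ox shifted r z) = (\<one> ox shifted r z) oo j r a"
proof -
 have "J r (a ox z) = (J r (a\<^sup>\<star> ox z\<^sup>\<star>))\<^sup>\<star>" by (simp add: J_simps[symmetric] tensor_op_adj)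
 also have "\<dots> = (\<one> ox shifted r z) oo j r a"
  using assms by (simp add: J_simple A_simps tensor_op_adj shifted_adj j_simps)
 finally show ?thesis using assms by (simp add: J_simple)
qed

text \<open>A multiplicative-domain argument. For \<open>X = a ox z\<close> the factors of
  \<open>J r X\<close> commute, so \<open>J r\<close> is multiplicative on
  \<open>X\<^sup>\<star> oo X\<close>; this makes the squared distance between
  \<open>conn r $ (J r X $ xi)\<close> and \<open>amp X $ (conn r $ xi)\<close> expand to zero, that
  is, the compression loses nothing.\<close>

lemma conn_intertwines_simple:
 assumes r: "0 <= r" and a: "a \<in> A"
 shows "conn r oo J r (a ox z) = amp (a ox z) oo conn r"
proof (rule bop_eqI)
 fix xi
 let ?X = "a ox z" and ?K = "conn r"
 have J2: "J r (?X\<^sup>\<star> oo ?X) = (J r ?X)\<^sup>\<star> oo J r ?X"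
 proof -
  have "J r (?X\<^sup>\<star> oo ?X) = j r (a\<^sup>\<star> oo a) oo (\<one> ox shifted r (z\<^sup>\<star> oo z))"
   using r a by (simp add: tensor_op_adj tensor_op_comp J_simple A_simps)
  also have "\<dots> = j r (a\<^sup>\<star> oo a) oo (\<one> ox shifted r (z\<^sup>\<star>)) oo (\<one> ox shifted r z)"
   using r by (simp add: shifted_mult tensor_op_comp comp_assoc)
  also have "j r (a\<^sup>\<star> oo a) oo (\<one> ox shifted r (z\<^sup>\<star>)) = (\<one> ox shifted r (z\<^sup>\<star>)) oo j r (a\<^sup>\<star> oo a)"
   using r a by (intro j_shifted_commute A_simps)
  finally show ?thesis
   using r a by (simp add: J_simple j_simps A_simps tensor_op_adj shifted_adj comp_assoc)
 qed
 let ?y = "J r ?X $ xi" and ?z = "amp ?X $ (?K $ xi)"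
 have 1: "(norm ?z)\<^sup>2 = (norm ?y)\<^sup>2"
 proof -
  have "cinner ?z ?z = cinner xi (J r (?X\<^sup>\<star> oo ?X) $ xi)"
   unfolding amp_adj_comp by (simp add: J_def)
  then show ?thesis unfolding norm_sq_Re J2 by simp
 qed
 have 2: "cinner (?K $ ?y) ?z = cinner ?y ?y"
  by (simp add: J_def)
 have "(norm (?K $ ?y - ?z))\<^sup>2 = 0"
  unfolding norm_sq_diff 1 2 isometry_norm[OF conn(2)[OF r]] by (simp add: norm_sq_Re)
 then show "(?K oo J r ?X) $ xi = (amp ?X oo ?K) $ xi" by simp
qed

lemma conn_intertwines:
 assumes r: "0 <= r" and X: "X \<in> M"
 shows "conn r oo J r X = amp X oo conn r"
proof (rule uwspan_eqI[where S = "{a ox b | a (b :: 'k noise operator). a \<in> A \<and> b \<in> UNIV}" and phi = "%X. conn r oo J r X" and psi = "%X. amp X oo conn r"])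
 let ?S = "{a ox b | a (b :: 'k noise operator). a \<in> A \<and> b \<in> UNIV}"
 show "continuous_map (subtopology uw_top (uwspan ?S)) uw_top (%X. conn r oo J r X)"
  using continuous_map_compose[OF J_uw_continuous uw_continuous_left[of "conn r"]]
  by (intro continuous_map_from_subtopology) (simp add: o_def)
 show "continuous_map (subtopology uw_top (uwspan ?S)) uw_top (%X. amp X oo conn r)"
  using continuous_map_compose[OF uw_continuous_amp uw_continuous_right[of "conn r"]]
  by (intro continuous_map_from_subtopology) (simp add: o_def)
 show "X \<in> uwspan ?S" using X unfolding mult_alg_eq[OF vna, symmetric] uw_tensor_eq .
 show "csub (uwspan ?S)" by (rule csub_uwspan)
 show "conn r oo J r x = amp x oo conn r" if "x \<in> ?S" for x
  using that conn_intertwines_simple[OF r] by blast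
qed (simp_all add: linear_map_on_def J_simps amp_simps comp_add_distrib)

lemma uwspan_M: "M = uwspan {a ox b | a (b :: 'k noise operator). a \<in> A \<and> b \<in> UNIV}"
 unfolding mult_alg_eq[OF vna, symmetric] uw_tensor_eq ..

lemma is_noise_shift: "0 <= r ==> is_noise_shift A r (noise_shift A r :: ('h, 'k noise) tensor operator => ('h, 'k noise) tensor operator)"
 using someI_ex[OF noise_shift_exists[OF vna]] unfolding noise_shift_def by blast

text \<open>The compression \<open>tau\<close> undoes the shift, so \<open>J r\<close> after
  \<open>tau\<close> satisfies the specification; the chosen map therefore satisfies it too.\<close>

lemma is_ampliation:
 assumes r: "0 <= r"
 shows "is_ampliation A j r (ampliation A j r)"
proof -
 define C where "C = (\<one> :: 'h operator) ox glue r (%_. 0 :: 'k)"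
 define tau where "tau Y = C\<^sup>\<star> oo Y oo C" for Y
 have taus: "tau (a ox shifted r z) = a ox z" for a z
 proof -
  have "(glue r (%_. 0 :: 'k))\<^sup>\<star> oo (shifted r z oo glue r (%_. 0)) = z"
   unfolding shifted_glue[OF r step_zero] by (simp add: comp_assoc[symmetric] glue_isometry[OF r step_zero])
  then show ?thesis by (simp add: tau_def C_def tensor_op_adj tensor_op_comp comp_assoc)
 qed
 have "is_ampliation A j r (%Y. J r (tau Y))"
  unfolding is_ampliation_def
 proof (intro conjI ballI)
  show "linear_map_on (A \<otimes>\<^sub>w future_algebra r) (%Y. J r (tau Y))"
   by (simp add: linear_map_on_def tau_def comp_add_distrib J_simps)
  have "continuous_map uw_top uw_top (%Y. J r (tau Y))"
   using continuous_map_compose[OF uw_continuous_sandwich[of "C\<^sup>\<star>" C] J_uw_continuous[of r]] by (simp add: o_def tau_def)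
  then show "normal_map_on (A \<otimes>\<^sub>w future_algebra r) (%Y. J r (tau Y))"
   unfolding normal_map_on_def by (rule continuous_map_from_subtopology)
  fix a and y :: "'k noise operator" assume a: "a \<in> A" and "y \<in> future_algebra r"
  then obtain z where "y = shifted r z" unfolding future_algebra_eq[OF r] by blast
  then show "J r (tau (a ox y)) = j r a oo (\<one> ox y)" by (simp add: taus J_simple[OF r a])
 qed
 then show ?thesis unfolding ampliation_def by (rule someI[where P = "is_ampliation A j r"])
qed

text \<open>The shift and the ampliation in the cocycle identity are choices known only by their
  specifications. Their composition is normal and linear on \<open>M\<close> and agrees with
  \<open>J r\<close> on simple tensors, hence on all of \<open>M\<close>.\<close>

lemma cocycle:
 assumes r: "0 <= r" and t: "0 <= t" and a: "a \<in> A"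
 shows "j (r + t) a = J r (j t a)"
proof -
 let ?sg = "noise_shift A r :: ('h, 'k noise) tensor operator => ('h, 'k noise) tensor operator" and ?kappa = "ampliation A j r"
 let ?S = "{a ox b | a (b :: 'k noise operator). a \<in> A \<and> b \<in> UNIV}"
 have sg: "star_hom_on M ?sg" "continuous_map (subtopology uw_top M) uw_top ?sg"
  "bij_betw ?sg M (A \<otimes>\<^sub>w future_algebra r)" "!!a z. a \<in> A ==> ?sg (a ox z) = a ox shifted r z"
  using is_noise_shift[OF r] unfolding is_noise_shift_def normal_map_on_def mult_alg_eq[OF vna] shifted_def by auto
 have kappa: "linear_map_on (A \<otimes>\<^sub>w future_algebra r) ?kappa" "continuous_map (subtopology uw_top (A \<otimes>\<^sub>w future_algebra r)) uw_top ?kappa"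
  "!!a z. a \<in> A ==> ?kappa (a ox shifted r z) = j r a oo (\<one> ox shifted r z)"
  using is_ampliation[OF r] unfolding is_ampliation_def normal_map_on_def future_algebra_eq[OF r] by auto
 have sgim: "?sg X \<in> A \<otimes>\<^sub>w future_algebra r" if "X \<in> M" for X using sg(3) that unfolding bij_betw_def by blast
 have linsg: "linear_map_on M ?sg" using sg(1) unfolding star_hom_on_def by blast
 have "?kappa (?sg X) = J r X" if X: "X \<in> uwspan ?S" for X
 proof (rule uwspan_eqI[where phi = "%X. ?kappa (?sg X)" and psi = "J r", OF _ _ _ _ csub_uwspan _ X])
  have "continuous_map (subtopology uw_top M) (subtopology uw_top (A \<otimes>\<^sub>w future_algebra r)) ?sg"
   using sg(2) sgim by (simp add: continuous_map_in_subtopology image_subset_iff)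
  from uwspan_subtopology_compose[OF this kappa(2)]
  show "continuous_map (subtopology uw_top (uwspan ?S)) uw_top (%X. ?kappa (?sg X))" unfolding uwspan_M .
  show "continuous_map (subtopology uw_top (uwspan ?S)) uw_top (J r)"
   by (rule continuous_map_from_subtopology[OF J_uw_continuous])
  show "linear_map_on (uwspan ?S) (%X. ?kappa (?sg X))"
   using linsg kappa(1) sgim unfolding linear_map_on_def uwspan_M[symmetric] by simp
  show "linear_map_on (uwspan ?S) (J r)" by (simp add: linear_map_on_def J_simps)
  show "?kappa (?sg x) = J r x" if "x \<in> ?S" for x
   using that by (auto simp: sg(4) kappa(3) J_simple[OF r])
 qed
 from this[of "j t a"] have "?kappa (?sg (j t a)) = J r (j t a)"
  using j_mult_alg[OF t a] unfolding uwspan_M by blast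
 moreover have "j (r + t) a = ?kappa (?sg (j t a))"
  using qs_flow r t a unfolding qs_flow_def qs_cocycle_def by blast
 ultimately show ?thesis by simp
qed

end

section \<open>Adapted curves and ampliated columns\<close>

text \<open>Weak convergence together with convergence of norms is norm convergence: expand the
  squared norm of \<open>y t - y s\<close>.\<close>

lemma continuous_strongI:
 fixes y :: "'t::topological_space => 'a::complex_hilbert"
 assumes w: "!!z. continuous_on S (%s. cinner z (y s))" and n: "continuous_on S (%s. (norm (y s))\<^sup>2)"
 shows "continuous_on S y"
 unfolding continuous_on_def
proof
 fix s assume s: "s \<in> S"
 have "((%t. (norm (y t))\<^sup>2 - 2 * Re (cinner (y s) (y t)) + (norm (y s))\<^sup>2) \<longlongrightarrow> (norm (y s))\<^sup>2 - 2 * Re (cinner (y s) (y s)) + (norm (y s))\<^sup>2) (at s within S)"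
  using w[of "y s"] n s unfolding continuous_on_def by (intro tendsto_add tendsto_diff tendsto_mult tendsto_Re tendsto_const) auto
 moreover have "(norm (y t))\<^sup>2 - 2 * Re (cinner (y s) (y t)) + (norm (y s))\<^sup>2 = (norm (y t - y s))\<^sup>2" for t
  unfolding norm_sq_diff using cinner_commute[of "y t" "y s"] by simp
 ultimately have "((%t. (norm (y t - y s))\<^sup>2) \<longlongrightarrow> 0) (at s within S)" by (simp add: norm_sq_Re)
 then have "((%t. norm (y t - y s)) \<longlongrightarrow> 0) (at s within S)"
  using tendsto_real_sqrt[of "%t. (norm (y t - y s))\<^sup>2" 0] by simp
 then show "(y \<longlongrightarrow> y s) (at s within S)" by (simp add: LIM_zero_iff tendsto_norm_zero_iff)
qed

lemma continuous_bop_apply: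
 fixes T :: "'t::topological_space => ('a::complex_hilbert, 'b::complex_hilbert) bop"
 assumes T: "!!x. continuous_on S (%s. T s $ x)" and bd: "!!s x. s \<in> S ==> norm (T s $ x) <= K * norm x"
  and y: "continuous_on S y"
 shows "continuous_on S (%s. T s $ y s)"
 unfolding continuous_on_def
proof
 fix s assume s: "s \<in> S"
 have "((%t. y t - y s) \<longlongrightarrow> 0) (at s within S)"
  using y s unfolding continuous_on_def by (simp add: LIM_zero_iff)
 then have "((%t. K * norm (y t - y s)) \<longlongrightarrow> 0) (at s within S)"
  using tendsto_mult_left[OF tendsto_norm_zero, of _ _ K] by force
 then have "((%t. T t $ (y t - y s)) \<longlongrightarrow> 0) (at s within S)"
  by (rule Lim_null_comparison[rotated]) (use bd in \<open>auto simp: eventually_at_filter simp del: bop_arith\<close>)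
 moreover have "((%t. T t $ y s) \<longlongrightarrow> T s $ y s) (at s within S)"
  using T s unfolding continuous_on_def by blast
 ultimately have "((%t. T t $ (y t - y s) + T t $ y s) \<longlongrightarrow> 0 + T s $ y s) (at s within S)" by (rule tendsto_add)
 then show "((%t. T t $ y t) \<longlongrightarrow> T s $ y s) (at s within S)" by simp
qed

lemma dsum_approx:
 assumes "0 < eps"
 obtains F where "finite F" "norm (rho - (\<Sum>i\<in>F. inc i $ coord i rho)) < eps"
proof -
 have "((%i. (norm (coord i rho))\<^sup>2) has_sum (norm rho)\<^sup>2) UNIV" by (rule parseval_norm)
 then have "\<forall>\<^sub>F F in finite_subsets_at_top UNIV. dist (\<Sum>i\<in>F. (norm (coord i rho))\<^sup>2) ((norm rho)\<^sup>2) < eps\<^sup>2"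
  unfolding has_sum_def tendsto_iff using assms by auto
 then obtain F where F: "finite F" "dist (\<Sum>i\<in>F. (norm (coord i rho))\<^sup>2) ((norm rho)\<^sup>2) < eps\<^sup>2"
  unfolding eventually_finite_subsets_at_top by blast
 let ?p = "\<Sum>i\<in>F. inc i $ coord i rho"
 have "cinner rho ?p = (\<Sum>i\<in>F. cinner (coord i rho) (coord i rho))" by (simp add: cinner_sum_right cinner_adj[symmetric] del: cinner_adj cinner_adj2)
 then have "Re (cinner rho ?p) = (\<Sum>i\<in>F. (norm (coord i rho))\<^sup>2)" by (simp add: norm_sq_Re)
 then have "(norm (rho - ?p))\<^sup>2 = (norm rho)\<^sup>2 - (\<Sum>i\<in>F. (norm (coord i rho))\<^sup>2)"
  by (simp add: norm_sq_diff norm_sum_inc[OF F(1)])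
 then have "(norm (rho - ?p))\<^sup>2 < eps\<^sup>2" using F(2) by (simp add: dist_real_def)
 then have "norm (rho - ?p) < eps" using assms by (simp add: power_less_imp_less_base)
 with F(1) show ?thesis by (rule that)
qed

lemma amp_norm_le:
 assumes "0 <= K" "!!x. norm (T $ x) <= K * norm x"
 shows "norm (amp T $ rho) <= K * norm rho"
proof (rule power2_le_imp_le)
 have "((%i. (norm (T $ coord i rho))\<^sup>2) has_sum (norm (amp T $ rho))\<^sup>2) UNIV" using parseval_norm[of "amp T $ rho"] by simp
 moreover have "((%i. K\<^sup>2 * (norm (coord i rho))\<^sup>2) has_sum K\<^sup>2 * (norm rho)\<^sup>2) UNIV"
  by (rule has_sum_cmult_right[OF parseval_norm])
 ultimately have "(norm (amp T $ rho))\<^sup>2 <= K\<^sup>2 * (norm rho)\<^sup>2"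
  by (rule has_sum_mono) (use assms in \<open>simp add: power_mult_distrib[symmetric] power_mono\<close>)
 then show "(norm (amp T $ rho))\<^sup>2 <= (K * norm rho)\<^sup>2" by (simp add: power_mult_distrib)
qed (use assms in simp)

text \<open>For a vector with finitely many nonzero coordinates the claim is a finite sum. The
  uniform bound \<open>K\<close> makes the truncations of \<open>rho\<close> converge uniformly in
  \<open>s\<close>; for each tolerance \<open>eps\<close> one truncation is picked by
  choice.\<close>

lemma continuous_amp_apply:
 fixes T :: "'t::topological_space => ('a::complex_hilbert, 'b::complex_hilbert) bop" and rho :: "('a, 'i) dsum"
 assumes T: "!!x. continuous_on S (%s. T s $ x)" and K: "0 <= K" "!!s x. s \<in> S ==> norm (T s $ x) <= K * norm x"
 shows "continuous_on S (%s. amp (T s) $ rho)"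
proof (rule uniform_limit_theorem[where F = "at_right (0::real)" and f = "%eps s. amp (T s) $ (SOME rho'. (\<exists>F. finite F \<and> rho' = (\<Sum>i\<in>F. inc i $ coord i rho)) \<and> norm (rho - rho') < eps)"])
 let ?P = "%eps rho'. (\<exists>F. finite F \<and> rho' = (\<Sum>i\<in>F. inc i $ coord i rho)) \<and> norm (rho - rho') < eps"
 have P: "?P eps (SOME rho'. ?P eps rho')" if eps: "0 < eps" for eps
 proof (rule someI_ex)
  obtain F where "finite F" "norm (rho - (\<Sum>i\<in>F. inc i $ coord i rho)) < eps" by (rule dsum_approx[OF eps])
  then show "\<exists>rho'. ?P eps rho'" by blast
 qed
 show "\<forall>\<^sub>F eps in at_right 0. continuous_on S (%s. amp (T s) $ (SOME rho'. ?P eps rho'))"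
  unfolding eventually_at_right_field
 proof (intro exI[of _ 1] conjI allI impI)
  fix eps :: real assume "0 < eps"
  then obtain F where F: "finite F" "(SOME rho'. ?P eps rho') = (\<Sum>i\<in>F. inc i $ coord i rho)" using P by meson
  have "continuous_on S (%s. \<Sum>i\<in>F. inc i $ (T s $ coord i rho))"
   using T unfolding continuous_on_def by (intro ballI tendsto_intros) blast
  then show "continuous_on S (%s. amp (T s) $ (SOME rho'. ?P eps rho'))" unfolding F(2) by (simp add: bop_sum)
 qed simp
 show "uniform_limit S (%eps s. amp (T s) $ (SOME rho'. ?P eps rho')) (%s. amp (T s) $ rho) (at_right 0)"
 proof (rule uniform_limitI)
  fix e :: real assume e: "0 < e"
  show "\<forall>\<^sub>F eps in at_right 0. \<forall>s\<in>S. dist (amp (T s) $ (SOME rho'. ?P eps rho')) (amp (T s) $ rho) < e"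
   unfolding eventually_at_right_field
  proof (intro exI[of _ "e / (K + 1)"] conjI allI impI ballI)
   show "0 < e / (K + 1)" using e K(1) by simp
   fix eps s assume eps: "0 < eps" "eps < e / (K + 1)" and s: "s \<in> S"
   let ?c = "SOME rho'. ?P eps rho'"
   have "dist (amp (T s) $ ?c) (amp (T s) $ rho) = norm (amp (T s) $ (rho - ?c))" by (simp add: dist_norm norm_minus_commute)
   also have "\<dots> <= K * norm (rho - ?c)" by (rule amp_norm_le[OF K(1) K(2)[OF s]])
   also have "\<dots> <= (K + 1) * eps" using P[OF eps(1)] K(1) by (intro mult_mono) auto
   also have "\<dots> < e" using eps(2) K(1) by (simp add: pos_less_divide_eq mult.commute)
   finally show "dist (amp (T s) $ ?c) (amp (T s) $ rho) < e" .
  qed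
 qed
qed (simp add: trivial_limit_at_right_real)

section \<open>Projections onto the past, and columns over the algebra\<close>

definition past :: "real => ('h::complex_hilbert, 'k::complex_hilbert noise) tensor operator" where
 "past s = \<one> ox past_proj s"

lemma past_coherent: "0 <= s ==> f \<in> step_functions ==>
  past s $ (u \<otimes> \<varpi> f) = cinner (\<varpi> (%_. 0)) (\<varpi> (unshift_fun s f)) *\<^sub>C (u \<otimes> \<varpi> (bef s f))"
 by (simp add: past_def past_proj_coherent tensor_bilinear)

lemma past_adj: "0 <= s ==> (past s)\<^sup>\<star> = past s"
 by (simp add: past_def tensor_op_adj past_proj_adj)

lemma past_cinner: "0 <= s ==> cinner (past s $ x) y = cinner x (past s $ y)"
 using cinner_adj[of "past s" x y] by (simp add: past_adj)

lemma past_mult: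
 assumes "0 <= r" "r <= s"
 shows "past s oo past r = past r" "past r oo past s = past r"
proof -
 show *: "past s oo past r = past r"
  using assms unfolding past_def tensor_op_comp by (simp add: past_proj_mult)
 show "past r oo past s = past r" using arg_cong[OF *, of adj] assms by (simp add: past_adj)
qed

lemma past_vacuum: "0 <= s ==> past s $ (u \<otimes> \<varpi> (%_. 0)) = u \<otimes> \<varpi> (%_. 0)"
 by (simp add: past_def past_proj_vacuum)

lemma cinner_past: "0 <= s ==> cinner (past s $ x) (past s $ y) = cinner x (past s $ y)"
 using past_mult(1)[of s s] past_adj[of s] cinner_adj[of "past s" x "past s $ y"]
 by (metis bop_comp.rep_eq cinner_adj2 order_refl)

lemma past_contraction: "0 <= s ==> norm (past s $ x) <= norm x"
proof -
 assume s: "0 <= s"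
 have "(norm (past s $ x))\<^sup>2 <= norm x * norm (past s $ x)"
  unfolding norm_sq_Re cinner_past[OF s] by (rule order.trans[OF complex_Re_le_cmod cinner_cauchy_schwarz])
 then show ?thesis by (cases "past s $ x = 0") (auto simp: power2_eq_square)
qed

text \<open>Membership of the column in \<open>ket_tensor A\<close>, expressed by commutation. In
  this form it can be verified for \<open>deriv_delta j x\<close> as well as for the given
  \<open>l\<close>.\<close>

definition ket_affil :: "'h::complex_hilbert operator set => ('h, ('k::complex_hilbert, 'h) tensor) bop => bool" where
 "ket_affil A l \<longleftrightarrow> (\<forall>b\<in>commutant A. l oo b = (\<one> ox b) oo l)"

definition ketc :: "'k::complex_hilbert => ('h::complex_hilbert, ('k, 'h) tensor) bop => 'h operator" where
 "ketc c l = (left_ket c)\<^sup>\<star> oo l"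

lemma left_ket_tensor: "(\<one> ox b) oo left_ket c = left_ket c oo b"
 by (rule bop_eqI) simp

lemma left_ket_adj_tensor: "(left_ket c)\<^sup>\<star> oo (\<one> ox b) = b oo (left_ket c)\<^sup>\<star>"
 using arg_cong[OF left_ket_tensor[of "b\<^sup>\<star>" c], of adj] by (simp add: tensor_op_adj)

lemma ket_tensor_affil:
 assumes A: "von_neumann_algebra A" and l: "l \<in> ket_tensor A"
 shows "ket_affil A l"
 unfolding ket_affil_def
proof
 fix b assume b: "b \<in> commutant A"
 let ?C = "{l :: ('a, ('b, 'a) tensor) bop. l oo b = (\<one> ox b) oo l}"
 have "closedin uw_top ?C" by (rule closedin_uw_eq[OF uw_continuous_right uw_continuous_left])
 moreover have "csub ?C" unfolding csub_def by (auto simp: comp_add_distrib)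
 moreover have "{left_ket c oo a | c a. a \<in> A} \<subseteq> ?C"
 proof clarify
  fix c :: 'b and a assume "a \<in> A"
  then have "a oo b = b oo a" using vna_mem[OF A] b by blast
  then show "(left_ket c oo a) oo b = (\<one> ox b) oo (left_ket c oo a)"
   by (simp only: comp_assoc[symmetric] left_ket_tensor) (simp only: comp_assoc)
 qed
 ultimately have "uwspan {left_ket c oo a | c a. a \<in> A} \<subseteq> ?C" by (rule uwspan_closed)
 then show "l oo b = (\<one> ox b) oo l" using l unfolding ket_tensor_def uwspan_def by blast
qed

text \<open>The reordering that moves the direct sum inside the second tensor factor. Its pairing
  with \<open>c \<otimes> zeta\<close> is all that is used to reduce columns to their slices
  \<open>ketc c l\<close>.\<close>

lemma swap_exists:
 obtains S :: "((('k::complex_hilbert, 'h::complex_hilbert) tensor, 'i) dsum, ('k, ('h, 'i) dsum) tensor) bop"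
 where "S\<^sup>\<star> oo S = \<one>" "!!c zeta eta. cinner (c \<otimes> zeta) (S $ eta) = cinner (amp (left_ket c) $ zeta) eta"
proof -
 have ii: "(inc i)\<^sup>\<star> oo inc j = (if i = j then \<one> else 0)" for i j :: 'i
  by (rule bop_eqI) (simp add: coord_inc)
 have t0: "(\<one> :: 'k operator) ox (0 :: 'h operator) = 0"
  by (rule tensor_bop_eqI) (simp add: tensor_bilinear(4)[of _ 0 0, simplified])
 have gram: "cinner ((\<one> ox inc i) $ x) ((\<one> ox inc j) $ y) = cinner (inc i $ x) (inc j $ y)" for i j :: 'i and x y :: "('k, 'h) tensor"
 proof -
  have "cinner ((\<one> ox inc i) $ x) ((\<one> ox inc j) $ y) = cinner x (((\<one> ox inc i)\<^sup>\<star> oo (\<one> ox inc j)) $ y)" by simp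
  also have "\<dots> = cinner (inc i $ x) (inc j $ y)"
   unfolding tensor_op_adj tensor_op_comp ii cinner_inc by (simp add: tensor_op_one t0)
  finally show ?thesis .
 qed
 have tot: "ctotal ((%(i, x). inc i $ x) ` (UNIV :: ('i \<times> ('k, 'h) tensor) set))"
 proof -
  have "(%(i, x). inc i $ x) ` (UNIV :: ('i \<times> ('k, 'h) tensor) set) = {inc i $ x | i x. True}" by auto
  then show ?thesis using total_inc[where 'h = "('k, 'h) tensor" and 'i = 'i] by (simp only:)
 qed
 have "\<exists>S. (\<forall>p. S $ (case p of (i::'i, x::('k,'h) tensor) => inc i $ x) = (case p of (i, x) => (\<one> ox inc i) $ x)) \<and> S\<^sup>\<star> oo S = \<one>"
 proof (rule isometric_extension[of UNIV "%(i::'i, x::('k,'h) tensor). ((\<one> :: 'k operator) ox inc i) $ x" "%(i, x). inc i $ x"])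
  fix S assume "!!p. p \<in> UNIV ==> S $ (case p of (i::'i, x::('k,'h) tensor) => inc i $ x) = (case p of (i, x) => ((\<one> :: 'k operator) ox inc i) $ x)"
   "ctotal ((%(i, x). inc i $ x) ` (UNIV :: ('i \<times> ('k, 'h) tensor) set)) ==> S\<^sup>\<star> oo S = \<one>"
  then show ?thesis using tot by blast
 qed (auto simp: gram simp del: cinner_adj cinner_adj2)
 then obtain S where S: "!!p. S $ (case p of (i::'i, x::('k,'h) tensor) => inc i $ x) = (case p of (i, x) => (\<one> ox inc i) $ x)"
  and iso: "S\<^sup>\<star> oo S = \<one>" by blast
 have Si: "S $ (inc i $ x) = (\<one> ox inc i) $ x" for i x using S[of "(i, x)"] by simp
 have LS: "(left_ket c)\<^sup>\<star> oo S = amp ((left_ket c)\<^sup>\<star>)" for c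
 proof (rule total_bop_eqI[OF total_inc])
  fix x :: "(('k, 'h) tensor, 'i) dsum" assume "x \<in> {inc i $ x | i x. True}"
  then obtain i y where x: "x = inc i $ y" by blast
  show "((left_ket c)\<^sup>\<star> oo S) $ x = amp ((left_ket c)\<^sup>\<star>) $ x"
   unfolding x using arg_cong[OF left_ket_adj_tensor[of c "inc i"], of "%T. T $ y"] by (simp add: Si)
 qed
 have "cinner (c \<otimes> zeta) (S $ eta) = cinner zeta (amp ((left_ket c)\<^sup>\<star>) $ eta)" for c zeta eta
  using arg_cong[OF LS[of c], of "%T. cinner zeta (T $ eta)"] by (simp add: left_ket.rep_eq)
 then show ?thesis using that[OF iso] by (simp add: amp_adj)
qed

section \<open>Strong continuity of the flow, and the image of a column under it\<close>

context flow
begin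

abbreviation E :: "('h, ('h, 'k noise) tensor) bop" where "E \<equiv> right_ket (\<varpi> (%_. 0))"

lemma ketc_mem:
 assumes "ket_affil A l"
 shows "ketc c l \<in> A" "l\<^sup>\<star> oo l \<in> A"
proof -
 have l: "l oo b = (\<one> ox b) oo l" if "b \<in> commutant A" for b using assms that unfolding ket_affil_def by blast
 have "ketc c l oo b = b oo ketc c l" if "b \<in> commutant A" for b
  by (simp only: ketc_def comp_assoc l[OF that]) (simp only: comp_assoc[symmetric] left_ket_adj_tensor)
 then show "ketc c l \<in> A" unfolding vna_mem[OF vna] by blast
 have "l\<^sup>\<star> oo l oo b = b oo (l\<^sup>\<star> oo l)" if b: "b \<in> commutant A" for b
 proof -
  have "b\<^sup>\<star> \<in> commutant A" by (rule commutant_adj[OF A_simps(4) b])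
  from arg_cong[OF l[OF this], of adj] have *: "l\<^sup>\<star> oo (\<one> ox b) = b oo l\<^sup>\<star>" by (simp add: tensor_op_adj)
  show ?thesis by (simp only: comp_assoc l[OF b]) (simp only: comp_assoc[symmetric] *)
 qed
 then show "l\<^sup>\<star> oo l \<in> A" unfolding vna_mem[OF vna] by blast
qed

lemma j_norm_le: "0 <= s ==> a \<in> A ==> norm (j s a $ x) <= opnorm a * norm x"
proof -
 assume s: "0 <= s" and a: "a \<in> A"
 have "norm (j s a $ x) = norm (amp a $ (dil s $ x))"
  using arg_cong[OF dil(2)[OF s a], of "%T. T $ x"] isometry_norm[OF dil(1)[OF s], of "j s a $ x"] by simp
 also have "\<dots> <= opnorm a * norm (dil s $ x)" by (rule amp_norm_le) (auto simp: opnorm)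
 finally show ?thesis by (simp add: isometry_norm[OF dil(1)[OF s]])
qed

lemma cinner_j_continuous: "a \<in> A ==> continuous_on {0..} (%s. cinner x (j s a $ y))"
 using continuous_map_compose[OF j_uw_continuous cinner_uw_continuous[of x y], of a] by (simp add: o_def)

text \<open>The homomorphism property upgrades weak to strong continuity: the squared norm of
  \<open>j s a $ y\<close> is a matrix element of \<open>j s\<close> at
  \<open>a\<^sup>\<star> oo a\<close>.\<close>

lemma j_strong_continuous:
 assumes a: "a \<in> A"
 shows "continuous_on {0..} (%s. j s a $ y)"
proof (rule continuous_strongI)
 show "continuous_on {0..} (%s. cinner z (j s a $ y))" for z by (rule cinner_j_continuous[OF a])
 have "continuous_on {0..} (%s. Re (cinner y (j s (a\<^sup>\<star> oo a) $ y)))"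
  by (intro continuous_intros cinner_j_continuous A_simps a)
 then show "continuous_on {0..} (%s. (norm (j s a $ y))\<^sup>2)"
  by (rule continuous_on_eq) (simp add: norm_sq_Re j_simps A_simps a)
qed

lemma j_curve: "a \<in> A ==> S \<subseteq> {0..} ==> continuous_on S y ==> continuous_on S (%s. j s a $ y s)"
 by (rule continuous_bop_apply[where K = "opnorm a"]) (auto intro: j_norm_le continuous_on_subset[OF j_strong_continuous])

lemma j_past: "0 <= s ==> a \<in> A ==> j s a oo past s = past s oo j s a"
 by (simp add: past_def past_proj_shifted[of s 0, simplified] j_shifted_commute)

text \<open>After the dilation the flow is a plain amplification, so the column becomes
  \<open>amp l\<close>; reordering by \<open>S\<close> and returning with the adjoint of the
  dilation gives the operator.\<close>

lemma jhat_exists: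
 assumes s: "0 <= s" and l: "ket_affil A l"
 shows "\<exists>R :: (('h, 'k noise) tensor, ('k, ('h, 'k noise) tensor) tensor) bop.
  (\<forall>c xi eta. cinner (c \<otimes> xi) (R $ eta) = cinner xi (j s (ketc c l) $ eta)) \<and> (\<forall>eta. (norm (R $ eta))\<^sup>2 = Re (cinner eta (j s (l\<^sup>\<star> oo l) $ eta)))"
proof -
 obtain S :: "((('k, 'h) tensor, ('h, 'k noise) tensor \<times> nat) dsum, ('k, ('h, ('h, 'k noise) tensor \<times> nat) dsum) tensor) bop"
  where S: "S\<^sup>\<star> oo S = \<one>" "!!c zeta eta. cinner (c \<otimes> zeta) (S $ eta) = cinner (amp (left_ket c) $ zeta) eta"
  by (rule swap_exists) (rule that)
 define R where "R = (\<one> ox (dil s)\<^sup>\<star>) oo S oo amp l oo dil s"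
 have Sl: "cinner (c \<otimes> zeta) (S $ (amp l $ (dil s $ eta))) = cinner zeta (dil s $ (j s (ketc c l) $ eta))" for c zeta eta
  unfolding S(2) using arg_cong[OF dil(2)[OF s ketc_mem(1)[OF l, of c]], of "%T. T $ eta"]
  by (simp add: ketc_def amp_adj amp_simps)
 have 1: "cinner (c \<otimes> xi) (R $ eta) = cinner xi (j s (ketc c l) $ eta)" for c xi eta
 proof -
  have "cinner (c \<otimes> xi) (R $ eta) = cinner (c \<otimes> (dil s $ xi)) (S $ (amp l $ (dil s $ eta)))"
   using cinner_adj2[of "c \<otimes> xi" "\<one> ox dil s" "S $ (amp l $ (dil s $ eta))"] by (simp add: R_def tensor_op_adj del: cinner_adj2)
  then show ?thesis unfolding Sl isometry_cinner[OF dil(1)[OF s]] .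
 qed
 \<comment> \<open>The vector already lies in the range of the ampliated dilation, because every
   slice \<open>ketc c l\<close> is in \<open>A\<close> and is intertwined. Returning thus preserves
   the norm.\<close>
 have "(\<one> ox dil s) $ (R $ eta) = S $ (amp l $ (dil s $ eta))" for eta
 proof (rule total_vec_eqI[OF total_tensor[OF total_UNIV total_UNIV]])
  fix x :: "('k, ('h, ('h, 'k noise) tensor \<times> nat) dsum) tensor" assume "x \<in> {x \<otimes> y | x y. x \<in> UNIV \<and> y \<in> UNIV}"
  then obtain c zeta where x: "x = c \<otimes> zeta" by blast
  have "cinner x ((\<one> ox dil s) $ (R $ eta)) = cinner (c \<otimes> ((dil s)\<^sup>\<star> $ zeta)) (R $ eta)"
   using cinner_adj[of "\<one> ox dil s" x "R $ eta"] by (simp add: x tensor_op_adj del: cinner_adj)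
  then show "cinner x ((\<one> ox dil s) $ (R $ eta)) = cinner x (S $ (amp l $ (dil s $ eta)))"
   unfolding x Sl 1 by simp
 qed
 then have n: "norm (R $ eta) = norm (amp l $ (dil s $ eta))" for eta
  using isometry_norm[of "\<one> ox dil s" "R $ eta"] isometry_norm[OF S(1)] by (simp add: tensor_op_adj tensor_op_comp dil(1)[OF s] tensor_op_one)
 have "(norm (R $ eta))\<^sup>2 = Re (cinner eta (j s (l\<^sup>\<star> oo l) $ eta))" for eta
  unfolding n norm_sq_Re amp_adj_comp dil_cinner[OF s ketc_mem(2)[OF l]] ..
 with 1 show ?thesis by blast
qed

text \<open>The identity on \<open>'k\<close> tensored with \<open>j s\<close>, applied to the
  column \<open>l\<close>. It is specified by its slices, and its norm formula stands for
  multiplicativity on \<open>l\<^sup>\<star> oo l\<close>.\<close>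

definition jhat :: "real => ('h, ('k, 'h) tensor) bop => (('h, 'k noise) tensor, ('k, ('h, 'k noise) tensor) tensor) bop" where
 "jhat s l = (SOME R. (\<forall>c xi eta. cinner (c \<otimes> xi) (R $ eta) = cinner xi (j s (ketc c l) $ eta)) \<and> (\<forall>eta. (norm (R $ eta))\<^sup>2 = Re (cinner eta (j s (l\<^sup>\<star> oo l) $ eta))))"

lemma jhat:
 assumes "0 <= s" "ket_affil A l"
 shows "cinner (c \<otimes> xi) (jhat s l $ eta) = cinner xi (j s (ketc c l) $ eta)"
  "(norm (jhat s l $ eta))\<^sup>2 = Re (cinner eta (j s (l\<^sup>\<star> oo l) $ eta))"
 using someI_ex[OF jhat_exists[OF assms]] unfolding jhat_def by blast+

lemma jhat_norm_le:
 assumes "0 <= s" "ket_affil A l"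
 shows "norm (jhat s l $ eta) <= opnorm l * norm eta"
proof (rule power2_le_imp_le)
 have "opnorm (l\<^sup>\<star> oo l) <= opnorm l * opnorm l"
 proof (rule opnorm_leI)
  fix x
  have "norm (l\<^sup>\<star> $ (l $ x)) <= opnorm l * norm (l $ x)" by (rule adj_norm_le) (auto simp: opnorm)
  also have "\<dots> <= opnorm l * (opnorm l * norm x)" by (intro mult_left_mono opnorm) simp
  finally show "norm ((l\<^sup>\<star> oo l) $ x) <= opnorm l * opnorm l * norm x" by simp
 qed simp
 have "(norm (jhat s l $ eta))\<^sup>2 <= norm eta * norm (j s (l\<^sup>\<star> oo l) $ eta)"
  unfolding jhat(2)[OF assms] by (rule order.trans[OF complex_Re_le_cmod cinner_cauchy_schwarz])
 also have "\<dots> <= norm eta * (opnorm l * opnorm l * norm eta)"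
  using mult_right_mono[OF \<open>opnorm (l\<^sup>\<star> oo l) <= opnorm l * opnorm l\<close>, of "norm eta"]
  by (intro mult_left_mono order.trans[OF j_norm_le[OF assms(1) ketc_mem(2)[OF assms(2)]]]) auto
 finally show "(norm (jhat s l $ eta))\<^sup>2 <= (opnorm l * norm eta)\<^sup>2" by (simp add: power2_eq_square mult_ac)
qed simp

lemma jhat_past:
 assumes "0 <= s" "ket_affil A l"
 shows "(\<one> ox past s) $ (jhat s l $ eta) = jhat s l $ (past s $ eta)"
proof (rule tensor_eqI)
 fix c xi
 have "cinner (c \<otimes> xi) ((\<one> ox past s) $ (jhat s l $ eta)) = cinner (c \<otimes> (past s $ xi)) (jhat s l $ eta)"
  using cinner_adj[of "\<one> ox past s" "c \<otimes> xi" "jhat s l $ eta"] by (simp add: tensor_op_adj past_adj[OF assms(1)] del: cinner_adj)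
 also have "\<dots> = cinner xi ((past s oo j s (ketc c l)) $ eta)"
  unfolding jhat(1)[OF assms] using cinner_adj[of "past s" xi] by (simp add: past_adj[OF assms(1)])
 also have "\<dots> = cinner (c \<otimes> xi) (jhat s l $ (past s $ eta))"
  unfolding jhat(1)[OF assms] j_past[OF assms(1) ketc_mem(1)[OF assms(2)], symmetric] by simp
 finally show "cinner (c \<otimes> xi) ((\<one> ox past s) $ (jhat s l $ eta)) = cinner (c \<otimes> xi) (jhat s l $ (past s $ eta))" .
qed

end

section \<open>Stochastic integrals\<close>

lemma zero_tensor [simp]: "0 \<otimes> y = 0" "x \<otimes> 0 = 0"
 using tensor_bilinear(3)[of 0 0 y] tensor_bilinear(4)[of x 0 0] by simp_all

lemma tensor_dense_induct [case_names closed add scale tensor]: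
 fixes phi :: "('a::complex_hilbert, 'b::complex_hilbert) tensor"
 assumes "closed {phi. P phi}" "!!phi psi. P phi ==> P psi ==> P (phi + psi)" "!!c phi. P phi ==> P (c *\<^sub>C phi)" "!!x y. P (x \<otimes> y)"
 shows "P phi"
proof -
 have "P (kcomb v)" for v :: "(complex \<times> ('a, 'b) simple_tensor) list"
 proof (induction v)
  case Nil
  have "kcomb [] = (0 :: ('a, 'b) tensor)" using kcomb_scale[of 0 "[]"] by (simp add: kscale_def)
  then show ?case using assms(3)[OF assms(4), of 0 0 0] by simp
 next
  case (Cons p v)
  obtain c x y where p: "p = (c, Simple_Tensor x y)" by (metis prod.exhaust simple_tensor.exhaust)
  have "kcomb [p] = c *\<^sub>C (x \<otimes> y)"
   using kcomb_scale[of c "[(1, Simple_Tensor x y)]"] by (simp add: p kscale_def tensor_vec_def kvec_def)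
  then have "P (kcomb [p])" using assms(3,4) by simp
  then show ?case using assms(2)[OF _ Cons] kcomb_append[of "[p]" v] by simp
 qed
 moreover obtain v where "(%n. kcomb (v n)) \<longlonglongrightarrow> phi" using kcomb_seq by blast
 ultimately show ?thesis using assms(1) unfolding closed_sequential_limits by fastforce
qed

lemma weakly_continuous_total:
 fixes y :: "real => ('a::complex_hilbert, 'b::complex_hilbert) tensor"
 assumes bd: "!!s. s \<in> S ==> norm (y s) <= K" and c: "!!u v. continuous_on S (%s. cinner (u \<otimes> v) (y s))"
 shows "continuous_on S (%s. cinner z (y s))"
proof (induction z rule: tensor_dense_induct)
 case closed
 show ?case unfolding closed_sequential_limits
 proof (intro allI impI, elim conjE, intro CollectI)
  fix x l assume x: "\<forall>n. x n \<in> {phi. continuous_on S (%s. cinner phi (y s))}" and l: "x \<longlonglongrightarrow> l"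
  show "continuous_on S (%s. cinner l (y s))"
  proof (rule uniform_limit_theorem[where F = sequentially and f = "%n s. cinner (x n) (y s)"])
   show "uniform_limit S (%n s. cinner (x n) (y s)) (%s. cinner l (y s)) sequentially"
   proof (rule uniform_limitI)
    fix e :: real assume e: "0 < e"
    have "0 < e / (\<bar>K\<bar> + 1)" using e by simp
    then have "\<forall>\<^sub>F n in sequentially. dist (x n) l < e / (\<bar>K\<bar> + 1)" using l unfolding tendsto_iff by blast
    then show "\<forall>\<^sub>F n in sequentially. \<forall>s\<in>S. dist (cinner (x n) (y s)) (cinner l (y s)) < e"
    proof (eventually_elim, intro ballI)
     fix n s assume n: "dist (x n) l < e / (\<bar>K\<bar> + 1)" and s: "s \<in> S"
     have "dist (cinner (x n) (y s)) (cinner l (y s)) <= norm (x n - l) * norm (y s)"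
      unfolding dist_norm cinner_diff_left[symmetric] by (rule cinner_cauchy_schwarz)
     also have "\<dots> <= dist (x n) l * (\<bar>K\<bar> + 1)" using bd[OF s] by (intro mult_mono) (auto simp: dist_norm)
     also have "\<dots> < e" using n by (simp add: pos_less_divide_eq)
     finally show "dist (cinner (x n) (y s)) (cinner l (y s)) < e" .
    qed
   qed
  qed (use x in auto)
 qed
qed (auto simp: cinner_add_left cinner_scaleC_left intro!: continuous_intros c)

lemma step_finite_discontinuities:
 fixes f :: "real => 'k::complex_hilbert"
 assumes "f \<in> step_functions"
 shows "\<exists>S. finite S \<and> (\<forall>x. x \<notin> S \<longrightarrow> isCont f x)"
 using assms
proof (induction rule: step_induct)
 case (elem a b c)
 have "frontier {a..<b} \<subseteq> {a, b}"
 proof -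
  have "closure {a..<b} \<subseteq> {a..b}" by (rule closure_minimal) auto
  moreover have "{a<..<b} \<subseteq> interior {a..<b}" by (rule interior_maximal) auto
  ultimately show ?thesis unfolding frontier_def by auto
 qed
 then have "isCont (elem_step a b c) x" if "x \<notin> {a, b}" for x
  using that unfolding elem_step_def by (intro continuous_intros) (auto simp: isCont_indicator)
 then show ?case by (intro exI[of _ "{a, b}"]) auto
next
 case (add f g)
 then obtain S T where "finite S" "finite T" "!!x. x \<notin> S ==> isCont f x" "!!x. x \<notin> T ==> isCont g x" by blast
 then show ?case by (intro exI[of _ "S \<union> T"]) auto
qed auto

lemma step_integrable:
 fixes beta :: "real => ('k::complex_hilbert, 'g::complex_hilbert) tensor"
 assumes "f \<in> step_functions" and beta: "continuous_on {a..t} beta"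
 shows "(%s. cinner (f s \<otimes> w) (beta s)) integrable_on {a..t}"
 using assms(1)
proof (induction rule: step_induct)
 case zero
 show ?case using has_integral_0 by (auto simp: integrable_on_def)
next
 case (elem x y c)
 have "(%s. cinner (c \<otimes> w) (beta s)) absolutely_integrable_on {a..t}"
  by (intro absolutely_integrable_continuous_real continuous_intros beta)
 then have "(%s. cinner (c \<otimes> w) (beta s)) absolutely_integrable_on ({x..<y} \<inter> {a..t})"
  by (rule set_integrable_subset) auto
 then have "(%s. if s \<in> {x..<y} then cinner (c \<otimes> w) (beta s) else 0) integrable_on {a..t}"
  by (simp only: integrable_restrict_Int) (rule set_lebesgue_integral_eq_integral(1))
 moreover have "cinner (elem_step x y c s \<otimes> w) (beta s) = (if s \<in> {x..<y} then cinner (c \<otimes> w) (beta s) else 0)" for s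
  by (simp add: elem_step_def indicator_def)
 ultimately show ?case by simp
next
 case (add f g)
 then show ?case by (simp add: tensor_bilinear cinner_add_left integrable_add)
qed

section \<open>Coherent vectors projected onto the past\<close>

lemma ip_bef_right:
 assumes "0 <= s" "f \<in> step_functions" "g \<in> step_functions"
 shows "ip f (bef s g) = ip (bef s f) (bef s g)"
proof -
 have z: "aft s (bef s g) = (%_. 0)" by (auto simp: restrict_to_def indicator_def)
 then show ?thesis using ip_split[OF assms(2) step_restrict_before[OF assms(3)], of s s] assms by (simp add: bef_bef z)
qed

lemma cinner_past_coherent:
 assumes "0 <= s" "f \<in> step_functions" "g \<in> step_functions"
 shows "cinner (past s $ (u \<otimes> \<varpi> f)) (past s $ (v \<otimes> \<varpi> g)) = cinner u v * exp (ip (bef s f) (bef s g) - (ip f f + ip g g) / 2)"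
proof -
 have "cinner (\<varpi> (%_. 0)) (\<varpi> (unshift_fun s g)) * cinner (\<varpi> f) (\<varpi> (bef s g)) = exp (ip (bef s f) (bef s g) - (ip f f + ip g g) / 2)"
  (is "?l = _")
 proof -
  have "ip g g = ip (bef s g) (bef s g) + ip (unshift_fun s g) (unshift_fun s g)"
   using ip_split[OF assms(3,3)] ip_unshift[OF assms(1,3,3)] by simp
  then show ?thesis unfolding cinner_coherent L2_of_zero exp_add[symmetric] ip_bef_right[OF assms]
   by (intro arg_cong[of _ _ exp]) (simp add: field_simps)
 qed
 then show ?thesis unfolding cinner_past[OF assms(1)] unfolding past_coherent[OF assms(1,3)]
  by (simp add: cinner_scaleC_right cinner_tensor mult_ac)
qed

text \<open>The inner product of two projected coherent vectors is a constant times the exponential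
  of the integral of \<open>cinner (f s) (g s)\<close> up to time \<open>s\<close>. Off the finitely
  many jumps its derivative is that integrand times itself, which is the function being
  integrated.\<close>

lemma gram_integral:
 assumes "0 <= a" "a <= t" "f \<in> step_functions" "g \<in> step_functions"
 shows "((%s. cinner (f s \<otimes> (past s $ (u \<otimes> \<varpi> f))) (g s \<otimes> (past s $ (v \<otimes> \<varpi> g)))) has_integral
  cinner (past t $ (u \<otimes> \<varpi> f)) (past t $ (v \<otimes> \<varpi> g)) - cinner (past a $ (u \<otimes> \<varpi> f)) (past a $ (v \<otimes> \<varpi> g))) {a..t}"
proof -
 let ?h = "%s. cinner (f s) (g s)" and ?c = "(ip f f + ip g g) / 2"
 define F where "F s = cinner u v * exp (integral {0..s} ?h - ?c)" for s
 have F: "cinner (past s $ (u \<otimes> \<varpi> f)) (past s $ (v \<otimes> \<varpi> g)) = F s" if "0 <= s" for s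
  using cinner_past_coherent[OF that assms(3,4)] integral_unique[OF ip_bef_integral[OF assms(3,4) that]] by (simp add: F_def)
 have int: "?h integrable_on {0..t}" using ip_bef_integral[OF assms(3,4), of t] assms(1,2) by auto
 obtain S T where S: "finite S" "finite T" "!!x. x \<notin> S ==> isCont f x" "!!x. x \<notin> T ==> isCont g x"
  using step_finite_discontinuities assms(3,4) by meson
 have der: "(F has_vector_derivative (?h x * F x)) (at x)" if x: "x \<in> {a<..<t} - (S \<union> T)" for x
 proof -
  have "isCont ?h x" using S(3,4)[of x] x unfolding isCont_def by (intro tendsto_intros) auto
  then have "((%u. integral {0..u} ?h) has_vector_derivative ?h x) (at x within {0..t})"
   using integral_has_vector_derivative_continuous_at[OF int, of x "{}"] x assms(1) continuous_at_imp_continuous_within[of x ?h "{0..t}"] by auto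
  moreover have "at x within {0..t} = at x" using x assms(1) by (intro at_within_interior) auto
  ultimately have d: "((%u. integral {0..u} ?h) has_vector_derivative ?h x) (at x)" by simp
  show ?thesis
   using has_vector_derivative_mult_right[OF field_vector_diff_chain_at[OF has_vector_derivative_diff[OF d has_vector_derivative_const[of ?c]], of exp "exp (integral {0..x} ?h - ?c)"], of "cinner u v"]
   by (auto simp: F_def[abs_def] o_def mult_ac intro: DERIV_exp)
 qed
 have "continuous_on {a..t} (%s. integral {0..s} ?h)"
  by (rule continuous_on_subset[OF indefinite_integral_continuous_1[OF int]]) (use assms(1) in auto)
 then have "continuous_on {a..t} F" unfolding F_def[abs_def] by (intro continuous_intros)
 from fundamental_theorem_of_calculus_interior_strong[OF _ assms(2) der this]
 have "((%x. ?h x * F x) has_integral F t - F a) {a..t}" using S(1,2) by blast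
 then have "((%s. cinner (f s \<otimes> (past s $ (u \<otimes> \<varpi> f))) (g s \<otimes> (past s $ (v \<otimes> \<varpi> g)))) has_integral F t - F a) {a..t}"
  by (rule has_integral_eq[rotated]) (use assms(1) in \<open>simp add: cinner_tensor F\<close>)
 then show ?thesis using F assms(1,2) by simp
qed

section \<open>Time and creation integrals of adapted curves\<close>

type_synonym ('h, 'k) hnoise = "('h, 'k noise) tensor"

text \<open>\<open>I\<close> is the time integral of \<open>alpha\<close> plus the creation integral
  of \<open>beta\<close> over \<open>[a, t]\<close>. In the latter the creation differential, tested
  against a coherent vector of \<open>f\<close>, becomes the pairing with
  \<open>f s\<close>.\<close>

definition is_ito :: "real => real => (real => ('h::complex_hilbert, 'k::complex_hilbert) hnoise) => (real => ('k, ('h, 'k) hnoise) tensor)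
  => ('h, 'k) hnoise => bool" where
 "is_ito a t alpha beta I \<longleftrightarrow> (\<forall>v. \<forall>f\<in>step_functions.
  ((%s. cinner (v \<otimes> \<varpi> f) (alpha s) + cinner (f s \<otimes> (v \<otimes> \<varpi> f)) (beta s)) has_integral cinner (v \<otimes> \<varpi> f) I) {a..t})"

lemma is_itoD: "is_ito a t alpha beta I ==> f \<in> step_functions ==>
  ((%s. cinner (v \<otimes> \<varpi> f) (alpha s) + cinner (f s \<otimes> (v \<otimes> \<varpi> f)) (beta s)) has_integral cinner (v \<otimes> \<varpi> f) I) {a..t}"
 unfolding is_ito_def by blast

lemma is_itoI: "(!!v f. f \<in> step_functions ==>
  ((%s. cinner (v \<otimes> \<varpi> f) (alpha s) + cinner (f s \<otimes> (v \<otimes> \<varpi> f)) (beta s)) has_integral cinner (v \<otimes> \<varpi> f) I) {a..t}) ==> is_ito a t alpha beta I"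
 unfolding is_ito_def by blast

lemma is_ito_unique: "is_ito a t alpha beta I ==> is_ito a t alpha beta I' ==> I = I'"
 by (rule coherent_vec_eqI) (rule has_integral_unique[OF is_itoD is_itoD])

lemma is_ito_add:
 assumes "is_ito a t alpha beta I" "is_ito a t alpha' beta' I'"
 shows "is_ito a t (%s. alpha s + alpha' s) (%s. beta s + beta' s) (I + I')"
proof (rule is_itoI)
 fix v and f :: "real => 'b" assume f: "f \<in> step_functions"
 show "((%s. cinner (v \<otimes> \<varpi> f) (alpha s + alpha' s) + cinner (f s \<otimes> (v \<otimes> \<varpi> f)) (beta s + beta' s)) has_integral cinner (v \<otimes> \<varpi> f) (I + I')) {a..t}"
  using has_integral_add[OF is_itoD[OF assms(1) f, of v] is_itoD[OF assms(2) f, of v]] by (simp add: cinner_add_right add_ac)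
qed

lemma is_ito_scaleC:
 assumes "is_ito a t alpha beta I"
 shows "is_ito a t (%s. c *\<^sub>C alpha s) (%s. c *\<^sub>C beta s) (c *\<^sub>C I)"
proof (rule is_itoI)
 fix v and f :: "real => 'b" assume f: "f \<in> step_functions"
 show "((%s. cinner (v \<otimes> \<varpi> f) (c *\<^sub>C alpha s) + cinner (f s \<otimes> (v \<otimes> \<varpi> f)) (c *\<^sub>C beta s)) has_integral cinner (v \<otimes> \<varpi> f) (c *\<^sub>C I)) {a..t}"
  using has_integral_mult_right[OF is_itoD[OF assms f, of v], of c] by (simp add: cinner_scaleC_right distrib_left)
qed

lemma is_ito_cong:
 assumes "!!s. a <= s ==> s <= t ==> alpha s = alpha' s" "!!s. a <= s ==> s <= t ==> beta s = beta' s" "is_ito a t alpha beta I"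
 shows "is_ito a t alpha' beta' I"
 by (rule is_itoI, rule has_integral_eq[OF _ is_itoD[OF assms(3)]]) (auto simp: assms(1,2))

lemma is_ito_combine: "a <= s ==> s <= t ==> is_ito a s alpha beta I ==> is_ito s t alpha beta I' ==> is_ito a t alpha beta (I + I')"
 by (rule is_itoI) (simp only: cinner_add_right, rule has_integral_combine[of a s t], auto intro: is_itoD simp: algebra_simps)

text \<open>Projecting the test vector onto the past replaces \<open>f\<close> by its restriction to
  \<open>[0, t[\<close> up to a scalar; adapted integrands on \<open>[a, t]\<close> do not see the
  difference.\<close>

lemma is_ito_past:
 fixes alpha :: "real => ('h::complex_hilbert, 'k::complex_hilbert) hnoise"
 assumes "0 <= a" "a <= t" "is_ito a t alpha beta I"
  and alpha: "!!s. a <= s ==> s <= t ==> past s $ alpha s = alpha s" and beta: "!!s. a <= s ==> s <= t ==> (\<one> ox past s) $ beta s = beta s"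
 shows "past t $ I = I"
proof (rule coherent_vec_eqI)
 fix v :: 'h and f :: "real => 'k" assume f: "f \<in> step_functions"
 have t: "0 <= t" using assms by simp
 let ?e = "v \<otimes> \<varpi> f" and ?b = "bef t f" and ?c = "cinner (\<varpi> (%_. 0)) (\<varpi> (unshift_fun t f))"
 have pe: "past t $ ?e = ?c *\<^sub>C (v \<otimes> \<varpi> ?b)" by (rule past_coherent[OF t f])
 have "((%s. cnj ?c * (cinner (v \<otimes> \<varpi> ?b) (alpha s) + cinner (?b s \<otimes> (v \<otimes> \<varpi> ?b)) (beta s))) has_integral cnj ?c * cinner (v \<otimes> \<varpi> ?b) I) {a..t}"
  using assms(3) step_restrict_before[OF f] unfolding is_ito_def by (intro has_integral_mult_right) blast
 moreover have "cnj ?c * cinner (v \<otimes> \<varpi> ?b) I = cinner ?e (past t $ I)"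
  using cinner_adj[of "past t" ?e I] by (simp add: past_adj[OF t] pe cinner_scaleC_left)
 ultimately have 1: "((%s. cnj ?c * (cinner (v \<otimes> \<varpi> ?b) (alpha s) + cinner (?b s \<otimes> (v \<otimes> \<varpi> ?b)) (beta s))) has_integral cinner ?e (past t $ I)) {a..t}" by simp
 \<comment> \<open>At \<open>s = t\<close> the restriction of \<open>f\<close> to the half-open
   interval is 0, so that single point is left out of the comparison.\<close>
 have "((%s. cinner ?e (alpha s) + cinner (f s \<otimes> ?e) (beta s)) has_integral cinner ?e (past t $ I)) {a..t}"
 proof (rule has_integral_spike_finite[OF _ _ 1, of "{t}"])
  fix s assume s: "s \<in> {a..t} - {t}"
  have b: "?b s = f s" using s assms(1) by (simp add: restrict_to_def)
  have 2: "past t $ alpha s = alpha s"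
   using alpha[of s] s assms(1) arg_cong[OF past_mult(1)[of s t], of "%T. T $ alpha s"] by simp
  have 3: "(\<one> ox past t) $ beta s = beta s"
   using beta[of s] s assms(1) arg_cong[OF tensor_op_comp[of \<one> "past t" \<one> "past s"], of "%T. T $ beta s"] by (simp add: past_mult(1))
  have "cinner ?e (alpha s) = cinner (past t $ ?e) (alpha s)"
   using cinner_adj[of "past t" ?e "alpha s"] by (simp add: past_adj[OF t] 2)
  moreover have "cinner (f s \<otimes> ?e) (beta s) = cinner (f s \<otimes> (past t $ ?e)) (beta s)"
   using cinner_adj[of "\<one> ox past t" "f s \<otimes> ?e" "beta s"] by (simp add: past_adj[OF t] tensor_op_adj 3)
  ultimately show "cinner ?e (alpha s) + cinner (f s \<otimes> ?e) (beta s) = cnj ?c * (cinner (v \<otimes> \<varpi> ?b) (alpha s) + cinner (?b s \<otimes> (v \<otimes> \<varpi> ?b)) (beta s))"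
   unfolding pe b by (simp add: cinner_scaleC_left tensor_bilinear algebra_simps)
 qed simp
 moreover have "((%s. cinner ?e (alpha s) + cinner (f s \<otimes> ?e) (beta s)) has_integral cinner ?e I) {a..t}"
  using assms(3) f unfolding is_ito_def by blast
 ultimately show "cinner ?e (past t $ I) = cinner ?e I" by (rule has_integral_unique)
qed

lemma is_ito_ampliation:
 fixes alpha :: "real => ('h::complex_hilbert, 'k::complex_hilbert) hnoise" and b :: "'h operator"
 assumes "is_ito a t alpha beta I"
 shows "is_ito a t (%s. (b ox \<one>) $ alpha s) (%s. (\<one> ox (b ox \<one>)) $ beta s) ((b ox \<one>) $ I)"
 unfolding is_ito_def
proof (intro allI ballI)
 fix v :: 'h and f :: "real => 'k" assume f: "f \<in> step_functions"
 have 1: "cinner (v \<otimes> \<varpi> f) ((b ox \<one>) $ x) = cinner ((b\<^sup>\<star> $ v) \<otimes> \<varpi> f) x" for x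
  using cinner_adj[of "b ox \<one>" "v \<otimes> \<varpi> f" x] by (simp add: tensor_op_adj)
 have 2: "cinner (c \<otimes> (v \<otimes> \<varpi> f)) ((\<one> ox (b ox \<one>)) $ x) = cinner (c \<otimes> ((b\<^sup>\<star> $ v) \<otimes> \<varpi> f)) x" for c :: 'k and x
  using cinner_adj[of "\<one> ox (b ox \<one>)" "c \<otimes> (v \<otimes> \<varpi> f)" x] by (simp add: tensor_op_adj)
 show "((%s. cinner (v \<otimes> \<varpi> f) ((b ox \<one>) $ alpha s) + cinner (f s \<otimes> (v \<otimes> \<varpi> f)) ((\<one> ox (b ox \<one>)) $ beta s)) has_integral cinner (v \<otimes> \<varpi> f) ((b ox \<one>) $ I)) {a..t}"
  unfolding 1 2 using assms f unfolding is_ito_def by blast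
qed

section \<open>The Clark-Ocone inequality and the existence of integrals\<close>

definition lin_comb :: "(complex \<times> 'h::complex_hilbert \<times> (real => 'k::complex_hilbert)) list => ('h, 'k) hnoise" where
 "lin_comb vs = (\<Sum>(c, v, f)\<leftarrow>vs. c *\<^sub>C (v \<otimes> \<varpi> f))"

text \<open>The integrand of the Clark-Ocone representation of \<open>lin_comb vs\<close>.\<close>

definition past_gradient :: "(complex \<times> 'h::complex_hilbert \<times> (real => 'k::complex_hilbert)) list => real => ('k, ('h, 'k) hnoise) tensor" where
 "past_gradient vs s = (\<Sum>(c, v, f)\<leftarrow>vs. c *\<^sub>C (f s \<otimes> (past s $ (v \<otimes> \<varpi> f))))"

lemma lin_comb_simps [simp]: "lin_comb [] = 0" "lin_comb ((c, v, f) # vs) = c *\<^sub>C (v \<otimes> \<varpi> f) + lin_comb vs"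
 "past_gradient [] s = 0" "past_gradient ((c, v, f) # vs) s = c *\<^sub>C (f s \<otimes> (past s $ (v \<otimes> \<varpi> f))) + past_gradient vs s"
 by (simp_all add: lin_comb_def past_gradient_def)

lemma past_gradient_integral:
 assumes a: "0 <= a" "a <= t" and vs: "!!c v f. (c, v, f) \<in> set vs ==> f \<in> step_functions"
  and ws: "!!c v f. (c, v, f) \<in> set ws ==> f \<in> step_functions"
 shows "((%s. cinner (past_gradient vs s) (past_gradient ws s)) has_integral
  cinner (past t $ lin_comb vs) (past t $ lin_comb ws) - cinner (past a $ lin_comb vs) (past a $ lin_comb ws)) {a..t}"
 using vs
proof (induction vs)
 case Nil
 then show ?case by simp
next
 case (Cons p vs)
 obtain c v f where p: "p = (c, v, f)" by (cases p) auto
 have f: "f \<in> step_functions" using Cons.prems[of c v f] p by simp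
 have "((%s. cinner (c *\<^sub>C (f s \<otimes> (past s $ (v \<otimes> \<varpi> f)))) (past_gradient ws s)) has_integral
  cinner (past t $ (c *\<^sub>C (v \<otimes> \<varpi> f))) (past t $ lin_comb ws) - cinner (past a $ (c *\<^sub>C (v \<otimes> \<varpi> f))) (past a $ lin_comb ws)) {a..t}"
  using ws
 proof (induction ws)
  case (Cons q ws)
  obtain d w g where q: "q = (d, w, g)" by (cases q) auto
  have g: "g \<in> step_functions" using Cons.prems[of d w g] q by simp
  have 1: "((%s. cinner (c *\<^sub>C (f s \<otimes> (past s $ (v \<otimes> \<varpi> f)))) (past_gradient ws s)) has_integral
   cinner (past t $ (c *\<^sub>C (v \<otimes> \<varpi> f))) (past t $ lin_comb ws) - cinner (past a $ (c *\<^sub>C (v \<otimes> \<varpi> f))) (past a $ lin_comb ws)) {a..t}"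
   using Cons.prems by (intro Cons.IH) auto
  show ?case
   using has_integral_add[OF has_integral_mult_right[OF gram_integral[OF a f g, of v w], of "cnj c * d"] 1]
   by (simp add: q cinner_add_right cinner_scaleC_left cinner_scaleC_right algebra_simps)
 qed simp
 moreover have "((%s. cinner (past_gradient vs s) (past_gradient ws s)) has_integral
  cinner (past t $ lin_comb vs) (past t $ lin_comb ws) - cinner (past a $ lin_comb vs) (past a $ lin_comb ws)) {a..t}"
  using Cons.prems by (intro Cons.IH) auto
 ultimately show ?case
  by (rule has_integral_eq_rhs[OF has_integral_add, THEN has_integral_eq[rotated]]) (simp_all add: p cinner_add_left algebra_simps)
qed

text \<open>The integral equals the growth of the squared norm of the projected vector between
  \<open>a\<close> and \<open>t\<close>, and projecting onto the past is contractive. Applied to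
  test vectors, it bounds creation integrals without any isometry formula.\<close>

lemma past_gradient_bound:
 assumes a: "0 <= a" "a <= t" and vs: "!!c v f. (c, v, f) \<in> set vs ==> f \<in> step_functions"
 shows "(%s. (norm (past_gradient vs s))\<^sup>2) integrable_on {a..t}"
  "integral {a..t} (%s. (norm (past_gradient vs s))\<^sup>2) <= (norm (lin_comb vs))\<^sup>2"
proof -
 have 1: "((%s. (norm (past_gradient vs s))\<^sup>2) has_integral (norm (past t $ lin_comb vs))\<^sup>2 - (norm (past a $ lin_comb vs))\<^sup>2) {a..t}"
  using has_integral_linear[OF past_gradient_integral[OF a vs vs] bounded_linear_Re] by (simp add: o_def norm_sq_Re)
 show "(%s. (norm (past_gradient vs s))\<^sup>2) integrable_on {a..t}" using 1 by blast
 have "(norm (past t $ lin_comb vs))\<^sup>2 <= (norm (lin_comb vs))\<^sup>2"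
  using past_contraction[of t] a by (intro power_mono) auto
 then show "integral {a..t} (%s. (norm (past_gradient vs s))\<^sup>2) <= (norm (lin_comb vs))\<^sup>2"
  unfolding integral_unique[OF 1] by (smt (verit) zero_le_power2)
qed

lemma ito_integrable:
 fixes alpha :: "real => ('h::complex_hilbert, 'k::complex_hilbert) hnoise"
 assumes "f \<in> step_functions" "continuous_on {a..t} alpha" "continuous_on {a..t} beta"
 shows "(%s. cinner (v \<otimes> \<varpi> f) (alpha s) + cinner (f s \<otimes> (v \<otimes> \<varpi> f)) (beta s)) integrable_on {a..t}"
 by (intro integrable_add step_integrable integrable_continuous_real continuous_intros assms)

text \<open>Adaptedness of \<open>beta\<close> lets the test vector in the creation term be
  projected onto the past, so a combination of coherent vectors pairs with \<open>beta\<close>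
  through its \<open>past_gradient\<close>. By Cauchy-Schwarz and the Clark-Ocone inequality the
  prescribed functional is bounded by \<open>B1 + B2\<close>, hence given by a vector.\<close>

lemma ito_exists:
 fixes alpha :: "real => ('h::complex_hilbert, 'k::complex_hilbert) hnoise"
 assumes a: "0 <= a" "a <= t" and cont: "continuous_on {a..t} alpha" "continuous_on {a..t} beta"
  and ad: "!!s. a <= s ==> s <= t ==> (\<one> ox past s) $ beta s = beta s"
  and b1: "!!s. a <= s ==> s <= t ==> norm (alpha s) <= b1 s" "b1 integrable_on {a..t}" "integral {a..t} b1 <= B1" "0 <= B1"
  and b2: "!!s. a <= s ==> s <= t ==> norm (beta s) <= b2 s" "(%s. (b2 s)\<^sup>2) integrable_on {a..t}" "integral {a..t} (%s. (b2 s)\<^sup>2) <= B2\<^sup>2" "0 < B2"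
 shows "\<exists>I. is_ito a t alpha beta I \<and> norm I <= B1 + B2"
proof -
 define g where "g = (%v f s. cinner (v \<otimes> \<varpi> f) (alpha s) + cinner (f s \<otimes> (v \<otimes> \<varpi> f)) (beta s))"
 define L where "L = (%(v, f). integral {a..t} (g v f))"
 have L: "(g v f has_integral L (v, f)) {a..t}" if "f \<in> step_functions" for v f
  using ito_integrable[OF that cont] unfolding L_def g_def by (simp add: integrable_integral)
 have sum: "((%s. cinner (lin_comb vs) (alpha s) + cinner (past_gradient vs s) (beta s)) has_integral (\<Sum>(c, p)\<leftarrow>vs. cnj c * L p)) {a..t}"
  if "!!c v f. (c, v, f) \<in> set vs ==> f \<in> step_functions" for vs
  using that
 proof (induction vs)
  case (Cons p vs)
  obtain c v f where p: "p = (c, v, f)" by (cases p) auto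
  have f: "f \<in> step_functions" using Cons.prems[of c v f] p by simp
  have IH: "((%s. cinner (lin_comb vs) (alpha s) + cinner (past_gradient vs s) (beta s)) has_integral (\<Sum>(c, p)\<leftarrow>vs. cnj c * L p)) {a..t}"
   using Cons.prems by (intro Cons.IH) auto
  show ?case
  proof (rule has_integral_eq_rhs[OF has_integral_eq[OF _ has_integral_add[OF has_integral_mult_right[OF L[OF f, of v], of "cnj c"] IH]]])
   fix s assume s: "s \<in> {a..t}"
   then have "cinner (f s \<otimes> (past s $ (v \<otimes> \<varpi> f))) (beta s) = cinner (f s \<otimes> (v \<otimes> \<varpi> f)) (beta s)"
    using cinner_adj[of "\<one> ox past s" "f s \<otimes> (v \<otimes> \<varpi> f)" "beta s"] ad[of s] a(1) by (simp add: tensor_op_adj past_adj)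
   then show "cnj c * g v f s + (cinner (lin_comb vs) (alpha s) + cinner (past_gradient vs s) (beta s)) =
     cinner (lin_comb (p # vs)) (alpha s) + cinner (past_gradient (p # vs) s) (beta s)"
    by (simp add: p g_def cinner_add_left cinner_scaleC_left algebra_simps)
  qed (simp add: p)
 qed simp
 have bound: "cmod (\<Sum>(c, p)\<leftarrow>vs. cnj c * L p) <= (B1 + B2) * norm (lin_comb vs)"
  if vs: "!!c v f. (c, v, f) \<in> set vs ==> f \<in> step_functions" for vs
 proof -
  have le: "cmod (\<Sum>(c, p)\<leftarrow>vs. cnj c * L p) <= (B1 + B2) * (norm (lin_comb vs) + delta)" if delta: "0 < delta" for delta
  proof -
   \<comment> \<open>The increment \<open>delta\<close> keeps \<open>N\<close> positive even if the
     combination is zero; it is sent to 0 at the end.\<close>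
   define N where "N = norm (lin_comb vs) + delta"
   have N: "0 < N" "norm (lin_comb vs) <= N" using delta by (auto simp: N_def add_nonneg_pos)
   \<comment> \<open>AM-GM: \<open>2 x y <= (B\<^sub>2 / N) x\<^sup>2 + (N / B\<^sub>2) y\<^sup>2\<close>\<close>
   let ?G = "%s. N * b1 s + (B2 / N * (norm (past_gradient vs s))\<^sup>2 + N / B2 * (b2 s)\<^sup>2) / 2"
   have pg: "(%s. (norm (past_gradient vs s))\<^sup>2) integrable_on {a..t}" by (rule past_gradient_bound(1)[OF a]) (rule vs)
   have hi: "(?G has_integral N * integral {a..t} b1 + (B2 / N * integral {a..t} (%s. (norm (past_gradient vs s))\<^sup>2) + N / B2 * integral {a..t} (%s. (b2 s)\<^sup>2)) / 2) {a..t}"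
    by (intro has_integral_add has_integral_mult_right has_integral_divide integrable_integral b1(2) b2(2) pg)
   then have int: "?G integrable_on {a..t}" by blast
   have eq: "(\<Sum>(c, p)\<leftarrow>vs. cnj c * L p) = integral {a..t} (%s. cinner (lin_comb vs) (alpha s) + cinner (past_gradient vs s) (beta s))"
    by (rule integral_unique[OF sum, symmetric]) (rule vs)
   have "norm (\<Sum>(c, p)\<leftarrow>vs. cnj c * L p) <= integral {a..t} ?G"
    unfolding eq
   proof (rule integral_norm_bound_integral[OF _ int])
    fix s assume s: "s \<in> {a..t}"
    have "norm (cinner (lin_comb vs) (alpha s)) <= N * b1 s"
     by (rule order.trans[OF cinner_cauchy_schwarz]) (intro mult_mono N b1, use s N in auto)
    moreover have "norm (cinner (past_gradient vs s) (beta s)) <= norm (past_gradient vs s) * b2 s"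
     by (rule order.trans[OF cinner_cauchy_schwarz]) (intro mult_left_mono b2, use s in auto)
    moreover have "2 * (norm (past_gradient vs s) * b2 s) <= B2 / N * (norm (past_gradient vs s))\<^sup>2 + N / B2 * (b2 s)\<^sup>2"
    proof -
     have "0 <= (B2 * norm (past_gradient vs s) - N * b2 s)\<^sup>2 / (B2 * N)" using N b2(4) by simp
     also have "\<dots> = B2 / N * (norm (past_gradient vs s))\<^sup>2 + N / B2 * (b2 s)\<^sup>2 - 2 * (norm (past_gradient vs s) * b2 s)"
      using N b2(4) by (simp add: field_simps power2_eq_square)
     finally show ?thesis by simp
    qed
    ultimately show "norm (cinner (lin_comb vs) (alpha s) + cinner (past_gradient vs s) (beta s)) <= ?G s"
     using norm_triangle_ineq[of "cinner (lin_comb vs) (alpha s)" "cinner (past_gradient vs s) (beta s)"] by argo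
   qed (rule has_integral_integrable[OF sum], rule vs)
   also have "\<dots> = N * integral {a..t} b1 + (B2 / N * integral {a..t} (%s. (norm (past_gradient vs s))\<^sup>2) + N / B2 * integral {a..t} (%s. (b2 s)\<^sup>2)) / 2"
    by (rule integral_unique[OF hi])
   also have "\<dots> <= N * B1 + (B2 / N * N\<^sup>2 + N / B2 * B2\<^sup>2) / 2"
   proof -
    have "integral {a..t} (%s. (norm (past_gradient vs s))\<^sup>2) <= N\<^sup>2"
     by (rule order.trans[OF past_gradient_bound(2)[OF a] power_mono[OF N(2)]]) (use vs in auto)
    then show ?thesis using N b2(4) b1(3) b2(3)
     by (intro add_mono mult_left_mono divide_right_mono) auto
   qed
   also have "\<dots> = (B1 + B2) * N" using N b2(4) by (simp add: power2_eq_square field_simps)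
   finally show ?thesis by (simp add: N_def)
  qed
  have "cmod (\<Sum>(c, p)\<leftarrow>vs. cnj c * L p) <= (B1 + B2) * norm (lin_comb vs) + e" if e: "0 < e" for e
  proof -
   have B: "0 < B1 + B2" using b1(4) b2(4) by linarith
   show ?thesis using le[of "e / (B1 + B2)"] B e by (simp add: distrib_left)
  qed
  then show ?thesis by (rule field_le_epsilon)
 qed
 have cnj_sum: "(\<Sum>(c, p)\<leftarrow>vs. c *\<^sub>C cnj (L p)) = cnj (\<Sum>(c, p)\<leftarrow>vs. cnj c * L p)" for vs
  by (induction vs) (auto simp: scaleC_complex_def)
 \<comment> \<open>The prescribed values are antilinear in the test vector, so their conjugates
   extend to a bounded operator into the scalars; the adjoint at 1 is the integral.\<close>
 have "\<exists>R :: (('h, 'k) hnoise, complex) bop. (\<forall>v. \<forall>f\<in>step_functions. R $ (v \<otimes> \<varpi> f) = cnj (L (v, f))) \<and> (\<forall>x. norm (R $ x) <= (B1 + B2) * norm x)"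
 proof (rule family_extension[of "UNIV \<times> step_functions" "%p. cnj (L p)" "B1 + B2" "%(v, f). v \<otimes> \<varpi> f"])
  fix vs :: "(complex \<times> 'h \<times> (real => 'k)) list" assume "set vs \<subseteq> UNIV \<times> (UNIV \<times> step_functions)"
  then have "cmod (\<Sum>(c, p)\<leftarrow>vs. cnj c * L p) <= (B1 + B2) * norm (lin_comb vs)" by (intro bound) auto
  then show "norm (\<Sum>(c, p)\<leftarrow>vs. c *\<^sub>C cnj (L p)) <= (B1 + B2) * norm (\<Sum>(c, p)\<leftarrow>vs. c *\<^sub>C (case p of (v, f) => v \<otimes> \<varpi> f))"
   unfolding cnj_sum complex_mod_cnj by (simp add: lin_comb_def case_prod_unfold)
 next
  fix R :: "(('h, 'k) hnoise, complex) bop"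
  assume R: "!!p. p \<in> UNIV \<times> step_functions ==> R $ (case p of (v, f) => v \<otimes> \<varpi> f) = cnj (L p)" "!!x. norm (R $ x) <= (B1 + B2) * norm x"
  have "R $ (v \<otimes> \<varpi> f) = cnj (L (v, f))" if "f \<in> step_functions" for v f using R(1)[of "(v, f)"] that by simp
  with R(2) show ?thesis by blast
 qed (use b1(4) b2(4) in auto)
 then obtain R :: "(('h, 'k) hnoise, complex) bop" where R: "!!v f. f \<in> step_functions ==> R $ (v \<otimes> \<varpi> f) = cnj (L (v, f))"
  "!!x. norm (R $ x) <= (B1 + B2) * norm x" by blast
 have "is_ito a t alpha beta (R\<^sup>\<star> $ 1)"
 proof (rule is_itoI)
  fix v and f :: "real => 'k" assume f: "f \<in> step_functions"
  have "cinner (v \<otimes> \<varpi> f) (R\<^sup>\<star> $ 1) = L (v, f)" by (simp add: R(1)[OF f] cinner_complex_def)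
  then show "((%s. cinner (v \<otimes> \<varpi> f) (alpha s) + cinner (f s \<otimes> (v \<otimes> \<varpi> f)) (beta s)) has_integral cinner (v \<otimes> \<varpi> f) (R\<^sup>\<star> $ 1)) {a..t}"
   using L[OF f, of v] by (simp add: g_def)
 qed
 moreover have "norm (R\<^sup>\<star> $ 1) <= (B1 + B2) * norm (1::complex)"
  by (rule adj_norm_le[OF R(2)]) (use b1(4) b2(4) in auto)
 ultimately show ?thesis by auto
qed

lemma ito_exists_const:
 fixes alpha :: "real => ('h::complex_hilbert, 'k::complex_hilbert) hnoise"
 assumes a: "0 <= a" "a <= t" and cont: "continuous_on {a..t} alpha" "continuous_on {a..t} beta"
  and ad: "!!s. a <= s ==> s <= t ==> (\<one> ox past s) $ beta s = beta s"
  and b: "!!s. a <= s ==> s <= t ==> norm (alpha s) <= K" "!!s. a <= s ==> s <= t ==> norm (beta s) <= L"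
 shows "\<exists>I. is_ito a t alpha beta I \<and> norm I <= K * (t - a) + L * sqrt (t - a)"
proof -
 have K: "0 <= K" "0 <= L" using b[of a] a norm_ge_zero order.trans by blast+
 \<comment> \<open>The existence lemma asks for a strictly positive \<open>B2\<close>; the slack
   \<open>e\<close> covers \<open>L = 0\<close> and \<open>t = a\<close>, and disappears because the
   integral is unique.\<close>
 have "\<exists>I. is_ito a t alpha beta I \<and> norm I <= K * (t - a) + (L * sqrt (t - a) + e)" if e: "0 < e" for e
 proof (rule ito_exists[OF a cont ad b(1) _ _ _ b(2)])
  show "integral {a..t} (%s. L\<^sup>2) <= (L * sqrt (t - a) + e)\<^sup>2"
  proof -
   have "(L * sqrt (t - a))\<^sup>2 <= (L * sqrt (t - a) + e)\<^sup>2" using K a e by (intro power_mono) auto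
   then show ?thesis using a by (simp add: power_mult_distrib mult.commute)
  qed
 qed (use K a e in \<open>auto simp: mult.commute add_nonneg_pos\<close>)
 then obtain I where I: "!!e. 0 < e ==> is_ito a t alpha beta (I e)" "!!e. 0 < e ==> norm (I e) <= K * (t - a) + (L * sqrt (t - a) + e)" by metis
 have "norm (I 1) <= (K * (t - a) + L * sqrt (t - a)) + e" if "0 < e" for e
  using I(2)[OF that] is_ito_unique[OF I(1)[OF that] I(1)[of 1]] by simp
 then have "norm (I 1) <= K * (t - a) + L * sqrt (t - a)" by (rule field_le_epsilon)
 then show ?thesis using I(1)[of 1] by auto
qed

lemma ito_norm_const:
 fixes alpha :: "real => ('h::complex_hilbert, 'k::complex_hilbert) hnoise"
 assumes "0 <= a" "a <= t" "is_ito a t alpha beta I" "continuous_on {a..t} alpha" "continuous_on {a..t} beta"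
  "!!s. a <= s ==> s <= t ==> (\<one> ox past s) $ beta s = beta s"
  "!!s. a <= s ==> s <= t ==> norm (alpha s) <= K" "!!s. a <= s ==> s <= t ==> norm (beta s) <= L"
 shows "norm I <= K * (t - a) + L * sqrt (t - a)"
 using ito_exists_const[OF assms(1,2,4-8)] is_ito_unique[OF assms(3)] by blast

lemma exp_integral:
 assumes "0 < (c::real)" "a <= t"
 shows "((%s. exp (c * s)) has_integral (exp (c * t) - exp (c * a)) / c) {a..t}"
proof -
 have "((%s. exp (c * s) / c) has_vector_derivative exp (c * x)) (at x within {a..t})" for x
  using assms(1) by (auto simp: has_real_derivative_iff_has_vector_derivative[symmetric] intro!: derivative_eq_intros)
 from fundamental_theorem_of_calculus[OF assms(2) this] show ?thesis by (simp add: diff_divide_distrib)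
qed

text \<open>Integrating \<open>exp (c * s)\<close> gains \<open>1 / c\<close>, and the square-sum
  norm of the noise gains \<open>1 / sqrt (2 * c)\<close>. Both factors are small for large
  \<open>c\<close>, which is what makes iteration converge on the whole half-line.\<close>

lemma ito_exists_exp:
 fixes alpha :: "real => ('h::complex_hilbert, 'k::complex_hilbert) hnoise"
 assumes a: "0 <= a" "a <= t" and cont: "continuous_on {a..t} alpha" "continuous_on {a..t} beta"
  and ad: "!!s. a <= s ==> s <= t ==> (\<one> ox past s) $ beta s = beta s"
  and c: "0 < c" and b: "!!s. a <= s ==> s <= t ==> norm (alpha s) <= K * exp (c * s)" "!!s. a <= s ==> s <= t ==> norm (beta s) <= L * exp (c * s)"
  and KL: "0 <= K" "0 < L"
 shows "\<exists>I. is_ito a t alpha beta I \<and> norm I <= (K / c + L / sqrt (2 * c)) * exp (c * t)"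
proof -
 have "\<exists>I. is_ito a t alpha beta I \<and> norm I <= K * exp (c * t) / c + L * exp (c * t) / sqrt (2 * c)"
 proof (rule ito_exists[OF a cont ad b(1) _ _ _ b(2)])
  have 1: "((%s. K * exp (c * s)) has_integral K * ((exp (c * t) - exp (c * a)) / c)) {a..t}"
   by (rule has_integral_mult_right[OF exp_integral[OF c a(2)]])
  show "integral {a..t} (%s. K * exp (c * s)) <= K * exp (c * t) / c"
   unfolding integral_unique[OF 1] using c KL by (simp add: divide_right_mono mult_left_mono)
  show "(%s. K * exp (c * s)) integrable_on {a..t}" using 1 by blast
  have 2: "((%s. L\<^sup>2 * exp (2 * c * s)) has_integral L\<^sup>2 * ((exp (2 * c * t) - exp (2 * c * a)) / (2 * c))) {a..t}"
   by (rule has_integral_mult_right[OF exp_integral]) (use c a in auto)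
  have 3: "(L * exp (c * s))\<^sup>2 = L\<^sup>2 * exp (2 * c * s)" for s
   using exp_double[of "c * s"] by (simp add: power_mult_distrib mult.assoc)
  have 4: "(L * exp (c * t) / sqrt (2 * c))\<^sup>2 = L\<^sup>2 * exp (2 * c * t) / (2 * c)"
   using c by (simp add: power_divide 3)
  show "integral {a..t} (%s. (L * exp (c * s))\<^sup>2) <= (L * exp (c * t) / sqrt (2 * c))\<^sup>2"
   unfolding 3 4 integral_unique[OF 2] using c by (simp add: divide_right_mono mult_left_mono)
  show "(%s. (L * exp (c * s))\<^sup>2) integrable_on {a..t}" unfolding 3 using 2 by blast
 qed (use KL c in auto)
 then show ?thesis by (simp add: distrib_right)
qed

lemma continuous_bounded_Icc:
 fixes f :: "real => 'a::real_normed_vector"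
 assumes "continuous_on {a..} f" "a <= s"
 shows "\<exists>K. \<forall>r. s <= r \<and> r <= t \<longrightarrow> norm (f r) <= K"
proof -
 have "continuous_on {s..t} f" by (rule continuous_on_subset[OF assms(1)]) (use assms(2) in auto)
 from compact_imp_bounded[OF compact_continuous_image[OF this compact_Icc]]
 obtain K where "!!r. r \<in> {s..t} ==> norm (f r) <= K" unfolding bounded_iff by blast
 then show ?thesis by (intro exI[of _ K]) auto
qed

text \<open>Increments of the integral are integrals over short intervals, bounded by a multiple of
  their length plus a multiple of its square root.\<close>

lemma ito_continuous:
 fixes alpha :: "real => ('h::complex_hilbert, 'k::complex_hilbert) hnoise"
 assumes a: "0 <= a" and I: "!!t. a <= t ==> is_ito a t alpha beta (I t)" and cont: "continuous_on {a..} alpha" "continuous_on {a..} beta"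
  and ad: "!!s. a <= s ==> (\<one> ox past s) $ beta s = beta s"
 shows "continuous_on {a..} I"
proof -
 have diff: "is_ito s t alpha beta (I t - I s)" if "a <= s" "s <= t" for s t
 proof -
  have c: "continuous_on {s..t} alpha" "continuous_on {s..t} beta" using that by (auto intro: continuous_on_subset[OF cont(1)] continuous_on_subset[OF cont(2)])
  obtain K L where KL: "!!r. s <= r ==> r <= t ==> norm (alpha r) <= K" "!!r. s <= r ==> r <= t ==> norm (beta r) <= L"
   using continuous_bounded_Icc[OF cont(1) \<open>a <= s\<close>, of t] continuous_bounded_Icc[OF cont(2) \<open>a <= s\<close>, of t] by blast
  have "\<exists>I'. is_ito s t alpha beta I' \<and> norm I' <= K * (t - s) + L * sqrt (t - s)"
   by (rule ito_exists_const[OF _ that(2) c ad KL]) (use that a in auto)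
  then obtain I' where I': "is_ito s t alpha beta I'" by blast
  have "I t = I s + I'" by (rule is_ito_unique[OF I is_ito_combine[OF that I I']]) (use that in auto)
  then show ?thesis using I' by simp
 qed
 show ?thesis unfolding continuous_on_def
 proof
  fix r assume r: "r \<in> {a..}"
  have c: "continuous_on {a..r + 1} alpha" "continuous_on {a..r + 1} beta" by (auto intro: continuous_on_subset[OF cont(1)] continuous_on_subset[OF cont(2)])
  obtain K L where KL: "!!s. a <= s ==> s <= r + 1 ==> norm (alpha s) <= K" "!!s. a <= s ==> s <= r + 1 ==> norm (beta s) <= L"
   using continuous_bounded_Icc[OF cont(1) order_refl, of "r + 1"] continuous_bounded_Icc[OF cont(2) order_refl, of "r + 1"] by blast
  have le: "norm (I t - I s) <= K * (t - s) + L * sqrt (t - s)" if "a <= s" "s <= t" "t <= r + 1" for s t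
  proof (rule ito_norm_const[OF _ that(2) diff[OF that(1,2)]])
   show "continuous_on {s..t} alpha" "continuous_on {s..t} beta" using that by (auto intro: continuous_on_subset[OF c(1)] continuous_on_subset[OF c(2)])
  qed (use that a KL ad in auto)
  have "norm (I t - I r) <= K * \<bar>t - r\<bar> + L * sqrt \<bar>t - r\<bar>" if "a <= t" "t <= r + 1" for t
   using le[of r t] le[of t r] that r by (cases "r <= t") (auto simp: norm_minus_commute)
  then have ev: "\<forall>\<^sub>F t in at r within {a..}. norm (I t - I r) <= K * \<bar>t - r\<bar> + L * sqrt \<bar>t - r\<bar>"
   unfolding eventually_at by (intro exI[of _ 1]) (auto simp: dist_real_def)
  have "((%t. K * \<bar>t - r\<bar> + L * sqrt \<bar>t - r\<bar>) \<longlongrightarrow> K * \<bar>r - r\<bar> + L * sqrt \<bar>r - r\<bar>) (at r within {a..})"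
   by (intro tendsto_intros)
  then have "((%t. K * \<bar>t - r\<bar> + L * sqrt \<bar>t - r\<bar>) \<longlongrightarrow> 0) (at r within {a..})" by simp
  from Lim_null_comparison[OF ev this] have "((%t. I t - I r) \<longlongrightarrow> 0) (at r within {a..})" .
  then show "(I \<longlongrightarrow> I r) (at r within {a..})" by (simp add: LIM_zero_iff)
 qed
qed

section \<open>The stochastic differential equation\<close>

lemma scaleC_diff: "c *\<^sub>C (x - y) = c *\<^sub>C x - c *\<^sub>C (y :: 'a::complex_hilbert)"
 by (rule cinner_ext') (simp add: cinner_diff_right cinner_scaleC_right right_diff_distrib)

context flow
begin

lemma jhat_strong_continuous:
 assumes l: "ket_affil A l"
 shows "continuous_on {0..} (%s. jhat s l $ eta)"
proof (rule continuous_strongI)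
 show "continuous_on {0..} (%s. cinner z (jhat s l $ eta))" for z
 proof (rule weakly_continuous_total)
  show "norm (jhat s l $ eta) <= opnorm l * norm eta" if "s \<in> {0..}" for s using jhat_norm_le[OF _ l] that by simp
  show "continuous_on {0..} (%s. cinner (c \<otimes> xi) (jhat s l $ eta))" for c xi
   by (rule continuous_on_eq[OF cinner_j_continuous[OF ketc_mem(1)[OF l]]]) (simp add: jhat(1)[OF _ l])
 qed
 have "continuous_on {0..} (%s. Re (cinner eta (j s (l\<^sup>\<star> oo l) $ eta)))"
  by (intro continuous_intros cinner_j_continuous ketc_mem(2) l)
 then show "continuous_on {0..} (%s. (norm (jhat s l $ eta))\<^sup>2)"
  by (rule continuous_on_eq) (simp add: jhat(2)[OF _ l])
qed

lemma jhat_curve: "ket_affil A l ==> S \<subseteq> {0..} ==> continuous_on S y ==> continuous_on S (%s. jhat s l $ y s)"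
 by (rule continuous_bop_apply[where K = "opnorm l"]) (auto intro: jhat_norm_le continuous_on_subset[OF jhat_strong_continuous])

lemma jhat_commutant:
 assumes s: "0 <= s" and l: "ket_affil A l" and b: "b \<in> commutant A"
 shows "(\<one> ox (b ox \<one>)) $ (jhat s l $ eta) = jhat s l $ ((b ox \<one>) $ eta)"
proof (rule tensor_eqI)
 fix c xi
 have comm: "j s (ketc c l) oo (b ox \<one>) = (b ox \<one>) oo j s (ketc c l)"
  using j_mult_alg[OF s ketc_mem(1)[OF l, of c]] b unfolding mult_alg_def by blast
 have "cinner (c \<otimes> xi) ((\<one> ox (b ox \<one>)) $ (jhat s l $ eta)) = cinner (c \<otimes> ((b ox \<one>)\<^sup>\<star> $ xi)) (jhat s l $ eta)"
  using cinner_adj[of "\<one> ox (b ox \<one>)" "c \<otimes> xi" "jhat s l $ eta"] by (simp add: tensor_op_adj del: cinner_adj)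
 also have "\<dots> = cinner xi (((b ox \<one>) oo j s (ketc c l)) $ eta)"
  unfolding jhat(1)[OF s l] by simp
 also have "\<dots> = cinner (c \<otimes> xi) (jhat s l $ ((b ox \<one>) $ eta))"
  unfolding jhat(1)[OF s l] comm[symmetric] by simp
 finally show "cinner (c \<otimes> xi) ((\<one> ox (b ox \<one>)) $ (jhat s l $ eta)) = cinner (c \<otimes> xi) (jhat s l $ ((b ox \<one>) $ eta))" .
qed

end

text \<open>The drift \<open>d\<close> and the noise coefficient \<open>l\<close> are unrelated
  here; the relation that makes \<open>P\<close> unital is added only in
  \<open>conservative_flow\<close>.\<close>

locale driven_flow = flow A j
 for A :: "'h::complex_hilbert operator set" and j :: "real => 'h operator => ('h, 'k::complex_hilbert noise) tensor operator" +
 fixes d :: "'h operator" and l :: "('h, ('k, 'h) tensor) bop"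
 assumes d: "d \<in> A" and l: "ket_affil A l"
begin

section \<open>Iteration in the exponentially weighted norm\<close>

definition curve :: "real => (real => ('h, 'k) hnoise) => bool" where
 "curve a y \<longleftrightarrow> continuous_on {a..} y \<and> (\<forall>s\<ge>a. past s $ y s = y s)"

abbreviation step_int :: "real => real => (real => ('h, 'k) hnoise) => ('h, 'k) hnoise => bool" where
 "step_int a t y \<equiv> is_ito a t (%s. j s d $ y s) (%s. jhat s l $ y s)"

lemma step_int_add: "step_int a t y I ==> step_int a t y' I' ==> step_int a t (%s. y s + y' s) (I + I')"
 using is_ito_add[of a t "%s. j s d $ y s" "%s. jhat s l $ y s" I "%s. j s d $ y' s" "%s. jhat s l $ y' s" I'] by simp

lemma step_int_scaleC: "step_int a t y I ==> step_int a t (%s. c *\<^sub>C y s) (c *\<^sub>C I)"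
 using is_ito_scaleC[of a t "%s. j s d $ y s" "%s. jhat s l $ y s" I c] by simp

lemma step_int_diff: "step_int a t y I ==> step_int a t y' I' ==> step_int a t (%s. y s - y' s) (I - I')"
 using step_int_add[of a t y I "%s. (-1) *\<^sub>C y' s" "(-1) *\<^sub>C I'"] step_int_scaleC[of a t y' I' "-1"]
 by (simp add: scaleC_minus_one)

lemma curve_add: "curve a y ==> curve a y' ==> curve a (%s. y s + y' s)"
 by (auto simp: curve_def intro: continuous_intros)

lemma curve_diff: "curve a y ==> curve a y' ==> curve a (%s. y s - y' s)"
 by (auto simp: curve_def intro: continuous_intros)

lemma curve_bop:
 assumes "curve a y" "!!s. a <= s ==> T oo past s = past s oo T"
 shows "curve a (%s. T $ y s)"
 unfolding curve_def
proof (intro conjI allI impI)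
 show "continuous_on {a..} (%s. T $ y s)"
  using assms(1) unfolding curve_def continuous_on_def by (auto intro: tendsto_bop)
 fix s assume s: "a <= s"
 have "past s $ (T $ y s) = T $ (past s $ y s)" using arg_cong[OF assms(2)[OF s], of "%R. R $ y s"] by simp
 then show "past s $ (T $ y s) = T $ y s" using assms(1) s unfolding curve_def by simp
qed

text \<open>The rate at which the map \<open>y \<mapsto> \<integral> j\<^sub>s(d) y\<^sub>s ds + noise\<close> becomes a contraction with constant \<open>1/2\<close>
 for the norm \<open>sup\<^sub>s e\<^bsup>-rate s\<^esup> \<parallel>y\<^sub>s\<parallel>\<close>.\<close>

definition rate :: real where "rate = 4 * (opnorm d + 1) + 8 * (opnorm l + 1)\<^sup>2"

lemma opnorm_pos [simp]: "0 < opnorm T + 1"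
 using opnorm_nonneg[of T] by linarith

lemma rate_pos: "0 < rate"
proof -
 have "0 < 4 * (opnorm d + 1)" by (rule mult_pos_pos[OF _ opnorm_pos]) simp
 moreover have "0 <= 8 * (opnorm l + 1)\<^sup>2" by simp
 ultimately show ?thesis unfolding rate_def by linarith
qed

text \<open>The two summands of \<open>rate\<close> bring the drift and the noise contribution down
  to 1/4 each. The added ones keep the constants positive for zero coefficients, as
  \<open>ito_exists_exp\<close> demands of the noise bound.\<close>

lemma rate_half: "(opnorm d + 1) / rate + (opnorm l + 1) / sqrt (2 * rate) <= 1 / 2"
proof -
 have "4 * (opnorm d + 1) <= rate" unfolding rate_def by simp
 then have 1: "(opnorm d + 1) / rate <= 1 / 4" using rate_pos by (simp add: field_simps)
 have "(4 * (opnorm l + 1))\<^sup>2 <= 2 * rate" unfolding rate_def power_mult_distrib using opnorm_nonneg[of d] by simp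
 then have "4 * (opnorm l + 1) <= sqrt (2 * rate)" by (rule real_le_rsqrt)
 moreover have "0 < sqrt (2 * rate)" using rate_pos by simp
 ultimately have 2: "(opnorm l + 1) / sqrt (2 * rate) <= 1 / 4" by (simp add: field_simps)
 from 1 2 show ?thesis by linarith
qed

lemma step_int_exists:
 assumes a: "0 <= a" and y: "curve a y" and B: "!!s. a <= s ==> norm (y s) <= B * exp (rate * s)" "0 < B"
 shows "\<exists>y'. (\<forall>t\<ge>a. step_int a t y (y' t)) \<and> curve a y' \<and> (\<forall>t\<ge>a. norm (y' t) <= B / 2 * exp (rate * t))"
proof -
 have cont: "continuous_on {a..} (%s. j s d $ y s)" "continuous_on {a..} (%s. jhat s l $ y s)"
  using y a unfolding curve_def by (auto intro!: j_curve[OF d] jhat_curve[OF l])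
 have ad: "past s $ (j s d $ y s) = j s d $ y s" "(\<one> ox past s) $ (jhat s l $ y s) = jhat s l $ y s" if "a <= s" for s
 proof -
  have s: "0 <= s" "past s $ y s = y s" using that a y unfolding curve_def by auto
  show "past s $ (j s d $ y s) = j s d $ y s"
   using arg_cong[OF j_past[OF s(1) d], of "%T. T $ y s"] s(2) by simp
  show "(\<one> ox past s) $ (jhat s l $ y s) = jhat s l $ y s"
   unfolding jhat_past[OF s(1) l] s(2) ..
 qed
 have ex: "\<exists>I. step_int a t y I \<and> norm I <= B / 2 * exp (rate * t)" if t: "a <= t" for t
 proof -
  have "\<exists>I. step_int a t y I \<and> norm I <= ((opnorm d + 1) * B / rate + (opnorm l + 1) * B / sqrt (2 * rate)) * exp (rate * t)"
  proof (rule ito_exists_exp[OF a t _ _ ad(2) rate_pos])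
   show "continuous_on {a..t} (%s. j s d $ y s)" "continuous_on {a..t} (%s. jhat s l $ y s)"
    by (auto intro: continuous_on_subset[OF cont(1)] continuous_on_subset[OF cont(2)])
   fix s assume s: "a <= s" "s <= t"
   have "norm (j s d $ y s) <= (opnorm d + 1) * (B * exp (rate * s))"
    by (rule order.trans[OF j_norm_le[OF _ d]]) (use s a B in \<open>auto intro!: mult_mono simp del: opnorm_pos\<close>)
   then show "norm (j s d $ y s) <= (opnorm d + 1) * B * exp (rate * s)" by (simp add: mult.assoc)
   have "norm (jhat s l $ y s) <= (opnorm l + 1) * (B * exp (rate * s))"
    by (rule order.trans[OF jhat_norm_le[OF _ l]]) (use s a B in \<open>auto intro!: mult_mono simp del: opnorm_pos\<close>)
   then show "norm (jhat s l $ y s) <= (opnorm l + 1) * B * exp (rate * s)" by (simp add: mult.assoc)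
  qed (use B(2) in \<open>auto simp: less_imp_le\<close>)
  moreover have "((opnorm d + 1) * B / rate + (opnorm l + 1) * B / sqrt (2 * rate)) * exp (rate * t) <= B / 2 * exp (rate * t)"
  proof -
   have "((opnorm d + 1) * B / rate + (opnorm l + 1) * B / sqrt (2 * rate)) = B * ((opnorm d + 1) / rate + (opnorm l + 1) / sqrt (2 * rate))"
    by (simp add: distrib_left mult.commute)
   also have "\<dots> <= B * (1 / 2)" using B(2) rate_half by (intro mult_left_mono) auto
   finally show ?thesis by (intro mult_right_mono) auto
  qed
  ultimately show ?thesis using order.trans by blast
 qed
 then have "\<forall>t. \<exists>I. a <= t \<longrightarrow> step_int a t y I \<and> norm I <= B / 2 * exp (rate * t)" by blast
 from choice[OF this] obtain y' where y': "!!t. a <= t ==> step_int a t y (y' t)" "!!t. a <= t ==> norm (y' t) <= B / 2 * exp (rate * t)" by blast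
 have "continuous_on {a..} y'" by (rule ito_continuous[OF a y'(1) cont ad(2)])
 moreover have "past t $ y' t = y' t" if "a <= t" for t by (rule is_ito_past[OF a that y'(1)[OF that] ad])
 ultimately show ?thesis using y' unfolding curve_def by blast
qed

text \<open>The curve is its own image under the integral map, so any exponential bound on it may be
  halved, indefinitely.\<close>

lemma sde_zero:
 assumes a: "0 <= a" and y: "curve a y" and B: "!!s. a <= s ==> norm (y s) <= B * exp (rate * s)" "0 < B"
  and eq: "!!t. a <= t ==> step_int a t y (y t)" and t: "a <= t"
 shows "y t = 0"
proof -
 have le: "\<forall>s\<ge>a. norm (y s) <= B / 2 ^ n * exp (rate * s)" for n
 proof (induction n)
  case (Suc n)
  then obtain y' where y': "\<forall>t\<ge>a. step_int a t y (y' t)" "\<forall>t\<ge>a. norm (y' t) <= B / 2 ^ n / 2 * exp (rate * t)"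
   using step_int_exists[OF a y, of "B / 2 ^ n"] B(2) by auto
  have "y' s = y s" if "a <= s" for s using y'(1) eq[OF that] that is_ito_unique by blast
  then show ?case using y'(2) by (simp add: mult.commute)
 qed (use B in simp)
 have "(%n. B * exp (rate * t) * (1 / 2) ^ n) \<longlonglongrightarrow> B * exp (rate * t) * 0"
  by (intro tendsto_intros LIMSEQ_realpow_zero) auto
 then have "norm (y t) <= B * exp (rate * t) * 0"
  by (rule LIMSEQ_le_const) (use le t in \<open>auto simp: power_divide mult_ac\<close>)
 then show ?thesis by simp
qed

lemma sde_unique:
 assumes a: "0 <= a" and y: "curve a y" "curve a y'"
  and B: "!!s. a <= s ==> norm (y s) <= B * exp (rate * s)" "!!s. a <= s ==> norm (y' s) <= B' * exp (rate * s)"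
  and eq: "!!t. a <= t ==> step_int a t y (y t - y0)" "!!t. a <= t ==> step_int a t y' (y' t - y0)" and t: "a <= t"
 shows "y t = y' t"
proof -
 have "y t - y' t = 0"
 proof (rule sde_zero[OF a curve_diff[OF y] _ _ _ t])
  show "0 < \<bar>B\<bar> + \<bar>B'\<bar> + 1" by simp
  fix s assume s: "a <= s"
  have "norm (y s - y' s) <= B * exp (rate * s) + B' * exp (rate * s)"
   using norm_triangle_ineq4[of "y s" "y' s"] B(1)[OF s] B(2)[OF s] by linarith
  also have "\<dots> <= (\<bar>B\<bar> + \<bar>B'\<bar> + 1) * exp (rate * s)"
   unfolding distrib_right[symmetric] by (intro mult_right_mono) auto
  finally show "norm (y s - y' s) <= (\<bar>B\<bar> + \<bar>B'\<bar> + 1) * exp (rate * s)" .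
  show "step_int a s (%s. y s - y' s) (y s - y' s)"
   using step_int_diff[OF eq(1)[OF s] eq(2)[OF s]] by simp
 qed
 then show ?thesis by simp
qed

lemma past_initial: "past 0 $ y0 = y0 ==> 0 <= s ==> past s $ y0 = y0"
 using arg_cong[OF past_mult(1)[of 0 s], of "%T. T $ y0"] by simp

text \<open>The solution is the sum of the iterates of the integral map on the constant curve
  \<open>y0\<close>; the \<open>n\<close>-th iterate is of weighted size
  \<open>B / 2 ^ n\<close>.\<close>

lemma sde_exists:
 assumes y0: "past 0 $ y0 = y0"
 shows "\<exists>y. curve 0 y \<and> (\<forall>t\<ge>0. step_int 0 t y (y t - y0)) \<and> (\<forall>t\<ge>0. norm (y t) <= 2 * norm y0 * exp (rate * t))"
proof (cases "y0 = 0")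
 case True
 have "step_int 0 t (%_. 0) 0" for t by (rule is_itoI) simp
 then show ?thesis using True by (intro exI[of _ "%_. 0"]) (auto simp: curve_def)
next
 case False
 define B where "B = norm y0"
 have B: "0 < B" using False by (simp add: B_def)
 let ?P = "%n y. curve 0 y \<and> (\<forall>t\<ge>0. norm (y t) <= B / 2 ^ n * exp (rate * t))"
 let ?Q = "%y y'. \<forall>t\<ge>0. step_int 0 t y (y' t)"
 have "\<exists>Y. (\<forall>n. ?P n (Y n) \<and> ?Q (Y n) (Y (Suc n))) \<and> Y 0 = (%_. y0)"
 proof -
  have P0: "?P 0 (%_. y0)"
  proof (intro conjI allI impI)
   fix t :: real assume "0 <= t"
   then have "1 <= exp (rate * t)" using rate_pos by simp
   then show "norm y0 <= B / 2 ^ 0 * exp (rate * t)" using B by (simp add: B_def)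
  qed (auto simp: curve_def past_initial[OF y0])
  have "\<exists>Y. \<forall>n. (?P n (Y n) \<and> (n = 0 \<longrightarrow> Y n = (%_. y0))) \<and> ?Q (Y n) (Y (Suc n))"
  proof (rule dependent_nat_choice)
   show "\<exists>x. ?P 0 x \<and> (0 = (0::nat) \<longrightarrow> x = (%_. y0))" using P0 by blast
   fix y and n :: nat assume y: "?P n y \<and> (n = 0 \<longrightarrow> y = (%_. y0))"
   then have "\<exists>y'. (\<forall>t\<ge>0. step_int 0 t y (y' t)) \<and> curve 0 y' \<and> (\<forall>t\<ge>0. norm (y' t) <= B / 2 ^ n / 2 * exp (rate * t))"
    by (intro step_int_exists) (use B in auto)
   then show "\<exists>y'. (?P (Suc n) y' \<and> (Suc n = 0 \<longrightarrow> y' = (%_. y0))) \<and> ?Q y y'" by (auto simp: mult.commute)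
  qed
  then show ?thesis by blast
 qed
 then obtain Y where Y: "!!n. curve 0 (Y n)" "!!n t. 0 <= t ==> norm (Y n t) <= B / 2 ^ n * exp (rate * t)"
  "!!n t. 0 <= t ==> step_int 0 t (Y n) (Y (Suc n) t)" "Y 0 = (%_. y0)" by blast
 define y where "y t = (\<Sum>n. Y n t)" for t
 define S where "S N t = (\<Sum>n<N. Y n t)" for N t
 have geo: "summable (%n. B / 2 ^ (n + N) * exp (rate * t))" "(\<Sum>n. B / 2 ^ (n + N) * exp (rate * t)) = 2 * B / 2 ^ N * exp (rate * t)" for N t
 proof -
  have "(%n. B / 2 ^ N * exp (rate * t) * (1 / 2) ^ n) sums (B / 2 ^ N * exp (rate * t) * (1 / (1 - 1 / 2)))"
   by (intro sums_mult geometric_sums) simp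
  then have "(%n. B / 2 ^ (n + N) * exp (rate * t)) sums (2 * B / 2 ^ N * exp (rate * t))"
   by (simp add: power_add power_divide mult_ac)
  then show "summable (%n. B / 2 ^ (n + N) * exp (rate * t))" "(\<Sum>n. B / 2 ^ (n + N) * exp (rate * t)) = 2 * B / 2 ^ N * exp (rate * t)"
   by (auto simp: sums_iff)
 qed
 have summable: "summable (%n. Y n t)" if "0 <= t" for t
  by (rule summable_comparison_test'[OF geo(1)[of 0 t]]) (use Y(2)[OF that] in simp)
 have tail: "norm (y t - S N t) <= 2 * B / 2 ^ N * exp (rate * t)" if t: "0 <= t" for N t
 proof -
  have "y t - S N t = (\<Sum>n. Y (n + N) t)"
   using suminf_minus_initial_segment[OF summable[OF t], of N] by (simp add: y_def S_def)
  also have "norm \<dots> <= (\<Sum>n. B / 2 ^ (n + N) * exp (rate * t))"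
  proof (rule order.trans[OF summable_norm suminf_le])
   show "summable (%n. norm (Y (n + N) t))"
    by (rule summable_comparison_test'[OF geo(1)[of N t], of 0]) (use Y(2)[OF t] in simp)
   then show "summable (%n. norm (Y (n + N) t))" .
  qed (use Y(2)[OF t] geo(1) in auto)
  finally show ?thesis unfolding geo(2) .
 qed
 have SY: "(%N. S N t) \<longlonglongrightarrow> y t" if "0 <= t" for t
  using summable_LIMSEQ[OF summable[OF that]] by (simp add: S_def y_def)
 have half: "(%N. C / 2 ^ N) \<longlonglongrightarrow> 0" for C :: real
  using tendsto_mult_left[OF LIMSEQ_realpow_zero[of "1/2::real"], of C] by (simp add: power_divide)
 have cS: "curve 0 (S N)" for N
  unfolding S_def by (induction N) (auto simp: curve_def bop_sum intro!: continuous_intros Y(1)[unfolded curve_def, THEN conjunct1] sum.cong Y(1)[unfolded curve_def, THEN conjunct2, rule_format])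
 have cy: "curve 0 y"
  unfolding curve_def
 proof (intro conjI allI impI)
  \<comment> \<open>The partial sums converge uniformly on the whole half-line only after the weight
    has been divided out.\<close>
  have "continuous_on {0..} (%t. exp (- (rate * t)) *\<^sub>R y t)"
  proof (rule uniform_limit_theorem[where F = sequentially and f = "%N t. exp (- (rate * t)) *\<^sub>R S N t"])
   show "\<forall>\<^sub>F N in sequentially. continuous_on {0..} (%t. exp (- (rate * t)) *\<^sub>R S N t)"
    using cS unfolding curve_def by (intro always_eventually allI continuous_intros) auto
   show "uniform_limit {0..} (%N t. exp (- (rate * t)) *\<^sub>R S N t) (%t. exp (- (rate * t)) *\<^sub>R y t) sequentially"
   proof (rule uniform_limitI)
    fix e :: real assume e: "0 < e"
    have "\<forall>\<^sub>F N in sequentially. 2 * B / 2 ^ N < e" using half[of "2 * B"] e by (auto simp: order_tendsto_iff)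
    then show "\<forall>\<^sub>F N in sequentially. \<forall>t\<in>{0..}. dist (exp (- (rate * t)) *\<^sub>R S N t) (exp (- (rate * t)) *\<^sub>R y t) < e"
    proof (eventually_elim, intro ballI)
     fix N t assume N: "2 * B / 2 ^ N < e" and t: "t \<in> {0::real..}"
     have "dist (exp (- (rate * t)) *\<^sub>R S N t) (exp (- (rate * t)) *\<^sub>R y t) = exp (- (rate * t)) * norm (y t - S N t)"
      by (simp add: dist_norm norm_minus_commute flip: scaleR_diff_right)
     also have "\<dots> <= exp (- (rate * t)) * (2 * B / 2 ^ N * exp (rate * t))" using tail[of t N] t by (intro mult_left_mono) auto
     also have "\<dots> = 2 * B / 2 ^ N" by (simp add: exp_minus)
     finally show "dist (exp (- (rate * t)) *\<^sub>R S N t) (exp (- (rate * t)) *\<^sub>R y t) < e" using N by linarith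
    qed
   qed
  qed simp
  moreover have "continuous_on {0..} (%t. exp (rate * t))" by (intro continuous_intros)
  ultimately have "continuous_on {0..} (%t. exp (rate * t) *\<^sub>R (exp (- (rate * t)) *\<^sub>R y t))" by (rule continuous_on_scaleR[rotated])
  then show "continuous_on {0..} y" by (simp add: exp_minus)
  fix s :: real assume s: "0 <= s"
  have "(%N. past s $ S N s) \<longlonglongrightarrow> past s $ y s" by (intro tendsto_bop SY s)
  moreover have "(%N. past s $ S N s) = (%N. S N s)" using cS s unfolding curve_def by auto
  ultimately show "past s $ y s = y s" using SY[OF s] LIMSEQ_unique by metis
 qed
 \<comment> \<open>Integrating a partial sum shifts its index by one, the constant term
   \<open>y0\<close> being lost.\<close>
 have stepS: "step_int 0 t (S N) (S (Suc N) t - y0)" if t: "0 <= t" for N t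
 proof (induction N)
  case 0
  have "step_int 0 t (%_. 0) 0" by (rule is_itoI) simp
  then show ?case by (simp add: S_def Y(4))
 next
  case (Suc N)
  from step_int_add[OF Suc Y(3)[OF t, of N]] have "step_int 0 t (%s. S N s + Y N s) (S (Suc N) t - y0 + Y (Suc N) t)" .
  moreover have "S N s + Y N s = S (Suc N) s" for s by (simp add: S_def)
  moreover have "S (Suc N) t - y0 + Y (Suc N) t = S (Suc (Suc N)) t - y0" by (simp add: S_def)
  ultimately show ?case by (simp only:)
 qed
 have tail_int: "\<exists>y'. \<forall>t\<ge>0. step_int 0 t (%s. y s - S N s) (y' t) \<and> norm (y' t) <= B / 2 ^ N * exp (rate * t)" for N
 proof -
  have "\<exists>y'. (\<forall>t\<ge>0. step_int 0 t (%s. y s - S N s) (y' t)) \<and> curve 0 y' \<and> (\<forall>t\<ge>0. norm (y' t) <= 2 * B / 2 ^ N / 2 * exp (rate * t))"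
   by (rule step_int_exists[OF order_refl curve_diff[OF cy cS] tail]) (use B in auto)
  then show ?thesis by auto
 qed
 have "step_int 0 t y (y t - y0)" if t: "0 <= t" for t
 proof -
  obtain R where R: "!!N. step_int 0 t (%s. y s - S N s) (R N)" "!!N. norm (R N) <= B / 2 ^ N * exp (rate * t)"
  proof -
   have "\<forall>N. \<exists>I. step_int 0 t (%s. y s - S N s) I \<and> norm I <= B / 2 ^ N * exp (rate * t)" using tail_int t by blast
   from choice[OF this] show ?thesis using that by blast
  qed
  \<comment> \<open>The integral of the limit is the integral of a partial sum plus that of the
    tail. The value is the same for every \<open>N\<close>, so it can be computed as
    \<open>N\<close> tends to infinity.\<close>
  have I: "step_int 0 t y (R N + (S (Suc N) t - y0))" for N
   using step_int_add[OF R(1)[of N] stepS[OF t, of N]] by simp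
  have c: "R N + (S (Suc N) t - y0) = R 0 + (S (Suc 0) t - y0)" for N by (rule is_ito_unique[OF I I])
  have "R \<longlonglongrightarrow> 0"
  proof (rule Lim_null_comparison[where g = "%N. B * exp (rate * t) / 2 ^ N"])
   show "\<forall>\<^sub>F N in sequentially. norm (R N) <= B * exp (rate * t) / 2 ^ N" using R(2) by (simp add: mult_ac)
  qed (rule half)
  then have "(%N. R N + (S (Suc N) t - y0)) \<longlonglongrightarrow> 0 + (y t - y0)"
   by (intro tendsto_intros LIMSEQ_Suc SY t)
  moreover have "(%N. R N + (S (Suc N) t - y0)) = (%N. R 0 + (S (Suc 0) t - y0))" by (rule ext) (rule c)
  ultimately have "(%N::nat. R 0 + (S (Suc 0) t - y0)) \<longlonglongrightarrow> 0 + (y t - y0)" by (simp only:)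
  then have "R 0 + (S (Suc 0) t - y0) = 0 + (y t - y0)" unfolding LIMSEQ_const_iff .
  with I[of 0] show ?thesis by (simp only: add_0_left)
 qed
 moreover have "norm (y t) <= 2 * norm y0 * exp (rate * t)" if "0 <= t" for t
  using tail[OF that, of 0] by (simp add: S_def B_def)
 ultimately show ?thesis using cy by blast
qed

text \<open>Uniqueness makes the solution linear in its initial vector, and the exponential bound
  makes it bounded; so the curves assemble into operators.\<close>

lemma solution_exists:
 "\<exists>Z :: real => ('h, ('h, 'k) hnoise) bop. (\<forall>u. curve 0 (%t. Z t $ u)) \<and> (\<forall>u. \<forall>t\<ge>0. step_int 0 t (%s. Z s $ u) (Z t $ u - E $ u))
  \<and> (\<forall>u. \<forall>t\<ge>0. norm (Z t $ u) <= 2 * exp (rate * t) * norm u)"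
proof -
 have "past 0 $ (E $ u) = E $ u" for u :: 'h by (simp add: right_ket.rep_eq past_vacuum)
 moreover have nE: "norm (E $ u) = norm u" for u :: 'h by (simp add: right_ket.rep_eq norm_tensor coherent_vacuum)
 ultimately have "\<exists>y. curve 0 y \<and> (\<forall>t\<ge>0. step_int 0 t y (y t - E $ u)) \<and> (\<forall>t\<ge>0. norm (y t) <= 2 * norm u * exp (rate * t))" for u :: 'h
  using sde_exists[of "E $ u"] by simp
 then have "\<forall>u. \<exists>y. curve 0 y \<and> (\<forall>t\<ge>0. step_int 0 t y (y t - E $ u)) \<and> (\<forall>t\<ge>0. norm (y t) <= 2 * norm u * exp (rate * t))" ..
 from choice[OF this] obtain y where y: "!!u. curve 0 (y u)" "!!u t. 0 <= t ==> step_int 0 t (y u) (y u t - E $ u)"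
  "!!u t. 0 <= t ==> norm (y u t) <= 2 * norm u * exp (rate * t)" by blast
 have add: "y (u + v) t = y u t + y v t" if t: "0 <= t" for u v t
 proof (rule sde_unique[where y' = "%t. y u t + y v t" and B' = "2 * norm u + 2 * norm v", OF order_refl y(1) curve_add[OF y(1) y(1)] y(3) _ y(2) _ t])
  fix s :: real assume s: "0 <= s"
  show "norm (y u s + y v s) <= (2 * norm u + 2 * norm v) * exp (rate * s)"
   using norm_triangle_ineq[of "y u s" "y v s"] y(3)[OF s, of u] y(3)[OF s, of v] by (simp add: distrib_right)
  show "step_int 0 s (%s. y u s + y v s) (y u s + y v s - E $ (u + v))"
   using step_int_add[OF y(2)[OF s, of u] y(2)[OF s, of v]] by (simp add: tensor_bilinear algebra_simps)
 qed
 have scale: "y (c *\<^sub>C u) t = c *\<^sub>C y u t" if t: "0 <= t" for c u t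
 proof (rule sde_unique[where y' = "%t. c *\<^sub>C y u t" and B' = "cmod c * (2 * norm u)", OF order_refl y(1) _ y(3) _ y(2) _ t])
  show "curve 0 (%t. c *\<^sub>C y u t)"
   using y(1)[of u] unfolding curve_def continuous_on_def by (auto intro: tendsto_scaleC)
  fix s :: real assume s: "0 <= s"
  show "norm (c *\<^sub>C y u s) <= cmod c * (2 * norm u) * exp (rate * s)"
   using mult_left_mono[OF y(3)[OF s, of u], of "cmod c"] by (simp add: norm_scaleC mult_ac)
  show "step_int 0 s (%s. c *\<^sub>C y u s) (c *\<^sub>C y u s - E $ (c *\<^sub>C u))"
   using step_int_scaleC[OF y(2)[OF s, of u], of c] by (simp add: scaleC_diff tensor_bilinear)
 qed
 have "\<exists>Z :: ('h, ('h, 'k) hnoise) bop. \<forall>u. Z $ u = y u t" if t: "0 <= t" for t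
  by (rule bop_exists[of "%u. y u t" "2 * exp (rate * t)"]) (use add scale y(3) t in \<open>auto simp: mult_ac\<close>)
 then have "\<forall>t. \<exists>Z :: ('h, ('h, 'k) hnoise) bop. 0 <= t \<longrightarrow> (\<forall>u. Z $ u = y u t)" by blast
 from choice[OF this] obtain Z :: "real => ('h, ('h, 'k) hnoise) bop" where Z: "!!t u. 0 <= t ==> Z t $ u = y u t" by blast
 show ?thesis
 proof (intro exI[of _ Z] conjI allI impI)
  fix u
  show "curve 0 (%t. Z t $ u)"
   using y(1)[of u] unfolding curve_def by (auto simp: Z cong: continuous_on_cong_simp)
  fix t :: real assume t: "0 <= t"
  show "norm (Z t $ u) <= 2 * exp (rate * t) * norm u" using y(3)[OF t, of u] by (simp add: Z[OF t] mult_ac)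
  have "step_int 0 t (%s. Z s $ u) (y u t - E $ u)"
   by (rule is_ito_cong[OF _ _ y(2)[OF t]]) (simp_all add: Z)
  then show "step_int 0 t (%s. Z s $ u) (Z t $ u - E $ u)" by (simp add: Z[OF t])
 qed
qed

definition Z :: "real => ('h, ('h, 'k) hnoise) bop" where
 "Z = (SOME Z. (\<forall>u. curve 0 (%t. Z t $ u)) \<and> (\<forall>u. \<forall>t\<ge>0. step_int 0 t (%s. Z s $ u) (Z t $ u - E $ u))
  \<and> (\<forall>u. \<forall>t\<ge>0. norm (Z t $ u) <= 2 * exp (rate * t) * norm u))"

lemma Z:
 shows "curve 0 (%t. Z t $ u)" "0 <= t ==> step_int 0 t (%s. Z s $ u) (Z t $ u - E $ u)"
  "0 <= t ==> norm (Z t $ u) <= 2 * exp (rate * t) * norm u"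
 using someI_ex[OF solution_exists] unfolding Z_def by blast+

lemma Z_zero: "Z 0 = E"
proof (rule bop_eqI)
 fix u
 have "step_int 0 0 (%s. Z s $ u) 0" by (rule is_itoI) (simp add: has_integral_refl)
 from is_ito_unique[OF Z(2)[OF order_refl] this] show "Z 0 $ u = E $ u" by simp
qed

text \<open>Operators \<open>b ox \<one>\<close> with \<open>b\<close> in the commutant pass through
  both coefficients, so both sides solve the same equation with initial vector
  \<open>E $ (b $ u)\<close>.\<close>

lemma Z_commutant:
 assumes b: "b \<in> commutant A" and t: "0 <= t"
 shows "Z t oo b = (b ox \<one>) oo Z t"
proof (rule bop_eqI)
 fix u
 have comm: "(b ox \<one>) oo past s = past s oo (b ox (\<one> :: 'k noise operator))" for s
  by (simp add: past_def tensor_op_comp)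
 have "Z t $ (b $ u) = (b ox \<one>) $ (Z t $ u)"
 proof (rule sde_unique[OF order_refl Z(1) curve_bop[OF Z(1) comm] _ _ Z(2) _ t])
  fix s :: real assume s: "0 <= s"
  show "norm (Z s $ (b $ u)) <= 2 * norm (b $ u) * exp (rate * s)" using Z(3)[OF s, of "b $ u"] by (simp add: mult_ac)
  have "norm ((b ox (\<one> :: 'k noise operator)) $ (Z s $ u)) <= opnorm (b ox (\<one> :: 'k noise operator)) * (2 * exp (rate * s) * norm u)"
   by (rule order.trans[OF opnorm]) (intro mult_left_mono Z s opnorm_nonneg)
  then show "norm ((b ox \<one>) $ (Z s $ u)) <= opnorm (b ox (\<one> :: 'k noise operator)) * (2 * norm u) * exp (rate * s)" by (simp add: mult_ac)
  have "(b ox \<one>) $ (E $ u) = E $ (b $ u)" by (simp add: right_ket.rep_eq)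
  moreover have "step_int 0 s (%s. (b ox \<one>) $ (Z s $ u)) ((b ox \<one>) $ (Z s $ u - E $ u))"
  proof (rule is_ito_cong[OF _ _ is_ito_ampliation[OF Z(2)[OF s, of u], of b]])
   fix r :: real assume r: "0 <= r"
   have "j r d oo (b ox \<one>) = (b ox \<one>) oo j r d" using j_mult_alg[OF r d] b unfolding mult_alg_def by blast
   from arg_cong[OF this, of "%T. T $ (Z r $ u)"] show "(b ox \<one>) $ (j r d $ (Z r $ u)) = j r d $ ((b ox \<one>) $ (Z r $ u))" by simp
   show "(\<one> ox (b ox \<one>)) $ (jhat r l $ (Z r $ u)) = jhat r l $ ((b ox \<one>) $ (Z r $ u))"
    by (rule jhat_commutant[OF r l b])
  qed
  ultimately show "step_int 0 s (%s. (b ox \<one>) $ (Z s $ u)) ((b ox \<one>) $ (Z s $ u) - E $ (b $ u))" by simp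
 qed
 then show "(Z t oo b) $ u = ((b ox \<one>) oo Z t) $ u" by simp
qed

end

section \<open>The perturbed semigroup\<close>

lemma E_isometry: "(right_ket (\<varpi> (%_. 0)))\<^sup>\<star> oo right_ket (\<varpi> (%_. 0)) = \<one>"
 by (rule bop_eqI) (simp add: right_ket_adj coherent_vacuum)

lemma has_sum_finite_sum:
 fixes f :: "'i => 'x => complex"
 shows "finite F ==> (!!i. i \<in> F ==> (f i has_sum S i) A) ==> ((%x. \<Sum>i\<in>F. f i x) has_sum (\<Sum>i\<in>F. S i)) A"
 by (induction F rule: finite_induct) (auto intro: has_sum_add)

lemma sum_nonneg_Reals: "(!!i. i \<in> F ==> f i \<in> \<real>\<^sub>\<ge>\<^sub>0) ==> (\<Sum>i\<in>F. f i :: complex) \<in> \<real>\<^sub>\<ge>\<^sub>0"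
 by (induction F rule: infinite_finite_induct) (auto intro: nonneg_Reals_add_I)

lemma past_shift: "0 <= r ==> 0 <= t ==> past (r + t) = \<one> ox shifted r (past_proj t)"
 by (simp add: past_def past_proj_shifted)

section \<open>The connecting isometry on vectors of the past\<close>

context flow
begin

text \<open>On a vector of the past the future leg is the vacuum, so the connecting isometry is just
  the dilation followed by the vacuum embedding in each copy.\<close>

lemma conn_past: "0 <= r ==> conn r oo past r = amp E oo dil r oo past r"
proof (rule coherent_bop_eqI)
 fix u and f :: "real => 'k" assume r: "0 <= r" and f: "f \<in> step_functions"
 have "conn r $ (u \<otimes> \<varpi> (bef r f)) = amp E $ (dil r $ (u \<otimes> \<varpi> (bef r f)))"
  by (simp add: conn(1)[OF r step_restrict_before[OF f]] unshift_bef[OF r] bef_bef)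
 then show "(conn r oo past r) $ (u \<otimes> \<varpi> f) = (amp E oo dil r oo past r) $ (u \<otimes> \<varpi> f)"
  by (simp add: past_coherent[OF r f])
qed

lemma conn_past_vector: "0 <= r ==> past r $ xi = xi ==> conn r $ xi = amp E $ (dil r $ xi)"
 using arg_cong[OF conn_past[of r], of "%T. T $ xi"] by simp

lemma J_conn_adj: "0 <= r ==> X \<in> M ==> J r X $ ((conn r)\<^sup>\<star> $ eta) = (conn r)\<^sup>\<star> $ (amp X $ eta)"
proof -
 assume r: "0 <= r" and X: "X \<in> M"
 have "(conn r oo J r (X\<^sup>\<star>))\<^sup>\<star> = (amp (X\<^sup>\<star>) oo conn r)\<^sup>\<star>"
  using conn_intertwines[OF r mult_alg_adj[OF vna X]] by simp
 from arg_cong[OF this, of "%T. T $ eta"] show ?thesis by (simp add: J_simps amp_adj)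
qed

lemma past_J: "0 <= r ==> 0 <= t ==> past (r + t) $ ((conn r)\<^sup>\<star> $ eta) = (conn r)\<^sup>\<star> $ (amp (past t) $ eta)"
 using J_conn_adj[OF _ simple_mem_mult_alg[OF A_simps(5)], of r "past_proj t" eta]
 by (simp add: past_shift J_one_simple past_def[of t])

lemma j_conn_adj: "0 <= r ==> 0 <= s ==> a \<in> A ==> j (r + s) a $ ((conn r)\<^sup>\<star> $ eta) = (conn r)\<^sup>\<star> $ (amp (j s a) $ eta)"
 by (simp add: cocycle J_conn_adj j_mult_alg)

lemma cinner_conn_adj:
 assumes "0 <= r" "f \<in> step_functions"
 shows "cinner (v \<otimes> \<varpi> f) ((conn r)\<^sup>\<star> $ (inc i $ x)) = cinner (coord i (dil r $ (v \<otimes> \<varpi> (bef r f))) \<otimes> \<varpi> (unshift_fun r f)) x"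
 using assms cinner_adj[of "inc i" "amp (right_ket (\<varpi> (unshift_fun r f))) $ (dil r $ (v \<otimes> \<varpi> (bef r f)))" x]
 by (simp add: conn(1) del: cinner_adj)

end

section \<open>Restarted solutions and the cocycle property of the solution\<close>

context driven_flow
begin

lemma Z_past: "0 <= t ==> past t $ (Z t $ u) = Z t $ u"
 using Z(1)[of u] unfolding curve_def by blast

text \<open>The solution restarted at time \<open>r\<close> in every copy of the dilation,
  transported back by the connecting isometry. With \<open>rho = dil r $ (Z r $ u)\<close> it is the
  candidate for the continuation of \<open>Z r $ u\<close>.\<close>

definition shifted_curve :: "real => ('h, ('h, 'k noise) tensor \<times> nat) dsum => real => ('h, 'k) hnoise" where
 "shifted_curve r rho t = (conn r)\<^sup>\<star> $ (amp (Z (t - r)) $ rho)"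

lemma shifted_curve_bound:
 assumes "0 <= r" "r <= t"
 shows "norm (shifted_curve r rho t) <= 2 * norm rho * exp (rate * t)"
proof -
 have "norm (shifted_curve r rho t) <= 1 * norm (amp (Z (t - r)) $ rho)"
  unfolding shifted_curve_def by (rule adj_norm_le) (simp_all add: isometry_norm[OF conn(2)[OF assms(1)]])
 also have "norm (amp (Z (t - r)) $ rho) <= 2 * exp (rate * (t - r)) * norm rho"
  by (rule amp_norm_le) (use Z(3) assms in auto)
 also have "\<dots> <= 2 * exp (rate * t) * norm rho"
  using assms rate_pos by (intro mult_right_mono mult_left_mono) (auto simp: mult_left_mono)
 finally show ?thesis by (simp add: mult_ac)
qed

lemma shifted_curve:
 assumes r: "0 <= r"
 shows "curve r (shifted_curve r rho)"
 unfolding curve_def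
proof (intro conjI allI impI)
 \<comment> \<open>The exponential growth of \<open>Z\<close> is normalised away, since continuity
   of amplifications is available only under a uniform bound.\<close>
 let ?T = "%t. complex_of_real (exp (- (rate * (t - r)))) *\<^sub>C Z (t - r)"
 have "continuous_on {r..} (%t. Z (t - r) $ x)" for x
 proof -
  have "continuous_on {0..} (%t. Z t $ x)" using Z(1)[of x] unfolding curve_def by blast
  then show ?thesis by (rule continuous_on_compose2[where g = "%t. Z t $ x"]) (auto intro!: continuous_intros)
 qed
 moreover have "norm (?T t $ x) <= 2 * norm x" if "t \<in> {r..}" for t x
 proof -
  have "norm (?T t $ x) = exp (- (rate * (t - r))) * norm (Z (t - r) $ x)" by (simp add: norm_scaleC del: of_real_exp)
  also have "\<dots> <= exp (- (rate * (t - r))) * (2 * exp (rate * (t - r)) * norm x)"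
   using Z(3)[of "t - r" x] that by (intro mult_left_mono) auto
  also have "\<dots> = 2 * norm x" by (simp add: exp_minus)
  finally show ?thesis .
 qed
 ultimately have "continuous_on {r..} (%t. amp (?T t) $ rho)"
  by (intro continuous_amp_apply[where K = 2]) (auto simp flip: scaleR_scaleC intro!: continuous_intros)
 moreover have "continuous_on {r..} (%t. exp (rate * (t - r)))" by (intro continuous_intros)
 ultimately have "continuous_on {r..} (%t. exp (rate * (t - r)) *\<^sub>R (amp (?T t) $ rho))" by (rule continuous_on_scaleR[rotated])
 moreover have "exp (rate * (t - r)) *\<^sub>R (amp (?T t) $ rho) = amp (Z (t - r)) $ rho" for t
 proof -
  have "complex_of_real (exp (rate * (t - r))) * complex_of_real (exp (- (rate * (t - r)))) = 1"
   unfolding of_real_mult[symmetric] exp_add[symmetric] by simp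
  then show ?thesis by (simp add: amp_simps scaleR_scaleC scaleC_scaleC del: of_real_exp)
 qed
 ultimately have "continuous_on {r..} (%t. amp (Z (t - r)) $ rho)" by (simp only:)
 then show "continuous_on {r..} (shifted_curve r rho)"
  unfolding shifted_curve_def[abs_def] continuous_on_def by (auto intro: tendsto_bop)
 fix s assume s: "r <= s"
 have "past (s - r) oo Z (s - r) = Z (s - r)" by (rule bop_eqI) (use s in \<open>simp add: Z_past\<close>)
 from arg_cong[OF this, of "%T. amp T $ rho"] have "amp (past (s - r)) $ (amp (Z (s - r)) $ rho) = amp (Z (s - r)) $ rho"
  by (simp add: amp_simps)
 then show "past s $ shifted_curve r rho s = shifted_curve r rho s"
  using past_J[OF r, of "s - r"] s by (simp add: shifted_curve_def)
qed

text \<open>On a single copy the amplification is one solution \<open>Z (s - r) $ w\<close>. Pairing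
  with a coherent vector of \<open>f\<close> becomes pairing with one of
  \<open>unshift_fun r f\<close>, so the equation for \<open>Z\<close> turns into the claim by a
  translation of time; the cocycle identity identifies the coefficients.\<close>

lemma shifted_curve_sde_inc:
 assumes r: "0 <= r" and t: "r <= t"
 shows "step_int r t (shifted_curve r (inc i $ w)) ((conn r)\<^sup>\<star> $ (inc i $ (Z (t - r) $ w - E $ w)))"
proof (rule is_itoI)
 fix v and f :: "real => 'k" assume f: "f \<in> step_functions"
 let ?e = "coord i (dil r $ (v \<otimes> \<varpi> (bef r f)))" and ?f = "unshift_fun r f"
 let ?g = "%s. cinner (?e \<otimes> \<varpi> ?f) (j s d $ (Z s $ w)) + cinner (?f s \<otimes> (?e \<otimes> \<varpi> ?f)) (jhat s l $ (Z s $ w))"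
 have "(?g has_integral cinner (?e \<otimes> \<varpi> ?f) (Z (t - r) $ w - E $ w)) {0..t - r}"
  by (rule is_itoD[OF Z(2) step_unshift[OF f]]) (use t in simp)
 from has_integral_shift_real_ivl[OF this, of "- r"]
 have "((%s. ?g (s - r)) has_integral cinner (?e \<otimes> \<varpi> ?f) (Z (t - r) $ w - E $ w)) {r..t}" by simp
 then show "((%s. cinner (v \<otimes> \<varpi> f) (j s d $ shifted_curve r (inc i $ w) s) + cinner (f s \<otimes> (v \<otimes> \<varpi> f)) (jhat s l $ shifted_curve r (inc i $ w) s))
  has_integral cinner (v \<otimes> \<varpi> f) ((conn r)\<^sup>\<star> $ (inc i $ (Z (t - r) $ w - E $ w)))) {r..t}"
  unfolding cinner_conn_adj[OF r f]
 proof (rule has_integral_eq[rotated])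
  fix s assume s: "s \<in> {r..t}"
  have a: "j s a $ shifted_curve r (inc i $ w) s = (conn r)\<^sup>\<star> $ (inc i $ (j (s - r) a $ (Z (s - r) $ w)))" if "a \<in> A" for a
   using j_conn_adj[OF r _ that, of "s - r"] s by (simp add: shifted_curve_def)
  have f': "?f (s - r) = f s" using s by (simp add: unshift_fun_def)
  show "?g (s - r) = cinner (v \<otimes> \<varpi> f) (j s d $ shifted_curve r (inc i $ w) s) + cinner (f s \<otimes> (v \<otimes> \<varpi> f)) (jhat s l $ shifted_curve r (inc i $ w) s)"
   using s r unfolding f' by (simp add: jhat(1)[OF _ l] a[OF d] a[OF ketc_mem(1)[OF l]] cinner_conn_adj[OF r f] del: cinner_adj cinner_adj2)
 qed
qed

text \<open>The integral exists by the iteration bound and depends on \<open>rho\<close> linearly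
  and boundedly; so it is determined by the vectors living in a single copy.\<close>

lemma shifted_curve_sde:
 assumes r: "0 <= r" and t: "r <= t"
 shows "step_int r t (shifted_curve r rho) (shifted_curve r rho t - (conn r)\<^sup>\<star> $ (amp E $ rho))"
proof -
 have ex: "\<exists>I. step_int r t (shifted_curve r rho) I \<and> norm I <= exp (rate * t) * norm rho" for rho
 proof (cases "rho = 0")
  case True
  have "step_int r t (%_. 0) 0" by (rule is_itoI) simp
  then show ?thesis using True by (auto simp: shifted_curve_def[abs_def])
 next
  case False
  then have "\<exists>y. (\<forall>t\<ge>r. step_int r t (shifted_curve r rho) (y t)) \<and> curve r y \<and> (\<forall>t\<ge>r. norm (y t) <= 2 * norm rho / 2 * exp (rate * t))"
   by (intro step_int_exists r shifted_curve shifted_curve_bound) auto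
  then obtain y where "step_int r t (shifted_curve r rho) (y t)" "norm (y t) <= norm rho * exp (rate * t)" using t by auto
  then show ?thesis by (auto simp: mult.commute)
 qed
 then have "\<forall>rho. \<exists>I. step_int r t (shifted_curve r rho) I \<and> norm I <= exp (rate * t) * norm rho" by blast
 from choice[OF this] obtain I where I: "!!rho. step_int r t (shifted_curve r rho) (I rho)" "!!rho. norm (I rho) <= exp (rate * t) * norm rho" by blast
 have lin: "shifted_curve r (rho + rho') = (%s. shifted_curve r rho s + shifted_curve r rho' s)" "shifted_curve r (c *\<^sub>C rho) = (%s. c *\<^sub>C shifted_curve r rho s)" for rho rho' c
  by (simp_all add: shifted_curve_def fun_eq_iff)
 have add: "I (rho + rho') = I rho + I rho'" for rho rho'
  by (rule is_ito_unique[OF I(1)]) (simp only: lin, rule step_int_add[OF I(1) I(1)])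
 have scale: "I (c *\<^sub>C rho) = c *\<^sub>C I rho" for c rho
  by (rule is_ito_unique[OF I(1)]) (simp only: lin, rule step_int_scaleC[OF I(1)])
 have "\<exists>R. \<forall>rho. R $ rho = I rho" by (rule bop_exists[OF add scale I(2)]) blast
 then obtain R where R: "!!rho. R $ rho = I rho" by blast
 have "R = (conn r)\<^sup>\<star> oo (amp (Z (t - r)) - amp E)"
 proof (rule total_bop_eqI[OF total_inc])
  fix x :: "('h, ('h, 'k noise) tensor \<times> nat) dsum" assume "x \<in> {inc i $ x | i x. True}"
  then obtain i w where x: "x = inc i $ w" by blast
  have "I x = (conn r)\<^sup>\<star> $ (inc i $ (Z (t - r) $ w - E $ w))"
   unfolding x by (rule is_ito_unique[OF I(1) shifted_curve_sde_inc[OF r t]])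
  then show "R $ x = ((conn r)\<^sup>\<star> oo (amp (Z (t - r)) - amp E)) $ x"
   by (simp add: R x minus_bop.rep_eq)
 qed
 then have "I rho = shifted_curve r rho t - (conn r)\<^sup>\<star> $ (amp E $ rho)"
  using R[of rho] by (simp add: shifted_curve_def minus_bop.rep_eq)
 then show ?thesis using I(1)[of rho] by simp
qed

text \<open>From time \<open>r\<close> on, both sides solve the equation with value
  \<open>Z r $ u\<close> at \<open>r\<close>: for the right side this is
  \<open>conn_past_vector\<close>, since \<open>Z r $ u\<close> belongs to the past of
  \<open>r\<close>.\<close>

lemma Z_cocycle:
 assumes r: "0 <= r" and t: "0 <= t"
 shows "Z (r + t) $ u = (conn r)\<^sup>\<star> $ (amp (Z t) $ (dil r $ (Z r $ u)))"
proof -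
 let ?rho = "dil r $ (Z r $ u)"
 have c: "(conn r)\<^sup>\<star> $ (amp E $ ?rho) = Z r $ u"
  using conn_past_vector[OF r Z_past[OF r, of u]] isometry_adj[OF conn(2)[OF r], of "Z r $ u"] by simp
 have cr: "curve r (%s. Z s $ u)"
  using Z(1)[of u] r unfolding curve_def by (auto intro: continuous_on_subset)
 \<comment> \<open>The added 1 makes the constant positive also for \<open>u = 0\<close>, as
   \<open>step_int_exists\<close> requires.\<close>
 have bd: "norm (Z s $ u) <= (2 * norm u + 1) * exp (rate * s)" if "r <= s" for s
  by (rule order.trans[OF Z(3)[of s u]]) (use that r in \<open>simp_all add: algebra_simps\<close>)
 have "0 < 2 * norm u + 1" by (simp add: add_nonneg_pos)
 from step_int_exists[OF r cr bd this] obtain y' where y': "!!s. r <= s ==> step_int r s (%s. Z s $ u) (y' s)" by blast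
 have eq: "step_int r s (%s. Z s $ u) (Z s $ u - Z r $ u)" if s: "r <= s" for s
 proof -
  have "Z s $ u - E $ u = (Z r $ u - E $ u) + y' s"
   by (rule is_ito_unique[OF Z(2) is_ito_combine[OF r s Z(2)[OF r] y'[OF s]]]) (use r s in simp)
  then have "y' s = Z s $ u - Z r $ u" by (simp add: algebra_simps)
  then show ?thesis using y'[OF s] by simp
 qed
 have "Z (r + t) $ u = shifted_curve r ?rho (r + t)"
  by (rule sde_unique[OF r cr shifted_curve[OF r] bd shifted_curve_bound[OF r] eq shifted_curve_sde[OF r, of _ ?rho, unfolded c]]) (use t in auto)
 then show ?thesis by (simp add: shifted_curve_def)
qed

section \<open>Complete positivity, normality and the semigroup law\<close>

definition P :: "real => 'h operator => 'h operator" where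
 "P t x = (Z t)\<^sup>\<star> oo j t x oo Z t"

lemma cinner_P: "cinner v (P t x $ u) = cinner (Z t $ v) (j t x $ (Z t $ u))"
 by (simp add: P_def)

lemma P_mem:
 assumes t: "0 <= t" and x: "x \<in> A"
 shows "P t x \<in> A"
 unfolding vna_mem[OF vna]
proof
 fix b assume b: "b \<in> commutant A"
 have "b\<^sup>\<star> \<in> commutant A" by (rule commutant_adj[OF A_simps(4) b])
 from arg_cong[OF Z_commutant[OF this t], of adj] have 1: "b oo (Z t)\<^sup>\<star> = (Z t)\<^sup>\<star> oo (b ox \<one>)" by (simp add: tensor_op_adj)
 have 2: "j t x oo (b ox \<one>) = (b ox \<one>) oo j t x" using j_mult_alg[OF t x] b unfolding mult_alg_def by blast
 have "P t x oo b = (Z t)\<^sup>\<star> oo ((j t x oo (b ox \<one>)) oo Z t)" by (simp only: P_def comp_assoc Z_commutant[OF b t])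
 also have "\<dots> = ((Z t)\<^sup>\<star> oo (b ox \<one>)) oo (j t x oo Z t)" by (simp only: 2 comp_assoc)
 also have "\<dots> = b oo P t x" by (simp only: 1[symmetric] P_def comp_assoc)
 finally show "P t x oo b = b oo P t x" .
qed

lemma P_linear: "0 <= t ==> linear_map_on A (P t)"
 by (simp add: linear_map_on_def P_def j_simps comp_add_distrib)

lemma P_normal: "0 <= t ==> normal_map_on A (P t)"
 using continuous_map_compose[OF normal_hom.normal[OF normal_hom, unfolded normal_map_on_def] uw_continuous_sandwich[of "(Z t)\<^sup>\<star>" "Z t"], of t]
 unfolding normal_map_on_def o_def P_def[abs_def] .

text \<open>In the dilation the matrix form of \<open>P t\<close> is a convergent sum, over the
  coordinates, of values of the form given by \<open>a\<close>, each of them nonnegative.\<close>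

lemma P_cp:
 assumes t: "0 <= t"
 shows "completely_positive_on A (P t)"
 unfolding completely_positive_on_def nonneg_matrix_def
proof (intro allI impI)
 fix n :: nat and a and v :: "nat => 'h"
 assume a: "\<forall>i<n. \<forall>j<n. a i j \<in> A" and pos: "\<forall>v. (\<Sum>i<n. \<Sum>j<n. cinner (v i) (a i j $ v j)) \<in> \<real>\<^sub>\<ge>\<^sub>0"
 define rho where "rho i = dil t $ (Z t $ v i)" for i
 have "cinner (v i) (P t (a i k) $ v k) = cinner (rho i) (amp (a i k) $ rho k)" if "i < n" "k < n" for i k :: nat
  using a that by (simp add: cinner_P rho_def dil_cinner[OF t])
 then have "(\<Sum>i<n. \<Sum>k<n. cinner (v i) (P t (a i k) $ v k)) = (\<Sum>i<n. \<Sum>k<n. cinner (rho i) (amp (a i k) $ rho k))" by simp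
 moreover have "((%m. \<Sum>i<n. \<Sum>k<n. cinner (coord m (rho i)) (coord m (amp (a i k) $ rho k))) has_sum (\<Sum>i<n. \<Sum>k<n. cinner (rho i) (amp (a i k) $ rho k))) UNIV"
  by (intro has_sum_finite_sum parseval) auto
 then have "((%m. \<Sum>i<n. \<Sum>k<n. cinner (coord m (rho i)) (a i k $ coord m (rho k))) has_sum (\<Sum>i<n. \<Sum>k<n. cinner (rho i) (amp (a i k) $ rho k))) UNIV"
  by simp
 then have "(\<Sum>i<n. \<Sum>k<n. cinner (rho i) (amp (a i k) $ rho k)) \<in> \<real>\<^sub>\<ge>\<^sub>0"
  unfolding has_sum_def
  by (rule Lim_in_closed_set[OF closed_nonneg_Reals_complex, rotated 2])
   (intro always_eventually allI sum_nonneg_Reals[of _ "%m. \<Sum>i<n. \<Sum>k<n. cinner (coord m (rho i)) (a i k $ coord m (rho k))"] pos[rule_format], simp)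
 ultimately show "(\<Sum>i<n. \<Sum>k<n. cinner (v i) (P t (a i k) $ v k)) \<in> \<real>\<^sub>\<ge>\<^sub>0" by simp
qed

lemma P_positive: "0 <= t ==> positive_map_on A (P t)"
 using P_cp[of t, unfolded completely_positive_on_def, rule_format, of 1 "%_ _. a" for a]
 unfolding positive_map_on_def nonneg_op_def nonneg_matrix_def by fastforce

lemma P_zero: "x \<in> A ==> P 0 x = x"
 unfolding P_def Z_zero by (rule bop_cinner_eqI) (simp add: j_zero cinner_tensor coherent_vacuum)

text \<open>\<open>Z t\<close> changes the space, whereas \<open>J r\<close> acts on operators of
  one space; composing with the adjoint vacuum embedding puts the solution within reach of
  \<open>conn_intertwines\<close>.\<close>

lemma Z_vacuum_mem: "0 <= t ==> Z t oo E\<^sup>\<star> \<in> M"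
 unfolding mult_alg_def
proof (intro CollectI ballI)
 fix b assume t: "0 <= t" and b: "b \<in> commutant A"
 have "E\<^sup>\<star> oo (b ox \<one>) = b oo E\<^sup>\<star>"
  using arg_cong[OF right_ket_tensor[of "b\<^sup>\<star>" "\<varpi> (%_. 0)"], of adj] by (simp add: tensor_op_adj)
 then show "(Z t oo E\<^sup>\<star>) oo (b ox \<one>) = (b ox \<one>) oo (Z t oo E\<^sup>\<star>)"
  by (simp only: comp_assoc) (simp only: comp_assoc[symmetric] Z_commutant[OF b t])
qed

text \<open>The cocycle property only displays \<open>Z (r + t)\<close> as the adjoint of
  \<open>conn r\<close> applied to a vector. That this vector lies in the range of
  \<open>conn r\<close>, so that the isometry cancels, is the intertwining for
  \<open>Z t oo E\<^sup>\<star>\<close>; then the amplified solution and the cocycle of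
  \<open>j\<close> combine to \<open>amp (P t x)\<close>.\<close>

lemma P_semigroup:
 assumes r: "0 <= r" and t: "0 <= t" and x: "x \<in> A"
 shows "P (r + t) x = P r (P t x)"
proof (rule bop_cinner_eqI)
 fix u v
 let ?Y = "Z t oo E\<^sup>\<star>" and ?rho = "%u. dil r $ (Z r $ u)"
 have cE: "conn r $ (Z r $ u) = amp E $ ?rho u" for u by (rule conn_past_vector[OF r Z_past[OF r]])
 have YE: "?Y oo E = Z t" by (simp add: comp_assoc E_isometry)
 have "amp (Z t) $ ?rho u = amp ?Y $ (conn r $ (Z r $ u))" for u
  unfolding cE using arg_cong[OF YE, of "%T. amp T $ ?rho u"] by (simp add: amp_simps)
 then have 1: "conn r $ (J r ?Y $ (Z r $ u)) = amp (Z t) $ ?rho u" for u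
  using arg_cong[OF conn_intertwines[OF r Z_vacuum_mem[OF t]], of "%T. T $ (Z r $ u)"] by simp
 have "Z (r + t) $ u = J r ?Y $ (Z r $ u)" for u
  unfolding Z_cocycle[OF r t] 1[symmetric] isometry_adj[OF conn(2)[OF r]] ..
 then have Zc: "conn r $ (Z (r + t) $ u) = amp (Z t) $ ?rho u" for u using 1 by simp
 have "cinner v (P (r + t) x $ u) = cinner (conn r $ (Z (r + t) $ v)) (amp (j t x) $ (conn r $ (Z (r + t) $ u)))"
  unfolding cinner_P cocycle[OF r t x] by (simp add: J_def)
 also have "\<dots> = cinner (?rho v) (amp (P t x) $ ?rho u)"
  unfolding Zc by (simp add: P_def amp_simps amp_adj)
 also have "\<dots> = cinner v (P r (P t x) $ u)"
  unfolding dil_cinner[OF r P_mem[OF t x]] cinner_P ..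
 finally show "cinner v (P (r + t) x $ u) = cinner v (P r (P t x) $ u)" .
qed

lemma P_continuous:
 assumes x: "x \<in> A"
 shows "continuous_on {0..} (%t. cinner v (P t x $ u))"
 unfolding cinner_P using Z(1) unfolding curve_def by (intro continuous_intros j_curve x) auto

end

section \<open>The stochastic derivative\<close>

text \<open>Only right derivatives are at hand, so the mean value theorem is replaced by a supremum
  argument: the largest \<open>sg\<close> up to which the growth stays below slope \<open>e\<close>
  must be \<open>t\<close>, because the inequality persists at \<open>sg\<close> by continuity and a
  little beyond it by the derivative.\<close>

lemma zero_right_derivative:
 fixes D :: "real => complex"
 assumes cont: "continuous_on {0..t} D" and t: "0 <= t"
  and der: "!!r. 0 <= r ==> r < t ==> ((%tau. (D (r + tau) - D r) / of_real tau) \<longlongrightarrow> 0) (at_right 0)"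
 shows "D t = D 0"
proof -
 have le: "cmod (D t - D 0) <= e * t" if e: "0 < e" for e
 proof -
  define S where "S = {s \<in> {0..t}. \<forall>r\<in>{0..s}. cmod (D r - D 0) <= e * r}"
  define sg where "sg = Sup S"
  have S: "0 \<in> S" "bdd_above S" using t by (auto simp: S_def intro: bdd_aboveI[of _ t])
  have sg: "0 <= sg" "sg <= t" unfolding sg_def
   using cSup_upper[OF S(1) S(2)] S(1) by (auto intro!: cSup_least simp: S_def)
  have below: "cmod (D r - D 0) <= e * r" if r: "0 <= r" "r < sg" for r
  proof -
   obtain s where "s \<in> S" "r < s" using less_cSupE[of r S] r S(1) unfolding sg_def by blast
   then show ?thesis using r by (auto simp: S_def)
  qed
  have at: "cmod (D sg - D 0) <= e * sg"
  proof (cases "sg = 0")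
   case False
   then have cl: "closure {0<..<sg} = {0..sg}" using sg by simp
   have "0 <= e * sg - cmod (D sg - D 0)"
   proof (rule continuous_ge_on_closure[where f = "%r. e * r - cmod (D r - D 0)"])
    show "continuous_on (closure {0<..<sg}) (%r. e * r - cmod (D r - D 0))"
     unfolding cl using sg by (intro continuous_intros continuous_on_subset[OF cont]) auto
   qed (use below sg cl in auto)
   then show ?thesis by simp
  qed simp
  have "sg = t"
  proof (rule ccontr)
   assume "sg \<noteq> t"
   then have st: "sg < t" using sg by simp
   obtain b where b: "0 < b" "!!tau. 0 < tau ==> tau < b ==> cmod ((D (sg + tau) - D sg) / of_real tau) < e"
    using tendstoD[OF der[OF sg(1) st] e] unfolding eventually_at_right_field by auto
   define s where "s = min t (sg + b / 2)"
   have above: "cmod (D r - D 0) <= e * r" if r: "sg < r" "r <= s" for r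
   proof -
    have "cmod (D (sg + (r - sg)) - D sg) <= e * (r - sg)"
     using b(2)[of "r - sg"] r b(1) by (simp add: s_def norm_divide divide_less_eq less_imp_le del: of_real_diff)
    then have "cmod (D r - D sg) + cmod (D sg - D 0) <= e * r" using at by (simp add: right_diff_distrib)
    then show ?thesis using norm_triangle_ineq[of "D r - D sg" "D sg - D 0"] by simp
   qed
   have "cmod (D r - D 0) <= e * r" if "0 <= r" "r <= s" for r
    using at above[of r] below[of r] that by (cases r sg rule: linorder_cases) auto
   then have "s \<in> S" using sg t b(1) unfolding S_def by (auto simp: s_def)
   then have "s <= sg" unfolding sg_def by (rule cSup_upper[OF _ S(2)])
   then show False using st b(1) by (simp add: s_def)
  qed
  then show ?thesis using at by simp
 qed
 have "cmod (D t - D 0) <= 0 + e" if e: "0 < e" for e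
 proof -
  have "cmod (D t - D 0) <= e / (t + 1) * t" by (rule le) (use e t in simp)
  also have "\<dots> <= e / (t + 1) * (t + 1)" by (rule mult_left_mono) (use e t in auto)
  finally show ?thesis using t by simp
 qed
 then have "cmod (D t - D 0) <= 0" by (rule field_le_epsilon)
 then show ?thesis by simp
qed

lemma integral_right_derivative:
 fixes psi :: "real => complex"
 assumes int: "psi integrable_on {0..t}" and r: "0 <= r" "r < t" and c: "continuous (at r within {r..t}) psi"
 shows "((%tau. (integral {0..r + tau} psi - integral {0..r} psi) / of_real tau) \<longlongrightarrow> psi r) (at_right 0)"
proof -
 have ir: "psi integrable_on {r..t}" by (rule integrable_subinterval_real[OF int]) (use r in auto)
 have "((%u. integral {r..u} psi) has_vector_derivative psi r) (at r within {r..t})"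
  using integral_has_vector_derivative_continuous_at[OF ir, of r "{}"] c r by simp
 then have lim: "((%y. (1 / norm (y - r)) *\<^sub>R (integral {r..y} psi - (integral {r..r} psi + (y - r) *\<^sub>R psi r))) \<longlongrightarrow> 0) (at r within {r..t})"
  unfolding has_vector_derivative_def has_derivative_within by blast
 have "filterlim (%tau. r + tau) (at r within {r..t}) (at_right 0)"
  unfolding filterlim_at
 proof
  show "\<forall>\<^sub>F tau in at_right 0. r + tau \<in> {r..t} \<and> r + tau \<noteq> r"
   unfolding eventually_at_right_field using r by (intro exI[of _ "t - r"]) auto
  show "((%tau. r + tau) \<longlongrightarrow> r) (at_right 0)" by (rule tendsto_eq_intros refl | simp)+
 qed
 from filterlim_compose[OF lim this]
 have "((%tau. (1 / norm (r + tau - r)) *\<^sub>R (integral {r..r + tau} psi - (integral {r..r} psi + (r + tau - r) *\<^sub>R psi r))) \<longlongrightarrow> 0) (at_right 0)" .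
 moreover have "\<forall>\<^sub>F tau in at_right 0. (1 / norm (r + tau - r)) *\<^sub>R (integral {r..r + tau} psi - (integral {r..r} psi + (r + tau - r) *\<^sub>R psi r))
   = (integral {0..r + tau} psi - integral {0..r} psi) / of_real tau - psi r"
  unfolding eventually_at_right_field
 proof (intro exI[of _ "t - r"] conjI allI impI)
  fix tau assume tau: "0 < tau" "tau < t - r"
  have "integral {0..r} psi + integral {r..r + tau} psi = integral {0..r + tau} psi"
   by (rule Henstock_Kurzweil_Integration.integral_combine) (use r tau in \<open>auto intro: integrable_subinterval_real[OF int]\<close>)
  then show "(1 / norm (r + tau - r)) *\<^sub>R (integral {r..r + tau} psi - (integral {r..r} psi + (r + tau - r) *\<^sub>R psi r))
   = (integral {0..r + tau} psi - integral {0..r} psi) / of_real tau - psi r"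
   using tau(1) by (auto simp: scaleR_conv_of_real field_simps)
 qed (use r in simp)
 ultimately have "((%tau. (integral {0..r + tau} psi - integral {0..r} psi) / of_real tau - psi r) \<longlongrightarrow> 0) (at_right 0)"
  by (rule Lim_transform_eventually)
 then show ?thesis by (rule LIM_zero_cancel)
qed

text \<open>The difference between \<open>phi\<close> and the indefinite integral of
  \<open>psi\<close> has vanishing right derivative. Jumps of \<open>psi\<close> are harmless as
  long as it is continuous from the right.\<close>

lemma right_derivative_integral:
 fixes phi psi :: "real => complex"
 assumes cont: "continuous_on {0..t} phi" and t: "0 <= t" and int: "psi integrable_on {0..t}"
  and c: "!!r. 0 <= r ==> r < t ==> continuous (at r within {r..t}) psi"
  and der: "!!r. 0 <= r ==> r < t ==> ((%tau. (phi (r + tau) - phi r) / of_real tau) \<longlongrightarrow> psi r) (at_right 0)"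
 shows "(psi has_integral phi t - phi 0) {0..t}"
proof -
 let ?D = "%s. phi s - integral {0..s} psi"
 have "?D t = ?D 0"
 proof (rule zero_right_derivative[OF _ t])
  show "continuous_on {0..t} ?D" by (intro continuous_intros cont indefinite_integral_continuous_1 int)
  show "((%tau. (?D (r + tau) - ?D r) / of_real tau) \<longlongrightarrow> 0) (at_right 0)" if "0 <= r" "r < t" for r
  proof -
   have "(?D (r + tau) - ?D r) / of_real tau = (phi (r + tau) - phi r) / of_real tau - (integral {0..r + tau} psi - integral {0..r} psi) / of_real tau" for tau
    unfolding diff_divide_distrib[symmetric] by (intro arg_cong2[where f = "(/)"]) simp_all
   then show ?thesis
    using tendsto_diff[OF der[OF that] integral_right_derivative[OF int that c[OF that]]] by (simp only:) simp
  qed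
 qed
 then have "integral {0..t} psi = phi t - phi 0" by (simp add: algebra_simps)
 then show ?thesis using int by (simp add: has_integral_iff)
qed

section \<open>Coherent vectors over a short initial interval\<close>

lemma step_right_constant:
 fixes f :: "real => 'k::complex_hilbert"
 assumes "f \<in> step_functions"
 shows "\<exists>e>0. \<forall>s. r <= s \<and> s < r + e \<longrightarrow> f s = f r"
 using assms
proof (induction rule: step_induct)
 case zero
 show ?case by (intro exI[of _ 1]) simp
next
 case (elem a b c)
 let ?e = "if r < a then a - r else if r < b then b - r else 1"
 show ?case by (intro exI[of _ ?e]) (auto simp: elem_step_def indicator_def)
next
 case (add f g)
 then obtain e e' where e: "0 < e" "0 < e'" "\<forall>s. r <= s \<and> s < r + e \<longrightarrow> f s = f r" "\<forall>s. r <= s \<and> s < r + e' \<longrightarrow> g s = g r"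
  by (elim exE conjE) (rule that)
 show ?case
 proof (intro exI[of _ "min e e'"] conjI allI impI)
  show "f s + g s = f r + g r" if "r <= s \<and> s < r + min e e'" for s
   using e(3)[rule_format, of s] e(4)[rule_format, of s] that by (simp add: min_def split: if_splits)
 qed (use e in simp)
qed

text \<open>With \<open>r\<close> the squared norm of \<open>y\<close>, the squared norm of the
  remainder is \<open>exp r - 1 - r\<close>, which is at most the square of \<open>r\<close> when
  \<open>r\<close> is at most 1.\<close>

lemma expv_remainder:
 assumes "norm y <= 1"
 shows "norm (expv y - expv 0 - sym_power 1 y) <= (norm y)\<^sup>2"
proof (rule power2_le_imp_le)
 have 1: "cinner (sym_power 1 y) (expv 0) = 0" "cinner (sym_power 1 y) (expv y) = cinner y y" "cinner (sym_power 1 y) (sym_power 1 y) = cinner y y"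
  by (simp_all add: cinner_sym_power_expv cinner_sym_power)
 have 2: "cinner (expv 0) (sym_power 1 y) = 0" "cinner (expv y) (sym_power 1 y) = cinner y y"
  using 1 cinner_commute[of "expv 0" "sym_power 1 y"] cinner_commute[of "expv y" "sym_power 1 y"] cinner_commute[of y y] by simp_all
 have "(norm (expv y - expv 0 - sym_power 1 y))\<^sup>2 = exp ((norm y)\<^sup>2) - 1 - (norm y)\<^sup>2"
  unfolding norm_sq_Re cinner_diff_left cinner_diff_right 1 2 cinner_expv by (simp add: cinner_self exp_of_real flip: of_real_power)
 also have "\<dots> <= ((norm y)\<^sup>2)\<^sup>2"
  using exp_bound[of "(norm y)\<^sup>2"] assms by (simp add: power_le_one)
 finally show "(norm (expv y - expv 0 - sym_power 1 y))\<^sup>2 <= ((norm y)\<^sup>2)\<^sup>2" .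
qed simp

text \<open>Before \<open>tau\<close> the function is the constant \<open>c\<close>, so its past is
  an exponential vector over the square root of \<open>tau\<close> times a vector of norm
  \<open>norm c\<close>. Expanding to first order leaves an error of order
  \<open>tau\<close>.\<close>

lemma past_proj_expansion:
 fixes f :: "real => 'k::complex_hilbert"
 assumes tau: "0 < tau" "tau * (norm c)\<^sup>2 <= 1" and f: "f \<in> step_functions" and c: "!!s. 0 <= s ==> s < tau ==> f s = c"
 shows "\<exists>rho. past_proj tau $ \<varpi> f = cinner (\<varpi> (%_. 0)) (\<varpi> f) *\<^sub>C (\<varpi> (%_. 0) + of_real (sqrt tau) *\<^sub>C particle tau c + rho) \<and> norm rho <= tau * (norm c)\<^sup>2"
proof -
 define y' where "y' = L2_of (restrict_to {0..<tau} (%_. (1 / sqrt tau) *\<^sub>R c))"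
 define y where "y = L2_of (bef tau f)"
 have b: "bef tau f = (%s. of_real (sqrt tau) *\<^sub>C restrict_to {0..<tau} (%_. (1 / sqrt tau) *\<^sub>R c) s)"
  using c tau by (intro ext) (auto simp: restrict_to_def indicator_def simp flip: scaleR_scaleC)
 have y: "y = of_real (sqrt tau) *\<^sub>C y'"
  unfolding y_def y'_def b by (rule L2_of_scaleC[OF step_sqi[OF particle_step]]) (use tau in simp)
 have p: "particle tau c = sym_power 1 y'" by (simp add: particle_def y'_def)
 have "cinner y' y' = cinner c c" using cinner_particle[OF tau(1), of c c] unfolding p cinner_sym_power by simp
 then have "(norm y')\<^sup>2 = (norm c)\<^sup>2" by (simp only: norm_sq_Re)
 then have "norm y' = norm c" by (simp only: power2_eq_iff_nonneg norm_ge_zero)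
 then have ny: "(norm y)\<^sup>2 = tau * (norm c)\<^sup>2" using tau by (simp add: y norm_scaleC power_mult_distrib)
 then have "(norm y)\<^sup>2 <= 1" using tau by simp
 then have "norm y <= 1" by (simp add: power_le_one_iff abs_square_le_1)
 note rem = expv_remainder[OF this, unfolded ny]
 have v: "\<varpi> (%_. 0 :: 'k) = expv 0" by (simp add: coherent_eq)
 let ?kappa = "cinner (\<varpi> (%_. 0)) (\<varpi> (unshift_fun tau f))"
 have u0: "unshift_fun tau (%_. 0 :: 'k) = (%_. 0)" by (simp add: unshift_fun_def fun_eq_iff)
 have "cinner (\<varpi> (%_. 0)) (\<varpi> f) = of_real (exp (- (norm y)\<^sup>2 / 2)) * ?kappa"
  using coherent_split_unshift[OF less_imp_le[OF tau(1)] step_zero f]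
  by (simp add: u0) (simp add: cinner_coherent y_def cinner_self flip: of_real_power exp_of_real)
 moreover have "past_proj tau $ \<varpi> f = (of_real (exp (- (norm y)\<^sup>2 / 2)) * ?kappa) *\<^sub>C expv y"
  using tau f by (simp add: past_proj_coherent coherent_eq[of "bef tau f"] y_def scaleR_scaleC scaleC_scaleC mult.commute del: of_real_exp)
 moreover have "expv y = \<varpi> (%_. 0) + of_real (sqrt tau) *\<^sub>C particle tau c + (expv y - expv 0 - sym_power 1 y)"
  by (simp add: v p y sym_power_1_linear del: One_nat_def)
 ultimately show ?thesis using rem by metis
qed

lemma limitin_uw_add:
 assumes "limitin uw_top f S F" "limitin uw_top g T F"
 shows "limitin uw_top (%t. f t + g t) (S + T) F"
 using assms unfolding limitin_uw_iff by (simp add: uwf_add tendsto_add)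

section \<open>Difference quotients and the blocks of the stochastic derivative\<close>

context flow
begin

abbreviation incr :: "real => 'h operator => ('h, 'k noise) tensor operator" where
 "incr t x \<equiv> j t x - x ox \<one>"

text \<open>The row operator built from the scaled vacuum embedding and the one-particle isometry;
  its adjoint is the column on the other side of the difference quotient.\<close>

definition dress :: "real => ('h \<times> ('k, 'h) tensor, ('h, 'k noise) tensor) bop" where
 "dress t = row_op (of_real (1 / sqrt t) *\<^sub>C E) (one_particle t)"

lemma dress_apply: "dress t $ (u, w) = of_real (1 / sqrt t) *\<^sub>C (E $ u) + one_particle t $ w"
 by (simp add: dress_def row_op.rep_eq)

lemma difference_quotient_eq: "difference_quotient j t x = (dress t)\<^sup>\<star> oo incr t x oo dress t"
proof -
 have col: "column_op (of_real (1 / sqrt t) *\<^sub>C E\<^sup>\<star>) ((one_particle t)\<^sup>\<star>) = (dress t)\<^sup>\<star>"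
  by (rule bop_cinner_eqI, unfold cinner_adj2)
   (simp add: dress_def column_op.rep_eq row_op.rep_eq cinner_prod_def cinner_add_left cinner_scaleC_left cinner_scaleC_right)
 show ?thesis unfolding difference_quotient_def Let_def col dress_def[symmetric] ..
qed

lemma cinner_difference_quotient:
 "cinner p (difference_quotient j t x $ q) = cinner (dress t $ p) (incr t x $ (dress t $ q))"
 by (simp only: difference_quotient_eq bop_comp.rep_eq cinner_adj2)

lemma stoch_deriv_limit: "x \<in> deriv_dom A j ==> limitin uw_top (%t. difference_quotient j t x) (stoch_deriv j x) (at_right 0)"
 unfolding stoch_deriv_def
 by (rule theI', rule ex_ex1I) (auto simp: deriv_dom_def intro: limitin_Hausdorff_unique[OF _ _ _ Hausdorff_uw_top])

lemma deriv_dom_mem: "x \<in> deriv_dom A j ==> x \<in> A"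
 by (simp add: deriv_dom_def)

lemma incr_adj: "0 <= t ==> x \<in> A ==> incr t (x\<^sup>\<star>) = (incr t x)\<^sup>\<star>"
 by (simp add: j_simps tensor_op_adj)

lemma stoch_deriv_adj:
 assumes "x \<in> deriv_dom A j"
 shows "x\<^sup>\<star> \<in> deriv_dom A j" "stoch_deriv j (x\<^sup>\<star>) = (stoch_deriv j x)\<^sup>\<star>"
proof -
 have "difference_quotient j t (x\<^sup>\<star>) = (difference_quotient j t x)\<^sup>\<star>" if "0 < t" for t
  by (simp only: difference_quotient_eq incr_adj[OF less_imp_le[OF that] deriv_dom_mem[OF assms]] adj_comp adj_simps comp_assoc)
 then have "\<forall>\<^sub>F t in at_right 0. (difference_quotient j t x)\<^sup>\<star> = difference_quotient j t (x\<^sup>\<star>)"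
  unfolding eventually_at_right_field by (intro exI[of _ 1]) simp
 then have lim: "limitin uw_top (%t. difference_quotient j t (x\<^sup>\<star>)) ((stoch_deriv j x)\<^sup>\<star>) (at_right 0)"
  by (rule limitin_transform_eventually) (rule continuous_map_limit[OF uw_continuous_adj stoch_deriv_limit[OF assms], unfolded o_def])
 then show "x\<^sup>\<star> \<in> deriv_dom A j" unfolding deriv_dom_def using A_simps(4)[OF deriv_dom_mem[OF assms]] by blast
 then show "stoch_deriv j (x\<^sup>\<star>) = (stoch_deriv j x)\<^sup>\<star>"
  using limitin_Hausdorff_unique[OF stoch_deriv_limit lim _ Hausdorff_uw_top] by simp
qed

lemma stoch_deriv_tendsto:
 "x \<in> deriv_dom A j ==> ((%t. cinner (dress t $ p) (incr t x $ (dress t $ q))) \<longlongrightarrow> cinner p (stoch_deriv j x $ q)) (at_right 0)"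
 using limitin_uw_cinner[OF stoch_deriv_limit] unfolding cinner_difference_quotient .

text \<open>\<open>dress t\<close> intertwines the diagonal operator with entries \<open>b\<close>
  and \<open>\<one> ox b\<close> with \<open>b ox \<one>\<close>, which commutes with the increment.
  The limit inherits this, and so the blocks belong to \<open>A\<close> or are affiliated
  columns.\<close>

lemma stoch_deriv_commutant:
 assumes x: "x \<in> deriv_dom A j" and b: "b \<in> commutant A"
 shows "cinner (v, w) (stoch_deriv j x $ (b $ u, 0)) = cinner (b\<^sup>\<star> $ v, (\<one> ox b\<^sup>\<star>) $ w) (stoch_deriv j x $ (u, 0))"
proof (rule tendsto_unique[OF _ stoch_deriv_tendsto[OF x]])
 have V: "one_particle t oo (\<one> ox c) = (c ox \<one>) oo one_particle t" if "0 < t" for t c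
  by (rule tensor_bop_eqI) (use that in \<open>simp add: one_particle_apply\<close>)
 have d: "dress t $ (c $ u, (\<one> ox c) $ w) = (c ox \<one>) $ (dress t $ (u, w))" if "0 < t" for t c u w
  using arg_cong[OF V[OF that, of c], of "%T. T $ w"] by (simp add: dress_apply)
 have "cinner (dress t $ (v, w)) (incr t x $ (dress t $ (b $ u, 0)))
   = cinner (dress t $ (b\<^sup>\<star> $ v, (\<one> ox b\<^sup>\<star>) $ w)) (incr t x $ (dress t $ (u, 0)))" if t: "0 < t" for t
 proof -
  have 1: "j t x oo (b ox \<one>) = (b ox \<one>) oo j t x" and "x oo b = b oo x"
   using j_mult_alg[of t x] t deriv_dom_mem[OF x] b vna_mem[OF vna, of x] unfolding mult_alg_def by auto
  then have 2: "(x ox (\<one> :: 'k noise operator)) oo (b ox \<one>) = (b ox \<one>) oo (x ox \<one>)" by (simp only: tensor_op_comp)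
  have "incr t x $ ((b ox \<one>) $ xi) = (b ox \<one>) $ (incr t x $ xi)" for xi
   using arg_cong[OF 1, of "%T. T $ xi"] arg_cong[OF 2, of "%T. T $ xi"] by (simp add: minus_bop.rep_eq)
  then show ?thesis
   using d[OF t, of b u 0] cinner_adj[of "b ox \<one>" "dress t $ (v, w)" "incr t x $ (dress t $ (u, 0))"]
   by (simp add: d[OF t] tensor_op_adj del: cinner_adj)
 qed
 then have "\<forall>\<^sub>F t in at_right 0. cinner (dress t $ (b\<^sup>\<star> $ v, (\<one> ox b\<^sup>\<star>) $ w)) (incr t x $ (dress t $ (u, 0)))
   = cinner (dress t $ (v, w)) (incr t x $ (dress t $ (b $ u, 0)))"
  unfolding eventually_at_right_field by (intro exI[of _ 1]) simp
 then show "((%t. cinner (dress t $ (v, w)) (incr t x $ (dress t $ (b $ u, 0)))) \<longlongrightarrow> cinner (b\<^sup>\<star> $ v, (\<one> ox b\<^sup>\<star>) $ w) (stoch_deriv j x $ (u, 0))) (at_right 0)"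
  by (rule Lim_transform_eventually[OF stoch_deriv_tendsto[OF x]])
qed simp

lemma cinner_deriv:
 "cinner v (deriv_L j x $ u) = cinner (v, 0) (stoch_deriv j x $ (u, 0))"
 "cinner w (deriv_delta j x $ u) = cinner (0, w) (stoch_deriv j x $ (u, 0))"
 by (simp_all add: deriv_L_def deriv_delta_def row_op.rep_eq column_op.rep_eq cinner_prod_def)

lemma deriv_mem:
 assumes x: "x \<in> deriv_dom A j"
 shows "deriv_L j x \<in> A" "ket_affil A (deriv_delta j x)"
proof -
 show "deriv_L j x \<in> A" unfolding vna_mem[OF vna]
 proof (intro ballI bop_cinner_eqI)
  fix b u v assume b: "b \<in> commutant A"
  show "cinner v ((deriv_L j x oo b) $ u) = cinner v ((b oo deriv_L j x) $ u)"
   using stoch_deriv_commutant[OF x b, of v 0 u] cinner_adj[of b v "deriv_L j x $ u"] by (simp add: cinner_deriv del: cinner_adj)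
 qed
 show "ket_affil A (deriv_delta j x)" unfolding ket_affil_def
 proof (intro ballI bop_cinner_eqI)
  fix b u v assume b: "b \<in> commutant A"
  show "cinner v ((deriv_delta j x oo b) $ u) = cinner v (((\<one> ox b) oo deriv_delta j x) $ u)"
   using stoch_deriv_commutant[OF x b, of 0 v u] cinner_adj[of "\<one> ox b" v "deriv_delta j x $ u"]
   by (simp add: cinner_deriv tensor_op_adj del: cinner_adj)
 qed
qed

lemma incr_tendsto_zero: "x \<in> A ==> ((%t. incr t x $ xi) \<longlongrightarrow> 0) (at_right 0)"
proof -
 assume x: "x \<in> A"
 have "((%t. j t x $ xi) \<longlongrightarrow> j 0 x $ xi) (at_right 0)"
  using j_strong_continuous[OF x, of xi] unfolding continuous_on_def
  by (auto intro: tendsto_within_subset)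
 then show ?thesis by (simp add: j_zero[OF x] minus_bop.rep_eq LIM_zero)
qed

lemma incr_past: "0 <= t ==> x \<in> A ==> past t $ (incr t x $ (E $ u)) = incr t x $ (E $ u)"
 using arg_cong[OF j_past[of t x], of "%T. T $ (E $ u)"]
 by (simp add: minus_bop.rep_eq past_vacuum)

end

lemma tendsto_cinner_null:
 fixes a b :: "'t => 'a::complex_hilbert"
 assumes "\<forall>\<^sub>F t in F. norm (a t) <= K" "(b \<longlongrightarrow> 0) F"
 shows "((%t. cinner (a t) (b t)) \<longlongrightarrow> 0) F" "((%t. cinner (b t) (a t)) \<longlongrightarrow> 0) F"
proof -
 have "((%t. K * norm (b t)) \<longlongrightarrow> K * 0) F" by (intro tendsto_intros tendsto_norm_zero assms(2))
 then have lim: "((%t. K * norm (b t)) \<longlongrightarrow> 0) F" by simp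
 have le: "norm (cinner (a t) (b t)) <= K * norm (b t) \<and> norm (cinner (b t) (a t)) <= K * norm (b t)" if "norm (a t) <= K" for t
  using cinner_cauchy_schwarz[of "a t" "b t"] cinner_cauchy_schwarz[of "b t" "a t"] mult_right_mono[OF that norm_ge_zero, of "b t"]
  unfolding mult.commute[of "norm (b t)" "norm (a t)"] by auto
 have 1: "\<forall>\<^sub>F t in F. norm (cinner (a t) (b t)) <= K * norm (b t)" "\<forall>\<^sub>F t in F. norm (cinner (b t) (a t)) <= K * norm (b t)"
  by (rule eventually_mono[OF assms(1)], use le in blast)+
 show "((%t. cinner (a t) (b t)) \<longlongrightarrow> 0) F" "((%t. cinner (b t) (a t)) \<longlongrightarrow> 0) F"
  by (rule Lim_null_comparison[OF 1(1) lim], rule Lim_null_comparison[OF 1(2) lim])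
qed

lemma eventually_unit_interval: "(!!t::real. 0 < t ==> t < 1 ==> Q t) ==> \<forall>\<^sub>F t in at_right 0. Q t"
 unfolding eventually_at_right_field by (intro exI[of _ 1]) auto

section \<open>The increment of the flow on vacuum vectors\<close>

context flow
begin

lemma incr_E_norm: "0 <= t ==> x \<in> A ==> norm (incr t x $ xi) <= (opnorm x + opnorm (x ox (\<one> :: 'k noise operator))) * norm xi"
 using norm_triangle_ineq4[of "j t x $ xi" "(x ox (\<one> :: 'k noise operator)) $ xi"] j_norm_le[of t x xi] opnorm[of "x ox (\<one> :: 'k noise operator)" xi]
 by (simp add: minus_bop.rep_eq distrib_right)

text \<open>The increment applied to a vacuum vector belongs to the past of \<open>tau\<close>, so
  the coherent test vector may be projected and expanded. Its vacuum and one-particle terms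
  reproduce the difference quotient tested at \<open>(v, f 0 \<otimes> v)\<close>; the remainder, of
  order \<open>tau\<close>, survives division by \<open>tau\<close> only as a bounded
  factor.\<close>

lemma slice_expansion:
 assumes x: "x \<in> A" and f: "f \<in> step_functions" and tau: "0 < tau" "tau * (norm (f 0))\<^sup>2 <= 1" and c: "!!s. 0 <= s ==> s < tau ==> f s = f 0"
 shows "cmod (cinner (v \<otimes> \<varpi> f) (incr tau x $ (E $ u)) / of_real tau
   - cinner (\<varpi> f) (\<varpi> (%_. 0)) * cinner (v, f 0 \<otimes> v) (difference_quotient j tau x $ (u, 0)))
  <= cmod (cinner (\<varpi> f) (\<varpi> (%_. 0))) * (norm (f 0))\<^sup>2 * norm v * norm (incr tau x $ (E $ u))"
proof -
 let ?y = "incr tau x $ (E $ u)" and ?gamma = "cinner (\<varpi> f) (\<varpi> (%_. 0))"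
 obtain rho where rho: "past_proj tau $ \<varpi> f = cinner (\<varpi> (%_. 0)) (\<varpi> f) *\<^sub>C (\<varpi> (%_. 0) + of_real (sqrt tau) *\<^sub>C particle tau (f 0) + rho)" "norm rho <= tau * (norm (f 0))\<^sup>2"
  using past_proj_expansion[OF tau f c] by blast
 have "cinner (v \<otimes> \<varpi> f) ?y = cinner (past tau $ (v \<otimes> \<varpi> f)) ?y"
  unfolding past_cinner[OF less_imp_le[OF tau(1)]] incr_past[OF less_imp_le[OF tau(1)] x] ..
 also have "past tau $ (v \<otimes> \<varpi> f) = cnj ?gamma *\<^sub>C (E $ v + of_real (sqrt tau) *\<^sub>C (v \<otimes> particle tau (f 0)) + v \<otimes> rho)"
  using cinner_commute[of "\<varpi> (%_. 0)" "\<varpi> f"] by (simp add: past_def rho(1) tensor_bilinear scaleC_add_right)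
 also have "cinner \<dots> ?y = ?gamma * (cinner (E $ v) ?y + of_real (sqrt tau) * cinner (v \<otimes> particle tau (f 0)) ?y + cinner (v \<otimes> rho) ?y)"
  by (simp only: cinner_scaleC_left cinner_add_left complex_cnj_complex_of_real complex_cnj_cnj)
 finally have 1: "cinner (v \<otimes> \<varpi> f) ?y = ?gamma * (cinner (E $ v) ?y + of_real (sqrt tau) * cinner (v \<otimes> particle tau (f 0)) ?y + cinner (v \<otimes> rho) ?y)" .
 have s: "complex_of_real tau = of_real (sqrt tau) * of_real (sqrt tau)" "complex_of_real (sqrt tau) \<noteq> 0" using tau by (simp_all flip: of_real_mult)
 have 2: "cinner (v, f 0 \<otimes> v) (difference_quotient j tau x $ (u, 0)) = cinner (E $ v) ?y / of_real tau + cinner (v \<otimes> particle tau (f 0)) ?y / of_real (sqrt tau)"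
 proof -
  have "incr tau x $ (dress tau $ (u, 0)) = of_real (1 / sqrt tau) *\<^sub>C ?y" by (simp only: dress_apply bop_arith add_0_right)
  moreover have "dress tau $ (v, f 0 \<otimes> v) = of_real (1 / sqrt tau) *\<^sub>C (E $ v) + v \<otimes> particle tau (f 0)" using tau by (simp only: dress_apply one_particle_apply)
  ultimately show ?thesis
   unfolding cinner_difference_quotient s(1) cinner_add_left cinner_scaleC_left cinner_scaleC_right by (simp only:) (simp add: cinner_add_left cinner_scaleC_left cinner_scaleC_right add_divide_distrib del: bop_arith minus_bop.rep_eq)
 qed
 have "cinner (v \<otimes> \<varpi> f) ?y / of_real tau - ?gamma * cinner (v, f 0 \<otimes> v) (difference_quotient j tau x $ (u, 0)) = ?gamma * cinner (v \<otimes> rho) ?y / of_real tau"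
  unfolding 1 2 s(1) using s(2) by (simp add: field_simps)
 also have "cmod \<dots> <= cmod ?gamma * (norm v * (tau * (norm (f 0))\<^sup>2) * norm ?y) / tau"
  using tau rho(2) cinner_cauchy_schwarz[of "v \<otimes> rho" ?y]
  by (simp only: norm_mult norm_divide norm_of_real abs_of_pos)
   (intro divide_right_mono mult_left_mono, auto simp: norm_tensor elim!: order.trans intro!: mult_right_mono mult_left_mono)
 also have "\<dots> = cmod ?gamma * (norm (f 0))\<^sup>2 * norm v * norm ?y" using tau by simp
 finally show ?thesis .
qed

text \<open>The error in \<open>slice_expansion\<close> carries the increment itself, which tends to
  0 strongly and is uniformly bounded; so it tends to 0 ultraweakly. The ultraweak form of the limit
  is what will survive amplification.\<close>

lemma slice_limit:
 assumes x: "x \<in> deriv_dom A j" and f: "f \<in> step_functions"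
 shows "limitin uw_top (%tau. of_real (1 / tau) *\<^sub>C ((right_ket (\<varpi> f))\<^sup>\<star> oo incr tau x oo E))
  (cinner (\<varpi> f) (\<varpi> (%_. 0)) *\<^sub>C (deriv_L j x + ketc (f 0) (deriv_delta j x))) (at_right 0)"
proof -
 let ?gamma = "cinner (\<varpi> f) (\<varpi> (%_. 0))" and ?C = "column_op \<one> (left_ket (f 0)) :: ('h, 'h \<times> ('k, 'h) tensor) bop"
  and ?I = "column_op \<one> 0 :: ('h, 'h \<times> ('k, 'h) tensor) bop"
 let ?S = "%tau. of_real (1 / tau) *\<^sub>C ((right_ket (\<varpi> f))\<^sup>\<star> oo incr tau x oo E)"
  and ?Q = "%tau. ?gamma *\<^sub>C (?C\<^sup>\<star> oo difference_quotient j tau x oo ?I)"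
 have "?C\<^sup>\<star> oo stoch_deriv j x oo ?I = deriv_L j x + ketc (f 0) (deriv_delta j x)"
  by (rule bop_cinner_eqI) (simp add: ketc_def cinner_deriv cinner_add_right column_op.rep_eq left_ket.rep_eq cinner_prod_def)
 then have Q: "limitin uw_top ?Q (?gamma *\<^sub>C (deriv_L j x + ketc (f 0) (deriv_delta j x))) (at_right 0)"
  using continuous_map_limit[OF uw_continuous_scaleC[OF uw_continuous_sandwich[of "?C\<^sup>\<star>" ?I]] stoch_deriv_limit[OF x], of ?gamma]
  by (simp add: o_def)
 obtain e where e: "0 < e" "\<forall>s. 0 <= s \<and> s < 0 + e \<longrightarrow> f s = f 0" using step_right_constant[OF f, of 0] by blast
 \<comment> \<open>Below \<open>b\<close> the function \<open>f\<close> is constant and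
   \<open>tau\<close> times the squared norm of its value is at most 1; the added 1 avoids division
   by zero.\<close>
 define b where "b = min e (1 / ((norm (f 0))\<^sup>2 + 1))"
 have N: "0 < (norm (f 0))\<^sup>2 + 1" by (rule add_nonneg_pos) auto
 then have b: "0 < b" using e(1) by (simp add: b_def)
 have R: "norm ((?S tau - ?Q tau) $ u) <= cmod ?gamma * (norm (f 0))\<^sup>2 * norm (incr tau x $ (E $ u))" if tau: "0 < tau" "tau < b" for tau u
 proof (rule norm_le_cinner)
  fix v
  have "tau * ((norm (f 0))\<^sup>2 + 1) <= 1" using tau(2) pos_less_divide_eq[OF N, of tau 1] by (simp add: b_def)
  then have "tau * (norm (f 0))\<^sup>2 <= 1" using tau(1) by (simp add: distrib_left)
  then have "cmod (cinner (v \<otimes> \<varpi> f) (incr tau x $ (E $ u)) / of_real tau - ?gamma * cinner (v, f 0 \<otimes> v) (difference_quotient j tau x $ (u, 0)))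
   <= cmod ?gamma * (norm (f 0))\<^sup>2 * norm v * norm (incr tau x $ (E $ u))"
   by (intro slice_expansion deriv_dom_mem x f e(2)[rule_format]) (use tau in \<open>simp_all add: b_def\<close>)
  moreover have "cinner v ((?S tau - ?Q tau) $ u) = cinner (v \<otimes> \<varpi> f) (incr tau x $ (E $ u)) / of_real tau - ?gamma * cinner (v, f 0 \<otimes> v) (difference_quotient j tau x $ (u, 0))"
   by (simp add: minus_bop.rep_eq[of "?S tau"] cinner_diff_right[of v] cinner_scaleC_right[of v] column_op.rep_eq left_ket.rep_eq del: bop_arith)
  ultimately show "cmod (cinner v ((?S tau - ?Q tau) $ u)) <= cmod ?gamma * (norm (f 0))\<^sup>2 * norm (incr tau x $ (E $ u)) * norm v" by (simp only: mult_ac)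
 qed simp
 have ev: "\<forall>\<^sub>F tau in at_right 0. 0 < tau \<and> tau < b" unfolding eventually_at_right_field using b by blast
 have "limitin uw_top (%tau. ?S tau - ?Q tau) 0 (at_right 0)"
 proof (rule limitin_uw_bounded)
  let ?K = "opnorm x + opnorm (x ox (\<one> :: 'k noise operator))"
  show "\<forall>\<^sub>F tau in at_right 0. \<forall>u. norm ((?S tau - ?Q tau) $ u) <= cmod ?gamma * (norm (f 0))\<^sup>2 * ?K * norm u"
   using ev
  proof (eventually_elim, intro allI)
   fix tau u assume tau: "0 < tau \<and> tau < b"
   have "norm (incr tau x $ (E $ u)) <= ?K * norm u"
    using incr_E_norm[of tau x "E $ u"] tau deriv_dom_mem[OF x] by (simp add: norm_tensor coherent_vacuum)
   then have "cmod ?gamma * (norm (f 0))\<^sup>2 * norm (incr tau x $ (E $ u)) <= cmod ?gamma * (norm (f 0))\<^sup>2 * (?K * norm u)"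
    by (rule mult_left_mono) simp
   then have "cmod ?gamma * (norm (f 0))\<^sup>2 * norm (incr tau x $ (E $ u)) <= cmod ?gamma * (norm (f 0))\<^sup>2 * ?K * norm u"
    by (simp only: mult.assoc)
   with R[OF conjunct1[OF tau] conjunct2[OF tau], of u]
   show "norm ((?S tau - ?Q tau) $ u) <= cmod ?gamma * (norm (f 0))\<^sup>2 * ?K * norm u" by (rule order.trans)
  qed
  fix v u
  have "((%tau. cmod ?gamma * (norm (f 0))\<^sup>2 * norm (incr tau x $ (E $ u))) \<longlongrightarrow> cmod ?gamma * (norm (f 0))\<^sup>2 * 0) (at_right 0)"
   by (intro tendsto_mult_left tendsto_norm_zero incr_tendsto_zero deriv_dom_mem x)
  then have "((%tau. cmod ?gamma * (norm (f 0))\<^sup>2 * norm (incr tau x $ (E $ u))) \<longlongrightarrow> 0) (at_right 0)" by (simp only: mult_zero_right)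
  then have "((%tau. (?S tau - ?Q tau) $ u) \<longlongrightarrow> 0) (at_right 0)"
   by (rule Lim_null_comparison[rotated]) (use ev R in \<open>auto elim!: eventually_mono simp del: minus_bop.rep_eq\<close>)
  from tendsto_cinner[OF tendsto_const[of v] this] show "((%tau. cinner v ((?S tau - ?Q tau) $ u)) \<longlongrightarrow> cinner v (0 $ u)) (at_right 0)"
   by (simp only: zero_bop.rep_eq)
 qed
 note lim = limitin_uw_add[OF Q this]
 have eq: "(%tau. ?Q tau + (?S tau - ?Q tau)) = ?S" by (intro ext) (simp only: add_diff_eq add_diff_cancel_left')
 show ?thesis using lim unfolding eq add_0_right .
qed

text \<open>The structure relation in integrated form: \<open>j\<^sub>t(x) - x\<close> applied to the vacuum is the stochastic
 integral of \<open>j\<^sub>s(L x)\<close> and \<open>j\<^sub>s(delta x)\<close>; by the cocycle property both sides have the same right derivative.\<close>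

lemma incr_ito:
 assumes x: "x \<in> deriv_dom A j" and t: "0 <= t"
 shows "is_ito 0 t (%s. j s (deriv_L j x) $ (E $ u)) (%s. jhat s (deriv_delta j x) $ (E $ u)) (incr t x $ (E $ u))"
proof (rule is_itoI)
 fix v :: 'h and f :: "real => 'k" assume f: "f \<in> step_functions"
 note L = deriv_mem(1)[OF x] and D = deriv_mem(2)[OF x]
 let ?e = "v \<otimes> \<varpi> f" and ?xi = "E $ u"
 let ?psi = "%s. cinner ?e (j s (deriv_L j x) $ ?xi) + cinner (f s \<otimes> ?e) (jhat s (deriv_delta j x) $ ?xi)"
 have cont: "continuous_on S (%s. j s (deriv_L j x) $ ?xi)" "continuous_on S (%s. jhat s (deriv_delta j x) $ ?xi)" if "S \<subseteq> {0..}" for S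
  by (intro j_curve jhat_curve L D that continuous_on_const)+
 have "(?psi has_integral cinner ?e (j t x $ ?xi) - cinner ?e (j 0 x $ ?xi)) {0..t}"
 proof (rule right_derivative_integral[OF _ t])
  show "continuous_on {0..t} (%s. cinner ?e (j s x $ ?xi))"
   by (rule continuous_on_subset[OF cinner_j_continuous[OF deriv_dom_mem[OF x]]]) auto
  show "?psi integrable_on {0..t}" by (rule ito_integrable[OF f cont(1) cont(2)]) auto
  fix r assume r: "0 <= r" "r < t"
  obtain e where e: "0 < e" "\<forall>s. r <= s \<and> s < r + e \<longrightarrow> f s = f r" using step_right_constant[OF f, of r] by blast
  have "continuous_on {r..t} (%s. cinner ?e (j s (deriv_L j x) $ ?xi) + cinner (f r \<otimes> ?e) (jhat s (deriv_delta j x) $ ?xi))"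
   using r by (intro continuous_intros cont) auto
  then have "continuous (at r within {r..t}) (%s. cinner ?e (j s (deriv_L j x) $ ?xi) + cinner (f r \<otimes> ?e) (jhat s (deriv_delta j x) $ ?xi))"
   using r by (simp add: continuous_on_eq_continuous_within)
  then show "continuous (at r within {r..t}) ?psi"
  proof (rule continuous_transform_within[OF _ e(1)])
   fix s assume "s \<in> {r..t}" "dist s r < e"
   then have "f s = f r" by (intro e(2)[rule_format]) (auto simp: dist_real_def)
   then show "cinner ?e (j s (deriv_L j x) $ ?xi) + cinner (f r \<otimes> ?e) (jhat s (deriv_delta j x) $ ?xi) = ?psi s" by (simp only:)
  qed (use r in simp)
  let ?f = "unshift_fun r f" and ?D = "deriv_L j x + ketc (f r) (deriv_delta j x)"
  let ?z = "dil r $ (v \<otimes> \<varpi> (bef r f))" and ?z' = "dil r $ (u \<otimes> \<varpi> (%_. 0))"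
  have u0: "unshift_fun r (%_. 0 :: 'k) = (%_. 0)" and f0: "?f 0 = f r" by (simp_all add: unshift_fun_def fun_eq_iff)
  have DA: "?D \<in> A" by (intro A_simps L ketc_mem D)
  \<comment> \<open>The cocycle identity rewrites an increment after time \<open>r\<close> as
    \<open>J r\<close> of an increment after time 0, whose matrix elements are amplified slices in
    the dilation.\<close>
  have q: "cinner ?z (amp (of_real (1 / tau) *\<^sub>C ((right_ket (\<varpi> ?f))\<^sup>\<star> oo incr tau x oo E)) $ ?z') = (cinner ?e (j (r + tau) x $ ?xi) - cinner ?e (j r x $ ?xi)) / of_real tau"
   if tau: "0 < tau" for tau
  proof -
   have "j (r + tau) x = J r (incr tau x) + j r x"
    using J_simps(1)[of r "incr tau x" "x ox \<one>"] cocycle[OF r(1) _ deriv_dom_mem[OF x], of tau] J_j[OF r(1) deriv_dom_mem[OF x]] tau by simp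
   then have "cinner ?e (j (r + tau) x $ ?xi) - cinner ?e (j r x $ ?xi) = cinner ?e (J r (incr tau x) $ (u \<otimes> \<varpi> (%_. 0)))"
    by (simp add: plus_bop.rep_eq cinner_add_right)
   then show ?thesis using cinner_J_dil[OF r(1) step_zero f, of v "incr tau x" u]
    by (simp add: u0 coherent_slice_def amp_simps(2) cinner_scaleC_right del: cinner_adj cinner_adj2)
  qed
  \<comment> \<open>Weak convergence of the slices would not suffice here: the amplification
    evaluates them at infinitely many coordinates.\<close>
  have "((%tau. cinner ?z (amp (of_real (1 / tau) *\<^sub>C ((right_ket (\<varpi> ?f))\<^sup>\<star> oo incr tau x oo E)) $ ?z')) \<longlongrightarrow>
    cinner ?z (amp (cinner (\<varpi> ?f) (\<varpi> (%_. 0)) *\<^sub>C ?D) $ ?z')) (at_right 0)"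
   using limitin_uw_cinner[OF continuous_map_limit[OF uw_continuous_amp slice_limit[OF x step_unshift[OF f], of r]], of ?z ?z'] unfolding o_def f0 .
  moreover have "cinner ?z (amp (cinner (\<varpi> ?f) (\<varpi> (%_. 0)) *\<^sub>C ?D) $ ?z') = ?psi r"
  proof -
   have "cinner ?z (amp (cinner (\<varpi> ?f) (\<varpi> (%_. 0)) *\<^sub>C ?D) $ ?z') = cinner (\<varpi> ?f) (\<varpi> (%_. 0)) * cinner (v \<otimes> \<varpi> (bef r f)) (j r ?D $ (u \<otimes> \<varpi> (%_. 0)))"
    unfolding amp_simps(2) scaleC_bop.rep_eq cinner_scaleC_right dil_cinner[OF r(1) DA] ..
   also have "\<dots> = cinner ?e (j r ?D $ ?xi)"
    using j_adapted[OF r(1) DA f step_zero, of v u] by (simp add: u0)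
   also have "\<dots> = ?psi r"
    by (simp add: j_simps(1)[OF r(1) L ketc_mem(1)[OF D]] jhat(1)[OF r(1) D] plus_bop.rep_eq cinner_add_right)
   finally show ?thesis .
  qed
  ultimately show "((%tau. (cinner ?e (j (r + tau) x $ ?xi) - cinner ?e (j r x $ ?xi)) / of_real tau) \<longlongrightarrow> ?psi r) (at_right 0)"
   using Lim_transform_eventually[OF _ eventually_unit_interval[OF q]] by simp
 qed
 then show "(?psi has_integral cinner ?e (incr t x $ ?xi)) {0..t}"
  by (simp add: j_zero[OF deriv_dom_mem[OF x]] minus_bop.rep_eq cinner_diff_right del: cinner_adj cinner_adj2)
qed

end

section \<open>The generator\<close>

context flow
begin

lemma vacuum_ito: "is_ito 0 t alpha beta I ==> ((%s. cinner (E $ w) (alpha s)) has_integral cinner (E $ w) I) {0..t}"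
 using is_itoD[OF _ step_zero, of 0 t alpha beta I w] by simp

text \<open>A creation integral is orthogonal to the vacuum. Hence the integral has norm of order
  the square root of \<open>t\<close>, but its vacuum component is of order
  \<open>t\<close>.\<close>

lemma ito_small:
 assumes t: "0 < t" "t <= 1" and I: "is_ito 0 t alpha beta I" "continuous_on {0..t} alpha" "continuous_on {0..t} beta"
  "!!s. 0 <= s ==> s <= t ==> (\<one> ox past s) $ beta s = beta s"
  and b: "!!s. 0 <= s ==> s <= t ==> norm (alpha s) <= K * norm (u::'h)" "!!s. 0 <= s ==> s <= t ==> norm (beta s) <= L * norm u" and L: "0 <= K" "0 <= L"
 shows "norm I <= (K + L) * sqrt t * norm u" "cmod (cinner (E $ w) I) <= (K + L) * t * norm w * norm u"
proof -
 have "t <= sqrt t" using t by (simp add: real_le_rsqrt power2_eq_square mult_left_le)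
 then have "K * norm u * t <= K * norm u * sqrt t" using L by (intro mult_left_mono) auto
 moreover have "norm I <= K * norm u * (t - 0) + L * norm u * sqrt (t - 0)"
  by (rule ito_norm_const[OF order_refl _ I b]) (use t in auto)
 ultimately show "norm I <= (K + L) * sqrt t * norm u" by (simp add: algebra_simps)
 have "norm (cinner (E $ w) I) <= norm w * (K * norm u) * measure lborel {0..t}"
 proof (rule has_integral_bound_real[OF _ finite.emptyI vacuum_ito[OF I(1)]])
  fix s assume "s \<in> {0..t} - {}"
  then show "norm (cinner (E $ w) (alpha s)) <= norm w * (K * norm u)"
   using b(1)[of s] mult_left_mono[of "norm (alpha s)" "K * norm u" "norm w"] cinner_cauchy_schwarz[of "E $ w" "alpha s"]
   by (simp add: norm_tensor coherent_vacuum)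
 qed (use L in auto)
 also have "\<dots> <= (K + L) * t * norm w * norm u"
  using t L by (simp add: algebra_simps)
 finally show "cmod (cinner (E $ w) I) <= (K + L) * t * norm w * norm u" .
qed

lemma incr_small:
 assumes x: "x \<in> deriv_dom A j"
 shows "\<exists>C\<ge>0. \<forall>t u. 0 < t \<longrightarrow> t <= 1 \<longrightarrow> norm (incr t x $ (E $ u)) <= C * sqrt t * norm u
  \<and> (\<forall>w. cmod (cinner (E $ w) (incr t x $ (E $ u))) <= C * t * norm w * norm u)"
proof (intro exI conjI allI impI)
 let ?C = "opnorm (deriv_L j x) + opnorm (deriv_delta j x)"
 fix t u assume t: "0 < t" "t <= (1::real)"
 note L = deriv_mem(1)[OF x] and D = deriv_mem(2)[OF x]
 have E: "norm (E $ u) = norm u" by (simp add: norm_tensor coherent_vacuum)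
 have *: "is_ito 0 t (%s. j s (deriv_L j x) $ (E $ u)) (%s. jhat s (deriv_delta j x) $ (E $ u)) (incr t x $ (E $ u))"
  by (rule incr_ito[OF x]) (use t in simp)
 have **: "continuous_on {0..t} (%s. j s (deriv_L j x) $ (E $ u))" "continuous_on {0..t} (%s. jhat s (deriv_delta j x) $ (E $ u))"
  by (intro j_curve jhat_curve L D continuous_on_const, auto)+
 have ***: "(\<one> ox past s) $ (jhat s (deriv_delta j x) $ (E $ u)) = jhat s (deriv_delta j x) $ (E $ u)"
  "norm (j s (deriv_L j x) $ (E $ u)) <= opnorm (deriv_L j x) * norm u" "norm (jhat s (deriv_delta j x) $ (E $ u)) <= opnorm (deriv_delta j x) * norm u"
  if "0 <= s" for s
  using jhat_past[OF that D, of "E $ u"] j_norm_le[OF that L, of "E $ u"] jhat_norm_le[OF that D, of "E $ u"] that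
  unfolding E by (simp_all add: past_vacuum)
 show "norm (incr t x $ (E $ u)) <= ?C * sqrt t * norm u"
  by (rule ito_small(1)[OF t * ** ***]) auto
 show "cmod (cinner (E $ w) (incr t x $ (E $ u))) <= ?C * t * norm w * norm u" for w
  by (rule ito_small(2)[OF t * ** ***]) auto
qed simp

lemma past_E:
 assumes "0 <= s"
 shows "((\<one> :: 'k operator) ox past s) $ ((\<one> ox E) $ w) = (\<one> ox E) $ w"
proof -
 have "((\<one> :: 'k operator) ox past s) oo (\<one> ox E) = \<one> ox E"
  by (rule tensor_bop_eqI) (simp add: past_vacuum assms)
 from arg_cong[OF this, of "%T. T $ w"] show ?thesis by simp
qed

text \<open>This ties the one-particle isometry of the stochastic derivative to the noise term of
  the equation. On \<open>c \<otimes> u\<close> it is a computation with coherent vectors; a general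
  \<open>w\<close> is reached because the integral of the constant column is bounded and linear in
  \<open>w\<close>.\<close>

lemma one_particle_ito:
 assumes t: "0 < t"
 shows "is_ito 0 t (%_. 0) (%_. (\<one> ox E) $ w) (of_real (sqrt t) *\<^sub>C (one_particle t $ w))"
proof -
 let ?beta = "%w. ((\<one> :: 'k operator) ox E) $ (w :: ('k, 'h) tensor)"
 let ?K = "opnorm ((\<one> :: 'k operator) ox E) * sqrt t"
 have "\<exists>I. is_ito 0 t (%_. 0) (%_. ?beta w) I \<and> norm I <= 0 * (t - 0) + opnorm ((\<one> :: 'k operator) ox E) * norm w * sqrt (t - 0)" for w
  by (rule ito_exists_const) (use t past_E opnorm in auto)
 then have "\<forall>w. \<exists>I. is_ito 0 t (%_. 0) (%_. ?beta w) I \<and> norm I <= ?K * norm w" by (simp add: mult_ac)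
 from choice[OF this] obtain I where I: "!!w. is_ito 0 t (%_. 0) (%_. ?beta w) (I w)" "!!w. norm (I w) <= ?K * norm w" by blast
 have add: "I (w + w') = I w + I w'" for w w'
  by (rule is_ito_unique[OF I(1)]) (use is_ito_add[OF I(1)[of w] I(1)[of w']] in simp)
 have scale: "I (c *\<^sub>C w) = c *\<^sub>C I w" for c w
  by (rule is_ito_unique[OF I(1)]) (use is_ito_scaleC[OF I(1)[of w], of c] scaleC_zero_left[of "c *\<^sub>C 0"] in \<open>simp add: scaleC_zero_right\<close>)
 have "\<exists>R. \<forall>w. R $ w = I w" by (rule bop_exists[OF add scale I(2)]) blast
 then obtain R where R: "!!w. R $ w = I w" by blast
 have "R = of_real (sqrt t) *\<^sub>C one_particle t"
 proof (rule tensor_bop_eqI)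
  fix c :: 'k and u :: 'h
  have "is_ito 0 t (%_. 0) (%_. ?beta (c \<otimes> u)) (of_real (sqrt t) *\<^sub>C (u \<otimes> particle t c))"
  proof (rule is_itoI)
   fix v :: 'h and f :: "real => 'k" assume f: "f \<in> step_functions"
   have "(%s. cinner (f s \<otimes> (v \<otimes> \<varpi> f)) (?beta (c \<otimes> u))) integrable_on {0..t}" by (rule step_integrable[OF f continuous_on_const])
   moreover have "integral {0..t} (%s. cinner (f s \<otimes> (v \<otimes> \<varpi> f)) (?beta (c \<otimes> u))) = cinner (v \<otimes> \<varpi> f) (of_real (sqrt t) *\<^sub>C (u \<otimes> particle t c))"
    using t by (simp add: cinner_tensor cinner_scaleC_right cinner_coherent_particle_t[OF t f] mult_ac)
   ultimately show "((%s. cinner (v \<otimes> \<varpi> f) 0 + cinner (f s \<otimes> (v \<otimes> \<varpi> f)) (?beta (c \<otimes> u))) has_integral cinner (v \<otimes> \<varpi> f) (of_real (sqrt t) *\<^sub>C (u \<otimes> particle t c))) {0..t}"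
    by (simp only: has_integral_iff cinner_zero_right add_0_left)
  qed
  from is_ito_unique[OF I(1) this] show "R $ (c \<otimes> u) = (of_real (sqrt t) *\<^sub>C one_particle t) $ (c \<otimes> u)"
   using t by (simp add: R one_particle_apply)
 qed
 then show ?thesis using I(1)[of w] R[of w] by simp
qed

end

section \<open>The solution for small times\<close>

context driven_flow
begin

lemma solution_curve:
 assumes "T \<subseteq> {0..}"
 shows "continuous_on T (%s. Z s $ u)" "continuous_on T (%s. j s d $ (Z s $ u))" "continuous_on T (%s. jhat s l $ (Z s $ u))"
proof -
 show 1: "continuous_on T (%s. Z s $ u)" using Z(1)[of u] assms unfolding curve_def by (auto intro: continuous_on_subset)
 show "continuous_on T (%s. j s d $ (Z s $ u))" "continuous_on T (%s. jhat s l $ (Z s $ u))"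
  by (rule j_curve[OF d assms 1], rule jhat_curve[OF l assms 1])
qed

lemma solution_bound:
 assumes "0 <= s" "s <= 1"
 shows "norm (j s d $ (Z s $ u)) <= opnorm d * (2 * exp rate) * norm u" "norm (jhat s l $ (Z s $ u)) <= opnorm l * (2 * exp rate) * norm u"
proof -
 have "exp (rate * s) <= exp rate" using assms rate_pos by (simp add: mult_left_le)
 then have "2 * exp (rate * s) * norm u <= 2 * exp rate * norm u" by (intro mult_right_mono) auto
 then have 1: "norm (Z s $ u) <= 2 * exp rate * norm u" using Z(3)[OF assms(1), of u] by linarith
 show "norm (j s d $ (Z s $ u)) <= opnorm d * (2 * exp rate) * norm u"
  using order.trans[OF j_norm_le[OF assms(1) d] mult_left_mono[OF 1 opnorm_nonneg[of d]]] by (simp add: mult.assoc)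
 show "norm (jhat s l $ (Z s $ u)) <= opnorm l * (2 * exp rate) * norm u"
  using order.trans[OF jhat_norm_le[OF assms(1) l] mult_left_mono[OF 1 opnorm_nonneg[of l]]] by (simp add: mult.assoc)
qed

abbreviation Q :: "real => 'h => ('h, 'k) hnoise" where "Q t u \<equiv> Z t $ u - E $ u"

lemma Q_small:
 "\<exists>C\<ge>0. \<forall>t u. 0 < t \<longrightarrow> t <= 1 \<longrightarrow> norm (Q t u) <= C * sqrt t * norm u \<and> (\<forall>w. cmod (cinner (E $ w) (Q t u)) <= C * t * norm w * norm u)"
proof (intro exI conjI allI impI)
 let ?C = "opnorm d * (2 * exp rate) + opnorm l * (2 * exp rate)"
 fix t u assume t: "0 < t" "t <= (1::real)"
 have ad: "(\<one> ox past s) $ (jhat s l $ (Z s $ u)) = jhat s l $ (Z s $ u)" if "0 <= s" for s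
  by (simp add: jhat_past[OF that l] Z_past[OF that])
 show "norm (Q t u) <= ?C * sqrt t * norm u"
  by (rule ito_small(1)[OF t Z(2) solution_curve(2) solution_curve(3) ad solution_bound]) (use t in auto)
 show "cmod (cinner (E $ w) (Q t u)) <= ?C * t * norm w * norm u" for w
  by (rule ito_small(2)[OF t Z(2) solution_curve(2) solution_curve(3) ad solution_bound]) (use t in auto)
qed (simp add: add_nonneg_nonneg)

text \<open>Against a vacuum vector only the drift integral remains, and its integrand is continuous
  with value \<open>cinner w (d $ u)\<close> at time 0.\<close>

lemma Q_vacuum_limit: "((%t. cinner (E $ w) (Q t u) / of_real t) \<longlongrightarrow> cinner w (d $ u)) (at_right 0)"
proof -
 let ?g = "%s. cinner (E $ w) (j s d $ (Z s $ u))"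
 have c: "continuous_on {0..1} ?g" by (intro continuous_intros solution_curve) auto
 have "((%tau. (integral {0..0 + tau} ?g - integral {0..0} ?g) / of_real tau) \<longlongrightarrow> ?g 0) (at_right 0)"
  by (rule integral_right_derivative[of _ 1]) (use c in \<open>auto simp: continuous_on_eq_continuous_within intro: integrable_continuous_real\<close>)
 moreover have "?g 0 = cinner w (d $ u)" by (simp add: Z_zero j_zero[OF d] cinner_tensor coherent_vacuum)
 moreover have "(integral {0..0 + t} ?g - integral {0..0} ?g) / of_real t = cinner (E $ w) (Q t u) / of_real t" if "0 < t" for t
  using integral_unique[OF vacuum_ito[OF Z(2)[of t u], of w]] that by simp
 ultimately show ?thesis using Lim_transform_eventually[OF _ eventually_unit_interval] by (metis (no_types, lifting))
qed

text \<open>After subtraction of the integral of the constant column, the noise integrand vanishes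
  at time 0. The remainder is thus small compared with the square root of \<open>t\<close>, the
  drift being of order \<open>t\<close> anyway.\<close>

lemma Q_limit: "((%t. of_real (1 / sqrt t) *\<^sub>C Q t u - one_particle t $ (l $ u)) \<longlongrightarrow> 0) (at_right 0)"
proof (rule tendstoI)
 fix e :: real assume e: "0 < e"
 let ?beta = "%s. jhat s l $ (Z s $ u) - (\<one> ox E) $ (l $ u)" and ?K = "opnorm d * (2 * exp rate) * norm u"
 have beta0: "?beta 0 = 0"
 proof -
  have "jhat 0 l $ (E $ u) = (\<one> ox E) $ (l $ u)"
  proof (rule tensor_eqI)
   fix c xi
   show "cinner (c \<otimes> xi) (jhat 0 l $ (E $ u)) = cinner (c \<otimes> xi) ((\<one> ox E) $ (l $ u))"
    using cinner_adj[of "\<one> ox E" "c \<otimes> xi" "l $ u"] cinner_adj[of E xi "(left_ket c)\<^sup>\<star> $ (l $ u)"]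
    by (simp add: jhat(1)[OF _ l] j_zero[OF ketc_mem(1)[OF l], unfolded ketc_def] tensor_op_adj ketc_def left_ket.rep_eq del: cinner_adj)
  qed
  then show ?thesis by (simp add: Z_zero)
 qed
 have "continuous_on {0..} ?beta" by (intro continuous_intros solution_curve) auto
 then have "(?beta \<longlongrightarrow> ?beta 0) (at 0 within {0..})" unfolding continuous_on_def by (rule bspec) simp
 then have "\<forall>\<^sub>F s in at 0 within {0..}. dist (?beta s) (?beta 0) < e / 2" by (rule tendstoD) (use e in simp)
 then obtain b where b0: "0 < b" "!!s. s \<in> {0..} ==> s \<noteq> 0 ==> dist s 0 < b ==> dist (?beta s) (?beta 0) < e / 2"
  unfolding eventually_at by blast
 have b: "norm (?beta s) <= e / 2" if "0 <= s" "s < b" for s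
  using b0(2)[of s] b0(1) that e unfolding beta0 by (cases "s = 0", simp_all add: beta0 dist_real_def less_imp_le)
 have "((%t. ?K * sqrt t + e / 2) \<longlongrightarrow> ?K * sqrt 0 + e / 2) (at_right 0)" by (intro tendsto_intros)
 then have "\<forall>\<^sub>F t in at_right 0. ?K * sqrt t + e / 2 < e" by (rule order_tendstoD) (use e in simp)
 moreover have "\<forall>\<^sub>F t in at_right 0. 0 < t \<and> t < min b 1"
  unfolding eventually_at_right_field using b0(1) by (intro exI[of _ "min b 1"]) auto
 ultimately show "\<forall>\<^sub>F t in at_right 0. dist (of_real (1 / sqrt t) *\<^sub>C Q t u - one_particle t $ (l $ u)) 0 < e"
 proof eventually_elim
  fix t assume le: "?K * sqrt t + e / 2 < e" and "0 < t \<and> t < min b 1"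
  then have t: "0 < t" "t < b" "t <= 1" by auto
  let ?I = "Q t u - of_real (sqrt t) *\<^sub>C (one_particle t $ (l $ u))"
  have I: "is_ito 0 t (%s. j s d $ (Z s $ u)) ?beta ?I"
   using is_ito_add[OF Z(2)[OF less_imp_le[OF t(1)], of u] is_ito_scaleC[OF one_particle_ito[OF t(1)], of "-1" "l $ u"]]
   by (simp add: scaleC_minus_one)
  have ad: "(\<one> ox past s) $ ?beta s = ?beta s" if "0 <= s" for s
   using that by (simp add: jhat_past[OF that l] Z_past[OF that] past_E)
  have "norm ?I <= ?K * (t - 0) + e / 2 * sqrt (t - 0)"
   by (rule ito_norm_const[OF order_refl less_imp_le[OF t(1)] I solution_curve(2) _ ad solution_bound(1) b])
    (use t in \<open>auto intro!: continuous_intros solution_curve\<close>)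
  then have n: "norm ?I <= (?K * sqrt t + e / 2) * sqrt t" using t(1) by (simp add: distrib_right mult.assoc)
  have "of_real (1 / sqrt t) *\<^sub>C Q t u - one_particle t $ (l $ u) = of_real (1 / sqrt t) *\<^sub>C ?I"
   using t(1) by (simp add: scaleC_diff scaleC_scaleC flip: of_real_mult)
  then have "norm (of_real (1 / sqrt t) *\<^sub>C Q t u - one_particle t $ (l $ u)) = norm ?I / sqrt t"
   using t(1) by (simp add: norm_scaleC norm_divide)
  also have "\<dots> <= ?K * sqrt t + e / 2" using n t(1) by (simp add: pos_divide_le_eq)
  finally show "dist (of_real (1 / sqrt t) *\<^sub>C Q t u - one_particle t $ (l $ u)) 0 < e" using le by (simp add: dist_norm)
 qed
qed

end

section \<open>Difference quotients of the perturbed semigroup\<close>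

context driven_flow
begin

text \<open>Separate \<open>j t x\<close> into its increment and \<open>x ox \<one>\<close>, and
  write \<open>Z t\<close> as \<open>E\<close> plus \<open>Q t\<close> in the second part; the pure
  vacuum term there is cancelled by \<open>x\<close>.\<close>

lemma P_decomposition:
 assumes "x \<in> A" "0 <= t"
 shows "cinner v ((P t x - x) $ u) = cinner (Z t $ v) (incr t x $ (Z t $ u))
  + (cinner (E $ (x\<^sup>\<star> $ v)) (Q t u) + cinner (Q t v) (E $ (x $ u)) + cinner (Q t v) ((x ox \<one>) $ Q t u))"
proof -
 have "cinner (E $ (x\<^sup>\<star> $ v)) xi = cinner (E $ v) ((x ox \<one>) $ xi)" for xi
  using cinner_adj[of "x ox \<one>" "E $ v" xi] by (simp add: tensor_op_adj)
 moreover have "cinner (E $ v) (E $ (x $ u)) = cinner v (x $ u)" by (simp add: cinner_tensor coherent_vacuum)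
 moreover have "(x ox \<one>) $ (E $ u) = E $ (x $ u)" by simp
 ultimately show ?thesis
  by (simp only: minus_bop.rep_eq cinner_diff_right cinner_diff_left cinner_P bop_arith)
   (simp del: cinner_adj cinner_adj2)
qed

lemma cinner_sqrt_bound:
 assumes t: "0 < t" and a: "norm a <= alpha * sqrt t * norm v" and b: "norm b <= beta * sqrt t * norm u" and "0 <= alpha"
 shows "cmod (cinner a b) <= alpha * beta * t * norm v * norm u"
proof -
 have "cmod (cinner a b) <= (alpha * sqrt t * norm v) * (beta * sqrt t * norm u)"
  by (rule order.trans[OF cinner_cauchy_schwarz]) (intro mult_mono a b, use assms in auto)
 also have "\<dots> = alpha * beta * (sqrt t * sqrt t) * norm v * norm u" by (simp only: mult_ac)
 finally show ?thesis using t by simp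
qed

text \<open>Every term pairs two vectors of order the square root of \<open>t\<close>, or is a
  vacuum component of order \<open>t\<close>; moving an increment to the other side uses the
  domain's invariance under adjoints. The uniform bound is what turns \<open>P_limit\<close> into
  ultraweak convergence.\<close>

lemma P_bound:
 assumes x: "x \<in> deriv_dom A j"
 shows "\<exists>C. \<forall>t u. 0 < t \<longrightarrow> t <= 1 \<longrightarrow> norm ((P t x - x) $ u) <= C * t * norm u"
proof -
 note xA = deriv_dom_mem[OF x]
 obtain C1 where C1: "0 <= C1" "!!t u. 0 < t ==> t <= 1 ==> norm (incr t x $ (E $ u)) <= C1 * sqrt t * norm u"
  "!!t u w. 0 < t ==> t <= 1 ==> cmod (cinner (E $ w) (incr t x $ (E $ u))) <= C1 * t * norm w * norm u"
  using incr_small[OF x] by blast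
 obtain C2 where C2: "0 <= C2" "!!t u. 0 < t ==> t <= 1 ==> norm (incr t (x\<^sup>\<star>) $ (E $ u)) <= C2 * sqrt t * norm u"
  using incr_small[OF stoch_deriv_adj(1)[OF x]] by blast
 obtain CQ where CQ: "0 <= CQ" "!!t u. 0 < t ==> t <= 1 ==> norm (Q t u) <= CQ * sqrt t * norm u"
  "!!t u w. 0 < t ==> t <= 1 ==> cmod (cinner (E $ w) (Q t u)) <= CQ * t * norm w * norm u"
  using Q_small by blast
 define KX where "KX = opnorm (x ox (\<one> :: 'k noise operator))"
 let ?C = "C1 + C2 * CQ + CQ * C1 + CQ * ((opnorm x + KX) * CQ) + CQ * opnorm (x\<^sup>\<star>) + CQ * opnorm x + CQ * (KX * CQ)"
 have nn: "0 <= KX" "0 <= ?C" unfolding KX_def using C1(1) C2(1) CQ(1) by (auto intro!: add_nonneg_nonneg mult_nonneg_nonneg)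
 have "norm ((P t x - x) $ u) <= ?C * t * norm u" if t: "0 < t" "t <= 1" for t u
 proof (rule norm_le_cinner)
  fix v
  have adj: "cinner (incr t (x\<^sup>\<star>) $ a) b = cinner a (incr t x $ b)" for a b
   unfolding incr_adj[OF less_imp_le[OF t(1)] xA] by (rule cinner_adj)
  have 1: "cmod (cinner (Z t $ v) (incr t x $ (Z t $ u))) <= (C1 + C2 * CQ + CQ * C1 + CQ * ((opnorm x + KX) * CQ)) * t * norm v * norm u"
  proof -
   have "norm (incr t x $ Q t u) <= (opnorm x + KX) * CQ * sqrt t * norm u"
    using order.trans[OF incr_E_norm[OF less_imp_le[OF t(1)] xA] mult_left_mono[OF CQ(2)[OF t, of u]]] nn(1) by (simp add: KX_def mult.assoc)
   then have "cmod (cinner (Q t v) (incr t x $ Q t u)) <= CQ * ((opnorm x + KX) * CQ) * t * norm v * norm u"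
    by (rule cinner_sqrt_bound[OF t(1) CQ(2)[OF t] _ CQ(1)])
   moreover have "cmod (cinner (incr t (x\<^sup>\<star>) $ (E $ v)) (Q t u)) <= C2 * CQ * t * norm v * norm u"
    by (rule cinner_sqrt_bound[OF t(1) C2(2)[OF t] CQ(2)[OF t] C2(1)])
   moreover have "cmod (cinner (Q t v) (incr t x $ (E $ u))) <= CQ * C1 * t * norm v * norm u"
    by (rule cinner_sqrt_bound[OF t(1) CQ(2)[OF t] C1(2)[OF t] CQ(1)])
   moreover have "cinner (Z t $ v) (incr t x $ (Z t $ u)) = cinner (E $ v) (incr t x $ (E $ u)) + cinner (incr t (x\<^sup>\<star>) $ (E $ v)) (Q t u)
     + cinner (Q t v) (incr t x $ (E $ u)) + cinner (Q t v) (incr t x $ Q t u)"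
    unfolding adj by (simp only: bop_arith(2) cinner_diff_left cinner_diff_right) simp
   ultimately show ?thesis using C1(3)[OF t, of v u]
    unfolding distrib_right by (smt (verit) norm_triangle_ineq)
  qed
  have EQ: "cmod (cinner (E $ (T $ v)) (Q t u)) <= CQ * opnorm T * t * norm v * norm u" for T u v
  proof -
   have "CQ * t * norm (T $ v) * norm u <= CQ * t * (opnorm T * norm v) * norm u"
    by (intro mult_right_mono mult_left_mono opnorm) (use t CQ(1) in auto)
   then show ?thesis using CQ(3)[OF t, of "T $ v" u] by (simp add: mult_ac)
  qed
  have "cmod (cinner (E $ (x\<^sup>\<star> $ v)) (Q t u)) <= CQ * opnorm (x\<^sup>\<star>) * t * norm v * norm u" by (rule EQ)
  moreover have "cmod (cinner (Q t v) (E $ (x $ u))) <= CQ * opnorm x * t * norm v * norm u"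
  proof -
   have "cmod (cinner (Q t v) (E $ (x $ u))) = cmod (cinner (E $ (x $ u)) (Q t v))" by (subst cinner_commute) (rule complex_mod_cnj)
   then show ?thesis using EQ[of x u v] by (simp add: mult_ac)
  qed
  moreover have "cmod (cinner (Q t v) ((x ox \<one>) $ Q t u)) <= CQ * (KX * CQ) * t * norm v * norm u"
  proof (rule cinner_sqrt_bound[OF t(1) CQ(2)[OF t] _ CQ(1)])
   show "norm ((x ox \<one>) $ Q t u) <= KX * CQ * sqrt t * norm u"
    using order.trans[OF opnorm[of "x ox (\<one> :: 'k noise operator)" "Q t u"] mult_left_mono[OF CQ(2)[OF t, of u]]] nn(1) by (simp add: KX_def mult.assoc)
  qed
  ultimately have "cmod (cinner v ((P t x - x) $ u)) <= ?C * t * norm v * norm u"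
   using 1 unfolding P_decomposition[OF xA less_imp_le[OF t(1)]] distrib_right by (smt (verit) norm_triangle_ineq)
  then show "cmod (cinner v ((P t x - x) $ u)) <= ?C * t * norm u * norm v" by (simp only: mult_ac)
 qed (use nn(2) t in simp)
 then show ?thesis by blast
qed

lemma incr_dress_bounded:
 assumes x: "x \<in> deriv_dom A j"
 shows "\<exists>K. \<forall>\<^sub>F t in at_right 0. norm (incr t x $ (dress t $ (u, w))) <= K"
proof -
 obtain C where C: "!!t u. 0 < t ==> t <= 1 ==> norm (incr t x $ (E $ u)) <= C * sqrt t * norm u"
  using incr_small[OF x] by blast
 let ?K = "opnorm x + opnorm (x ox (\<one> :: 'k noise operator))"
 have "norm (incr t x $ (dress t $ (u, w))) <= C * norm u + ?K * norm w" if t: "0 < t" "t < 1" for t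
 proof -
  have "norm (of_real (1 / sqrt t) *\<^sub>C (incr t x $ (E $ u))) <= C * norm u"
   using C[of t u] t by (simp add: norm_scaleC norm_divide pos_divide_le_eq mult_ac)
  moreover have "norm (incr t x $ (one_particle t $ w)) <= ?K * norm w"
   using incr_E_norm[of t x "one_particle t $ w"] isometry_norm[OF one_particle_apply(2)[OF t(1)], of w] t deriv_dom_mem[OF x] by simp
  ultimately show ?thesis unfolding dress_apply bop_arith(1,5) by (rule norm_triangle_le[OF add_mono])
 qed
 then have "\<forall>\<^sub>F t in at_right 0. norm (incr t x $ (dress t $ (u, w))) <= C * norm u + ?K * norm w"
  by (rule eventually_unit_interval)
 then show ?thesis ..
qed

text \<open>By \<open>Q_limit\<close> the scaled vector \<open>Z t $ u\<close> is
  \<open>dress t $ (u, l $ u)\<close> plus a null vector. The increment term therefore tends to the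
  stochastic derivative at such pairs, the quadratic term in \<open>Q\<close> to the pairing of
  \<open>l $ v\<close> with \<open>(\<one> ox x) $ (l $ u)\<close>, and the linear ones to the
  drift.\<close>

lemma P_limit:
 assumes x: "x \<in> deriv_dom A j"
 shows "((%t. cinner v ((P t x - x) $ u) / of_real t) \<longlongrightarrow> cinner (v, l $ v) (stoch_deriv j x $ (u, l $ u))
  + (cinner (x\<^sup>\<star> $ v) (d $ u) + cnj (cinner (x $ u) (d $ v)) + cinner (l $ v) ((\<one> ox x) $ (l $ u)))) (at_right 0)"
proof -
 note xA = deriv_dom_mem[OF x]
 let ?X = "x ox (\<one> :: 'k noise operator)"
 define eta where "eta u t = of_real (1 / sqrt t) *\<^sub>C Q t u - one_particle t $ (l $ u)" for u t
 have eta: "(eta u \<longlongrightarrow> 0) (at_right 0)" for u unfolding eta_def[abs_def] by (rule Q_limit)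
 have DQ: "of_real (1 / sqrt t) *\<^sub>C Q t u = one_particle t $ (l $ u) + eta u t"
  "of_real (1 / sqrt t) *\<^sub>C (Z t $ u) = dress t $ (u, l $ u) + eta u t" for u t
  by (simp_all add: eta_def dress_apply scaleC_diff)
 have sq: "cinner (of_real (1 / sqrt t) *\<^sub>C a) (T $ (of_real (1 / sqrt t) *\<^sub>C b)) = cinner a (T $ b) / of_real t" if "0 < t" for a b T and t :: real
  using that by (simp add: cinner_scaleC_left cinner_scaleC_right flip: of_real_mult)
 have bd: "\<forall>\<^sub>F t in at_right 0. norm (one_particle t $ w) <= norm w" for w :: "('k, 'h) tensor"
  by (rule eventually_unit_interval) (simp add: isometry_norm[OF one_particle_apply(2)])
 have one: "((%t. cinner (Z t $ v) (incr t x $ (Z t $ u)) / of_real t) \<longlongrightarrow> cinner (v, l $ v) (stoch_deriv j x $ (u, l $ u)) + 0 + (0 + 0)) (at_right 0)"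
 proof (rule Lim_transform_eventually)
  let ?D = "%t u. dress t $ (u, l $ u)"
  obtain K where K: "\<forall>\<^sub>F t in at_right 0. norm (incr t x $ ?D t u) <= K" using incr_dress_bounded[OF x] by blast
  obtain K' where K': "\<forall>\<^sub>F t in at_right 0. norm (incr t (x\<^sup>\<star>) $ ?D t v) <= K'" using incr_dress_bounded[OF stoch_deriv_adj(1)[OF x]] by blast
  let ?K = "opnorm x + opnorm ?X"
  have "((%t. ?K * norm (eta u t)) \<longlongrightarrow> ?K * 0) (at_right 0)" by (intro tendsto_mult_left tendsto_norm_zero eta)
  then have "((%t. ?K * norm (eta u t)) \<longlongrightarrow> 0) (at_right 0)" by (simp only: mult_zero_right)
  moreover have "\<forall>\<^sub>F t in at_right 0. norm (incr t x $ eta u t) <= ?K * norm (eta u t)"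
   by (rule eventually_unit_interval) (rule incr_E_norm[OF less_imp_le xA])
  ultimately have 0: "((%t. incr t x $ eta u t) \<longlongrightarrow> 0) (at_right 0)" by (rule Lim_null_comparison[rotated])
  \<comment> \<open>In each cross term one vector stays bounded by
    \<open>incr_dress_bounded\<close>, for \<open>x\<close> or its adjoint, while the other tends to
    0.\<close>
  show "((%t. cinner (?D t v) (incr t x $ ?D t u) + cinner (incr t (x\<^sup>\<star>) $ ?D t v) (eta u t) + (cinner (eta v t) (incr t x $ ?D t u) + cinner (eta v t) (incr t x $ eta u t)))
   \<longlongrightarrow> cinner (v, l $ v) (stoch_deriv j x $ (u, l $ u)) + 0 + (0 + 0)) (at_right 0)"
   using tendsto_cinner[OF eta[of v] 0]
   by (intro tendsto_add stoch_deriv_tendsto[OF x] tendsto_cinner_null(1)[OF K' eta] tendsto_cinner_null(2)[OF K eta]) (simp only: cinner_zero_right)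
  show "\<forall>\<^sub>F t in at_right 0. cinner (?D t v) (incr t x $ ?D t u) + cinner (incr t (x\<^sup>\<star>) $ ?D t v) (eta u t) + (cinner (eta v t) (incr t x $ ?D t u) + cinner (eta v t) (incr t x $ eta u t))
   = cinner (Z t $ v) (incr t x $ (Z t $ u)) / of_real t"
  proof (rule eventually_unit_interval)
   fix t :: real assume t: "0 < t"
   have adj: "cinner (incr t (x\<^sup>\<star>) $ a) b = cinner a (incr t x $ b)" for a b
    unfolding incr_adj[OF less_imp_le[OF t] xA] by (rule cinner_adj)
   show "cinner (?D t v) (incr t x $ ?D t u) + cinner (incr t (x\<^sup>\<star>) $ ?D t v) (eta u t) + (cinner (eta v t) (incr t x $ ?D t u) + cinner (eta v t) (incr t x $ eta u t))
    = cinner (Z t $ v) (incr t x $ (Z t $ u)) / of_real t"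
    unfolding sq[OF t, symmetric] DQ(2) adj by (simp only: bop_arith(1) cinner_add_left cinner_add_right add_ac)
  qed
 qed
 have two: "((%t. cinner (Q t v) (?X $ Q t u) / of_real t) \<longlongrightarrow> cinner (l $ v) ((\<one> ox x) $ (l $ u)) + 0 + (0 + 0)) (at_right 0)"
 proof (rule Lim_transform_eventually)
  let ?V = "%t. one_particle t :: (('k, 'h) tensor, ('h, 'k noise) tensor) bop"
  have Xeta: "((%t. ?X $ eta u t) \<longlongrightarrow> 0) (at_right 0)" using tendsto_bop[OF eta[of u], of ?X] by simp
  show "((%t. cinner (l $ v) ((\<one> ox x) $ (l $ u)) + cinner (?V t $ (l $ v)) (?X $ eta u t) + (cinner (eta v t) (?V t $ ((\<one> ox x) $ (l $ u))) + cinner (eta v t) (?X $ eta u t)))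
   \<longlongrightarrow> cinner (l $ v) ((\<one> ox x) $ (l $ u)) + 0 + (0 + 0)) (at_right 0)"
   using tendsto_cinner[OF eta[of v] Xeta]
   by (intro tendsto_add tendsto_const tendsto_cinner_null(1)[OF bd Xeta] tendsto_cinner_null(2)[OF bd eta]) (simp only: cinner_zero_right)
  show "\<forall>\<^sub>F t in at_right 0. cinner (l $ v) ((\<one> ox x) $ (l $ u)) + cinner (?V t $ (l $ v)) (?X $ eta u t) + (cinner (eta v t) (?V t $ ((\<one> ox x) $ (l $ u))) + cinner (eta v t) (?X $ eta u t))
   = cinner (Q t v) (?X $ Q t u) / of_real t"
  proof (rule eventually_unit_interval)
   fix t :: real assume t: "0 < t"
   have "?X oo ?V t = ?V t oo (\<one> ox x)" by (rule tensor_bop_eqI) (simp add: one_particle_apply[OF t])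
   from arg_cong[OF this, of "%T. T $ (l $ u)"] have XV: "?X $ (?V t $ (l $ u)) = ?V t $ ((\<one> ox x) $ (l $ u))" by simp
   show "cinner (l $ v) ((\<one> ox x) $ (l $ u)) + cinner (?V t $ (l $ v)) (?X $ eta u t) + (cinner (eta v t) (?V t $ ((\<one> ox x) $ (l $ u))) + cinner (eta v t) (?X $ eta u t))
    = cinner (Q t v) (?X $ Q t u) / of_real t"
    unfolding sq[OF t, symmetric] DQ(1) isometry_cinner[OF one_particle_apply(2)[OF t], of "l $ v", symmetric] XV[symmetric]
    by (simp only: bop_arith(1) cinner_add_left cinner_add_right add_ac)
  qed
 qed
 have "cinner v ((P t x - x) $ u) / of_real t = cinner (Z t $ v) (incr t x $ (Z t $ u)) / of_real t
   + (cinner (E $ (x\<^sup>\<star> $ v)) (Q t u) / of_real t + cnj (cinner (E $ (x $ u)) (Q t v) / of_real t) + cinner (Q t v) (?X $ Q t u) / of_real t)" if t: "0 < t" for t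
  unfolding P_decomposition[OF xA less_imp_le[OF t]] cinner_commute[of "Q t v" "E $ (x $ u)"]
  by (simp only: add_divide_distrib complex_cnj_divide complex_cnj_complex_of_real)
 then have "\<forall>\<^sub>F t in at_right 0. cinner (Z t $ v) (incr t x $ (Z t $ u)) / of_real t
   + (cinner (E $ (x\<^sup>\<star> $ v)) (Q t u) / of_real t + cnj (cinner (E $ (x $ u)) (Q t v) / of_real t) + cinner (Q t v) (?X $ Q t u) / of_real t)
  = cinner v ((P t x - x) $ u) / of_real t" by (intro eventually_unit_interval) (simp only:)
 from Lim_transform_eventually[OF tendsto_add[OF one tendsto_add[OF tendsto_add[OF Q_vacuum_limit tendsto_cnj[OF Q_vacuum_limit]] two]] this]
 show ?thesis by (simp only: add_0_right)
qed

text \<open>Weak convergence and the bound of order \<open>t\<close> give ultraweak convergence; as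
  the algebra is ultraweakly closed, the limit \<open>G\<close> lies in it, as membership in the
  generator's graph requires.\<close>

lemma P_generator:
 assumes x: "x \<in> deriv_dom A j"
  and G: "!!u v. cinner v (G $ u) = cinner (v, l $ v) (stoch_deriv j x $ (u, l $ u))
  + (cinner (x\<^sup>\<star> $ v) (d $ u) + cnj (cinner (x $ u) (d $ v)) + cinner (l $ v) ((\<one> ox x) $ (l $ u)))"
 shows "(x, G) \<in> uw_generator A P"
proof -
 obtain C where C: "!!t u. 0 < t ==> t <= 1 ==> norm ((P t x - x) $ u) <= C * t * norm u" using P_bound[OF x] by blast
 have lim: "limitin uw_top (%t. complex_of_real (1 / t) *\<^sub>C (P t x - x)) G (at_right 0)"
 proof (rule limitin_uw_bounded)
  show "\<forall>\<^sub>F t in at_right 0. \<forall>u. norm ((complex_of_real (1 / t) *\<^sub>C (P t x - x)) $ u) <= C * norm u"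
  proof (intro eventually_unit_interval allI)
   fix t :: real and u assume "0 < t" "t < 1"
   then show "norm ((complex_of_real (1 / t) *\<^sub>C (P t x - x)) $ u) <= C * norm u"
    using C[of t u] by (simp add: scaleC_bop.rep_eq norm_scaleC norm_divide pos_divide_le_eq mult_ac del: minus_bop.rep_eq)
  qed
  show "((%t. cinner v ((complex_of_real (1 / t) *\<^sub>C (P t x - x)) $ u)) \<longlongrightarrow> cinner v (G $ u)) (at_right 0)" for u v
   using P_limit[OF x, of v u] unfolding G by (simp add: scaleC_bop.rep_eq cinner_scaleC_right del: minus_bop.rep_eq)
 qed
 moreover have "complex_of_real (1 / t) *\<^sub>C (P t x - x) \<in> A" if t: "0 < t" for t
 proof -
  have "P t x + (-1) *\<^sub>C x \<in> A" by (intro A_simps(1,2) P_mem deriv_dom_mem x) (use t in simp)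
  moreover have "P t x + (-1) *\<^sub>C x = P t x - x" by (rule bop_eqI) (simp add: scaleC_bop.rep_eq scaleC_minus_one)
  ultimately show ?thesis by (intro A_simps(2)) simp
 qed
 then have "\<forall>\<^sub>F t in at_right 0. complex_of_real (1 / t) *\<^sub>C (P t x - x) \<in> A" by (rule eventually_unit_interval)
 ultimately have "G \<in> A" by (rule limitin_closedin[OF _ vna_closed[OF vna]]) simp
 then show ?thesis using lim deriv_dom_mem[OF x] unfolding uw_generator_def by blast
qed

end

section \<open>Unitality and continuity of the semigroup\<close>

locale conservative_flow = driven_flow A j d l
 for A :: "'h::complex_hilbert operator set" and j :: "real => 'h operator => ('h, 'k::complex_hilbert noise) tensor operator" and d l +
 assumes conservative: "d + d\<^sup>\<star> + l\<^sup>\<star> oo l = 0"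
begin

lemma P_one_generator: "(\<one>, 0) \<in> uw_generator A P"
proof -
 have "0 = difference_quotient j t \<one>" if "0 < t" for t
  unfolding difference_quotient_eq by (rule bop_eqI) (use that in \<open>simp add: j_simps(5) tensor_op_one\<close>)
 then have "\<forall>\<^sub>F t in at_right 0. 0 = difference_quotient j t \<one>" by (rule eventually_unit_interval)
 moreover have "limitin uw_top (%_. 0) 0 (at_right (0::real))" unfolding limitin_uw_iff by simp
 ultimately have lim: "limitin uw_top (%t. difference_quotient j t \<one>) 0 (at_right 0)"
  by (rule limitin_transform_eventually)
 then have 1: "\<one> \<in> deriv_dom A j" using A_simps(5) by (auto simp: deriv_dom_def)
 have 0: "stoch_deriv j \<one> = 0" using limitin_Hausdorff_unique[OF stoch_deriv_limit[OF 1] lim _ Hausdorff_uw_top] by simp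
 have "cinner v (d $ u) + cnj (cinner u (d $ v)) + cinner (l $ v) (l $ u) = 0" for u v
  using arg_cong[OF conservative, of "%T. cinner v (T $ u)"] cinner_commute[of u "d $ v"] by (simp add: cinner_add_right)
 then show ?thesis by (intro P_generator[OF 1]) (simp add: 0 tensor_op_one)
qed

text \<open>The semigroup law moves the right derivative at 0 to any time \<open>r\<close>: there it
  is the amplified difference quotient at the unit, evaluated at \<open>dil r $ (Z r $ u)\<close>,
  and ultraweak convergence passes through \<open>amp\<close>. A continuous function with zero right
  derivative is constant.\<close>

lemma P_one:
 assumes t: "0 <= t"
 shows "P t \<one> = \<one>"
proof (rule bop_cinner_eqI)
 fix u v
 have "cinner v (P t \<one> $ u) = cinner v (P 0 \<one> $ u)"
 proof (rule zero_right_derivative[OF _ t])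
  show "continuous_on {0..t} (%t. cinner v (P t \<one> $ u))" by (rule continuous_on_subset[OF P_continuous[OF A_simps(5)]]) auto
  fix r :: real assume r: "0 <= r"
  let ?z = "%v. dil r $ (Z r $ v)" and ?Y = "%tau. complex_of_real (1 / tau) *\<^sub>C (P tau \<one> - \<one>)"
  have "((%tau. cinner (?z v) (amp (?Y tau) $ ?z u)) \<longlongrightarrow> cinner (?z v) (amp 0 $ ?z u)) (at_right 0)"
   using limitin_uw_cinner[OF continuous_map_limit[OF uw_continuous_amp], of ?Y 0 "at_right 0" "?z v" "?z u"] P_one_generator
   unfolding uw_generator_def o_def by blast
  moreover have "amp (0 :: 'h operator) = (0 :: (('h, ('h, 'k noise) tensor \<times> nat) dsum) operator)"
   using amp_simps(2)[of 0 "0 :: 'h operator"] by simp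
  ultimately have "((%tau. cinner (?z v) (amp (?Y tau) $ ?z u)) \<longlongrightarrow> 0) (at_right 0)" by simp
  moreover have "cinner (?z v) (amp (?Y tau) $ ?z u) = (cinner v (P (r + tau) \<one> $ u) - cinner v (P r \<one> $ u)) / of_real tau" if tau: "0 < tau" for tau
  proof -
   have "cinner (?z v) (amp y $ ?z u) = cinner v (P r y $ u)" if "y \<in> A" for y by (simp only: dil_cinner[OF r that] cinner_P)
   note pr = this
   have "amp (P tau \<one> - \<one>) + amp \<one> = amp (P tau \<one>)" by (simp only: amp_simps(1)[symmetric] diff_add_cancel)
   from arg_cong[OF this, of "%T. cinner (?z v) (T $ ?z u)"]
   have "cinner (?z v) (amp (P tau \<one> - \<one>) $ ?z u) + cinner v (P r \<one> $ u) = cinner v (P (r + tau) \<one> $ u)"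
    unfolding plus_bop.rep_eq cinner_add_right pr[OF A_simps(5)] pr[OF P_mem[OF less_imp_le[OF tau] A_simps(5)]]
     P_semigroup[OF r less_imp_le[OF tau] A_simps(5)] .
   then have "cinner (?z v) (amp (P tau \<one> - \<one>) $ ?z u) = cinner v (P (r + tau) \<one> $ u) - cinner v (P r \<one> $ u)" by (simp only: eq_diff_eq)
   then show ?thesis by (simp only: amp_simps(2) scaleC_bop.rep_eq cinner_scaleC_right) (simp add: field_simps)
  qed
  ultimately show "((%tau. (cinner v (P (r + tau) \<one> $ u) - cinner v (P r \<one> $ u)) / of_real tau) \<longlongrightarrow> 0) (at_right 0)"
   using Lim_transform_eventually[OF _ eventually_unit_interval] by (metis (no_types, lifting))
 qed
 then show "cinner v (P t \<one> $ u) = cinner v (\<one> $ u)" by (simp add: P_zero A_simps(5))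
qed

text \<open>Unitality says that \<open>Z t\<close> is isometric. This supplies a bound uniform on
  the half-line, under which amplified curves are continuous; the functional \<open>uwf u v\<close>
  then becomes an inner product of two such curves.\<close>

lemma P_uw_continuous:
 assumes x: "x \<in> A"
 shows "continuous_map (top_of_set {0..}) uw_top (%t. P t x)"
 unfolding continuous_map_uw_iff
proof (intro allI impI)
 fix u v :: "nat => 'h" assume "l2fam u" "l2fam v"
 then obtain zeta zeta' where zeta: "!!i. coord i zeta = u i" "!!i. coord i zeta' = v i" by (metis dsum_of_l2fam)
 have iso: "norm (Z s $ y) <= 1 * norm y" if "s \<in> {0..}" for s y
  using isometry_norm[of "Z s" y] P_one[of s] that by (simp add: P_def j_simps(5))
 have "norm (j s x $ (Z s $ y)) <= opnorm x * norm y" if "s \<in> {0..}" for s y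
  using order.trans[OF j_norm_le[of s x "Z s $ y"] mult_left_mono[OF iso[OF that, of y]]] that x by simp
 then have "continuous_on {0..} (%t. cinner (amp (Z t) $ zeta) (amp (j t x oo Z t) $ zeta'))"
  using iso by (intro continuous_intros continuous_amp_apply[where K = 1] continuous_amp_apply[where K = "opnorm x"])
   (auto intro!: solution_curve(1) j_curve x)
 moreover have "cinner (amp (Z t) $ zeta) (amp (j t x oo Z t) $ zeta') = uwf u v (P t x)" for t
  unfolding amp_adj_comp unfolding cinner_amp zeta by (simp only: P_def comp_assoc)
 ultimately show "continuous_map (top_of_set {0..}) euclidean (%t. uwf u v (P t x))" by simp
qed

lemma P_markov: "markov_semigroup A P"
 unfolding markov_semigroup_def
 by (intro conjI allI impI ballI P_linear P_normal P_positive P_one P_zero P_semigroup P_uw_continuous) (auto intro: P_mem)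

end

theorem corollary8p2:
  fixes A :: "'h::complex_hilbert operator set"
    and P0 :: "real \<Rightarrow> 'h operator \<Rightarrow> 'h operator"
    and j :: "real \<Rightarrow> 'h operator \<Rightarrow> ('h, 'k::complex_hilbert noise) tensor operator"
    and l :: "('h, ('k, 'h) tensor) bop"
    and h :: "'h operator"
  assumes "von_neumann_algebra A"
    and "markov_semigroup A P0"
    and "qs_flow A j"
    and "\<forall>t\<ge>0. \<forall>a\<in>A. P0 t a = vacuum_expectation (j t a)"
    and "l \<in> ket_tensor A"
    and "h \<in> A" and "h = h\<^sup>\<star>"
  shows "let k = \<i> *\<^sub>C h - (1/2) *\<^sub>C (l\<^sup>\<star> \<bullet>\<^sub>o l) in
    \<exists>P. markov_semigroup A P \<and> (\<forall>t\<ge>0. completely_positive_on A (P t)) \<and>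
      {(x, deriv_L j x + l\<^sup>\<star> \<bullet>\<^sub>o deriv_delta j x + l\<^sup>\<star> \<bullet>\<^sub>o deriv_pi j x \<bullet>\<^sub>o l
          + deriv_delta_dagger j x \<bullet>\<^sub>o l + k\<^sup>\<star> \<bullet>\<^sub>o x + x \<bullet>\<^sub>o k) | x. x \<in> deriv_dom A j}
        \<subseteq> uw_generator A P"
proof -
 define k where "k = \<i> *\<^sub>C h - (1/2) *\<^sub>C (l\<^sup>\<star> oo l)"
 interpret flow A j using assms by unfold_locales
 note affil = ket_tensor_affil[OF assms(1,5)]
 have "\<i> *\<^sub>C h + (-1/2) *\<^sub>C (l\<^sup>\<star> oo l) \<in> A" by (intro A_simps assms ketc_mem affil)
 moreover have "\<i> *\<^sub>C h + (-1/2) *\<^sub>C (l\<^sup>\<star> oo l) = k"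
  unfolding k_def by (rule bop_cinner_eqI) (simp add: cinner_add_right cinner_diff_right cinner_scaleC_right)
 ultimately have kA: "k \<in> A" by simp
 \<comment> \<open>Self-adjointness of \<open>h\<close> cancels the imaginary parts in the sum of
   \<open>k\<close> and its adjoint, leaving minus \<open>l\<^sup>\<star> oo l\<close>.\<close>
 have "cinner v (h $ u) = cinner (h $ v) u" for u v using cinner_adj[of h v u] assms(7) by simp
 then have cons: "k + k\<^sup>\<star> + l\<^sup>\<star> oo l = 0"
  by (intro bop_cinner_eqI) (simp add: k_def cinner_add_left cinner_add_right cinner_diff_left cinner_diff_right cinner_scaleC_left cinner_scaleC_right)
 interpret conservative_flow A j k l by unfold_locales (fact kA affil cons)+
 have "(x, deriv_L j x + l\<^sup>\<star> oo deriv_delta j x + l\<^sup>\<star> oo deriv_pi j x oo l + deriv_delta_dagger j x oo l + k\<^sup>\<star> oo x + x oo k) \<in> uw_generator A P"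
  if x: "x \<in> deriv_dom A j" for x
 proof (rule P_generator[OF x])
  fix u v
  let ?theta = "stoch_deriv j x"
  \<comment> \<open>The corner of the derivative is the difference of \<open>deriv_pi\<close> and
    \<open>\<one> ox x\<close>; the latter is the quadratic term that \<open>P_generator\<close>
    adds separately.\<close>
  have pi: "cinner w (deriv_pi j x $ w') = cinner (0, w) (?theta $ (0, w')) + cinner w ((\<one> ox x) $ w')" for w w'
   by (simp add: deriv_pi_def row_op.rep_eq column_op.rep_eq cinner_prod_def cinner_add_right)
  have dagger: "cinner v (deriv_delta_dagger j x $ w) = cinner (v, 0) (?theta $ (0, w))" for w
  proof -
   have "cinner (deriv_delta j (x\<^sup>\<star>) $ v) w = cnj (cinner (0, w) (?theta\<^sup>\<star> $ (v, 0)))"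
    unfolding cinner_deriv(2)[symmetric] stoch_deriv_adj(2)[OF x, symmetric] by (rule cinner_commute)
   then show ?thesis using cinner_commute[of "(v, 0)" "?theta $ (0, w)"] by (simp add: deriv_delta_dagger_def)
  qed
  \<comment> \<open>The two splittings produce the four blocks of the derivative, each with
    \<open>l\<close> or its adjoint where the one-particle slot is used.\<close>
  have s: "(u, l $ u) = (u, 0) + (0, l $ u)" "(v, l $ v) = (v, 0) + (0, l $ v)" by simp_all
  show "cinner v ((deriv_L j x + l\<^sup>\<star> oo deriv_delta j x + l\<^sup>\<star> oo deriv_pi j x oo l + deriv_delta_dagger j x oo l + k\<^sup>\<star> oo x + x oo k) $ u) =
   cinner (v, l $ v) (?theta $ (u, l $ u)) + (cinner (x\<^sup>\<star> $ v) (k $ u) + cnj (cinner (x $ u) (k $ v)) + cinner (l $ v) ((\<one> ox x) $ (l $ u)))"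
   unfolding s using cinner_commute[of "k $ v" "x $ u"]
   by (simp only: plus_bop.rep_eq bop_comp.rep_eq bop_arith(1) cinner_add_left cinner_add_right cinner_adj cinner_adj2 cinner_deriv pi dagger) (simp add: cinner_adj[symmetric] del: cinner_adj cinner_adj2)
 qed
 then show ?thesis unfolding Let_def k_def[symmetric] using P_markov P_cp by blast
qed

end
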